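(* Let $\Theta=(a,b)$ and for $\vartheta\in\Theta$ let $\mathbf{P}_\vartheta$ be the law under which $X^n=(X_0,X_1,\dots,X_n)$ satisfies $$X_j=S(\vartheta,X_{j-1})+\varepsilon_j,\qquad j=1,\dots,n,$$ where $S$ is a known function, $\varepsilon_1,\varepsilon_2,\dots$ are i.i.d. with known density $f>0$, and $X_0$ has the invariant density $\varphi(\vartheta,\cdot)$. Suppose that the assumptions (i)--(iv) listed in the context hold. Let $\hat\vartheta_n$ be the maximum likelihood estimator, $\ell=\ln f$, and put $$\hat U_n(x)=\frac{-1}{\sqrt{\mathrm{I}(\hat\vartheta_n)\,n}}\sum_{j=1}^{n}\ell'\bigl(X_j-S(\hat\vartheta_n,X_{j-1})\bigr)\,\dot S(\hat\vartheta_n,X_{j-1})\,\mathbf{1}_{\{X_{j-1}<x\}},\qquad x\in\mathbb{R},$$ $$\Delta_n=\int_{-\infty}^{\infty}\frac{\hat U_n(x)^2\,\dot S(\hat\vartheta_n,x)^2}{\mathrm{I}_{\hat\vartheta_n}}\,\varphi(\hat\vartheta_n,x)\,\mathrm{d}x .$$ Let $\alpha\in(0,1)$ and let $c_\alpha$ be defined by $\mathbf{P}(\Delta>c_\alpha)=\alpha$, where $\Delta=\int_0^1B(\tau)^2\,\mathrm{d}\tau$ and $B$ is a standard Brownian bridge on $[0,1]$. Then the test $\hat\psi_n=\mathbf{1}_{\{\Delta_n>c_\alpha\}}$ is asymptotically distribution free and belongs to the class $\mathcal{K}_\alpha$ as $n\to\infty$.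
   Context: Dots denote derivatives with respect to $\vartheta$, primes derivatives of $\ell$. Notation: $\mathrm{I}_f=\int_{-\infty}^{\infty}\frac{f'(x)^2}{f(x)}\,\mathrm{d}x$, $\mathrm{I}_\vartheta=\int_{-\infty}^{\infty}\dot S(\vartheta,x)^2\varphi(\vartheta,x)\,\mathrm{d}x$, and the Fisher information is $\mathrm{I}(\vartheta)=\mathrm{I}_f\,\mathrm{I}_\vartheta$ (positive and finite). The maximum likelihood estimator $\hat\vartheta_n$ maximizes over $\vartheta\in\Theta$ the log-likelihood $\ln\varphi(\vartheta,X_0)+\sum_{j=1}^{n}\ln f(X_j-S(\vartheta,X_{j-1}))$. Assumptions: (i) For all $\vartheta\in\Theta$ the time series $(X_j)$ is ergodic with invariant density $\varphi(\vartheta,x)$: for any function $h$ with $\mathbf{E}_\vartheta|h(\xi)|<\infty$, where $\xi\sim\varphi(\vartheta,\cdot)$, one has $\frac1n\sum_{j=1}^{n}h(X_j)\to\mathbf{E}_\vartheta h(\xi)$. (ii) $\varphi(\vartheta,x)\le C|x|^{-1-\gamma}$ with positive constants $\gamma,C$ not depending on $\vartheta$. (iii) $\ell=\ln f$ has three continuous bounded derivatives $\ell',\ell'',\ell'''$, and $S(\vartheta,x)$ has two continuous bounded derivatives $\dot S,\ddot S$ with respect to $\vartheta$. (iv) Regularity conditions hold such that the maximum likelihood estimator is consistent and, under $\mathbf{P}_\vartheta$, admits the representation $\sqrt n(\hat\vartheta_n-\vartheta)=\frac{-1}{\mathrm{I}(\vartheta)\sqrt n}\sum_{j=1}^{n}\ell'(X_j-S(\vartheta,X_{j-1}))\,\dot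 S(\vartheta,X_{j-1})+o(1)$. $\mathcal{K}_\alpha$ is the class of tests of asymptotic size $\alpha$: tests $\bar\psi_n$ with $\mathbf{E}_\vartheta\bar\psi_n=\alpha+o(1)$ as $n\to\infty$ for all $\vartheta\in\Theta$. The test is asymptotically distribution free if, under $\mathbf{P}_\vartheta$, the test statistic converges in distribution as $n\to\infty$ to a limit whose law does not depend on $\vartheta$ nor on the model functions $S,f$; here the limit is $\Delta$. *)

theory Defs
  imports "HOL-Probability.Probability"
begin

text \<open>
  A probability density that is invariant for \<open>x \<mapsto> s x + \<epsilon>\<close>, where \<open>\<epsilon>\<close> has density \<open>f\<close>.
  The invariance equation is required at every point, which selects one version of the density;
  for \<open>f > 0\<close> this version is strictly positive, so that \<open>ln (p x)\<close> is a genuine logarithm.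
\<close>
definition invariant_density :: "(real \<Rightarrow> real) \<Rightarrow> (real \<Rightarrow> real) \<Rightarrow> (real \<Rightarrow> real) \<Rightarrow> bool" where
  "invariant_density s f p \<longleftrightarrow>
     p \<in> borel_measurable borel \<and> (\<forall>x. 0 \<le> p x) \<and>
     (\<integral>\<^sup>+x. ennreal (p x) \<partial>lborel) = 1 \<and>
     (\<forall>y. ennreal (p y) = (\<integral>\<^sup>+x. ennreal (f (y - s x) * p x) \<partial>lborel))"

text \<open>
  \<open>\<epsilon>(0 := X 0)\<close> is the family consisting of the initial value and the innovations.
\<close>
definition autoregression ::
  "'w measure \<Rightarrow> (nat \<Rightarrow> 'w \<Rightarrow> real) \<Rightarrow> (real \<Rightarrow> real) \<Rightarrow> (real \<Rightarrow> real) \<Rightarrow> (real \<Rightarrow> real) \<Rightarrow> bool" where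
  "autoregression M X s f p \<longleftrightarrow>
     prob_space M \<and> distributed M lborel (X 0) (\<lambda>x. ennreal (p x)) \<and>
     (\<exists>\<epsilon>. (\<forall>j\<ge>1. distributed M lborel (\<epsilon> j) (\<lambda>x. ennreal (f x))) \<and>
          prob_space.indep_vars M (\<lambda>_. borel) (\<epsilon>(0 := X 0)) UNIV \<and>
          (\<forall>j\<ge>1. \<forall>\<omega>\<in>space M. X j \<omega> = s (X (j - 1) \<omega>) + \<epsilon> j \<omega>))"

definition ergodic_with_density ::
  "'w measure \<Rightarrow> (nat \<Rightarrow> 'w \<Rightarrow> real) \<Rightarrow> (real \<Rightarrow> real) \<Rightarrow> bool" where
  "ergodic_with_density M X p \<longleftrightarrow>
     (\<forall>h. h \<in> borel_measurable borel \<longrightarrow> integrable lborel (\<lambda>x. h x * p x) \<longrightarrow>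
        (AE \<omega> in M. (\<lambda>n. (\<Sum>j=1..n. h (X j \<omega>)) / real n)
                      \<longlonglongrightarrow> (\<integral>x. h x * p x \<partial>lborel)))"

definition conv_in_prob :: "'w measure \<Rightarrow> (nat \<Rightarrow> 'w \<Rightarrow> real) \<Rightarrow> real \<Rightarrow> bool" where
  "conv_in_prob M Y c \<longleftrightarrow>
     (\<forall>e>0. (\<lambda>n. measure M {\<omega>\<in>space M. e < \<bar>Y n \<omega> - c\<bar>}) \<longlonglongrightarrow> 0)"

definition log_density :: "(real \<Rightarrow> real) \<Rightarrow> real \<Rightarrow> real" where
  "log_density f = (\<lambda>x. ln (f x))"

definition three_bounded_derivs :: "(real \<Rightarrow> real) \<Rightarrow> bool" where
  "three_bounded_derivs g \<longleftrightarrow>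
     (\<forall>i<3. \<forall>x. (deriv ^^ i) g field_differentiable at x) \<and>
     (\<forall>i\<in>{1..3}. continuous_on UNIV ((deriv ^^ i) g) \<and> bounded (range ((deriv ^^ i) g)))"

text \<open>
  Derivatives in the parameter: continuous in \<open>\<theta>\<close> for each \<open>x\<close>, bounded uniformly in \<open>(\<theta>, x)\<close>.
\<close>
definition two_bounded_param_derivs :: "real set \<Rightarrow> (real \<Rightarrow> real \<Rightarrow> real) \<Rightarrow> bool" where
  "two_bounded_param_derivs \<Theta> S \<longleftrightarrow>
     (\<forall>i<2. \<forall>\<theta>\<in>\<Theta>. \<forall>x. (deriv ^^ i) (\<lambda>t. S t x) field_differentiable at \<theta>) \<and>
     (\<forall>i\<in>{1..2}. (\<forall>x. continuous_on \<Theta> ((deriv ^^ i) (\<lambda>t. S t x))) \<and>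
                 (\<exists>K. \<forall>\<theta>\<in>\<Theta>. \<forall>x. \<bar>(deriv ^^ i) (\<lambda>t. S t x) \<theta>\<bar> \<le> K))"

definition S_dot :: "(real \<Rightarrow> real \<Rightarrow> real) \<Rightarrow> real \<Rightarrow> real \<Rightarrow> real" where
  "S_dot S \<theta> x = deriv (\<lambda>t. S t x) \<theta>"

definition info_density :: "(real \<Rightarrow> real) \<Rightarrow> real" where
  "info_density f = (\<integral>x. (deriv f x)\<^sup>2 / f x \<partial>lborel)"

definition info_regression ::
  "(real \<Rightarrow> real \<Rightarrow> real) \<Rightarrow> (real \<Rightarrow> real \<Rightarrow> real) \<Rightarrow> real \<Rightarrow> real" where
  "info_regression S \<phi> \<theta> = (\<integral>x. (S_dot S \<theta> x)\<^sup>2 * \<phi> \<theta> x \<partial>lborel)"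

definition fisher_info ::
  "(real \<Rightarrow> real \<Rightarrow> real) \<Rightarrow> (real \<Rightarrow> real) \<Rightarrow> (real \<Rightarrow> real \<Rightarrow> real) \<Rightarrow> real \<Rightarrow> real" where
  "fisher_info S f \<phi> \<theta> = info_density f * info_regression S \<phi> \<theta>"

text \<open>
  A statistic based on \<open>X\<^sub>0, \<dots>, X\<^sub>n\<close> is a measurable function on \<open>data_space n\<close>.
\<close>
abbreviation data_space :: "nat \<Rightarrow> (nat \<Rightarrow> real) measure" where
  "data_space n \<equiv> Pi\<^sub>M {..n} (\<lambda>_. borel)"

definition sample :: "(nat \<Rightarrow> 'w \<Rightarrow> real) \<Rightarrow> nat \<Rightarrow> 'w \<Rightarrow> nat \<Rightarrow> real" where
  "sample X n \<omega> = (\<lambda>j\<in>{..n}. X j \<omega>)"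

definition log_likelihood ::
  "(real \<Rightarrow> real \<Rightarrow> real) \<Rightarrow> (real \<Rightarrow> real) \<Rightarrow> (real \<Rightarrow> real \<Rightarrow> real) \<Rightarrow> nat \<Rightarrow> (nat \<Rightarrow> real) \<Rightarrow> real \<Rightarrow> real" where
  "log_likelihood S f \<phi> n x \<theta> =
     ln (\<phi> \<theta> (x 0)) + (\<Sum>j=1..n. ln (f (x j - S \<theta> (x (j - 1)))))"

text \<open>
  Since \<open>\<Theta>\<close> is open, the likelihood need not attain its maximum for every conceivable data set.
  The estimator maximizes it whenever a maximizer exists, and is some value in \<open>\<Theta>\<close> otherwise.
\<close>
definition max_likelihood_estimator ::
  "real set \<Rightarrow> (real \<Rightarrow> real \<Rightarrow> real) \<Rightarrow> (real \<Rightarrow> real) \<Rightarrow> (real \<Rightarrow> real \<Rightarrow> real) \<Rightarrow>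
   (nat \<Rightarrow> (nat \<Rightarrow> real) \<Rightarrow> real) \<Rightarrow> bool" where
  "max_likelihood_estimator \<Theta> S f \<phi> est \<longleftrightarrow>
     (\<forall>n\<ge>1. est n \<in> borel_measurable (data_space n) \<and>
        (\<forall>x\<in>space (data_space n). est n x \<in> \<Theta> \<and>
           ((\<exists>\<theta>. is_arg_max (log_likelihood S f \<phi> n x) (\<lambda>t. t \<in> \<Theta>) \<theta>) \<longrightarrow>
              is_arg_max (log_likelihood S f \<phi> n x) (\<lambda>t. t \<in> \<Theta>) (est n x))))"

text \<open>Here \<open>\<theta>\<close> stands for the value of the estimator.\<close>
definition U_hat ::
  "(real \<Rightarrow> real \<Rightarrow> real) \<Rightarrow> (real \<Rightarrow> real) \<Rightarrow> (real \<Rightarrow> real \<Rightarrow> real) \<Rightarrow> real \<Rightarrow> nat \<Rightarrow> (nat \<Rightarrow> real) \<Rightarrow> real \<Rightarrow> real" where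
  "U_hat S f \<phi> \<theta> n x y =
     - 1 / sqrt (fisher_info S f \<phi> \<theta> * real n) *
       (\<Sum>j=1..n. deriv (log_density f) (x j - S \<theta> (x (j - 1))) * S_dot S \<theta> (x (j - 1)) *
                  indicator {..<y} (x (j - 1)))"

definition Delta_stat ::
  "(real \<Rightarrow> real \<Rightarrow> real) \<Rightarrow> (real \<Rightarrow> real) \<Rightarrow> (real \<Rightarrow> real \<Rightarrow> real) \<Rightarrow>
   (nat \<Rightarrow> (nat \<Rightarrow> real) \<Rightarrow> real) \<Rightarrow> nat \<Rightarrow> (nat \<Rightarrow> real) \<Rightarrow> real" where
  "Delta_stat S f \<phi> est n x =
     (let \<theta> = est n x in
        \<integral>y. (U_hat S f \<phi> \<theta> n x y)\<^sup>2 * (S_dot S \<theta> y)\<^sup>2 / info_regression S \<phi> \<theta> * \<phi> \<theta> y \<partial>lborel)"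

text \<open>
  Tests may be randomized, hence take values in the unit interval.
\<close>
definition asymp_size_class ::
  "real set \<Rightarrow> (real \<Rightarrow> 'w measure) \<Rightarrow> (nat \<Rightarrow> 'w \<Rightarrow> real) \<Rightarrow> real \<Rightarrow> (nat \<Rightarrow> (nat \<Rightarrow> real) \<Rightarrow> real) set" where
  "asymp_size_class \<Theta> P X \<alpha> =
     {\<psi>. (\<forall>n\<ge>1. \<psi> n \<in> borel_measurable (data_space n) \<and>
                (\<forall>x\<in>space (data_space n). 0 \<le> \<psi> n x \<and> \<psi> n x \<le> 1)) \<and>
         (\<forall>\<theta>\<in>\<Theta>. (\<lambda>n. \<integral>\<omega>. \<psi> n (sample X n \<omega>) \<partial>P \<theta>) \<longlonglongrightarrow> \<alpha>)}"

text \<open>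
  Convergence in distribution of the statistic to one law \<open>L\<close> for all \<open>\<theta>\<close>. Distribution freeness
  over the model functions is obtained by supplying an \<open>L\<close> that does not involve them.
\<close>
definition asymp_distribution_free ::
  "real set \<Rightarrow> (real \<Rightarrow> 'w measure) \<Rightarrow> (nat \<Rightarrow> 'w \<Rightarrow> real) \<Rightarrow> (nat \<Rightarrow> (nat \<Rightarrow> real) \<Rightarrow> real) \<Rightarrow>
   real measure \<Rightarrow> bool" where
  "asymp_distribution_free \<Theta> P X T L \<longleftrightarrow>
     (\<forall>n\<ge>1. T n \<in> borel_measurable (data_space n)) \<and>
     (\<forall>\<theta>\<in>\<Theta>. weak_conv_m (\<lambda>n. distr (P \<theta>) borel (\<lambda>\<omega>. T n (sample X n \<omega>))) L)"

text \<open>\<open>\<sigma> = 0\<close> is allowed: the point mass at \<open>0\<close> counts as a (degenerate) normal law.\<close>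
definition centered_normal :: "'b measure \<Rightarrow> ('b \<Rightarrow> real) \<Rightarrow> bool" where
  "centered_normal M Y \<longleftrightarrow> Y \<in> borel_measurable M \<and>
     (\<exists>\<sigma>. distr M borel Y = distr std_normal_distribution borel (\<lambda>z. \<sigma> * z))"

definition brownian_bridge :: "'b measure \<Rightarrow> (real \<Rightarrow> 'b \<Rightarrow> real) \<Rightarrow> bool" where
  "brownian_bridge M B \<longleftrightarrow> prob_space M \<and>
     (\<forall>I a. finite I \<and> I \<subseteq> {0..1} \<longrightarrow> centered_normal M (\<lambda>\<omega>. \<Sum>t\<in>I. a t * B t \<omega>)) \<and>
     (\<forall>s\<in>{0..1}. \<forall>t\<in>{0..1}. (\<integral>\<omega>. B s \<omega> * B t \<omega> \<partial>M) = min s t - s * t) \<and>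
     (\<forall>\<omega>\<in>space M. continuous_on {0..1} (\<lambda>t. B t \<omega>))"

definition bridge_functional :: "(real \<Rightarrow> 'b \<Rightarrow> real) \<Rightarrow> 'b \<Rightarrow> real" where
  "bridge_functional B \<omega> = (LINT \<tau>:{0..1}|lborel. (B \<tau> \<omega>)\<^sup>2)"

end

theory Submission
  imports Defs "HOL-Probability.Probability" "HOL-Real_Asymp.Real_Asymp"
begin

text \<open>
  Write \<open>\<theta>\<close> for the true parameter and let \<open>F\<close> be the distribution function with density
  \<open>S_dot S \<theta>\<^sup>2 * \<phi> \<theta> / info_regression\<close>. Expanding \<open>U_hat\<close> around \<open>\<theta>\<close> and inserting the
  representation of the estimator shows that \<open>U_hat\<close> is close to the normalized martingale
  \<open>Ut(y) = - (I n)\<^sup>-\<^sup>1\<^sup>/\<^sup>2 \<Sum> l'(\<epsilon>\<^sub>j) S_dot(X\<^sub>j\<^sub>-\<^sub>1) (1{X\<^sub>j\<^sub>-\<^sub>1 < y} - F y)\<close>, whose covariance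
  \<open>F (min y z) - F y * F z\<close> is that of a Brownian bridge run at time \<open>F\<close>. Neither tightness nor
  uniform estimates are needed: both the remainder and \<open>Ut\<close> enter only through integrals over
  \<open>y\<close> against an integrable weight that dominates all invariant densities, so second moments
  suffice. The invariant densities depend continuously on the parameter by a Doeblin argument.

  The law of \<open>\<integral> Ut\<^sup>2 dF\<close> is identified by Laplace transforms. Since
  \<open>exp (- \<bar>z\<bar>\<^sup>2 / 2)\<close> is a Gaussian average of \<open>exp (\<i> g \<bullet> z)\<close>, the Laplace transform of a finite
  sum of squares is determined by characteristic functions of linear combinations, to which a
  martingale central limit theorem applies; the \<open>N\<close>-point sums approximate the integral uniformly
  in \<open>n\<close>. The limit law has no atoms because resampling the bridge at time \<open>1/2\<close> makes the
  functional a nondegenerate quadratic polynomial in an independent normal variable.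
\<close>

subsection \<open>Densities with a smooth logarithm\<close>

text \<open>The term \<open>F y\<close> has its origin in the information identity:
  \<open>l2\<close> has mean minus that of \<open>l1\<^sup>2\<close>, so moving the parameter by
  \<open>H / sqrt n\<close> shifts the normalized score sum over
  \<open>X\<^sub>j\<^sub>-\<^sub>1 < y\<close> by about \<open>H * I * F y\<close>, and the
  representation of the estimator equates \<open>H * I\<close> with minus the total score. Three
  obstacles shape the rest. The ergodic hypothesis speaks about one function at a time, so averages
  are controlled in mean square for each \<open>y\<close> and only then integrated over
  \<open>y\<close>. The estimator depends on the whole sample, which rules out conditioning; it is
  therefore frozen as a number \<open>t\<close> near \<theta>, and all later estimates are
  deterministic on a fixed path outside an exceptional event. The second parameter derivative of
  \<open>S\<close> is continuous for each \<open>x\<close> separately, so its oscillation is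
  averaged along the path rather than bounded. The bound on \<open>l1\<close> makes \<open>f\<close>
  comparable with its translates up to \<open>exp (L * distance)\<close>; this one inequality bounds
  every invariant density, dominates difference quotients and supplies the Doeblin
  minorization.\<close>

locale smooth_density =
  fixes f l1 l2 :: "real \<Rightarrow> real" and L :: real
  assumes f_pos: "\<And>x. 0 < f x"
    and f_deriv: "\<And>x. (f has_real_derivative l1 x * f x) (at x)"
    and l1_deriv: "\<And>x. (l1 has_real_derivative l2 x) (at x)"
    and l1_bound: "\<And>x. \<bar>l1 x\<bar> \<le> L"
    and l2_bound: "\<And>x. \<bar>l2 x\<bar> \<le> L"
    and l2_lipschitz: "\<And>x y. \<bar>l2 x - l2 y\<bar> \<le> L * \<bar>x - y\<bar>"
    and f_mass: "(\<integral>\<^sup>+x. ennreal (f x) \<partial>lborel) = 1"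
begin

lemma L_nonneg: "0 \<le> L"
  using l1_bound[of 0] by linarith

lemma f_continuous: "continuous_on UNIV f" and l1_continuous: "continuous_on UNIV l1"
  using f_deriv l1_deriv by (auto intro!: DERIV_continuous_on)

lemma l2_continuous: "continuous_on UNIV l2"
proof (rule lipschitz_on_continuous_on)
  show "L-lipschitz_on UNIV l2"
    using l2_lipschitz L_nonneg by (auto simp: lipschitz_on_def dist_real_def)
qed

lemma measurable_density [measurable]:
  "f \<in> borel_measurable borel" "l1 \<in> borel_measurable borel" "l2 \<in> borel_measurable borel"
  using f_continuous l1_continuous l2_continuous by (auto intro: borel_measurable_continuous_onI)

lemma f_integrable: "integrable lborel f" and f_integral: "(\<integral>x. f x \<partial>lborel) = 1"
proof -
  show "integrable lborel f"
    using f_mass f_pos by (intro integrableI_nonneg) (auto intro: less_imp_le)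
  then show "(\<integral>x. f x \<partial>lborel) = 1"
    using f_mass f_pos by (subst integral_eq_nn_integral) (auto intro: less_imp_le)
qed

text \<open>\<open>ln f\<close> is \<open>L\<close>-Lipschitz because its derivative is
  \<open>l1\<close>. This Harnack-type inequality is what every later domination of \<open>f\<close>
  rests on.\<close>

lemma f_ratio: "f y \<le> exp (L * \<bar>x - y\<bar>) * f x"
proof -
  have "((\<lambda>x. ln (f x)) has_real_derivative l1 z) (at z)" for z
    using f_pos[of z] f_deriv by (auto intro!: derivative_eq_intros)
  then have "norm (ln (f y) - ln (f x)) \<le> L * norm (y - x)"
    by (intro field_differentiable_bound[of UNIV "\<lambda>x. ln (f x)" l1])
       (use l1_bound in \<open>auto intro: DERIV_subset\<close>)
  then have "ln (f y) \<le> L * \<bar>x - y\<bar> + ln (f x)"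
    by (auto simp: abs_minus_commute abs_if split: if_splits)
  then have "exp (ln (f y)) \<le> exp (L * \<bar>x - y\<bar> + ln (f x))"
    by simp
  then show ?thesis
    using f_pos by (simp add: exp_add)
qed

text \<open>If \<open>f x\<close> were larger, then \<open>f\<close> would exceed one on average
  over \<open>{x..x+1}\<close> by \<open>f_ratio\<close>, against its total mass one.\<close>

lemma f_le: "f x \<le> exp L"
proof -
  have "exp (- L) * f x = (\<integral>y. exp (- L) * f x * indicator {x..x+1} y \<partial>lborel)"
    by simp
  also have "\<dots> \<le> (\<integral>y. f y \<partial>lborel)"
  proof (intro integral_mono f_integrable)
    fix y :: real
    show "exp (- L) * f x * indicator {x..x+1} y \<le> f y"
    proof (cases "y \<in> {x..x+1}")
      case True
      have "f x \<le> exp (L * \<bar>y - x\<bar>) * f y" by (rule f_ratio)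
      also have "\<dots> \<le> exp L * f y"
        using True L_nonneg f_pos[of y] mult_left_mono[of "\<bar>y - x\<bar>" 1 L] by auto
      finally show ?thesis
        using True by (simp add: exp_minus field_simps)
    qed (use f_pos[of y] in auto)
  qed (auto intro!: integrable_mult_right)
  finally show ?thesis
    using f_integral by (simp add: exp_minus field_simps)
qed

text \<open>The pointwise invariance equation makes \<open>p y\<close> an average of values of
  \<open>f\<close>. This covers the neighbourhood of the origin, where the polynomial tail bound
  blows up.\<close>

lemma invariant_density_le:
  assumes inv: "invariant_density s f p"
  shows "p y \<le> exp L"
proof -
  have p: "p \<in> borel_measurable borel" "\<And>x. 0 \<le> p x" "(\<integral>\<^sup>+x. ennreal (p x) \<partial>lborel) = 1"
    "ennreal (p y) = (\<integral>\<^sup>+x. ennreal (f (y - s x) * p x) \<partial>lborel)"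
    using inv unfolding invariant_density_def by blast+
  have "ennreal (p y) \<le> (\<integral>\<^sup>+x. ennreal (exp L) * ennreal (p x) \<partial>lborel)"
    unfolding p(4) using p(2) f_le
    by (intro nn_integral_mono) (auto simp flip: ennreal_mult intro!: ennreal_leI mult_right_mono)
  also have "\<dots> = ennreal (exp L)"
    using p(1,3) by (simp add: nn_integral_cmult)
  finally show ?thesis by simp
qed

text \<open>Difference quotients of \<open>g\<close> integrate to zero by translation invariance;
  the mean value inequality and \<open>f_ratio\<close> dominate them by a multiple of
  \<open>f\<close>, so the limit may be taken under the integral.\<close>

lemma integral_deriv_eq_0:
  assumes g: "\<And>x. (g has_real_derivative g' x) (at x)" and [measurable]: "g' \<in> borel_measurable borel"
    and int: "integrable lborel g" and bound: "\<And>x. \<bar>g' x\<bar> \<le> C * f x"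
  shows "(\<integral>x. g' x \<partial>lborel) = 0"
proof -
  define D where "D n x = (g (x + 1 / real (Suc n)) - g x) * real (Suc n)" for n x
  have [measurable]: "g \<in> borel_measurable borel"
    using int by auto
  have C: "0 \<le> C"
    using bound[of 0] f_pos[of 0] by (smt (verit) mult_neg_pos)
  have "D n x = g (1 / real (Suc n) + 1 * x) * real (Suc n) - g x * real (Suc n)" for n x
    by (simp add: D_def algebra_simps)
  moreover have "integrable lborel (\<lambda>x. g (1 / real (Suc n) + 1 * x))" for n
    by (rule lborel_integrable_real_affine[OF int]) simp
  moreover have "(\<integral>x. g (1 / real (Suc n) + 1 * x) \<partial>lborel) = (\<integral>x. g x \<partial>lborel)" for n
    using lborel_integral_real_affine[of 1 g "1 / real (Suc n)"] by simp
  ultimately have D0: "(\<integral>x. D n x \<partial>lborel) = 0" for n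
    using int by simp
  have lim: "(\<lambda>n. D n x) \<longlonglongrightarrow> g' x" for x
  proof -
    have "((\<lambda>h. (g (x + h) - g x) / h) \<longlongrightarrow> g' x) (at 0)"
      using g[of x] by (simp add: DERIV_def)
    moreover have "filterlim (\<lambda>n. 1 / real (Suc n)) (at 0) sequentially"
      unfolding filterlim_at using LIMSEQ_inverse_real_of_nat by (auto simp: inverse_eq_divide)
    ultimately have "(\<lambda>n. (g (x + 1 / real (Suc n)) - g x) / (1 / real (Suc n))) \<longlonglongrightarrow> g' x"
      by (rule filterlim_compose)
    then show ?thesis by (simp add: D_def)
  qed
  have bnd: "\<bar>D n x\<bar> \<le> C * exp L * f x" for n x
  proof -
    define h where "h = 1 / real (Suc n)"
    have h: "0 < h" "h \<le> 1" by (auto simp: h_def)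
    have "norm (g (x + h) - g x) \<le> (C * (exp L * f x)) * norm (x + h - x)"
    proof (rule field_differentiable_bound[of "{x..x+h}"])
      fix z assume z: "z \<in> {x..x+h}"
      show "(g has_real_derivative g' z) (at z within {x..x+h})"
        using g DERIV_subset by blast
      have "f z \<le> exp (L * \<bar>x - z\<bar>) * f x" by (rule f_ratio)
      also have "\<dots> \<le> exp L * f x"
        using z h L_nonneg f_pos[of x] mult_left_mono[of "\<bar>x - z\<bar>" 1 L] by auto
      finally show "norm (g' z) \<le> C * (exp L * f x)"
        using bound[of z] C mult_left_mono[of "f z" "exp L * f x" C] by simp
    qed (use h in auto)
    moreover have "D n x = (g (x + h) - g x) / h"
      unfolding D_def h_def by (simp only: divide_divide_eq_right div_by_1)
    ultimately show ?thesis
      using h by (simp only: abs_divide abs_of_pos pos_divide_le_eq real_norm_def mult.assoc) simp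
  qed
  have "(\<lambda>n. \<integral>x. D n x \<partial>lborel) \<longlonglongrightarrow> (\<integral>x. g' x \<partial>lborel)"
  proof (rule integral_dominated_convergence[where w="\<lambda>x. C * exp L * f x"])
    show "D n \<in> borel_measurable lborel" for n
      unfolding D_def[abs_def] by measurable
    show "AE x in lborel. norm (D n x) \<le> C * exp L * f x" for n
      using bnd by simp
  qed (use lim f_integrable in auto)
  then show ?thesis
    unfolding D0 by (simp add: LIMSEQ_const_iff)
qed

lemma integrable_bounded_times_f:
  assumes [measurable]: "k \<in> borel_measurable borel" and "\<And>x. \<bar>k x\<bar> \<le> C"
  shows "integrable lborel (\<lambda>x. k x * f x)"
proof (rule Bochner_Integration.integrable_bound[of _ "\<lambda>x. C * f x"])
  show "AE x in lborel. norm (k x * f x) \<le> norm (C * f x)"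
    using assms(2) f_pos by (intro AE_I2) (auto simp: abs_mult intro!: mult_mono order_trans[OF assms(2)])
qed (use f_integrable in auto)

lemma integral_l1_f: "(\<integral>x. l1 x * f x \<partial>lborel) = 0"
proof (rule integral_deriv_eq_0[where C=L])
  show "\<bar>l1 x * f x\<bar> \<le> L * f x" for x
    using l1_bound[of x] f_pos[of x] by (auto simp: abs_mult)
qed (use f_deriv f_integrable in auto)

text \<open>The information identity: \<open>l1 * f\<close> has derivative
  \<open>(l2 + l1\<^sup>2) * f\<close>, whose integral vanishes. It identifies the limit of the
  derivative of the score sum in \<open>G_mean_tendsto\<close>.\<close>

lemma integral_l2_f: "(\<integral>x. l2 x * f x \<partial>lborel) = - (\<integral>x. (l1 x)\<^sup>2 * f x \<partial>lborel)"
proof -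
  have sq: "(l1 x)\<^sup>2 \<le> L\<^sup>2" for x
    using l1_bound[of x] L_nonneg by (simp add: abs_le_square_iff[symmetric])
  have i1: "integrable lborel (\<lambda>x. l2 x * f x)" and i2: "integrable lborel (\<lambda>x. (l1 x)\<^sup>2 * f x)"
    using l2_bound sq by (auto intro!: integrable_bounded_times_f)
  have "(\<integral>x. l2 x * f x + (l1 x)\<^sup>2 * f x \<partial>lborel) = 0"
  proof (rule integral_deriv_eq_0[where C="L + L\<^sup>2"])
    show "((\<lambda>x. l1 x * f x) has_real_derivative l2 x * f x + (l1 x)\<^sup>2 * f x) (at x)" for x
      using f_deriv[of x] l1_deriv[of x]
      by (auto intro!: derivative_eq_intros simp: power2_eq_square algebra_simps)
    show "integrable lborel (\<lambda>x. l1 x * f x)"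
      using l1_bound by (intro integrable_bounded_times_f) auto
    fix x
    have "\<bar>l2 x * f x + (l1 x)\<^sup>2 * f x\<bar> = \<bar>l2 x + (l1 x)\<^sup>2\<bar> * f x"
      using f_pos[of x] by (simp add: abs_mult flip: distrib_right)
    also have "\<dots> \<le> (L + L\<^sup>2) * f x"
      using l2_bound[of x] sq[of x] f_pos[of x] abs_triangle_ineq[of "l2 x" "(l1 x)\<^sup>2"]
      by (intro mult_right_mono) (smt (verit) zero_le_power2, simp)
    finally show "\<bar>l2 x * f x + (l1 x)\<^sup>2 * f x\<bar> \<le> (L + L\<^sup>2) * f x" .
  qed measurable
  then show ?thesis
    using i1 i2 by (simp add: Bochner_Integration.integral_add)
qed

text \<open>The mean value inequality for \<open>l1 z - l2 x * z\<close>, whose derivative is at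
  most \<open>L * \<bar>h\<bar>\<close> on the segment.\<close>

lemma l1_taylor: "\<bar>l1 (x + h) - l1 x - l2 x * h\<bar> \<le> L * h\<^sup>2"
proof -
  have "norm (l1 (x + h) - l2 x * (x + h) - (l1 x - l2 x * x)) \<le> (L * \<bar>h\<bar>) * norm (x + h - x)"
  proof (rule field_differentiable_bound[of "closed_segment x (x + h)"])
    fix z assume z: "z \<in> closed_segment x (x + h)"
    show "((\<lambda>z. l1 z - l2 x * z) has_real_derivative l2 z - l2 x) (at z within closed_segment x (x + h))"
      using l1_deriv[of z] by (auto intro!: derivative_eq_intros intro: DERIV_subset)
    have "\<bar>z - x\<bar> \<le> \<bar>h\<bar>"
      using z by (auto simp: closed_segment_eq_real_ivl split: if_splits)
    then show "norm (l2 z - l2 x) \<le> L * \<bar>h\<bar>"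
      using l2_lipschitz[of z x] L_nonneg mult_left_mono[of "\<bar>z - x\<bar>" "\<bar>h\<bar>" L] by simp
  qed auto
  then show ?thesis
    by (simp add: algebra_simps power2_eq_square flip: abs_mult)
qed

end

subsection \<open>Stationary autoregressions\<close>

text \<open>Independence concerns only the generated sigma-algebras. Hence \<open>Y\<close> need
  only be measurable with respect to the one generated by \<open>Z\<close>; no factorization of
  \<open>Y\<close> through \<open>Z\<close> has to be produced.\<close>

lemma (in prob_space) indep_var_subset:
  assumes indep: "indep_var N Z T K"
    and Y: "Y \<in> measurable (vimage_algebra (space M) Z N) N'" and k: "k \<in> measurable T T'"
  shows "indep_var N' Y T' (\<lambda>\<omega>. k (K \<omega>))"
proof -
  let ?F = "vimage_algebra (space M) Z N"
  have Z: "Z \<in> measurable M N" and K: "K \<in> measurable M T"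
    using indep_var_rv1[OF indep] indep_var_rv2[OF indep] by auto
  have F: "sets ?F = {Z -` A \<inter> space M |A. A \<in> sets N}" "space ?F = space M"
    using measurable_space[OF Z] by (auto intro!: sets_vimage_algebra2)
  have FM: "sets ?F \<subseteq> sets M"
    using Z by (auto simp: F(1) intro: measurable_sets)
  have YM: "Y \<in> measurable M N'"
    using Y FM by (auto simp: measurable_def F(2))
  have sub1: "sigma_sets (space M) {Y -` A \<inter> space M |A. A \<in> sets N'} \<subseteq> sigma_sets (space M) {Z -` A \<inter> space M |A. A \<in> sets N}"
  proof (rule sigma_sets_mono)
    show "{Y -` A \<inter> space M |A. A \<in> sets N'} \<subseteq> sigma_sets (space M) {Z -` A \<inter> space M |A. A \<in> sets N}"
      using measurable_sets[OF Y] unfolding F by (auto intro!: sigma_sets.Basic)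
  qed
  have sub2: "sigma_sets (space M) {(\<lambda>\<omega>. k (K \<omega>)) -` A \<inter> space M |A. A \<in> sets T'} \<subseteq> sigma_sets (space M) {K -` A \<inter> space M |A. A \<in> sets T}"
  proof (intro sigma_sets_mono subsetI)
    fix B assume "B \<in> {(\<lambda>\<omega>. k (K \<omega>)) -` A \<inter> space M |A. A \<in> sets T'}"
    then obtain A where A: "A \<in> sets T'" "B = (\<lambda>\<omega>. k (K \<omega>)) -` A \<inter> space M" by auto
    then have "B = K -` (k -` A \<inter> space T) \<inter> space M"
      using measurable_space[OF K] by auto
    then show "B \<in> sigma_sets (space M) {K -` A \<inter> space M |A. A \<in> sets T}"
      using measurable_sets[OF k A(1)] by (intro sigma_sets.Basic CollectI exI[of _ "k -` A \<inter> space T"] conjI)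
  qed
  have "indep_set (sigma_sets (space M) {Y -` A \<inter> space M |A. A \<in> sets N'})
     (sigma_sets (space M) {(\<lambda>\<omega>. k (K \<omega>)) -` A \<inter> space M |A. A \<in> sets T'})"
    unfolding indep_set_def
  proof (rule indep_sets_mono_sets)
    show "indep_sets (case_bool (sigma_sets (space M) {Z -` A \<inter> space M |A. A \<in> sets N})
       (sigma_sets (space M) {K -` A \<inter> space M |A. A \<in> sets T})) UNIV"
      using indep unfolding indep_var_eq indep_set_def by simp
  qed (use sub1 sub2 in \<open>auto split: bool.split\<close>)
  then show ?thesis
    unfolding indep_var_eq using YM K k by auto
qed

text \<open>The initial value is carried as \<open>e 0\<close>, so that one independent family
  drives the path and \<open>e (Suc j)\<close> is the noise entering between \<open>X j\<close> and
  \<open>X (Suc j)\<close>.\<close>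

locale ar_process = prob_space M
  for M :: "'w measure" and X e :: "nat \<Rightarrow> 'w \<Rightarrow> real" and s f p :: "real \<Rightarrow> real" +
  assumes e_indep: "indep_vars (\<lambda>_. borel) e UNIV"
    and e_dist: "\<And>j. distributed M lborel (e (Suc j)) (\<lambda>x. ennreal (f x))"
    and X_0: "\<And>\<omega>. X 0 \<omega> = e 0 \<omega>"
    and e_0_dist: "distributed M lborel (e 0) (\<lambda>x. ennreal (p x))"
    and X_Suc: "\<And>j \<omega>. \<omega> \<in> space M \<Longrightarrow> X (Suc j) \<omega> = s (X j \<omega>) + e (Suc j) \<omega>"
    and s_measurable [measurable]: "s \<in> borel_measurable borel"
    and inv: "invariant_density s f p"
    and f_nonneg: "\<And>x. 0 \<le> f x" and f_meas [measurable]: "f \<in> borel_measurable borel"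
begin

lemma p_measurable [measurable]: "p \<in> borel_measurable borel" and p_nonneg: "0 \<le> p x"
  using inv by (auto simp: invariant_density_def)

lemma e_measurable [measurable]: "e j \<in> borel_measurable M"
  using e_indep by (auto simp: indep_vars_def)

text \<open>The history up to time \<open>j\<close>. Generating it by the restricted tuple matches
  the form in which disjoint blocks of an independent family are known to be independent.\<close>

definition F :: "nat \<Rightarrow> 'w measure" where
  "F j = vimage_algebra (space M) (\<lambda>\<omega>. \<lambda>i\<in>{..j}. e i \<omega>) (PiM {..j} (\<lambda>_. borel))"

lemma space_F: "space (F j) = space M"
  by (simp add: F_def)

lemma e_F: "i \<le> j \<Longrightarrow> e i \<in> borel_measurable (F j)"
proof -
  assume i: "i \<le> j"
  have "(\<lambda>\<omega>. (\<lambda>i\<in>{..j}. e i \<omega>) i) \<in> borel_measurable (F j)"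
    unfolding F_def
    by (rule measurable_compose[OF measurable_vimage_algebra1])
       (use i in \<open>auto simp: space_PiM PiE_iff extensional_def intro!: measurable_component_singleton split: if_splits\<close>)
  then show ?thesis using i by simp
qed

lemma X_F: "i \<le> j \<Longrightarrow> X i \<in> borel_measurable (F j)"
proof (induction i)
  case 0
  then show ?case using e_F[of 0 j] X_0 by (simp cong: measurable_cong)
next
  case (Suc i)
  then have [measurable]: "X i \<in> borel_measurable (F j)" "e (Suc i) \<in> borel_measurable (F j)"
    using e_F by auto
  have "(\<lambda>\<omega>. s (X i \<omega>) + e (Suc i) \<omega>) \<in> borel_measurable (F j)"
    by measurable
  then show ?case
    by (rule measurable_cong[THEN iffD1, rotated]) (simp add: X_Suc space_F)
qed

lemma F_measurable: "Y \<in> measurable (F j) N \<Longrightarrow> Y \<in> measurable M N"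
proof -
  assume Y: "Y \<in> measurable (F j) N"
  have "sets (F j) = {(\<lambda>\<omega>. \<lambda>i\<in>{..j}. e i \<omega>) -` A \<inter> space M |A. A \<in> sets (PiM {..j} (\<lambda>_. borel))}"
    unfolding F_def by (intro sets_vimage_algebra2) (auto simp: space_PiM)
  also have "\<dots> \<subseteq> sets M"
    by (auto intro!: measurable_sets measurable_restrict)
  finally show ?thesis
    using Y by (auto simp: measurable_def space_F)
qed

lemma X_measurable [measurable]: "X j \<in> borel_measurable M"
  by (rule F_measurable[OF X_F[OF order_refl]])

text \<open>The history reads the coordinates up to \<open>j\<close>, the next innovation only
  coordinate \<open>Suc j\<close>.\<close>

lemma indep_future:
  assumes "Y \<in> measurable (F j) N" "k \<in> measurable borel T"
  shows "indep_var N Y T (\<lambda>\<omega>. k (e (Suc j) \<omega>))"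
proof -
  have "indep_var (PiM {..j} (\<lambda>_. borel)) (\<lambda>\<omega>. \<lambda>i\<in>{..j}. e i \<omega>)
    (PiM {Suc j} (\<lambda>_. borel)) (\<lambda>\<omega>. \<lambda>i\<in>{Suc j}. e i \<omega>)"
    by (rule indep_var_restrict[OF e_indep]) auto
  then have "indep_var N Y T (\<lambda>\<omega>. (\<lambda>x. k (x (Suc j))) (\<lambda>i\<in>{Suc j}. e i \<omega>))"
    by (rule indep_var_subset)
       (use assms in \<open>auto simp: F_def intro!: measurable_compose[OF measurable_component_singleton]\<close>)
  then show ?thesis by simp
qed

lemma expectation_e:
  fixes k :: "real \<Rightarrow> 'c::{banach, second_countable_topology}"
  assumes [measurable]: "k \<in> borel_measurable borel"
  shows "(\<integral>\<omega>. k (e (Suc j) \<omega>) \<partial>M) = (\<integral>x. f x *\<^sub>R k x \<partial>lborel)"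
proof -
  have "(\<integral>\<omega>. k (e (Suc j) \<omega>) \<partial>M) = (\<integral>x. k x \<partial>distr M lborel (e (Suc j)))"
    by (subst integral_distr) auto
  also have "distr M lborel (e (Suc j)) = density lborel (\<lambda>x. ennreal (f x))"
    using e_dist[of j] by (simp add: distributed_def)
  also have "(\<integral>x. k x \<partial>density lborel (\<lambda>x. ennreal (f x))) = (\<integral>x. f x *\<^sub>R k x \<partial>lborel)"
    using f_nonneg by (subst integral_density) auto
  finally show ?thesis .
qed

lemma expectation_future:
  fixes Y :: "'w \<Rightarrow> 'c::{real_normed_field, banach, second_countable_topology}"
  assumes Y: "Y \<in> borel_measurable (F j)" "\<And>\<omega>. norm (Y \<omega>) \<le> C"
    and k [measurable]: "k \<in> borel_measurable borel" and "\<And>x. norm (k x) \<le> D"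
  shows "(\<integral>\<omega>. Y \<omega> * k (e (Suc j) \<omega>) \<partial>M) = (\<integral>\<omega>. Y \<omega> \<partial>M) * (\<integral>x. f x *\<^sub>R k x \<partial>lborel)"
proof -
  have [measurable]: "Y \<in> borel_measurable M" using F_measurable Y by blast
  have "integrable M Y"
    using assms by (auto intro!: integrable_const_bound[of _ C])
  moreover have "integrable M (\<lambda>\<omega>. k (e (Suc j) \<omega>))"
    using assms by (auto intro!: integrable_const_bound[of _ D])
  ultimately have "(\<integral>\<omega>. Y \<omega> * k (e (Suc j) \<omega>) \<partial>M) = (\<integral>\<omega>. Y \<omega> \<partial>M) * (\<integral>\<omega>. k (e (Suc j) \<omega>) \<partial>M)"
    using indep_future[OF Y(1), of k borel] by (intro indep_var_lebesgue_integral) auto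
  then show ?thesis by (simp add: expectation_e)
qed

text \<open>Stationarity, by induction: \<open>X j\<close> and \<open>e (Suc j)\<close> are
  independent, so the law of their combination has density
  \<open>\<integral> f (y - s x) * p x\<close>, which is \<open>p y\<close> by invariance.\<close>

lemma X_distributed: "distr M borel (X j) = density lborel (\<lambda>x. ennreal (p x))"
proof (induction j)
  case 0
  have "distr M borel (X 0) = distr M lborel (e 0)"
    using X_0 by (intro distr_cong) auto
  then show ?case
    using e_0_dist by (simp add: distributed_def)
next
  case (Suc j)
  have XF: "X j \<in> borel_measurable (F j)" by (rule X_F) simp
  have "indep_var borel (X j) borel (e (Suc j))"
    using indep_future[OF XF, of "\<lambda>x. x" borel] by simp
  then have joint: "distr M (borel \<Otimes>\<^sub>M borel) (\<lambda>\<omega>. (X j \<omega>, e (Suc j) \<omega>)) =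
     distr M borel (X j) \<Otimes>\<^sub>M distr M borel (e (Suc j))"
    unfolding indep_var_distribution_eq by simp
  have e_dens: "distr M borel (e (Suc j)) = density lborel (\<lambda>x. ennreal (f x))"
    using e_dist[of j] by (simp add: distributed_def cong: distr_cong)
  interpret E: prob_space "density lborel (\<lambda>x. ennreal (f x))"
    unfolding e_dens[symmetric] by (rule prob_space_distr) simp
  show ?case
  proof (rule measure_eqI)
    fix A assume "A \<in> sets (distr M borel (X (Suc j)))"
    then have [measurable]: "A \<in> sets borel" by simp
    have "emeasure (distr M borel (X (Suc j))) A = (\<integral>\<^sup>+\<omega>. indicator A (X (Suc j) \<omega>) \<partial>M)"
      by (subst emeasure_distr; simp flip: nn_integral_indicator)
         (auto intro!: nn_integral_cong simp: indicator_def)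
    also have "\<dots> = (\<integral>\<^sup>+\<omega>. (\<lambda>z. indicator A (s (fst z) + snd z)) (X j \<omega>, e (Suc j) \<omega>) \<partial>M)"
      by (intro nn_integral_cong) (simp add: X_Suc)
    also have "\<dots> = (\<integral>\<^sup>+z. indicator A (s (fst z) + snd z) \<partial>distr M (borel \<Otimes>\<^sub>M borel) (\<lambda>\<omega>. (X j \<omega>, e (Suc j) \<omega>)))"
      by (subst nn_integral_distr) auto
    also have "\<dots> = (\<integral>\<^sup>+x. \<integral>\<^sup>+u. indicator A (s x + u) \<partial>density lborel (\<lambda>x. ennreal (f x)) \<partial>density lborel (\<lambda>x. ennreal (p x)))"
      unfolding joint Suc e_dens by (subst E.nn_integral_fst[symmetric]) auto
    also have "\<dots> = (\<integral>\<^sup>+x. ennreal (p x) * (\<integral>\<^sup>+u. ennreal (f u) * indicator A (s x + u) \<partial>lborel) \<partial>lborel)"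
      by (subst nn_integral_density) (auto simp: nn_integral_density)
    also have "\<dots> = (\<integral>\<^sup>+x. ennreal (p x) * (\<integral>\<^sup>+y. ennreal (f (y - s x)) * indicator A y \<partial>lborel) \<partial>lborel)"
    proof -
      have "(\<integral>\<^sup>+u. ennreal (f u) * indicator A (s x + u) \<partial>lborel) = (\<integral>\<^sup>+y. ennreal (f (y - s x)) * indicator A y \<partial>lborel)" for x
        by (subst nn_integral_real_affine[where c=1 and t="- s x"]) auto
      then show ?thesis by simp
    qed
    also have "\<dots> = (\<integral>\<^sup>+x. \<integral>\<^sup>+y. ennreal (p x) * (ennreal (f (y - s x)) * indicator A y) \<partial>lborel \<partial>lborel)"
      by (subst nn_integral_cmult) auto
    \<comment> \<open>Exchanging the integrals isolates a fixed \<open>y\<close>, the form in which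
      the invariance equation is available.\<close>
    also have "\<dots> = (\<integral>\<^sup>+y. \<integral>\<^sup>+x. ennreal (p x) * (ennreal (f (y - s x)) * indicator A y) \<partial>lborel \<partial>lborel)"
      by (rule lborel_pair.Fubini') measurable
    also have "\<dots> = (\<integral>\<^sup>+y. ennreal (p y) * indicator A y \<partial>lborel)"
    proof (intro nn_integral_cong)
      fix y
      have "(\<integral>\<^sup>+x. ennreal (p x) * (ennreal (f (y - s x)) * indicator A y) \<partial>lborel) =
        (\<integral>\<^sup>+x. ennreal (f (y - s x) * p x) \<partial>lborel) * indicator A y"
        by (subst nn_integral_multc[symmetric]) (auto simp: ennreal_mult' f_nonneg p_nonneg mult_ac intro!: nn_integral_cong)
      also have "\<dots> = ennreal (p y) * indicator A y"
        using inv by (simp add: invariant_density_def)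
      finally show "(\<integral>\<^sup>+x. ennreal (p x) * (ennreal (f (y - s x)) * indicator A y) \<partial>lborel) = ennreal (p y) * indicator A y" .
    qed
    also have "\<dots> = emeasure (density lborel (\<lambda>x. ennreal (p x))) A"
      by (subst emeasure_density) auto
    finally show "emeasure (distr M borel (X (Suc j))) A = emeasure (density lborel (\<lambda>x. ennreal (p x))) A" .
  qed simp
qed

lemma expectation_X:
  fixes h :: "real \<Rightarrow> real"
  assumes [measurable]: "h \<in> borel_measurable borel"
  shows "(\<integral>\<omega>. h (X j \<omega>) \<partial>M) = (\<integral>x. h x * p x \<partial>lborel)"
proof -
  have "(\<integral>\<omega>. h (X j \<omega>) \<partial>M) = (\<integral>x. h x \<partial>distr M borel (X j))"
    by (subst integral_distr) auto
  then show ?thesis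
    using p_nonneg by (simp add: X_distributed integral_density mult.commute)
qed

lemma expectation_score_pair:
  fixes h k :: "real \<Rightarrow> real"
  assumes [measurable]: "h \<in> borel_measurable borel" "k \<in> borel_measurable borel"
    and "\<And>x. \<bar>h x\<bar> \<le> C" "\<And>x. \<bar>k x\<bar> \<le> D"
  shows "(\<integral>\<omega>. k (e (Suc j) \<omega>) * h (X j \<omega>) \<partial>M) = (\<integral>x. k x * f x \<partial>lborel) * (\<integral>x. h x * p x \<partial>lborel)"
proof -
  have [measurable]: "X j \<in> borel_measurable (F j)" by (rule X_F) simp
  have "(\<integral>\<omega>. h (X j \<omega>) * k (e (Suc j) \<omega>) \<partial>M) = (\<integral>\<omega>. h (X j \<omega>) \<partial>M) * (\<integral>x. f x *\<^sub>R k x \<partial>lborel)"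
    using assms by (intro expectation_future) auto
  then show ?thesis by (simp add: expectation_X mult_ac)
qed

text \<open>Martingale differences are orthogonal.\<close>
lemma expectation_score_sum_square:
  fixes h k :: "real \<Rightarrow> real"
  assumes [measurable]: "h \<in> borel_measurable borel" "k \<in> borel_measurable borel"
    and h: "\<And>x. \<bar>h x\<bar> \<le> C" and k: "\<And>x. \<bar>k x\<bar> \<le> D" and k0: "(\<integral>x. k x * f x \<partial>lborel) = 0"
  shows "(\<integral>\<omega>. (\<Sum>j<n. k (e (Suc j) \<omega>) * h (X j \<omega>))\<^sup>2 \<partial>M) =
     real n * ((\<integral>x. (k x)\<^sup>2 * f x \<partial>lborel) * (\<integral>x. (h x)\<^sup>2 * p x \<partial>lborel))"
proof (induction n)
  case (Suc n)
  let ?S = "\<lambda>\<omega>. \<Sum>j<n. k (e (Suc j) \<omega>) * h (X j \<omega>)"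
  have CD: "0 \<le> C" "0 \<le> D" using h[of 0] k[of 0] by auto
  have b1: "\<bar>k x * h y\<bar> \<le> D * C" for x y
    using h k CD by (auto simp: abs_mult intro!: mult_mono)
  have bS: "\<bar>?S \<omega>\<bar> \<le> real n * (D * C)" for \<omega>
  proof -
    have "\<bar>?S \<omega>\<bar> \<le> (\<Sum>j<n. D * C)" by (rule order_trans[OF sum_abs]) (intro sum_mono b1)
    then show ?thesis by simp
  qed
  have SF: "(\<lambda>\<omega>. ?S \<omega> * h (X n \<omega>)) \<in> borel_measurable (F n)"
    by (intro borel_measurable_times borel_measurable_sum measurable_compose[OF X_F assms(1)]
        measurable_compose[OF e_F assms(2)]) auto
  \<comment> \<open>The partial sum times \<open>h (X n)\<close> belongs to the history
    \<open>F n\<close>, and \<open>k\<close> is centred, so the mixed term of the square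
    vanishes.\<close>
  have "(\<integral>\<omega>. (?S \<omega> * h (X n \<omega>)) * k (e (Suc n) \<omega>) \<partial>M) = (\<integral>\<omega>. ?S \<omega> * h (X n \<omega>) \<partial>M) * (\<integral>x. f x *\<^sub>R k x \<partial>lborel)"
  proof (rule expectation_future[OF SF])
    show "norm (?S \<omega> * h (X n \<omega>)) \<le> (real n * (D * C)) * C" for \<omega>
      unfolding real_norm_def abs_mult by (intro mult_mono h bS) (auto simp: CD)
  qed (use k in auto)
  then have cross: "(\<integral>\<omega>. ?S \<omega> * (k (e (Suc n) \<omega>) * h (X n \<omega>)) \<partial>M) = 0"
    using k0 by (simp add: mult_ac)
  have i: "integrable M (\<lambda>\<omega>. (?S \<omega>)\<^sup>2)"
    using power_mono[OF bS, where n=2] by (intro integrable_const_bound[of _ "(real n * (D * C))\<^sup>2"]) auto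
  have i': "integrable M (\<lambda>\<omega>. (k (e (Suc n) \<omega>) * h (X n \<omega>))\<^sup>2)"
    using power_mono[OF b1, where n=2] by (intro integrable_const_bound[of _ "(D * C)\<^sup>2"]) auto
  have i'': "integrable M (\<lambda>\<omega>. ?S \<omega> * (k (e (Suc n) \<omega>) * h (X n \<omega>)))"
  proof (rule integrable_const_bound[of _ "(real n * (D * C)) * (D * C)"])
    show "AE \<omega> in M. norm (?S \<omega> * (k (e (Suc n) \<omega>) * h (X n \<omega>))) \<le> (real n * (D * C)) * (D * C)"
      unfolding real_norm_def abs_mult[of "?S _"] by (intro AE_I2 mult_mono b1 bS) (auto simp: CD)
  qed measurable
  have sq: "(\<integral>\<omega>. (k (e (Suc n) \<omega>) * h (X n \<omega>))\<^sup>2 \<partial>M) = (\<integral>x. (k x)\<^sup>2 * f x \<partial>lborel) * (\<integral>x. (h x)\<^sup>2 * p x \<partial>lborel)"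
    unfolding power_mult_distrib
    by (rule expectation_score_pair[where C="C\<^sup>2" and D="D\<^sup>2"])
       (use power_mono[OF h, where n=2] power_mono[OF k, where n=2] in auto)
  have "(\<integral>\<omega>. (\<Sum>j<Suc n. k (e (Suc j) \<omega>) * h (X j \<omega>))\<^sup>2 \<partial>M) =
     (\<integral>\<omega>. ((?S \<omega>)\<^sup>2 + 2 * (?S \<omega> * (k (e (Suc n) \<omega>) * h (X n \<omega>)))) + (k (e (Suc n) \<omega>) * h (X n \<omega>))\<^sup>2 \<partial>M)"
    by (intro Bochner_Integration.integral_cong) (auto simp: power2_eq_square algebra_simps)
  also have "\<dots> = (\<integral>\<omega>. (?S \<omega>)\<^sup>2 \<partial>M) + 2 * 0 + (\<integral>\<omega>. (k (e (Suc n) \<omega>) * h (X n \<omega>))\<^sup>2 \<partial>M)"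
    using i i' i'' cross by (subst Bochner_Integration.integral_add; simp)+
  also have "\<dots> = real (Suc n) * ((\<integral>x. (k x)\<^sup>2 * f x \<partial>lborel) * (\<integral>x. (h x)\<^sup>2 * p x \<partial>lborel))"
    unfolding sq Suc.IH by (simp add: distrib_right)
  finally show ?case .
qed simp

end

subsection \<open>A central limit theorem for the score\<close>

lemma tendsto_0_le:
  fixes u v :: "'a \<Rightarrow> real"
  assumes "(v \<longlongrightarrow> 0) G" "\<And>x. 0 \<le> u x" "\<And>x. u x \<le> v x"
  shows "(u \<longlongrightarrow> 0) G"
  by (rule Lim_null_comparison[OF _ assms(1)]) (use assms in auto)

text \<open>Factors are exchanged one at a time; norms at most one keep the individual errors from
  being amplified.\<close>

lemma norm_prod_diff_le:
  fixes a b :: "nat \<Rightarrow> complex"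
  assumes "\<And>j. norm (a j) \<le> 1" "\<And>j. norm (b j) \<le> 1"
  shows "norm ((\<Prod>j<n. a j) - (\<Prod>j<n. b j)) \<le> (\<Sum>j<n. norm (a j - b j))"
proof (induction n)
  case (Suc n)
  have "(\<Prod>j<Suc n. a j) - (\<Prod>j<Suc n. b j) =
    ((\<Prod>j<n. a j) - (\<Prod>j<n. b j)) * a n + (\<Prod>j<n. b j) * (a n - b n)"
    by (simp add: algebra_simps)
  also have "norm \<dots> \<le> norm ((\<Prod>j<n. a j) - (\<Prod>j<n. b j)) * norm (a n) + norm (\<Prod>j<n. b j) * norm (a n - b n)"
    by (intro order_trans[OF norm_triangle_ineq]) (simp add: norm_mult)
  also have "\<dots> \<le> norm ((\<Prod>j<n. a j) - (\<Prod>j<n. b j)) * 1 + 1 * norm (a n - b n)"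
    using assms by (intro add_mono mult_left_mono mult_right_mono) (auto simp flip: prod_norm intro!: prod_le_1)
  finally show ?case using Suc by simp
qed simp

text \<open>The summand \<open>u\<^sup>2 / 2\<close> cancels the quadratic Taylor term of
  \<open>exp (\<i> * u)\<close>, which leaves a cubic error. The constants met are
  \<open>27 / 8\<close> for the Taylor remainder and \<open>5 / 8\<close> for the surviving terms of
  orders three and four.\<close>

lemma norm_exp_minus_linear:
  fixes u :: real
  assumes "\<bar>u\<bar> \<le> 1"
  shows "norm (exp (\<i> * u + u\<^sup>2 / 2) - (1 + \<i> * u)) \<le> 5 * \<bar>u\<bar> ^ 3"
proof -
  define z :: complex where "z = \<i> * u + u\<^sup>2 / 2"
  have u2: "u\<^sup>2 \<le> \<bar>u\<bar>"
    using mult_left_mono[OF assms, of "\<bar>u\<bar>"] by (simp add: power2_eq_square)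
  have "norm z \<le> \<bar>u\<bar> + u\<^sup>2 / 2"
    unfolding z_def by (rule order_trans[OF norm_triangle_ineq]) (simp add: norm_mult norm_power norm_divide)
  then have nz: "norm z \<le> 3 / 2 * \<bar>u\<bar>" using u2 by simp
  have "\<bar>Re z\<bar> \<le> 1 / 2"
    using u2 assms by (simp add: z_def)
  then have "exp \<bar>Re z\<bar> \<le> exp (1 / 2)" by simp
  \<comment> \<open>Squaring reduces this to \<open>exp 1 \<le> 3 \<le> 4\<close>.\<close>
  also have "\<dots> \<le> (2::real)"
    by (rule power2_le_imp_le) (use exp_le in \<open>auto simp flip: exp_of_nat_mult exp_double\<close>)
  finally have e: "exp \<bar>Re z\<bar> \<le> 2" .
  have "norm (exp z - (\<Sum>k\<le>2. z ^ k / fact k)) \<le> exp \<bar>Re z\<bar> * norm z ^ 3 / 2"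
    using Taylor_exp[of z 2] by (simp add: eval_nat_numeral)
  also have "\<dots> \<le> 2 * (3 / 2 * \<bar>u\<bar>) ^ 3 / 2"
    using e nz by (intro divide_right_mono mult_mono power_mono) auto
  also have "\<dots> = 27 / 8 * \<bar>u\<bar> ^ 3" by (simp add: power3_eq_cube)
  finally have 1: "norm (exp z - (\<Sum>k\<le>2. z ^ k / fact k)) \<le> 27 / 8 * \<bar>u\<bar> ^ 3" .
  have "(\<Sum>k\<le>2. z ^ k / fact k) - (1 + \<i> * u) = \<i> * u ^ 3 / 2 + u ^ 4 / 8"
    by (simp add: z_def eval_nat_numeral field_simps)
  also have "norm \<dots> \<le> \<bar>u\<bar> ^ 3 / 2 + \<bar>u\<bar> ^ 4 / 8"
    by (rule order_trans[OF norm_triangle_ineq]) (simp add: norm_mult norm_power norm_divide)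
  also have "\<bar>u\<bar> ^ 4 \<le> \<bar>u\<bar> ^ 3"
    using assms by (intro power_decreasing) auto
  finally have 2: "norm ((\<Sum>k\<le>2. z ^ k / fact k) - (1 + \<i> * u)) \<le> 5 / 8 * \<bar>u\<bar> ^ 3" by simp
  have "norm (exp z - (1 + \<i> * u)) \<le> 27 / 8 * \<bar>u\<bar> ^ 3 + 5 / 8 * \<bar>u\<bar> ^ 3"
    using norm_triangle_mono[OF 1 2] by (simp only: diff_add_cancel add_diff_eq[symmetric] diff_add_eq) (simp add: algebra_simps)
  then show ?thesis
    unfolding z_def by (rule order_trans) (simp add: field_simps)
qed

section \<open>Ergodic averages and characteristic functions of score sums\<close>

locale ergodic_ar = ar_process +
  assumes ergodic: "ergodic_with_density M X p"
begin

lemma f_int: "integrable lborel f" "(\<integral>x. f x \<partial>lborel) = 1"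
proof -
  show 1: "(\<integral>x. f x \<partial>lborel) = 1"
    using expectation_e[of "\<lambda>_. 1::real"] prob_space by simp
  show "integrable lborel f"
    using 1 not_integrable_integral_eq by fastforce
qed

lemma p_int: "integrable lborel p" "(\<integral>x. p x \<partial>lborel) = 1"
proof -
  show 1: "(\<integral>x. p x \<partial>lborel) = 1"
    using expectation_X[of "\<lambda>_. 1::real"] prob_space by simp
  show "integrable lborel p"
    using 1 not_integrable_integral_eq by fastforce
qed

lemma integrable_bounded_times:
  assumes [measurable]: "k \<in> borel_measurable borel" and "\<And>x. \<bar>k x\<bar> \<le> C"
  shows "integrable lborel (\<lambda>x. k x * f x)" "integrable lborel (\<lambda>x. k x * p x)"
proof -
  show "integrable lborel (\<lambda>x. k x * f x)"
    by (rule Bochner_Integration.integrable_bound[of _ "\<lambda>x. C * f x"])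
       (use f_int f_nonneg assms(2) in \<open>auto simp: abs_mult intro!: mult_mono order_trans[OF assms(2)]\<close>)
  show "integrable lborel (\<lambda>x. k x * p x)"
    by (rule Bochner_Integration.integrable_bound[of _ "\<lambda>x. C * p x"])
       (use p_int p_nonneg assms(2) in \<open>auto simp: abs_mult intro!: mult_mono order_trans[OF assms(2)]\<close>)
qed

text \<open>The ergodic hypothesis averages over \<open>X 1\<close> to \<open>X n\<close>, the
  regressors are \<open>X 0\<close> to \<open>X (n - 1)\<close>. The two sums differ by
  \<open>h (X 0) - h (X n)\<close>, which is bounded and disappears after division by
  \<open>n\<close>.\<close>

lemma average_AE:
  assumes [measurable]: "h \<in> borel_measurable borel" and h: "\<And>x. \<bar>h x\<bar> \<le> C"
  shows "AE \<omega> in M. (\<lambda>n. (\<Sum>j<n. h (X j \<omega>)) / real n) \<longlonglongrightarrow> (\<integral>x. h x * p x \<partial>lborel)"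
proof -
  have "AE \<omega> in M. (\<lambda>n. (\<Sum>j=1..n. h (X j \<omega>)) / real n) \<longlonglongrightarrow> (\<integral>x. h x * p x \<partial>lborel)"
    using ergodic integrable_bounded_times(2)[OF assms] unfolding ergodic_with_density_def by auto
  then show ?thesis
  proof eventually_elim
    case (elim \<omega>)
    have shift: "(\<Sum>j=1..n. h (X j \<omega>)) + h (X 0 \<omega>) - h (X n \<omega>) = (\<Sum>j<n. h (X j \<omega>))" for n
      by (induction n) auto
    have "(\<lambda>n. (h (X 0 \<omega>) - h (X n \<omega>)) / real n) \<longlonglongrightarrow> 0"
    proof (rule Lim_null_comparison)
      show "\<forall>\<^sub>F n in sequentially. norm ((h (X 0 \<omega>) - h (X n \<omega>)) / real n) \<le> 2 * C / real n"
      proof (intro always_eventually allI)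
        fix n
        have "\<bar>h (X 0 \<omega>) - h (X n \<omega>)\<bar> \<le> 2 * C"
          using h[of "X 0 \<omega>"] h[of "X n \<omega>"] by linarith
        then show "norm ((h (X 0 \<omega>) - h (X n \<omega>)) / real n) \<le> 2 * C / real n"
          by (simp add: abs_divide divide_right_mono)
      qed
      show "(\<lambda>n. 2 * C / real n) \<longlonglongrightarrow> 0" by real_asymp
    qed
    from tendsto_add[OF elim this] show ?case
      by (simp add: shift[symmetric] add_divide_distrib diff_divide_distrib add_diff_eq)
  qed
qed

text \<open>Splitting off the mean \<kappa> of \<open>k\<close> leaves a martingale sum
  \<open>A\<close> with second moment proportional to \<open>n\<close>, and \<kappa> times an
  ergodic average \<open>B\<close>, whose almost sure convergence becomes convergence in mean square
  because it is bounded.\<close>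

lemma average_L2:
  assumes [measurable]: "h \<in> borel_measurable borel" "k \<in> borel_measurable borel"
    and h: "\<And>x. \<bar>h x\<bar> \<le> C" and k: "\<And>x. \<bar>k x\<bar> \<le> D"
  shows "(\<lambda>n. \<integral>\<omega>. ((\<Sum>j<n. k (e (Suc j) \<omega>) * h (X j \<omega>)) / real n
       - (\<integral>x. k x * f x \<partial>lborel) * (\<integral>x. h x * p x \<partial>lborel))\<^sup>2 \<partial>M) \<longlonglongrightarrow> 0"
proof -
  define \<kappa> where "\<kappa> = (\<integral>x. k x * f x \<partial>lborel)"
  define \<eta> where "\<eta> = (\<integral>x. h x * p x \<partial>lborel)"
  define V where "V = (\<integral>x. (k x - \<kappa>)\<^sup>2 * f x \<partial>lborel) * (\<integral>x. (h x)\<^sup>2 * p x \<partial>lborel)"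
  define A where "A n \<omega> = (\<Sum>j<n. (k (e (Suc j) \<omega>) - \<kappa>) * h (X j \<omega>))" for n \<omega>
  define B where "B n \<omega> = \<kappa> * ((\<Sum>j<n. h (X j \<omega>)) / real n - \<eta>)" for n \<omega>
  have C: "0 \<le> C" using h[of 0] by simp
  have k': "\<bar>k x - \<kappa>\<bar> \<le> D + \<bar>\<kappa>\<bar>" for x using k[of x] by simp
  have "(\<integral>x. (k x - \<kappa>) * f x \<partial>lborel) = 0"
    using integrable_bounded_times(1)[OF assms(2) k] f_int by (simp add: left_diff_distrib \<kappa>_def)
  then have EA: "(\<integral>\<omega>. (A n \<omega>)\<^sup>2 \<partial>M) = real n * V" for n
    unfolding A_def V_def using h k' by (intro expectation_score_sum_square) auto
  have avg_bound: "\<bar>(\<Sum>j<n. h (X j \<omega>)) / real n\<bar> \<le> C" for n \<omega>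
  proof -
    have "\<bar>\<Sum>j<n. h (X j \<omega>)\<bar> \<le> (\<Sum>j<n. C)" by (rule order_trans[OF sum_abs]) (intro sum_mono h)
    then show ?thesis using C by (cases "n = 0") (auto simp: field_simps)
  qed
  have A_meas [measurable]: "A n \<in> borel_measurable M" and B_meas [measurable]: "B n \<in> borel_measurable M" for n
    unfolding A_def B_def by measurable
  have A_bound: "\<bar>A n \<omega>\<bar> \<le> real n * ((D + \<bar>\<kappa>\<bar>) * C)" for n \<omega>
  proof -
    have "\<bar>A n \<omega>\<bar> \<le> (\<Sum>j<n. (D + \<bar>\<kappa>\<bar>) * C)"
      unfolding A_def
    proof (rule order_trans[OF sum_abs], rule sum_mono)
      show "\<bar>(k (e (Suc j) \<omega>) - \<kappa>) * h (X j \<omega>)\<bar> \<le> (D + \<bar>\<kappa>\<bar>) * C" for j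
        unfolding abs_mult by (intro mult_mono h k') (use order_trans[OF abs_ge_zero k'] in auto)
    qed
    then show ?thesis by simp
  qed
  have A_int: "integrable M (\<lambda>\<omega>. (A n \<omega>)\<^sup>2)" for n
    using power_mono[OF A_bound, where n=2]
    by (intro integrable_const_bound[of _ "(real n * ((D + \<bar>\<kappa>\<bar>) * C))\<^sup>2"]) auto
  have B_bound: "\<bar>B n \<omega>\<bar> \<le> \<bar>\<kappa>\<bar> * (C + \<bar>\<eta>\<bar>)" for n \<omega>
    unfolding B_def abs_mult using avg_bound[of \<omega> n]
    by (intro mult_left_mono order_trans[OF abs_triangle_ineq4] add_mono) auto
  have B2_bound: "(B n \<omega>)\<^sup>2 \<le> (\<bar>\<kappa>\<bar> * (C + \<bar>\<eta>\<bar>))\<^sup>2" for n \<omega>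
    using power_mono[OF B_bound, where n=2] by simp
  have B_int: "integrable M (\<lambda>\<omega>. (B n \<omega>)\<^sup>2)" for n
    using B2_bound by (intro integrable_const_bound[of _ "(\<bar>\<kappa>\<bar> * (C + \<bar>\<eta>\<bar>))\<^sup>2"]) auto
  have limB: "(\<lambda>n. \<integral>\<omega>. (B n \<omega>)\<^sup>2 \<partial>M) \<longlonglongrightarrow> (\<integral>\<omega>. 0 \<partial>M)"
  proof (rule integral_dominated_convergence[where w="\<lambda>_. (\<bar>\<kappa>\<bar> * (C + \<bar>\<eta>\<bar>))\<^sup>2"])
    show "AE \<omega> in M. (\<lambda>n. (B n \<omega>)\<^sup>2) \<longlonglongrightarrow> 0"
      using average_AE[OF assms(1) h]
    proof eventually_elim
      case (elim \<omega>)
      then have "(\<lambda>n. B n \<omega>) \<longlonglongrightarrow> \<kappa> * (\<eta> - \<eta>)"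
        unfolding B_def \<eta>_def by (intro tendsto_intros)
      from tendsto_power[OF this, of 2] show ?case by simp
    qed
  qed (use B2_bound in auto)
  have eq: "(\<Sum>j<n. k (e (Suc j) \<omega>) * h (X j \<omega>)) / real n - \<kappa> * \<eta> = A n \<omega> / real n + B n \<omega>" for n \<omega>
    by (simp add: A_def B_def left_diff_distrib sum_subtractf sum_distrib_left[symmetric] algebra_simps diff_divide_distrib)
  have le: "(\<integral>\<omega>. (A n \<omega> / real n + B n \<omega>)\<^sup>2 \<partial>M) \<le> 2 * V / real n + 2 * (\<integral>\<omega>. (B n \<omega>)\<^sup>2 \<partial>M)" for n
  proof -
    have pt: "(A n \<omega> / real n + B n \<omega>)\<^sup>2 \<le> 2 / (real n)\<^sup>2 * (A n \<omega>)\<^sup>2 + 2 * (B n \<omega>)\<^sup>2" for \<omega>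
      using sum_squares_bound[of "A n \<omega> / real n" "B n \<omega>"] by (simp add: power2_sum power_divide)
    have "(\<integral>\<omega>. (A n \<omega> / real n + B n \<omega>)\<^sup>2 \<partial>M) \<le> (\<integral>\<omega>. 2 / (real n)\<^sup>2 * (A n \<omega>)\<^sup>2 + 2 * (B n \<omega>)\<^sup>2 \<partial>M)"
    proof (intro integral_mono pt)
      show "integrable M (\<lambda>\<omega>. 2 / (real n)\<^sup>2 * (A n \<omega>)\<^sup>2 + 2 * (B n \<omega>)\<^sup>2)"
        using A_int[of n] B_int[of n] by auto
      then show "integrable M (\<lambda>\<omega>. (A n \<omega> / real n + B n \<omega>)\<^sup>2)"
        by (rule Bochner_Integration.integrable_bound) (use pt in auto)
    qed
    also have "\<dots> = 2 * V / real n + 2 * (\<integral>\<omega>. (B n \<omega>)\<^sup>2 \<partial>M)"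
      using A_int[of n] B_int[of n] by (simp add: EA) (simp add: power2_eq_square)
    finally show ?thesis .
  qed
  have "(\<lambda>n. 2 * V / real n + 2 * (\<integral>\<omega>. (B n \<omega>)\<^sup>2 \<partial>M)) \<longlonglongrightarrow> 0 + 2 * 0"
  proof (intro tendsto_add tendsto_mult tendsto_const)
    show "(\<lambda>n. 2 * V / real n) \<longlonglongrightarrow> 0" by real_asymp
    show "(\<lambda>n. \<integral>\<omega>. (B n \<omega>)\<^sup>2 \<partial>M) \<longlonglongrightarrow> 0" using limB by simp
  qed
  then have "(\<lambda>n. 2 * V / real n + 2 * (\<integral>\<omega>. (B n \<omega>)\<^sup>2 \<partial>M)) \<longlonglongrightarrow> 0"
    by simp
  then have "(\<lambda>n. \<integral>\<omega>. (A n \<omega> / real n + B n \<omega>)\<^sup>2 \<partial>M) \<longlonglongrightarrow> 0"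
    by (rule tendsto_0_le) (use le in auto)
  then show ?thesis
    unfolding \<kappa>_def[symmetric] \<eta>_def[symmetric] eq .
qed


text \<open>Given the history, the last factor has mean one because \<open>k\<close> is centred; so
  factors are removed one by one.\<close>

lemma expectation_product_eq_1:
  fixes h k :: "real \<Rightarrow> real" and c :: real
  assumes [measurable]: "h \<in> borel_measurable borel" "k \<in> borel_measurable borel"
    and h: "\<And>x. \<bar>h x\<bar> \<le> C" and k: "\<And>x. \<bar>k x\<bar> \<le> D" and k0: "(\<integral>x. k x * f x \<partial>lborel) = 0"
  shows "(\<integral>\<omega>. (\<Prod>j<n. 1 + \<i> * (c * (k (e (Suc j) \<omega>) * h (X j \<omega>)))) \<partial>M) = 1"
proof (induction n)
  case (Suc n)
  let ?P = "\<lambda>\<omega>. \<Prod>j<n. 1 + \<i> * (c * (k (e (Suc j) \<omega>) * h (X j \<omega>)))"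
  define b where "b = 1 + \<bar>c\<bar> * (D * C)"
  have CD: "0 \<le> C" "0 \<le> D" using h[of 0] k[of 0] by auto
  have P_bound: "norm (?P \<omega>) \<le> b ^ n" for \<omega>
  proof -
    have "norm (1 + \<i> * (c * (k (e (Suc j) \<omega>) * h (X j \<omega>)))) \<le> b" for j
      unfolding b_def
      by (rule order_trans[OF norm_triangle_ineq])
         (auto simp: norm_mult intro!: mult_left_mono mult_mono h k CD)
    then have "(\<Prod>j<n. norm (1 + \<i> * (c * (k (e (Suc j) \<omega>) * h (X j \<omega>))))) \<le> (\<Prod>j<n. b)"
      by (intro prod_mono) auto
    then show ?thesis by (simp add: prod_norm)
  qed
  have PF: "(\<lambda>\<omega>. ?P \<omega> * (\<i> * (c * h (X n \<omega>)))) \<in> borel_measurable (F n)"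
    by (intro borel_measurable_times borel_measurable_prod borel_measurable_add borel_measurable_const
        measurable_compose[OF _ borel_measurable_of_real] measurable_compose[OF X_F assms(1)]
        measurable_compose[OF e_F assms(2)]) auto
  have "(\<integral>\<omega>. (?P \<omega> * (\<i> * (c * h (X n \<omega>)))) * of_real (k (e (Suc n) \<omega>)) \<partial>M) =
      (\<integral>\<omega>. ?P \<omega> * (\<i> * (c * h (X n \<omega>))) \<partial>M) * (\<integral>x. f x *\<^sub>R complex_of_real (k x) \<partial>lborel)"
  proof (rule expectation_future[OF PF, where k="\<lambda>x. complex_of_real (k x)" and D=D])
    show "norm (?P \<omega> * (\<i> * (c * h (X n \<omega>)))) \<le> b ^ n * (\<bar>c\<bar> * C)" for \<omega>
    proof -
      have "norm (\<i> * complex_of_real (c * h (X n \<omega>))) \<le> \<bar>c\<bar> * C"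
        by (auto simp: norm_mult intro!: mult_left_mono h)
      then show ?thesis
        unfolding norm_mult[of "?P \<omega>"] by (intro mult_mono P_bound) (auto simp: b_def CD)
    qed
  qed (use k in auto)
  also have "(\<integral>x. f x *\<^sub>R complex_of_real (k x) \<partial>lborel) = (\<integral>x. complex_of_real (k x * f x) \<partial>lborel)"
    by (simp add: scaleR_conv_of_real mult.commute)
  also have "\<dots> = 0"
    unfolding integral_complex_of_real k0 by simp
  finally have z: "(\<integral>\<omega>. ?P \<omega> * (\<i> * (c * (k (e (Suc n) \<omega>) * h (X n \<omega>)))) \<partial>M) = 0"
    by (simp add: mult_ac)
  have "(\<integral>\<omega>. (\<Prod>j<Suc n. 1 + \<i> * (c * (k (e (Suc j) \<omega>) * h (X j \<omega>)))) \<partial>M) =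
    (\<integral>\<omega>. ?P \<omega> + ?P \<omega> * (\<i> * (c * (k (e (Suc n) \<omega>) * h (X n \<omega>)))) \<partial>M)"
    by (intro Bochner_Integration.integral_cong refl) (simp add: distrib_left)
  also have "\<dots> = 1 + 0"
  proof (subst Bochner_Integration.integral_add)
    show "integrable M ?P"
      using P_bound by (intro integrable_const_bound[of _ "b ^ n"]) auto
    show "integrable M (\<lambda>\<omega>. ?P \<omega> * (\<i> * (c * (k (e (Suc n) \<omega>) * h (X n \<omega>)))))"
    proof (rule integrable_const_bound[of _ "b ^ n * (\<bar>c\<bar> * (D * C))"])
      show "AE \<omega> in M. norm (?P \<omega> * (\<i> * (c * (k (e (Suc n) \<omega>) * h (X n \<omega>))))) \<le> b ^ n * (\<bar>c\<bar> * (D * C))"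
      proof (intro AE_I2)
        fix \<omega>
        have "norm (\<i> * complex_of_real (c * (k (e (Suc n) \<omega>) * h (X n \<omega>)))) \<le> \<bar>c\<bar> * (D * C)"
          by (auto simp: norm_mult CD intro!: mult_left_mono mult_mono h k)
        then show "norm (?P \<omega> * (\<i> * (c * (k (e (Suc n) \<omega>) * h (X n \<omega>))))) \<le> b ^ n * (\<bar>c\<bar> * (D * C))"
          unfolding norm_mult[of "?P \<omega>"] by (intro mult_mono P_bound) (auto simp: b_def CD)
      qed
    qed measurable
  qed (use z Suc in auto)
  finally show ?case by simp
qed (use prob_space in simp)

text \<open>
  The product \<open>\<Prod>(1 + \<i> u\<^sub>j)\<close> has mean one and is close to \<open>exp (\<i> \<Sum>u\<^sub>j + \<Sum>u\<^sub>j\<^sup>2 / 2)\<close>,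
  while \<open>\<Sum>u\<^sub>j\<^sup>2\<close> tends to a constant.
\<close>
theorem score_clt:
  fixes h k :: "real \<Rightarrow> real"
  assumes [measurable]: "h \<in> borel_measurable borel" "k \<in> borel_measurable borel"
    and h: "\<And>x. \<bar>h x\<bar> \<le> C" and k: "\<And>x. \<bar>k x\<bar> \<le> D" and k0: "(\<integral>x. k x * f x \<partial>lborel) = 0"
  shows "(\<lambda>n. \<integral>\<omega>. iexp ((\<Sum>j<n. k (e (Suc j) \<omega>) * h (X j \<omega>)) / sqrt (real n)) \<partial>M) \<longlonglongrightarrow>
    exp (- (((\<integral>x. (k x)\<^sup>2 * f x \<partial>lborel) * (\<integral>x. (h x)\<^sup>2 * p x \<partial>lborel)) / 2))"
proof -
  define V where "V = (\<integral>x. (k x)\<^sup>2 * f x \<partial>lborel) * (\<integral>x. (h x)\<^sup>2 * p x \<partial>lborel)"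
  \<comment> \<open>A bound for the unnormalized summands; the extra one makes it positive.\<close>
  define K where "K = D * C + 1"
  define u where "u n j \<omega> = (1 / sqrt (real n)) * (k (e (Suc j) \<omega>) * h (X j \<omega>))" for n j \<omega>
  define S where "S n \<omega> = (\<Sum>j<n. u n j \<omega>)" for n \<omega>
  define Q where "Q n \<omega> = (\<Sum>j<n. (u n j \<omega>)\<^sup>2)" for n \<omega>
  define T where "T n \<omega> = (\<Prod>j<n. 1 + \<i> * u n j \<omega>)" for n \<omega>
  have CD: "0 \<le> C" "0 \<le> D" using h[of 0] k[of 0] by auto
  then have K: "0 < K" by (simp add: K_def add_nonneg_pos)
  have [measurable]: "u n j \<in> borel_measurable M" "S n \<in> borel_measurable M" "Q n \<in> borel_measurable M"
     "T n \<in> borel_measurable M" for n j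
    unfolding u_def S_def Q_def T_def by measurable
  have u_bound: "\<bar>u n j \<omega>\<bar> \<le> K / sqrt (real n)" for n j \<omega>
  proof -
    have "\<bar>k (e (Suc j) \<omega>) * h (X j \<omega>)\<bar> \<le> D * C"
      unfolding abs_mult by (intro mult_mono h k CD) auto
    then show ?thesis
      by (simp add: u_def abs_divide K_def divide_right_mono)
  qed
  have u2_bound: "(u n j \<omega>)\<^sup>2 \<le> K\<^sup>2 / real n" for n j \<omega>
    using power_mono[OF u_bound[of n j \<omega>], where n=2] by (simp add: power_divide)
  have Q_bound: "0 \<le> Q n \<omega>" "Q n \<omega> \<le> K\<^sup>2" for n \<omega>
  proof -
    have "Q n \<omega> \<le> (\<Sum>j<n. K\<^sup>2 / real n)" unfolding Q_def by (intro sum_mono u2_bound)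
    also have "\<dots> \<le> K\<^sup>2" by simp
    finally show "Q n \<omega> \<le> K\<^sup>2" .
    show "0 \<le> Q n \<omega>" unfolding Q_def by (intro sum_nonneg) auto
  qed
  have ET: "(\<integral>\<omega>. T n \<omega> \<partial>M) = 1" for n
    unfolding T_def u_def by (rule expectation_product_eq_1[OF assms])
  have close: "norm (exp (\<i> * S n \<omega> + Q n \<omega> / 2) - T n \<omega>) \<le> exp (K\<^sup>2 / 2) * (5 * K ^ 3) / sqrt (real n)"
    if n: "K\<^sup>2 \<le> real n" for n \<omega>
  proof -
    have n0: "0 < real n" using n K by (smt (verit) zero_less_power)
    \<comment> \<open>Damping each factor by \<rho> brings its norm below one, as
      \<open>norm_prod_diff_le\<close> demands. Over all \<open>n\<close> factors the damping
      amounts to the fixed constant \<open>exp (- (K\<^sup>2 / 2))\<close>.\<close>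
    define \<rho> where "\<rho> = exp (- (K\<^sup>2 / real n / 2))"
    have \<rho>: "0 < \<rho>" "\<rho> \<le> 1" using n0 by (auto simp: \<rho>_def)
    define z where "z j = exp (\<i> * u n j \<omega> + (u n j \<omega>)\<^sup>2 / 2)" for j
    define w where "w j = 1 + \<i> * u n j \<omega>" for j
    have e_bound: "\<rho> * exp ((u n j \<omega>)\<^sup>2 / 2) \<le> 1" for j
      using u2_bound[of n j \<omega>] by (simp add: \<rho>_def flip: exp_add)
    have 1: "norm (\<rho> * z j) \<le> 1" for j
      using e_bound[of j] \<rho> by (simp add: z_def norm_mult)
    have 2: "norm (\<rho> * w j) \<le> 1" for j
    proof -
      have "(norm (w j))\<^sup>2 = 1 + (u n j \<omega>)\<^sup>2"
        by (simp add: w_def cmod_power2)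
      also have "\<dots> \<le> exp ((u n j \<omega>)\<^sup>2)" by (rule exp_ge_add_one_self)
      also have "\<dots> = (exp ((u n j \<omega>)\<^sup>2 / 2))\<^sup>2" by (simp flip: exp_double)
      finally have "norm (w j) \<le> exp ((u n j \<omega>)\<^sup>2 / 2)" by (rule power2_le_imp_le) simp
      then have "\<rho> * norm (w j) \<le> \<rho> * exp ((u n j \<omega>)\<^sup>2 / 2)" using \<rho> by (intro mult_left_mono) auto
      also note e_bound
      finally show ?thesis using \<rho> by (simp add: norm_mult)
    qed
    have u1: "\<bar>u n j \<omega>\<bar> \<le> 1" for j
    proof -
      have "K \<le> sqrt (real n)" using n by (rule real_le_rsqrt)
      then have "K / sqrt (real n) \<le> 1" using n0 by (simp add: divide_le_eq_1)
      then show ?thesis using u_bound[of n j \<omega>] by simp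
    qed
    have "norm ((\<Prod>j<n. \<rho> * z j) - (\<Prod>j<n. \<rho> * w j)) \<le> (\<Sum>j<n. norm (\<rho> * z j - \<rho> * w j))"
      by (rule norm_prod_diff_le[OF 1 2])
    also have "\<dots> \<le> (\<Sum>j<n. 5 * (K / sqrt (real n)) ^ 3)"
    proof (intro sum_mono)
      fix j
      have "norm (\<rho> * z j - \<rho> * w j) = \<rho> * norm (z j - w j)"
        using \<rho> by (simp add: norm_mult flip: right_diff_distrib)
      also have "\<dots> \<le> 1 * (5 * \<bar>u n j \<omega>\<bar> ^ 3)"
        using \<rho> norm_exp_minus_linear[OF u1] by (intro mult_mono) (auto simp: z_def w_def)
      also have "\<dots> \<le> 5 * (K / sqrt (real n)) ^ 3"
        using u_bound[of n j \<omega>] by (auto intro!: power_mono)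
      finally show "norm (\<rho> * z j - \<rho> * w j) \<le> 5 * (K / sqrt (real n)) ^ 3" .
    qed
    \<comment> \<open>\<open>n\<close> terms, each of order \<open>n\<close> to the power
      \<open>-3/2\<close>.\<close>
    also have "\<dots> = 5 * K ^ 3 / sqrt (real n)"
      using n0 by (simp add: power3_eq_cube field_simps)
    finally have "norm (\<rho> ^ n * ((\<Prod>j<n. z j) - (\<Prod>j<n. w j))) \<le> 5 * K ^ 3 / sqrt (real n)"
      by (simp add: prod.distrib right_diff_distrib)
    then have "\<rho> ^ n * norm ((\<Prod>j<n. z j) - (\<Prod>j<n. w j)) \<le> 5 * K ^ 3 / sqrt (real n)"
      using \<rho> by (simp add: norm_mult norm_power)
    moreover have "\<rho> ^ n = exp (- (K\<^sup>2 / 2))"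
      using n0 by (simp add: \<rho>_def flip: exp_of_nat_mult)
    moreover have "(\<Prod>j<n. z j) = exp (\<i> * S n \<omega> + Q n \<omega> / 2)"
      by (simp add: z_def S_def Q_def exp_sum[symmetric] sum.distrib sum_distrib_left sum_divide_distrib)
    moreover have "(\<Prod>j<n. w j) = T n \<omega>" by (simp add: w_def T_def)
    ultimately show ?thesis
      by (simp add: exp_minus field_simps)
  qed
  define \<delta> where "\<delta> n = (\<integral>\<omega>. \<bar>Q n \<omega> - V\<bar> \<partial>M)" for n
  have \<delta>: "\<delta> \<longlonglongrightarrow> 0"
  proof -
    have Q_eq: "Q n \<omega> = (\<Sum>j<n. (k (e (Suc j) \<omega>))\<^sup>2 * (h (X j \<omega>))\<^sup>2) / real n" for n \<omega>
      by (simp add: Q_def u_def power_mult_distrib power_divide sum_divide_distrib)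
    have lim: "(\<lambda>n. \<integral>\<omega>. (Q n \<omega> - V)\<^sup>2 \<partial>M) \<longlonglongrightarrow> 0"
      unfolding Q_eq V_def
      by (rule average_L2[where C="C\<^sup>2" and D="D\<^sup>2"])
         (use power_mono[OF h, where n=2] power_mono[OF k, where n=2] in auto)
    have int: "integrable M (\<lambda>\<omega>. (Q n \<omega> - V)\<^sup>2)" "integrable M (\<lambda>\<omega>. \<bar>Q n \<omega> - V\<bar>)" for n
    proof -
      have b: "\<bar>Q n \<omega> - V\<bar> \<le> K\<^sup>2 + \<bar>V\<bar>" for \<omega>
        using Q_bound[of n \<omega>] by linarith
      show "integrable M (\<lambda>\<omega>. \<bar>Q n \<omega> - V\<bar>)"
        using b by (intro integrable_const_bound[of _ "K\<^sup>2 + \<bar>V\<bar>"]) auto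
      show "integrable M (\<lambda>\<omega>. (Q n \<omega> - V)\<^sup>2)"
        using power_mono[OF b, where n=2] by (intro integrable_const_bound[of _ "(K\<^sup>2 + \<bar>V\<bar>)\<^sup>2"]) auto
    qed
    have "\<delta> n \<le> sqrt (\<integral>\<omega>. (Q n \<omega> - V)\<^sup>2 \<partial>M)" for n
    proof (rule real_le_rsqrt)
      show "(\<delta> n)\<^sup>2 \<le> (\<integral>\<omega>. (Q n \<omega> - V)\<^sup>2 \<partial>M)"
        unfolding \<delta>_def using jensens_inequality[OF int(2)[of n], where I=UNIV and q="\<lambda>x. x\<^sup>2"] int(1)[of n]
        by (auto simp: convex_power2)
    qed
    note \<delta>_le = this
    have "(\<lambda>n. sqrt (\<integral>\<omega>. (Q n \<omega> - V)\<^sup>2 \<partial>M)) \<longlonglongrightarrow> 0"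
      using tendsto_real_sqrt[OF lim] by simp
    then show ?thesis
      by (rule tendsto_0_le) (use \<delta>_le in \<open>auto simp: \<delta>_def\<close>)
  qed
  have V: "0 \<le> V"
    unfolding V_def using f_nonneg p_nonneg by (intro mult_nonneg_nonneg integral_nonneg_AE) auto
  \<comment> \<open>\<open>V\<close> is the limit of the means of \<open>Q n\<close>, so it lies in
    the interval on which the Lipschitz bound for \<open>exp\<close> is taken.\<close>
  have "V \<le> K\<^sup>2"
  proof -
    have "(\<lambda>n. \<integral>\<omega>. Q n \<omega> \<partial>M) \<longlonglongrightarrow> V"
    proof (rule LIM_zero_cancel, rule Lim_null_comparison[OF _ \<delta>])
      have "norm ((\<integral>\<omega>. Q n \<omega> \<partial>M) - V) \<le> \<delta> n" for n
      proof -
        have "integrable M (Q n)" using Q_bound by (intro integrable_const_bound[of _ "K\<^sup>2"]) auto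
        then have "(\<integral>\<omega>. Q n \<omega> \<partial>M) - V = (\<integral>\<omega>. Q n \<omega> - V \<partial>M)" by (simp add: prob_space)
        then show ?thesis unfolding \<delta>_def by (simp add: integral_abs_bound)
      qed
      then show "\<forall>\<^sub>F n in sequentially. norm ((\<integral>\<omega>. Q n \<omega> \<partial>M) - V) \<le> \<delta> n" by simp
    qed
    moreover have "(\<integral>\<omega>. Q n \<omega> \<partial>M) \<le> K\<^sup>2" for n
      using Q_bound[of n] by (intro integral_le_const integrable_const_bound[of _ "K\<^sup>2"]) auto
    ultimately show ?thesis by (intro LIMSEQ_le_const2) auto
  qed
  have exp_lip: "\<bar>exp (x / 2) - exp (V / 2)\<bar> \<le> exp (K\<^sup>2 / 2) * \<bar>x - V\<bar>" if "0 \<le> x" "x \<le> K\<^sup>2" for x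
  proof -
    have "norm (exp (x / 2) - exp (V / 2)) \<le> exp (K\<^sup>2 / 2) * norm (x - V)"
    proof (rule field_differentiable_bound[of "{0..K\<^sup>2}" "\<lambda>x. exp (x / 2)" "\<lambda>x. exp (x / 2) / 2"])
      show "((\<lambda>x. exp (x / 2)) has_real_derivative exp (z / 2) / 2) (at z within {0..K\<^sup>2})" for z
        by (auto intro!: derivative_eq_intros)
      show "norm (exp (z / 2) / 2) \<le> exp (K\<^sup>2 / 2)" if "z \<in> {0..K\<^sup>2}" for z
      proof -
        have "exp (z / 2) / 2 \<le> exp (z / 2)" by simp
        also have "\<dots> \<le> exp (K\<^sup>2 / 2)" using that by simp
        finally show ?thesis by simp
      qed
    qed (use that V \<open>V \<le> K\<^sup>2\<close> in auto)
    then show ?thesis by simp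
  qed
  have main: "norm ((\<integral>\<omega>. iexp (S n \<omega>) \<partial>M) * exp (V / 2) - 1) \<le>
      exp (K\<^sup>2 / 2) * (5 * K ^ 3) / sqrt (real n) + exp (K\<^sup>2 / 2) * \<delta> n" if n: "K\<^sup>2 \<le> real n" for n
  proof -
    have pt: "norm (iexp (S n \<omega>) * exp (V / 2) - T n \<omega>) \<le>
       exp (K\<^sup>2 / 2) * (5 * K ^ 3) / sqrt (real n) + exp (K\<^sup>2 / 2) * \<bar>Q n \<omega> - V\<bar>" for \<omega>
    proof -
      have "iexp (S n \<omega>) * exp (V / 2) - T n \<omega> = (exp (\<i> * S n \<omega> + Q n \<omega> / 2) - T n \<omega>)
          - iexp (S n \<omega>) * of_real (exp (Q n \<omega> / 2) - exp (V / 2))"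
        by (simp add: exp_add algebra_simps flip: exp_of_real)
      also have "norm \<dots> \<le> norm (exp (\<i> * S n \<omega> + Q n \<omega> / 2) - T n \<omega>) + norm (iexp (S n \<omega>) * of_real (exp (Q n \<omega> / 2) - exp (V / 2)))"
        by (rule norm_triangle_ineq4)
      also have "norm (iexp (S n \<omega>) * of_real (exp (Q n \<omega> / 2) - exp (V / 2))) = \<bar>exp (Q n \<omega> / 2) - exp (V / 2)\<bar>"
        by (simp only: norm_mult norm_of_real norm_exp_i_times mult_1)
      finally show ?thesis
        using close[OF n, of \<omega>] exp_lip[OF Q_bound[of n \<omega>]] by linarith
    qed
    have iQ: "integrable M (\<lambda>\<omega>. \<bar>Q n \<omega> - V\<bar>)"
    proof (rule integrable_const_bound[of _ "K\<^sup>2 + \<bar>V\<bar>"])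
      have "\<bar>Q n \<omega> - V\<bar> \<le> K\<^sup>2 + \<bar>V\<bar>" for \<omega>
        using Q_bound[of n \<omega>] by linarith
      then show "AE \<omega> in M. norm \<bar>Q n \<omega> - V\<bar> \<le> K\<^sup>2 + \<bar>V\<bar>" by simp
    qed measurable
    have iE: "integrable M (\<lambda>\<omega>. iexp (S n \<omega>))"
      by (intro integrable_const_bound[of _ 1]) auto
    have iD: "integrable M (\<lambda>\<omega>. iexp (S n \<omega>) * exp (V / 2) - T n \<omega>)"
    proof (rule Bochner_Integration.integrable_bound)
      show "integrable M (\<lambda>\<omega>. exp (K\<^sup>2 / 2) * (5 * K ^ 3) / sqrt (real n) + exp (K\<^sup>2 / 2) * \<bar>Q n \<omega> - V\<bar>)"
        using iQ by auto
      show "AE \<omega> in M. norm (iexp (S n \<omega>) * exp (V / 2) - T n \<omega>) \<le>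
         norm (exp (K\<^sup>2 / 2) * (5 * K ^ 3) / sqrt (real n) + exp (K\<^sup>2 / 2) * \<bar>Q n \<omega> - V\<bar>)"
        unfolding real_norm_def by (intro AE_I2 order_trans[OF pt] abs_ge_self)
    qed measurable
    have iT: "integrable M (T n)"
      using Bochner_Integration.integrable_diff[OF integrable_mult_left[OF iE, of "exp (V/2)"] iD] by simp
    \<comment> \<open>The constant one is the mean of \<open>T n\<close>, so the difference becomes
      the integral of a pointwise small quantity.\<close>
    have "(\<integral>\<omega>. iexp (S n \<omega>) \<partial>M) * exp (V / 2) - 1 = (\<integral>\<omega>. iexp (S n \<omega>) * exp (V / 2) - T n \<omega> \<partial>M)"
      using iE iT ET[of n] by (subst Bochner_Integration.integral_diff) auto
    also have "norm \<dots> \<le> (\<integral>\<omega>. norm (iexp (S n \<omega>) * exp (V / 2) - T n \<omega>) \<partial>M)"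
      by (rule integral_norm_bound)
    also have "\<dots> \<le> (\<integral>\<omega>. exp (K\<^sup>2 / 2) * (5 * K ^ 3) / sqrt (real n) + exp (K\<^sup>2 / 2) * \<bar>Q n \<omega> - V\<bar> \<partial>M)"
      using iD iQ by (intro integral_mono pt) auto
    also have "\<dots> = exp (K\<^sup>2 / 2) * (5 * K ^ 3) / sqrt (real n) + exp (K\<^sup>2 / 2) * \<delta> n"
      using iQ by (simp add: \<delta>_def prob_space)
    finally show ?thesis .
  qed
  have "(\<lambda>n. exp (K\<^sup>2 / 2) * (5 * K ^ 3) / sqrt (real n) + exp (K\<^sup>2 / 2) * \<delta> n) \<longlonglongrightarrow> 0 + exp (K\<^sup>2 / 2) * 0"
    by (intro tendsto_add tendsto_mult tendsto_const \<delta>) real_asymp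
  note bound_lim = this
  have lim0: "(\<lambda>n. (\<integral>\<omega>. iexp (S n \<omega>) \<partial>M) * exp (V / 2) - 1) \<longlonglongrightarrow> 0"
  proof (rule Lim_null_comparison)
    show "\<forall>\<^sub>F n in sequentially. norm ((\<integral>\<omega>. iexp (S n \<omega>) \<partial>M) * exp (V / 2) - 1)
       \<le> exp (K\<^sup>2 / 2) * (5 * K ^ 3) / sqrt (real n) + exp (K\<^sup>2 / 2) * \<delta> n"
      using eventually_ge_at_top[of "nat \<lceil>K\<^sup>2\<rceil>"] by eventually_elim (intro main, linarith)
    show "(\<lambda>n. exp (K\<^sup>2 / 2) * (5 * K ^ 3) / sqrt (real n) + exp (K\<^sup>2 / 2) * \<delta> n) \<longlonglongrightarrow> 0"
      using bound_lim by simp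
  qed
  have "(\<lambda>n. ((\<integral>\<omega>. iexp (S n \<omega>) \<partial>M) * exp (V / 2) - 1 + 1) * exp (- (V / 2))) \<longlonglongrightarrow> (0 + 1) * complex_of_real (exp (- (V / 2)))"
    by (intro tendsto_mult tendsto_add tendsto_const lim0)
  then have "(\<lambda>n. \<integral>\<omega>. iexp (S n \<omega>) \<partial>M) \<longlonglongrightarrow> exp (- (V / 2))"
    by (simp add: mult.assoc flip: exp_add of_real_mult exp_of_real)
  then show ?thesis
    by (simp add: V_def S_def u_def sum_divide_distrib)
qed

end

subsection \<open>Laplace transforms\<close>

text \<open>Riemann sums are integrals of the step functions \<open>s N\<close>, which converge
  pointwise by continuity and are dominated by a bound for \<open>u\<close>.\<close>

lemma riemann_sum_tendsto:
  fixes u :: "real \<Rightarrow> real"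
  assumes u: "continuous_on {0..1} u"
  shows "(\<lambda>N. (\<Sum>i<N. u (real i / real N)) / real N) \<longlonglongrightarrow> (LINT \<tau>:{0..1}|lborel. u \<tau>)"
proof -
  define s where "s N x = (\<Sum>i<N. u (real i / real N) * indicator {real i / real N..<(real i + 1) / real N} x)" for N x
  obtain C where "\<forall>y\<in>u ` {0..1}. norm y \<le> C"
    using compact_imp_bounded[OF compact_continuous_image[OF u compact_Icc]] unfolding bounded_iff by blast
  then have C: "\<bar>u x\<bar> \<le> C" if "x \<in> {0..1}" for x using that by auto
  have C0: "0 \<le> C" using C[of 0] by simp
  have out: "s N x = 0" if "x \<notin> {0..<1}" for N x
    unfolding s_def
  proof (intro sum.neutral ballI)
    fix i assume i: "i \<in> {..<N}"
    then have "(real i + 1) / real N \<le> 1" "0 \<le> real i / real N" by (auto simp: field_simps)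
    then have "0 \<le> x \<and> x < 1" if "real i / real N \<le> x" "x < (real i + 1) / real N"
      using that by linarith
    then have "x \<notin> {real i / real N..<(real i + 1) / real N}" using that by auto
    then show "u (real i / real N) * indicator {real i / real N..<(real i + 1) / real N} x = 0" by simp
  qed
  have inside: "s N x = u (real (nat \<lfloor>real N * x\<rfloor>) / real N)" "real (nat \<lfloor>real N * x\<rfloor>) / real N \<in> {0..1}"
      "\<bar>real (nat \<lfloor>real N * x\<rfloor>) / real N - x\<bar> \<le> 1 / real N" if x: "x \<in> {0..<1}" and N: "0 < N" for N x
  proof -
    define m where "m = nat \<lfloor>real N * x\<rfloor>"
    have m: "real m \<le> real N * x" "real N * x < real m + 1"
      using x N by (auto simp: m_def)
    have "real N * x < real N" using x N by simp
    then have "m < N" using m by linarith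
    have iff: "x \<in> {real i / real N..<(real i + 1) / real N} \<longleftrightarrow> i = m" for i
    proof -
      have "x \<in> {real i / real N..<(real i + 1) / real N} \<longleftrightarrow> real i \<le> real N * x \<and> real N * x < real i + 1"
        using N by (auto simp: field_simps)
      also have "\<dots> \<longleftrightarrow> i = m" using m by auto
      finally show ?thesis .
    qed
    have "s N x = (\<Sum>i<N. if i = m then u (real i / real N) else 0)"
      unfolding s_def by (intro sum.cong refl) (simp only: indicator_def iff, simp)
    then show "s N x = u (real m / real N)" using \<open>m < N\<close> by simp
    show "real m / real N \<in> {0..1}" using \<open>m < N\<close> by simp
    show "\<bar>real m / real N - x\<bar> \<le> 1 / real N"
    proof -
      have "real m / real N \<le> x" "x < (real m + 1) / real N" using m N by (auto simp: field_simps)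
      then show ?thesis by (simp add: add_divide_distrib)
    qed
  qed
  have "(\<lambda>N. \<integral>x. s N x \<partial>lborel) \<longlonglongrightarrow> (\<integral>x. indicator {0..<1} x *\<^sub>R u x \<partial>lborel)"
  proof (rule integral_dominated_convergence[where w="\<lambda>x. C * indicator {0..<1} x"])
    have "continuous_on {0..<1} u" using u by (rule continuous_on_subset) auto
    then show "(\<lambda>x. indicator {0..<1} x *\<^sub>R u x) \<in> borel_measurable lborel"
      using borel_measurable_continuous_on_indicator[of "{0..<1::real}" u] by simp
    show "s N \<in> borel_measurable lborel" for N unfolding s_def[abs_def] by measurable
    show "AE x in lborel. norm (s N x) \<le> C * indicator {0..<1} x" for N
    proof (intro AE_I2)
      fix x
      show "norm (s N x) \<le> C * indicator {0..<1} x"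
      proof (cases "x \<in> {0..<1} \<and> 0 < N")
        case True
        then show ?thesis using C[OF inside(2)[of x N]] inside(1)[of x N] by simp
      next
        case False
        then show ?thesis using out[of x N] C0 by (cases "N = 0") (auto simp: s_def)
      qed
    qed
    show "AE x in lborel. (\<lambda>N. s N x) \<longlonglongrightarrow> indicator {0..<1} x *\<^sub>R u x"
    proof (intro AE_I2)
      fix x :: real
      show "(\<lambda>N. s N x) \<longlonglongrightarrow> indicator {0..<1} x *\<^sub>R u x"
      proof (cases "x \<in> {0..<1}")
        case True
        have "(\<lambda>N. real (nat \<lfloor>real N * x\<rfloor>) / real N) \<longlonglongrightarrow> x"
        proof (rule LIM_zero_cancel, rule Lim_null_comparison)
          show "\<forall>\<^sub>F N in sequentially. norm (real (nat \<lfloor>real N * x\<rfloor>) / real N - x) \<le> 1 / real N"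
            using eventually_gt_at_top[of 0] by eventually_elim (use inside(3) True in auto)
        qed (rule lim_const_over_n)
        then have "(\<lambda>N. u (real (nat \<lfloor>real N * x\<rfloor>) / real N)) \<longlonglongrightarrow> u x"
          by (rule continuous_on_tendsto_compose[OF u])
             (use True inside(2) in \<open>auto intro!: eventually_mono[OF eventually_gt_at_top[of 0]]\<close>)
        moreover have "\<forall>\<^sub>F N in sequentially. u (real (nat \<lfloor>real N * x\<rfloor>) / real N) = s N x"
          using eventually_gt_at_top[of 0] by eventually_elim (use inside(1) True in auto)
        ultimately show ?thesis using True by (auto intro: Lim_transform_eventually)
      qed (simp add: out)
    qed
  qed auto
  moreover have "(\<integral>x. s N x \<partial>lborel) = (\<Sum>i<N. u (real i / real N)) / real N" for N
  proof -
    have "(\<integral>x. s N x \<partial>lborel) = (\<Sum>i<N. u (real i / real N) * ((real i + 1) / real N - real i / real N))"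
      unfolding s_def by (subst Bochner_Integration.integral_sum) (auto intro!: integrable_mult_right sum.cong simp: divide_right_mono)
    also have "\<dots> = (\<Sum>i<N. u (real i / real N)) / real N"
      by (simp add: sum_divide_distrib flip: diff_divide_distrib)
    finally show ?thesis .
  qed
  \<comment> \<open>The left-closed cells tile only the half-open interval; the endpoint one is a
    null set.\<close>
  moreover have "(\<integral>x. indicator {0..<1} x *\<^sub>R u x \<partial>lborel) = (LINT \<tau>:{0..1}|lborel. u \<tau>)"
    unfolding set_lebesgue_integral_def
  proof (rule integral_cong_AE)
    have "continuous_on {0..<1} u" using u by (rule continuous_on_subset) auto
    then show "(\<lambda>x. indicator {0..<1} x *\<^sub>R u x) \<in> borel_measurable lborel"
      using borel_measurable_continuous_on_indicator[of "{0..<1::real}" u] by simp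
    show "(\<lambda>x. indicator {0..1} x *\<^sub>R u x) \<in> borel_measurable lborel"
      using borel_measurable_continuous_on_indicator[of "{0..1::real}" u] u by simp
    show "AE x in lborel. indicator {0..<1} x *\<^sub>R u x = indicator {0..1} x *\<^sub>R u x"
      using AE_lborel_singleton[of 1] by eventually_elim (auto simp: indicator_def)
  qed
  ultimately show ?thesis by simp
qed

text \<open>Laplace transforms at natural numbers are the moments of \<open>exp (- Y)\<close>, a
  variable with values in \<open>{0..1}\<close>; convergence of moments extends to continuous
  functions by Weierstrass approximation.\<close>

lemma laplace_continuous_limit:
  fixes Y :: "nat \<Rightarrow> 'a \<Rightarrow> real" and Z :: "'b \<Rightarrow> real"
  assumes M: "prob_space M" and N: "prob_space N"
    and [measurable]: "\<And>n. Y n \<in> borel_measurable M" "Z \<in> borel_measurable N"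
    and Y0: "\<And>n \<omega>. 0 \<le> Y n \<omega>" and Z0: "\<And>\<omega>. 0 \<le> Z \<omega>"
    and lap: "\<And>k::nat. (\<lambda>n. \<integral>\<omega>. exp (- (real k * Y n \<omega>)) \<partial>M) \<longlonglongrightarrow> (\<integral>\<omega>. exp (- (real k * Z \<omega>)) \<partial>N)"
    and G: "continuous_on UNIV (G :: real \<Rightarrow> real)"
  shows "(\<lambda>n. \<integral>\<omega>. G (exp (- Y n \<omega>)) \<partial>M) \<longlonglongrightarrow> (\<integral>\<omega>. G (exp (- Z \<omega>)) \<partial>N)"
proof (rule LIMSEQ_I)
  fix \<epsilon> :: real assume \<epsilon>: "0 < \<epsilon>"
  interpret M: prob_space M by fact
  interpret N: prob_space N by fact
  have [measurable]: "G \<in> borel_measurable borel" using G by (rule borel_measurable_continuous_onI)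
  obtain q where q: "polynomial_function q" "\<And>x. x \<in> {0..1} \<Longrightarrow> norm (G x - q x) < \<epsilon> / 3"
    using Stone_Weierstrass_polynomial_function[of "{0..1::real}" G "\<epsilon> / 3"] continuous_on_subset[OF G, of "{0..1}"] \<epsilon> by auto
  from q(1) obtain a d where qa: "q = (\<lambda>x. \<Sum>i\<le>d. a i * x ^ i)"
    using real_polynomial_function_imp_sum real_polynomial_function_eq by metis
  obtain C where "\<forall>y\<in>G ` {0..1}. norm y \<le> C"
    using compact_imp_bounded[OF compact_continuous_image[OF continuous_on_subset[OF G, of "{0..1}"] compact_Icc]]
    unfolding bounded_iff by blast
  then have C: "\<bar>G x\<bar> \<le> C" if "x \<in> {0..1}" for x using that by auto
  \<comment> \<open>Stated for an arbitrary probability space, since it is applied both along the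
    sequence and to the limit.\<close>
  have ie: "integrable K (\<lambda>\<omega>. exp (- (real k * V \<omega>)))" "(\<integral>\<omega>. q (exp (- V \<omega>)) \<partial>K) = (\<Sum>i\<le>d. a i * (\<integral>\<omega>. exp (- (real i * V \<omega>)) \<partial>K))"
     "\<bar>(\<integral>\<omega>. G (exp (- V \<omega>)) \<partial>K) - (\<integral>\<omega>. q (exp (- V \<omega>)) \<partial>K)\<bar> \<le> \<epsilon> / 3"
    if K: "prob_space K" and [measurable]: "V \<in> borel_measurable K" and V: "\<And>\<omega>. 0 \<le> V \<omega>" for K :: "'c measure" and V k
  proof -
    interpret K: prob_space K by fact
    show ie: "integrable K (\<lambda>\<omega>. exp (- (real k * V \<omega>)))" for k
      using V by (intro K.integrable_const_bound[of _ 1]) auto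
    have qe: "q (exp (- V \<omega>)) = (\<Sum>i\<le>d. a i * exp (- (real i * V \<omega>)))" for \<omega>
      by (simp add: qa flip: exp_of_nat_mult)
    show "(\<integral>\<omega>. q (exp (- V \<omega>)) \<partial>K) = (\<Sum>i\<le>d. a i * (\<integral>\<omega>. exp (- (real i * V \<omega>)) \<partial>K))"
      unfolding qe using ie by (subst Bochner_Integration.integral_sum) auto
    have iq: "integrable K (\<lambda>\<omega>. q (exp (- V \<omega>)))" unfolding qe using ie by auto
    have iG: "integrable K (\<lambda>\<omega>. G (exp (- V \<omega>)))"
      using V C by (intro K.integrable_const_bound[of _ C]) auto
    have "\<bar>(\<integral>\<omega>. G (exp (- V \<omega>)) \<partial>K) - (\<integral>\<omega>. q (exp (- V \<omega>)) \<partial>K)\<bar> = \<bar>\<integral>\<omega>. G (exp (- V \<omega>)) - q (exp (- V \<omega>)) \<partial>K\<bar>"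
      using iq iG by simp
    also have "\<dots> \<le> (\<integral>\<omega>. \<bar>G (exp (- V \<omega>)) - q (exp (- V \<omega>))\<bar> \<partial>K)"
      by (rule integral_abs_bound)
    also have "\<dots> \<le> \<epsilon> / 3"
    proof (intro K.integral_le_const AE_I2)
      show "integrable K (\<lambda>\<omega>. \<bar>G (exp (- V \<omega>)) - q (exp (- V \<omega>))\<bar>)" using iq iG by simp
      show "\<bar>G (exp (- V \<omega>)) - q (exp (- V \<omega>))\<bar> \<le> \<epsilon> / 3" for \<omega>
        using q(2)[of "exp (- V \<omega>)"] V by (simp add: less_imp_le)
    qed
    finally show "\<bar>(\<integral>\<omega>. G (exp (- V \<omega>)) \<partial>K) - (\<integral>\<omega>. q (exp (- V \<omega>)) \<partial>K)\<bar> \<le> \<epsilon> / 3" .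
  qed
  have "(\<lambda>n. \<integral>\<omega>. q (exp (- Y n \<omega>)) \<partial>M) \<longlonglongrightarrow> (\<integral>\<omega>. q (exp (- Z \<omega>)) \<partial>N)"
    using ie(2)[OF M _ Y0] ie(2)[OF N _ Z0] by (simp add: tendsto_sum tendsto_mult lap)
  from LIMSEQ_D[OF this, of "\<epsilon> / 3"] \<epsilon> obtain n0 where
    n0: "\<And>n. n0 \<le> n \<Longrightarrow> \<bar>(\<integral>\<omega>. q (exp (- Y n \<omega>)) \<partial>M) - (\<integral>\<omega>. q (exp (- Z \<omega>)) \<partial>N)\<bar> < \<epsilon> / 3" by auto
  have "\<bar>(\<integral>\<omega>. G (exp (- Y n \<omega>)) \<partial>M) - (\<integral>\<omega>. G (exp (- Z \<omega>)) \<partial>N)\<bar> < \<epsilon>" if "n0 \<le> n" for n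
  proof -
    have "\<bar>(\<integral>\<omega>. G (exp (- Y n \<omega>)) \<partial>M) - (\<integral>\<omega>. q (exp (- Y n \<omega>)) \<partial>M)\<bar> \<le> \<epsilon> / 3"
      by (rule ie(3)[OF M _ Y0]) measurable
    moreover have "\<bar>(\<integral>\<omega>. G (exp (- Z \<omega>)) \<partial>N) - (\<integral>\<omega>. q (exp (- Z \<omega>)) \<partial>N)\<bar> \<le> \<epsilon> / 3"
      by (rule ie(3)[OF N _ Z0]) measurable
    ultimately show ?thesis using n0[OF that] by linarith
  qed
  then show "\<exists>n0. \<forall>n\<ge>n0. norm ((\<integral>\<omega>. G (exp (- Y n \<omega>)) \<partial>M) - (\<integral>\<omega>. G (exp (- Z \<omega>)) \<partial>N)) < \<epsilon>"
    by auto
qed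

lemma laplace_weak_conv:
  fixes Y :: "nat \<Rightarrow> 'a \<Rightarrow> real" and Z :: "'b \<Rightarrow> real"
  assumes M: "prob_space M" and N: "prob_space N"
    and [measurable]: "\<And>n. Y n \<in> borel_measurable M" "Z \<in> borel_measurable N"
    and Y0: "\<And>n \<omega>. 0 \<le> Y n \<omega>" and Z0: "\<And>\<omega>. 0 \<le> Z \<omega>"
    and lap: "\<And>k::nat. (\<lambda>n. \<integral>\<omega>. exp (- (real k * Y n \<omega>)) \<partial>M) \<longlonglongrightarrow> (\<integral>\<omega>. exp (- (real k * Z \<omega>)) \<partial>N)"
  shows "weak_conv_m (\<lambda>n. distr M borel (Y n)) (distr N borel Z)"
proof (rule integral_cts_step_conv_imp_weak_conv)
  show "real_distribution (distr M borel (Y n))" for n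
    using prob_space.prob_space_distr[OF M, of "Y n" borel] by (auto intro!: real_distribution.intro simp: real_distribution_axioms_def)
  show "real_distribution (distr N borel Z)"
    using prob_space.prob_space_distr[OF N, of Z borel] by (auto intro!: real_distribution.intro simp: real_distribution_axioms_def)
next
  fix x y :: real assume xy: "x < y"
  have cts: "continuous_on UNIV (cts_step x y)"
    using cts_step_uniformly_continuous[OF xy] by (rule uniformly_continuous_imp_continuous)
  have [measurable]: "cts_step x y \<in> borel_measurable borel"
    using cts by (rule borel_measurable_continuous_onI)
  \<comment> \<open>\<open>G\<close> expresses the step function through \<open>exp (- v)\<close>.
    Truncating at \<open>exp (- (\<bar>y\<bar> + 1))\<close> keeps the logarithm away from zero and
    changes nothing, since the step function vanishes beyond \<open>y\<close>.\<close>
  define G where "G u = cts_step x y (- ln (max u (exp (- (\<bar>y\<bar> + 1)))))" for u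
  have G: "continuous_on UNIV G"
    unfolding G_def
    by (intro continuous_on_compose2[OF cts] continuous_intros) (auto simp: max_def)
  have eq: "G (exp (- v)) = cts_step x y v" for v
  proof (cases "v \<le> \<bar>y\<bar> + 1")
    case True
    then have "max (exp (- v)) (exp (- (\<bar>y\<bar> + 1))) = exp (- v)" by (simp add: max_def)
    then show ?thesis by (simp add: G_def)
  next
    case False
    then have "max (exp (- v)) (exp (- (\<bar>y\<bar> + 1))) = exp (- (\<bar>y\<bar> + 1))" by (simp add: max_def)
    then show ?thesis using False xy by (simp add: G_def cts_step_def)
  qed
  show "(\<lambda>n. integral\<^sup>L (distr M borel (Y n)) (cts_step x y)) \<longlonglongrightarrow> integral\<^sup>L (distr N borel Z) (cts_step x y)"
    using laplace_continuous_limit[OF assms G] by (simp add: integral_distr eq)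
qed

text \<open>Tent functions around \<open>exp (- c)\<close> shrink to the indicator of that point.
  Applying the limit lemma to a constant sequence shows that both laws integrate each tent
  equally.\<close>

lemma laplace_eq_imp_atom_eq:
  fixes Y :: "'a \<Rightarrow> real" and Z :: "'b \<Rightarrow> real"
  assumes M: "prob_space M" and N: "prob_space N"
    and [measurable]: "Y \<in> borel_measurable M" "Z \<in> borel_measurable N"
    and Y0: "\<And>\<omega>. 0 \<le> Y \<omega>" and Z0: "\<And>\<omega>. 0 \<le> Z \<omega>"
    and lap: "\<And>k::nat. (\<integral>\<omega>. exp (- (real k * Y \<omega>)) \<partial>M) = (\<integral>\<omega>. exp (- (real k * Z \<omega>)) \<partial>N)"
  shows "measure M {\<omega>\<in>space M. Y \<omega> = c} = measure N {\<omega>\<in>space N. Z \<omega> = c}"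
proof -
  define G where "G m u = max 0 (1 - real m * \<bar>u - exp (- c)\<bar>)" for m :: nat and u
  have G: "continuous_on UNIV (G m)" for m
    unfolding G_def by (intro continuous_intros)
  have [measurable]: "G m \<in> borel_measurable borel" for m using G by (rule borel_measurable_continuous_onI)
  have eq: "(\<integral>\<omega>. G m (exp (- Y \<omega>)) \<partial>M) = (\<integral>\<omega>. G m (exp (- Z \<omega>)) \<partial>N)" for m
    using laplace_continuous_limit[OF M N, of "\<lambda>_. Y" Z "G m"] Y0 Z0 lap G by (simp add: LIMSEQ_const_iff)
  have lim: "(\<lambda>m. \<integral>\<omega>. G m (exp (- V \<omega>)) \<partial>K) \<longlonglongrightarrow> measure K {\<omega>\<in>space K. V \<omega> = c}"
    if K: "prob_space K" and [measurable]: "V \<in> borel_measurable K" for K :: "'c measure" and V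
  proof -
    interpret K: prob_space K by fact
    have "(\<lambda>m. \<integral>\<omega>. G m (exp (- V \<omega>)) \<partial>K) \<longlonglongrightarrow> (\<integral>\<omega>. indicator {\<omega>\<in>space K. V \<omega> = c} \<omega> \<partial>K)"
    proof (rule integral_dominated_convergence[where w="\<lambda>_. 1"])
      show "AE \<omega> in K. (\<lambda>m. G m (exp (- V \<omega>))) \<longlonglongrightarrow> indicator {\<omega>\<in>space K. V \<omega> = c} \<omega>"
      proof (intro AE_I2)
        fix \<omega> assume \<omega>: "\<omega> \<in> space K"
        show "(\<lambda>m. G m (exp (- V \<omega>))) \<longlonglongrightarrow> indicator {\<omega>\<in>space K. V \<omega> = c} \<omega>"
        proof (cases "V \<omega> = c")
          case False
          define d where "d = \<bar>exp (- V \<omega>) - exp (- c)\<bar>"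
          have d: "0 < d" using False by (simp add: d_def)
          have "\<forall>\<^sub>F m in sequentially. G m (exp (- V \<omega>)) = 0"
            using eventually_ge_at_top[of "nat \<lceil>1 / d\<rceil>"]
          proof eventually_elim
            case (elim m)
            then have "1 / d \<le> real m" by linarith
            then have "1 \<le> real m * d" using d by (simp add: field_simps)
            then show ?case by (simp add: G_def d_def)
          qed
          then show ?thesis using False by (simp add: tendsto_eventually)
        qed (use \<omega> in \<open>simp add: G_def\<close>)
      qed
    qed (auto simp: G_def)
    then show ?thesis by simp
  qed
  show ?thesis
    using lim[OF M, of Y] lim[OF N, of Z] eq LIMSEQ_unique by auto
qed

text \<open>
  Integrating \<open>exp (\<i> \<Sum> g\<^sub>i z\<^sub>i)\<close> over independent standard normal \<open>g\<^sub>i\<close> gives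
  \<open>exp (- \<Sum> z\<^sub>i\<^sup>2 / 2)\<close>, so the Laplace transform of a sum of squares is an average of
  characteristic functions of linear combinations.
\<close>
lemma gaussian_linearization:
  fixes Z :: "nat \<Rightarrow> 'a \<Rightarrow> real"
  assumes M: "prob_space M" and [measurable]: "\<And>i. Z i \<in> borel_measurable M"
  shows "(\<integral>\<omega>. complex_of_real (exp (- (\<Sum>i<N. (Z i \<omega>)\<^sup>2) / 2)) \<partial>M) =
     (\<integral>g. (\<integral>\<omega>. iexp (\<Sum>i<N. g i * Z i \<omega>) \<partial>M) \<partial>PiM {..<N} (\<lambda>_. std_normal_distribution))"
proof -
  interpret M: prob_space M by fact
  interpret R: real_distribution std_normal_distribution by (rule real_dist_normal_dist)
  interpret P: product_prob_space "\<lambda>_. std_normal_distribution" "{..<N}" by unfold_locales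
  let ?P = "PiM {..<N} (\<lambda>_. std_normal_distribution)"
  interpret PS: prob_space ?P by (rule prob_space_PiM) unfold_locales
  interpret pair: pair_sigma_finite M ?P by unfold_locales
  interpret pp: pair_prob_space M ?P by unfold_locales
  have inner: "(\<integral>g. iexp (\<Sum>i<N. g i * z i) \<partial>?P) = complex_of_real (exp (- (\<Sum>i<N. (z i)\<^sup>2) / 2))" for z :: "nat \<Rightarrow> real"
  proof -
    have "(\<integral>g. iexp (\<Sum>i<N. g i * z i) \<partial>?P) = (\<integral>g. (\<Prod>i<N. iexp (z i * g i)) \<partial>?P)"
      by (intro Bochner_Integration.integral_cong refl) (simp add: exp_sum[symmetric] sum_distrib_left mult_ac)
    also have "\<dots> = (\<Prod>i<N. \<integral>x. iexp (z i * x) \<partial>std_normal_distribution)"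
      by (rule P.product_integral_prod) (auto intro!: R.integrable_iexp)
    also have "\<dots> = (\<Prod>i<N. complex_of_real (exp (- (z i)\<^sup>2 / 2)))"
      using char_std_normal_distribution by (simp add: char_def fun_eq_iff)
    also have "\<dots> = complex_of_real (exp (- (\<Sum>i<N. (z i)\<^sup>2) / 2))"
      by (simp add: exp_sum[symmetric] sum_negf sum_divide_distrib flip: of_real_prod)
    finally show ?thesis .
  qed
  have [measurable]: "(\<lambda>x. snd x i) \<in> borel_measurable (M \<Otimes>\<^sub>M ?P)" if "i < N" for i
    by (rule measurable_compose[OF measurable_snd]) (use that measurable_component_singleton[of i "{..<N}" "\<lambda>_. std_normal_distribution"] in simp)
  have "integrable (M \<Otimes>\<^sub>M ?P) (\<lambda>x. iexp (\<Sum>i<N. snd x i * Z i (fst x)))"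
    by (intro pp.P.integrable_const_bound[of _ 1]) auto
  then have "(\<integral>\<omega>. (\<integral>g. iexp (\<Sum>i<N. g i * Z i \<omega>) \<partial>?P) \<partial>M) = (\<integral>g. (\<integral>\<omega>. iexp (\<Sum>i<N. g i * Z i \<omega>) \<partial>M) \<partial>?P)"
    by (intro pair.Fubini_integral[symmetric]) (simp add: case_prod_beta')
  then show ?thesis by (simp only: inner)
qed

text \<open>After linearization, convergence of characteristic functions holds for each coefficient
  vector \<open>g\<close>; being bounded by one, they may be integrated against the Gaussian law of
  \<open>g\<close>.\<close>

lemma laplace_squares_limit:
  fixes Z :: "nat \<Rightarrow> nat \<Rightarrow> 'a \<Rightarrow> real" and Y :: "nat \<Rightarrow> 'b \<Rightarrow> real"
  assumes M: "prob_space M" and N: "prob_space N"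
    and [measurable]: "\<And>n i. Z n i \<in> borel_measurable M" "\<And>i. Y i \<in> borel_measurable N"
    and lim: "\<And>g. (\<lambda>n. \<integral>\<omega>. iexp (\<Sum>i<K. g i * Z n i \<omega>) \<partial>M) \<longlonglongrightarrow> (\<integral>\<omega>. iexp (\<Sum>i<K. g i * Y i \<omega>) \<partial>N)"
  shows "(\<lambda>n. \<integral>\<omega>. exp (- (\<Sum>i<K. (Z n i \<omega>)\<^sup>2) / 2) \<partial>M) \<longlonglongrightarrow> (\<integral>\<omega>. exp (- (\<Sum>i<K. (Y i \<omega>)\<^sup>2) / 2) \<partial>N)"
proof -
  interpret R: real_distribution std_normal_distribution by (rule real_dist_normal_dist)
  let ?P = "PiM {..<K} (\<lambda>_. std_normal_distribution)"
  interpret P: prob_space ?P by (rule prob_space_PiM) unfold_locales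
  have meas: "(\<lambda>g. \<integral>\<omega>. iexp (\<Sum>i<K. g i * V i \<omega>) \<partial>Q) \<in> borel_measurable ?P"
    if Q: "prob_space Q" and [measurable]: "\<And>i. V i \<in> borel_measurable Q" for Q :: "'c measure" and V :: "nat \<Rightarrow> 'c \<Rightarrow> real"
  proof -
    interpret Q: prob_space Q by fact
    have [measurable]: "(\<lambda>x. fst x i) \<in> borel_measurable (?P \<Otimes>\<^sub>M Q)" if "i < K" for i
      by (rule measurable_compose[OF measurable_fst]) (use that measurable_component_singleton[of i "{..<K}" "\<lambda>_. std_normal_distribution"] in simp)
    show ?thesis
      by (rule Q.borel_measurable_lebesgue_integral) (simp add: case_prod_beta')
  qed
  have bnd: "norm (\<integral>\<omega>. iexp (\<Sum>i<K. g i * V i \<omega>) \<partial>Q) \<le> 1" if Q: "prob_space Q" for g and Q :: "'c measure" and V :: "nat \<Rightarrow> 'c \<Rightarrow> real"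
  proof -
    interpret Q: prob_space Q by fact
    have "norm (\<integral>\<omega>. iexp (\<Sum>i<K. g i * V i \<omega>) \<partial>Q) \<le> (\<integral>\<omega>. norm (iexp (\<Sum>i<K. g i * V i \<omega>)) \<partial>Q)"
      by (rule integral_norm_bound)
    also have "\<dots> = 1" by (simp only: norm_exp_i_times) (simp add: Q.prob_space)
    finally show ?thesis .
  qed
  have "(\<lambda>n. \<integral>g. (\<integral>\<omega>. iexp (\<Sum>i<K. g i * Z n i \<omega>) \<partial>M) \<partial>?P) \<longlonglongrightarrow> (\<integral>g. (\<integral>\<omega>. iexp (\<Sum>i<K. g i * Y i \<omega>) \<partial>N) \<partial>?P)"
  proof (rule integral_dominated_convergence[where w="\<lambda>_. 1"])
    show "AE g in ?P. norm (\<integral>\<omega>. iexp (\<Sum>i<K. g i * Z n i \<omega>) \<partial>M) \<le> 1" for n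
      by (intro AE_I2 bnd M)
    show "AE g in ?P. (\<lambda>n. \<integral>\<omega>. iexp (\<Sum>i<K. g i * Z n i \<omega>) \<partial>M) \<longlonglongrightarrow> (\<integral>\<omega>. iexp (\<Sum>i<K. g i * Y i \<omega>) \<partial>N)"
      by (intro AE_I2 lim)
  qed (use meas[OF M] meas[OF N] in auto)
  moreover have "(\<integral>g. (\<integral>\<omega>. iexp (\<Sum>i<K. g i * Z n i \<omega>) \<partial>M) \<partial>?P) = complex_of_real (\<integral>\<omega>. exp (- (\<Sum>i<K. (Z n i \<omega>)\<^sup>2) / 2) \<partial>M)" for n
    by (subst gaussian_linearization[OF M, symmetric]) (rule assms, rule integral_complex_of_real)
  moreover have "(\<integral>g. (\<integral>\<omega>. iexp (\<Sum>i<K. g i * Y i \<omega>) \<partial>N) \<partial>?P) = complex_of_real (\<integral>\<omega>. exp (- (\<Sum>i<K. (Y i \<omega>)\<^sup>2) / 2) \<partial>N)"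
    by (subst gaussian_linearization[OF N, symmetric]) (rule assms, rule integral_complex_of_real)
  ultimately show ?thesis
    by (simp only: tendsto_of_real_iff)
qed

text \<open>Exactly what gives \<open>bridge_functional\<close> a meaning as a random variable. It
  is instantiated by the bridge and by its resampled version on a product space.\<close>

locale continuous_process = prob_space M for M :: "'b measure" +
  fixes B :: "real \<Rightarrow> 'b \<Rightarrow> real"
  assumes meas: "\<And>t. t \<in> {0..1} \<Longrightarrow> B t \<in> borel_measurable M"
    and cont: "\<And>\<omega>. \<omega> \<in> space M \<Longrightarrow> continuous_on {0..1} (\<lambda>t. B t \<omega>)"
begin

lemma meas_grid: "i < K \<Longrightarrow> B (real i / real K) \<in> borel_measurable M"
  by (rule meas) auto

lemma bridge_functional_lim:
  "\<omega> \<in> space M \<Longrightarrow> (\<lambda>K. (\<Sum>i<K. (B (real i / real K) \<omega>)\<^sup>2) / real K) \<longlonglongrightarrow> bridge_functional B \<omega>"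
  unfolding bridge_functional_def
  by (rule riemann_sum_tendsto) (auto intro!: continuous_intros cont)

lemma grid_sum_measurable: "(\<lambda>\<omega>. (\<Sum>i<K. (B (real i / real K) \<omega>)\<^sup>2) / real K) \<in> borel_measurable M"
  by (intro borel_measurable_divide borel_measurable_sum borel_measurable_power meas_grid) auto

text \<open>Joint measurability in time and \<omega> is not among the assumptions; path continuity
  makes the functional a limit of grid sums, which involve only the marginals.\<close>

lemma bridge_functional_measurable [measurable]: "bridge_functional B \<in> borel_measurable M"
  by (rule borel_measurable_LIMSEQ_real[OF bridge_functional_lim grid_sum_measurable])

lemma bridge_functional_nonneg: "0 \<le> bridge_functional B \<omega>"
  unfolding bridge_functional_def set_lebesgue_integral_def
  by (intro integral_nonneg_AE AE_I2) (auto simp: indicator_def)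

text \<open>The factor \<open>sqrt (2 * k / real K)\<close> turns \<open>k\<close> times the grid
  average into half a sum of squares, the shape required by
  \<open>laplace_squares_limit\<close>.\<close>

lemma laplace_grid_limit:
  fixes k :: real
  assumes "0 \<le> k"
  shows "(\<lambda>K. \<integral>\<omega>. exp (- (\<Sum>i<K. (sqrt (2 * k / real K) * B (real i / real K) \<omega>)\<^sup>2) / 2) \<partial>M)
     \<longlonglongrightarrow> (\<integral>\<omega>. exp (- (k * bridge_functional B \<omega>)) \<partial>M)"
proof -
  have eq: "(\<Sum>i<K. (sqrt (2 * k / real K) * B (real i / real K) \<omega>)\<^sup>2) / 2 =
      k * ((\<Sum>i<K. (B (real i / real K) \<omega>)\<^sup>2) / real K)" for K \<omega>
    using assms by (simp add: power_mult_distrib sum_distrib_left sum_divide_distrib mult_ac)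
  have "(\<lambda>K. \<integral>\<omega>. exp (- (k * ((\<Sum>i<K. (B (real i / real K) \<omega>)\<^sup>2) / real K))) \<partial>M)
     \<longlonglongrightarrow> (\<integral>\<omega>. exp (- (k * bridge_functional B \<omega>)) \<partial>M)"
  proof (rule integral_dominated_convergence[where w="\<lambda>_. 1"])
    show "(\<lambda>\<omega>. exp (- (k * ((\<Sum>i<K. (B (real i / real K) \<omega>)\<^sup>2) / real K)))) \<in> borel_measurable M" for K
      by (rule measurable_compose[OF grid_sum_measurable]) measurable
    show "AE \<omega> in M. norm (exp (- (k * ((\<Sum>i<K. (B (real i / real K) \<omega>)\<^sup>2) / real K)))) \<le> 1" for K
      using assms by (auto intro!: mult_nonneg_nonneg sum_nonneg divide_nonneg_nonneg)
    show "AE \<omega> in M. (\<lambda>K. exp (- (k * ((\<Sum>i<K. (B (real i / real K) \<omega>)\<^sup>2) / real K))))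
        \<longlonglongrightarrow> exp (- (k * bridge_functional B \<omega>))"
      by (intro AE_I2 tendsto_intros bridge_functional_lim)
  qed auto
  then show ?thesis
    by (simp only: eq flip: minus_divide_left)
qed

end

text \<open>The functional is a limit of grid sums, whose Laplace transforms are determined by
  characteristic functions on the grid. Hence equality of these suffices, also for processes on
  different spaces.\<close>

lemma bridge_functional_laplace_eq:
  assumes "continuous_process M B" "continuous_process M' B'"
    and char_eq: "\<And>K g. (\<integral>\<omega>. iexp (\<Sum>i<K. g i * B (real i / real K) \<omega>) \<partial>M) =
        (\<integral>\<omega>. iexp (\<Sum>i<K. g i * B' (real i / real K) \<omega>) \<partial>M')"
    and k: "0 \<le> (k::real)"
  shows "(\<integral>\<omega>. exp (- (k * bridge_functional B \<omega>)) \<partial>M) = (\<integral>\<omega>. exp (- (k * bridge_functional B' \<omega>)) \<partial>M')"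
proof -
  interpret b: continuous_process M B by fact
  interpret b': continuous_process M' B' by fact
  have "(\<integral>\<omega>. exp (- (\<Sum>i<K. (sqrt (2 * k / real K) * B (real i / real K) \<omega>)\<^sup>2) / 2) \<partial>M) =
        (\<integral>\<omega>. exp (- (\<Sum>i<K. (sqrt (2 * k / real K) * B' (real i / real K) \<omega>)\<^sup>2) / 2) \<partial>M')" for K
  proof -
    \<comment> \<open>Extension by zero beyond the grid, because measurability is asked for every
      index and \<open>B\<close> is measurable only for times in \<open>{0..1}\<close>.\<close>
    define Z where "Z i \<omega> = (if i < K then sqrt (2 * k / real K) * B (real i / real K) \<omega> else 0)" for i \<omega>
    define Z' where "Z' i \<omega> = (if i < K then sqrt (2 * k / real K) * B' (real i / real K) \<omega> else 0)" for i \<omega>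
    have [measurable]: "Z i \<in> borel_measurable M" "Z' i \<in> borel_measurable M'" for i
      unfolding Z_def Z'_def using b.meas_grid[of i K] b'.meas_grid[of i K] by (cases "i < K"; simp)+
    have "(\<integral>\<omega>. iexp (\<Sum>i<K. g i * Z i \<omega>) \<partial>M) = (\<integral>\<omega>. iexp (\<Sum>i<K. g i * Z' i \<omega>) \<partial>M')" for g
      using char_eq[where K=K and g="\<lambda>i. g i * sqrt (2 * k / real K)"] by (simp add: Z_def Z'_def mult.assoc)
    then have "(\<lambda>n::nat. \<integral>\<omega>. exp (- (\<Sum>i<K. (Z i \<omega>)\<^sup>2) / 2) \<partial>M) \<longlonglongrightarrow> (\<integral>\<omega>. exp (- (\<Sum>i<K. (Z' i \<omega>)\<^sup>2) / 2) \<partial>M')"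
      by (intro laplace_squares_limit[OF b.prob_space_axioms b'.prob_space_axioms]) auto
    then show ?thesis
      by (simp add: LIMSEQ_const_iff Z_def Z'_def)
  qed
  then show ?thesis
    using b.laplace_grid_limit[OF k] b'.laplace_grid_limit[OF k] LIMSEQ_unique by auto
qed

subsection \<open>Brownian bridges\<close>

text \<open>The unspecified \<sigma> is eliminated in favour of the second moment, so that
  covariances alone determine characteristic functions.\<close>

lemma centered_normal_moments:
  assumes M: "prob_space M" and Y: "centered_normal M Y"
  shows "integrable M (\<lambda>\<omega>. (Y \<omega>)\<^sup>2)" "(\<integral>\<omega>. iexp (Y \<omega>) \<partial>M) = complex_of_real (exp (- (\<integral>\<omega>. (Y \<omega>)\<^sup>2 \<partial>M) / 2))"
proof -
  from Y obtain \<sigma> where [measurable]: "Y \<in> borel_measurable M"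
    and d: "distr M borel Y = distr std_normal_distribution borel (\<lambda>z. \<sigma> * z)"
    unfolding centered_normal_def by auto
  have m2: "integrable std_normal_distribution (\<lambda>x. x\<^sup>2)" "(\<integral>x. x\<^sup>2 \<partial>std_normal_distribution) = 1"
    using std_normal_distribution_even_moments[of 1] by (simp_all add: fact_numeral)
  have "integrable (distr M borel Y) (\<lambda>x. x\<^sup>2)"
    unfolding d using m2 by (simp add: integrable_distr_eq power_mult_distrib)
  then show "integrable M (\<lambda>\<omega>. (Y \<omega>)\<^sup>2)"
    by (simp add: integrable_distr_eq)
  have "(\<integral>\<omega>. (Y \<omega>)\<^sup>2 \<partial>M) = (\<integral>x. x\<^sup>2 \<partial>distr M borel Y)"
    by (simp add: integral_distr)
  also have "\<dots> = \<sigma>\<^sup>2"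
    unfolding d using m2 by (simp add: integral_distr power_mult_distrib)
  finally have v: "(\<integral>\<omega>. (Y \<omega>)\<^sup>2 \<partial>M) = \<sigma>\<^sup>2" .
  have "(\<integral>\<omega>. iexp (Y \<omega>) \<partial>M) = (\<integral>x. iexp x \<partial>distr M borel Y)"
    by (simp add: integral_distr)
  also have "\<dots> = char std_normal_distribution \<sigma>"
    unfolding d by (simp add: integral_distr char_def)
  finally show "(\<integral>\<omega>. iexp (Y \<omega>) \<partial>M) = complex_of_real (exp (- (\<integral>\<omega>. (Y \<omega>)\<^sup>2 \<partial>M) / 2))"
    by (simp add: char_std_normal_distribution v)
qed

locale bridge =
  fixes M :: "'b measure" and B :: "real \<Rightarrow> 'b \<Rightarrow> real"
  assumes bridge: "brownian_bridge M B"
begin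

lemma centered_normal_comb:
  "finite I \<Longrightarrow> I \<subseteq> {0..1} \<Longrightarrow> centered_normal M (\<lambda>\<omega>. \<Sum>t\<in>I. a t * B t \<omega>)"
  using bridge by (simp add: brownian_bridge_def)

sublocale continuous_process M B
proof -
  interpret prob_space M using bridge by (simp add: brownian_bridge_def)
  show "continuous_process M B"
  proof
    fix t :: real assume t: "t \<in> {0..1}"
    have "centered_normal M (\<lambda>\<omega>. \<Sum>t\<in>{t}. 1 * B t \<omega>)"
      using t by (intro centered_normal_comb) auto
    then show "B t \<in> borel_measurable M" by (simp add: centered_normal_def)
  qed (use bridge in \<open>auto simp: brownian_bridge_def\<close>)
qed

text \<open>The times \<open>t i\<close> may coincide, while the definition sums over a set of
  times; coefficients belonging to equal times are collected.\<close>

lemma centered_normal_sum: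
  fixes t :: "nat \<Rightarrow> real"
  assumes t: "\<And>i. i < K \<Longrightarrow> t i \<in> {0..1}"
  shows "centered_normal M (\<lambda>\<omega>. \<Sum>i<K. g i * B (t i) \<omega>)"
proof -
  define a where "a s = (\<Sum>i\<in>{i\<in>{..<K}. t i = s}. g i)" for s
  have "(\<Sum>i<K. g i * B (t i) \<omega>) = (\<Sum>s\<in>t ` {..<K}. a s * B s \<omega>)" for \<omega>
  proof -
    have "(\<Sum>s\<in>t ` {..<K}. a s * B s \<omega>) = (\<Sum>s\<in>t ` {..<K}. \<Sum>i\<in>{i\<in>{..<K}. t i = s}. g i * B (t i) \<omega>)"
      by (simp add: a_def sum_distrib_right)
    also have "\<dots> = (\<Sum>i<K. g i * B (t i) \<omega>)"
      by (rule sum.group) auto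
    finally show ?thesis by simp
  qed
  moreover have "centered_normal M (\<lambda>\<omega>. \<Sum>s\<in>t ` {..<K}. a s * B s \<omega>)"
    using t by (intro centered_normal_comb) auto
  ultimately show ?thesis by simp
qed

definition cov :: "real \<Rightarrow> real \<Rightarrow> real" where
  "cov s t = min s t - s * t"

lemma second_moment:
  fixes t :: "nat \<Rightarrow> real"
  assumes t: "\<And>i. i < K \<Longrightarrow> t i \<in> {0..1}"
  shows "(\<integral>\<omega>. (\<Sum>i<K. g i * B (t i) \<omega>)\<^sup>2 \<partial>M) = (\<Sum>i<K. \<Sum>j<K. g i * g j * cov (t i) (t j))"
proof -
  have B2: "integrable M (\<lambda>\<omega>. (B s \<omega>)\<^sup>2)" if "s \<in> {0..1}" for s
  proof -
    have "centered_normal M (\<lambda>\<omega>. \<Sum>t\<in>{s}. 1 * B t \<omega>)"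
      using that by (intro centered_normal_comb) auto
    then show ?thesis using centered_normal_moments(1)[OF prob_space_axioms] by simp
  qed
  have BB: "integrable M (\<lambda>\<omega>. B s \<omega> * B u \<omega>)" if "s \<in> {0..1}" "u \<in> {0..1}" for s u
  proof (rule Bochner_Integration.integrable_bound)
    show "integrable M (\<lambda>\<omega>. (B s \<omega>)\<^sup>2 + (B u \<omega>)\<^sup>2)" using B2 that by auto
    show "(\<lambda>\<omega>. B s \<omega> * B u \<omega>) \<in> borel_measurable M" using meas that by auto
    show "AE \<omega> in M. norm (B s \<omega> * B u \<omega>) \<le> norm ((B s \<omega>)\<^sup>2 + (B u \<omega>)\<^sup>2)"
    proof (intro AE_I2)
      fix \<omega>
      have "2 * \<bar>B s \<omega> * B u \<omega>\<bar> \<le> (B s \<omega>)\<^sup>2 + (B u \<omega>)\<^sup>2"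
        using sum_squares_bound[of "\<bar>B s \<omega>\<bar>" "\<bar>B u \<omega>\<bar>"] by (simp add: abs_mult)
      then show "norm (B s \<omega> * B u \<omega>) \<le> norm ((B s \<omega>)\<^sup>2 + (B u \<omega>)\<^sup>2)"
        by simp
    qed
  qed
  have BB': "integrable M (\<lambda>\<omega>. B (t i) \<omega> * B (t j) \<omega>)" if "i < K" "j < K" for i j
    using that by (intro BB t)
  have "(\<integral>\<omega>. (\<Sum>i<K. g i * B (t i) \<omega>)\<^sup>2 \<partial>M) = (\<integral>\<omega>. (\<Sum>i<K. \<Sum>j<K. g i * g j * (B (t i) \<omega> * B (t j) \<omega>)) \<partial>M)"
    by (simp add: power2_eq_square sum_product mult_ac)
  also have "\<dots> = (\<Sum>i<K. \<Sum>j<K. g i * g j * (\<integral>\<omega>. B (t i) \<omega> * B (t j) \<omega> \<partial>M))"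
  proof -
    have "(\<integral>\<omega>. (\<Sum>i<K. \<Sum>j<K. g i * g j * (B (t i) \<omega> * B (t j) \<omega>)) \<partial>M) =
      (\<Sum>i<K. \<integral>\<omega>. (\<Sum>j<K. g i * g j * (B (t i) \<omega> * B (t j) \<omega>)) \<partial>M)"
      by (intro Bochner_Integration.integral_sum Bochner_Integration.integrable_sum integrable_mult_right BB') auto
    also have "\<dots> = (\<Sum>i<K. \<Sum>j<K. \<integral>\<omega>. g i * g j * (B (t i) \<omega> * B (t j) \<omega>) \<partial>M)"
      by (intro sum.cong refl Bochner_Integration.integral_sum integrable_mult_right BB') auto
    finally show ?thesis by simp
  qed
  also have "\<dots> = (\<Sum>i<K. \<Sum>j<K. g i * g j * cov (t i) (t j))"
    using bridge t by (intro sum.cong refl) (auto simp: brownian_bridge_def cov_def)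
  finally show ?thesis .
qed

lemma char_sum:
  fixes t :: "nat \<Rightarrow> real"
  assumes t: "\<And>i. i < K \<Longrightarrow> t i \<in> {0..1}"
  shows "(\<integral>\<omega>. iexp (\<Sum>i<K. g i * B (t i) \<omega>) \<partial>M) =
    complex_of_real (exp (- (\<Sum>i<K. \<Sum>j<K. g i * g j * cov (t i) (t j)) / 2))"
  using centered_normal_moments(2)[OF prob_space_axioms centered_normal_sum[OF t]] second_moment[OF t]
  by simp

text \<open>
  Replacing the value at time \<open>1/2\<close> by an independent normal variable gives another bridge,
  whose functional is, for fixed \<open>\<omega>\<close>, a quadratic polynomial in that variable.
\<close>

definition \<gamma> :: "real \<Rightarrow> real" where
  "\<gamma> t = 4 * min t (1 / 2) - 2 * t"

text \<open>\<open>\<gamma> t\<close> is the regression coefficient of \<open>B t\<close> on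
  \<open>B (1 / 2)\<close>, namely \<open>cov t (1 / 2)\<close> divided by the variance
  \<open>1 / 4\<close>. The residual is uncorrelated with \<open>B (1 / 2)\<close>, and
  \<open>snd x / 2\<close> restores the variance \<open>1 / 4\<close>.\<close>

definition B' :: "real \<Rightarrow> 'b \<times> real \<Rightarrow> real" where
  "B' t x = B t (fst x) - \<gamma> t * B (1 / 2) (fst x) + \<gamma> t * (snd x / 2)"

lemma continuous_process_B': "continuous_process (M \<Otimes>\<^sub>M std_normal_distribution) B'"
proof -
  interpret R: real_distribution std_normal_distribution by (rule real_dist_normal_dist)
  interpret pp: pair_prob_space M std_normal_distribution by unfold_locales
  have [measurable]: "B (1 / 2) \<in> borel_measurable M" by (rule meas) simp
  show ?thesis
  proof
    show "B' t \<in> borel_measurable (M \<Otimes>\<^sub>M std_normal_distribution)" if "t \<in> {0..1}" for t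
    proof -
      have [measurable]: "B t \<in> borel_measurable M" by (rule meas) fact
      show ?thesis unfolding B'_def[abs_def] by measurable
    qed
    fix x assume "x \<in> space (M \<Otimes>\<^sub>M std_normal_distribution)"
    then have "fst x \<in> space M" by (auto simp: space_pair_measure)
    then show "continuous_on {0..1} (\<lambda>t. B' t x)"
      unfolding B'_def \<gamma>_def by (intro continuous_intros cont)
  qed
qed

text \<open>The residual part \<open>W\<close> has its variance lowered by
  \<open>s\<^sup>2 / 4\<close>; the independent normal variable with factor \<open>s / 2\<close>
  adds exactly this amount.\<close>

lemma char_B':
  fixes t :: "nat \<Rightarrow> real"
  assumes t: "\<And>i. i < K \<Longrightarrow> t i \<in> {0..1}"
  shows "(\<integral>x. iexp (\<Sum>i<K. g i * B' (t i) x) \<partial>(M \<Otimes>\<^sub>M std_normal_distribution)) = (\<integral>\<omega>. iexp (\<Sum>i<K. g i * B (t i) \<omega>) \<partial>M)"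
proof -
  interpret R: real_distribution std_normal_distribution by (rule real_dist_normal_dist)
  interpret pair: pair_sigma_finite M std_normal_distribution by unfold_locales
  interpret pp: pair_prob_space M std_normal_distribution by unfold_locales
  interpret c: continuous_process "M \<Otimes>\<^sub>M std_normal_distribution" B' by (rule continuous_process_B')
  define s where "s = (\<Sum>i<K. g i * \<gamma> (t i))"
  \<comment> \<open>The time \<open>1 / 2\<close> enters as an additional index \<open>K\<close>
    with coefficient \<open>- s\<close>, so that \<open>char_sum\<close> covers the
    residual.\<close>
  define g' where "g' i = (if i = K then - s else g i)" for i
  define t' where "t' i = (if i = K then 1 / 2 else t i)" for i
  define W where "W \<omega> = (\<Sum>i<Suc K. g' i * B (t' i) \<omega>)" for \<omega>
  have W: "W \<omega> = (\<Sum>i<K. g i * B (t i) \<omega>) - s * B (1 / 2) \<omega>" for \<omega>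
    by (simp add: W_def g'_def t'_def)
  have split: "(\<Sum>i<K. g i * B' (t i) x) = W (fst x) + s / 2 * snd x" for x
    by (simp add: B'_def W s_def algebra_simps sum.distrib sum_subtractf sum_distrib_left sum_distrib_right sum_divide_distrib)
  have [measurable]: "W \<in> borel_measurable M"
    unfolding W_def by (intro borel_measurable_sum borel_measurable_times borel_measurable_const meas)
      (use t in \<open>auto simp: t'_def split: if_splits dest: less_SucE\<close>)
  have int: "integrable (M \<Otimes>\<^sub>M std_normal_distribution) (\<lambda>(\<omega>, z). iexp (W \<omega>) * iexp (s / 2 * z))"
    by (intro pp.P.integrable_const_bound[of _ 1]) (auto simp: norm_mult)
  have "(\<integral>x. iexp (\<Sum>i<K. g i * B' (t i) x) \<partial>(M \<Otimes>\<^sub>M std_normal_distribution)) =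
     (\<integral>(\<omega>, z). iexp (W \<omega>) * iexp (s / 2 * z) \<partial>(M \<Otimes>\<^sub>M std_normal_distribution))"
    by (intro Bochner_Integration.integral_cong refl) (auto simp: split distrib_left simp flip: exp_add)
  also have "\<dots> = (\<integral>\<omega>. \<integral>z. iexp (W \<omega>) * iexp (s / 2 * z) \<partial>std_normal_distribution \<partial>M)"
    using pair.integral_fst'[OF int] by simp
  also have "\<dots> = (\<integral>\<omega>. iexp (W \<omega>) \<partial>M) * char std_normal_distribution (s / 2)"
    unfolding char_def by (simp only: integral_mult_right_zero integral_mult_left_zero)
  also have "(\<integral>\<omega>. iexp (W \<omega>) \<partial>M) = complex_of_real (exp (- (\<Sum>i<Suc K. \<Sum>j<Suc K. g' i * g' j * cov (t' i) (t' j)) / 2))"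
    unfolding W_def by (rule char_sum) (use t in \<open>auto simp: t'_def less_Suc_eq\<close>)
  \<comment> \<open>The additional row and column contribute \<open>- s\<^sup>2 / 4\<close> each,
    the corner \<open>s\<^sup>2 / 4\<close>.\<close>
  also have "(\<Sum>i<Suc K. \<Sum>j<Suc K. g' i * g' j * cov (t' i) (t' j)) =
     (\<Sum>i<K. \<Sum>j<K. g i * g j * cov (t i) (t j)) - s\<^sup>2 / 4"
  proof -
    have c1: "cov (t i) (1 / 2) = \<gamma> (t i) / 4" "cov (1 / 2) (t i) = \<gamma> (t i) / 4" for i
      by (simp_all add: cov_def \<gamma>_def min.commute)
    have "(\<Sum>i<Suc K. \<Sum>j<Suc K. g' i * g' j * cov (t' i) (t' j)) =
      (\<Sum>i<K. (\<Sum>j<K. g i * g j * cov (t i) (t j)) - s * (g i * \<gamma> (t i)) / 4)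
       + ((\<Sum>j<K. - s * (g j * \<gamma> (t j)) / 4) + s\<^sup>2 / 4)"
      by (simp add: g'_def t'_def c1) (simp add: cov_def power2_eq_square mult_ac)
    also have "\<dots> = (\<Sum>i<K. \<Sum>j<K. g i * g j * cov (t i) (t j)) - s * s / 4 + (- s * s / 4 + s\<^sup>2 / 4)"
      unfolding s_def[of] by (simp add: sum_subtractf sum_negf flip: sum_distrib_left sum_divide_distrib)
    finally show ?thesis by (simp add: power2_eq_square)
  qed
  finally have *: "(\<integral>x. iexp (\<Sum>i<K. g i * B' (t i) x) \<partial>(M \<Otimes>\<^sub>M std_normal_distribution)) =
     complex_of_real (exp (- ((\<Sum>i<K. \<Sum>j<K. g i * g j * cov (t i) (t j)) - s\<^sup>2 / 4) / 2)) *
     complex_of_real (exp (- (s / 2)\<^sup>2 / 2))"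
    by (simp only: char_std_normal_distribution)
  have "exp (- (Q - s\<^sup>2 / 4) / 2) * exp (- (s / 2)\<^sup>2 / 2) = exp (- Q / 2)" for Q
    unfolding exp_add[symmetric] by (simp add: power_divide diff_divide_distrib)
  with * show ?thesis
    by (simp only: char_sum[where t=t and g=g and K=K, OF t] flip: of_real_mult)
qed

text \<open>Equality of Laplace transforms moves the question to the resampled process. There, for
  fixed \<omega>, a level set in the normal variable is the root set of a polynomial with positive
  leading coefficient, hence finite.\<close>

theorem bridge_functional_atomless: "measure M {\<omega>\<in>space M. bridge_functional B \<omega> = c} = 0"
proof -
  interpret R: real_distribution std_normal_distribution by (rule real_dist_normal_dist)
  interpret pair: pair_sigma_finite M std_normal_distribution by unfold_locales
  interpret pp: pair_prob_space M std_normal_distribution by unfold_locales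
  let ?M' = "M \<Otimes>\<^sub>M std_normal_distribution"
  interpret c: continuous_process ?M' B' by (rule continuous_process_B')
  have grid: "real i / real K \<in> {0..1}" if "i < K" for i K :: nat using that by simp
  have "measure M {\<omega>\<in>space M. bridge_functional B \<omega> = c} = measure ?M' {x\<in>space ?M'. bridge_functional B' x = c}"
  proof (rule laplace_eq_imp_atom_eq)
    show "(\<integral>\<omega>. exp (- (real k * bridge_functional B \<omega>)) \<partial>M) = (\<integral>x. exp (- (real k * bridge_functional B' x)) \<partial>?M')" for k
      by (rule bridge_functional_laplace_eq[OF continuous_process_axioms continuous_process_B'])
         (simp_all only: char_B'[OF grid] of_nat_0_le_iff)
  qed (auto simp: bridge_functional_nonneg c.bridge_functional_nonneg intro: prob_space_axioms pp.P.prob_space_axioms)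
  also have "\<dots> = 0"
  proof -
    have "AE x in ?M'. bridge_functional B' x \<noteq> c"
    proof (rule pair.AE_pair_measure)
      show "{x \<in> space ?M'. bridge_functional B' x \<noteq> c} \<in> sets ?M'" by measurable
      show "AE \<omega> in M. AE z in std_normal_distribution. bridge_functional B' (\<omega>, z) \<noteq> c"
      proof (rule AE_I2)
        fix \<omega> assume \<omega>: "\<omega> \<in> space M"
        define u where "u t = B t \<omega> - \<gamma> t * B (1 / 2) \<omega>" for t
        have cu: "continuous_on {0..1} u" and c\<gamma>: "continuous_on {0..1} \<gamma>"
          unfolding u_def \<gamma>_def by (intro continuous_intros cont \<omega>)+
        have i: "set_integrable lborel {0..1} (\<lambda>t. (u t)\<^sup>2)" "set_integrable lborel {0..1} (\<lambda>t. u t * \<gamma> t)"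
          "set_integrable lborel {0..1} (\<lambda>t. (\<gamma> t)\<^sup>2)"
          by (intro borel_integrable_atLeastAtMost' continuous_intros cu c\<gamma>)+
        define a0 a1 a2 where "a0 = (LINT t:{0..1}|lborel. (u t)\<^sup>2)" and "a1 = (LINT t:{0..1}|lborel. u t * \<gamma> t)"
          and "a2 = (LINT t:{0..1}|lborel. (\<gamma> t)\<^sup>2) / 4"
        have quad: "bridge_functional B' (\<omega>, z) = a0 + a1 * z + a2 * z\<^sup>2" for z
        proof -
          have "bridge_functional B' (\<omega>, z) = (LINT t:{0..1}|lborel. (u t)\<^sup>2 + (z * (u t * \<gamma> t) + (z\<^sup>2 / 4) * (\<gamma> t)\<^sup>2))"
            unfolding bridge_functional_def B'_def u_def
            by (intro set_lebesgue_integral_cong) (auto simp: power2_eq_square algebra_simps)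
          also have "\<dots> = a0 + (z * a1 + (z\<^sup>2 / 4) * (4 * a2))"
            using i by (simp add: set_integral_add a0_def a1_def a2_def set_integrable_mult_right)
          finally show ?thesis by (simp add: mult_ac)
        qed
        \<comment> \<open>On \<open>{1/4..3/4}\<close> the function \<gamma> is at least
          \<open>1 / 2\<close>; this makes the leading coefficient \<open>a2\<close>
          positive.\<close>
        have "1 / 8 \<le> (LINT t:{0..1}|lborel. (\<gamma> t)\<^sup>2)"
        proof -
          have "(LINT t:{0..1}|lborel. 1 / 4 * indicator {1/4..3/4::real} t) \<le> (LINT t:{0..1}|lborel. (\<gamma> t)\<^sup>2)"
          proof (rule set_integral_mono[OF _ i(3)])
            show "set_integrable lborel {0..1} (\<lambda>t. 1 / 4 * indicator {1/4..3/4::real} t :: real)"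
              unfolding set_integrable_def real_scaleR_def
              by (subst mult.commute) (intro integrable_real_mult_indicator integrable_mult_right integrable_real_indicator emeasure_bounded_finite; simp)
            fix t :: real
            show "1 / 4 * indicator {1/4..3/4::real} t \<le> (\<gamma> t)\<^sup>2"
            proof (cases "t \<in> {1/4..3/4}")
              case True
              then have "1 / 2 \<le> \<gamma> t" by (auto simp: \<gamma>_def min_def)
              then show ?thesis using power_mono[of "1 / 2" "\<gamma> t" 2] True by (simp add: power2_eq_square)
            qed simp
          qed
          also have "(LINT t:{0..1}|lborel. (1 / 4 :: real) * indicator {1/4..3/4::real} t) = (\<integral>t. 1 / 4 * indicator {1/4..3/4::real} t \<partial>lborel)"
            unfolding set_lebesgue_integral_def by (intro Bochner_Integration.integral_cong) (auto simp: indicator_def)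
          also have "\<dots> = 1 / 8" by simp
          finally show ?thesis .
        qed
        then have a2: "0 < a2" by (simp add: a2_def)
        have "{z. a0 + a1 * z + a2 * z\<^sup>2 = c} = {z. poly [:a0 - c, a1, a2:] z = 0}"
          by (auto simp: power2_eq_square algebra_simps)
        moreover have "finite {z. poly [:a0 - c, a1, a2:] z = 0}"
          using a2 by (intro poly_roots_finite) auto
        ultimately have fin: "finite {z. a0 + a1 * z + a2 * z\<^sup>2 = c}" by simp
        have "AE z in lborel. z \<notin> {z. a0 + a1 * z + a2 * z\<^sup>2 = c}"
          using finite_imp_null_set_lborel[OF fin] by (rule AE_not_in)
        then show "AE z in std_normal_distribution. bridge_functional B' (\<omega>, z) \<noteq> c"
          by (subst AE_density) (auto simp: quad elim!: eventually_mono)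
      qed
    qed
    moreover have "{x\<in>space ?M'. bridge_functional B' x = c} \<in> sets ?M'" by measurable
    ultimately have "measure ?M' {x\<in>space ?M'. bridge_functional B' x = c} = 0"
      by (auto simp: pp.P.prob_eq_0 elim: eventually_mono)
    then show ?thesis .
  qed
  finally show ?thesis .
qed

end

subsection \<open>Dependence on the parameter\<close>

text \<open>Rounding \<open>T\<close> down to a multiple of \<open>1 / k\<close> makes it countably
  valued, and continuity in the parameter recovers the limit; rounded values outside the interval
  are replaced by its midpoint. It serves to insert the estimator for the parameter.\<close>

lemma caratheodory_measurable:
  fixes g :: "real \<Rightarrow> real \<Rightarrow> real"
  assumes ab: "a < b" and [measurable]: "T \<in> borel_measurable N" "Y \<in> borel_measurable N"
    and T: "\<And>\<omega>. \<omega> \<in> space N \<Longrightarrow> T \<omega> \<in> {a<..<b}"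
    and g: "\<And>t. t \<in> {a<..<b} \<Longrightarrow> g t \<in> borel_measurable borel"
    and cont: "\<And>x. continuous_on {a<..<b} (\<lambda>t. g t x)"
  shows "(\<lambda>\<omega>. g (T \<omega>) (Y \<omega>)) \<in> borel_measurable N"
proof -
  define c where "c k i = (if real_of_int i / real k \<in> {a<..<b} then real_of_int i / real k else (a + b) / 2)" for k :: nat and i :: int
  have c: "c k i \<in> {a<..<b}" for k i using ab by (auto simp: c_def)
  have "(\<lambda>\<omega>. g (c k \<lfloor>real k * T \<omega>\<rfloor>) (Y \<omega>)) \<in> borel_measurable N" for k
  proof -
    have [measurable]: "g (c k i) \<in> borel_measurable borel" for i by (rule g[OF c])
    show ?thesis by (rule measurable_compose_countable[where g="\<lambda>\<omega>. \<lfloor>real k * T \<omega>\<rfloor>"]) measurable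
  qed
  moreover have "(\<lambda>k. g (c k \<lfloor>real k * T \<omega>\<rfloor>) (Y \<omega>)) \<longlonglongrightarrow> g (T \<omega>) (Y \<omega>)" if \<omega>: "\<omega> \<in> space N" for \<omega>
  proof (rule continuous_on_tendsto_compose[OF cont])
    have "(\<lambda>k. real_of_int \<lfloor>real k * T \<omega>\<rfloor> / real k) \<longlonglongrightarrow> T \<omega>"
    proof (rule LIM_zero_cancel, rule Lim_null_comparison)
      show "\<forall>\<^sub>F k in sequentially. norm (real_of_int \<lfloor>real k * T \<omega>\<rfloor> / real k - T \<omega>) \<le> 1 / real k"
        using eventually_gt_at_top[of 0]
      proof eventually_elim
        case (elim k)
        have "real_of_int \<lfloor>real k * T \<omega>\<rfloor> / real k - T \<omega> = (real_of_int \<lfloor>real k * T \<omega>\<rfloor> - real k * T \<omega>) / real k"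
          using elim by (simp add: diff_divide_distrib)
        moreover have "\<bar>real_of_int \<lfloor>real k * T \<omega>\<rfloor> - real k * T \<omega>\<bar> \<le> 1" by linarith
        ultimately show ?case by (simp add: abs_divide divide_right_mono)
      qed
    qed (rule lim_const_over_n)
    note lim = this
    have "\<forall>\<^sub>F k in sequentially. real_of_int \<lfloor>real k * T \<omega>\<rfloor> / real k \<in> {a<..<b}"
      using T[OF \<omega>] by (intro topological_tendstoD[OF lim]) auto
    then have "\<forall>\<^sub>F k in sequentially. real_of_int \<lfloor>real k * T \<omega>\<rfloor> / real k = c k \<lfloor>real k * T \<omega>\<rfloor>"
      by eventually_elim (simp add: c_def)
    then show "(\<lambda>k. c k \<lfloor>real k * T \<omega>\<rfloor>) \<longlonglongrightarrow> T \<omega>"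
      by (rule Lim_transform_eventually[OF lim])
  qed (use T \<omega> c in auto)
  ultimately show ?thesis by (rule borel_measurable_LIMSEQ_real[rotated])
qed

text \<open>A limit of difference quotients; the steps \<open>(b - t) / (real n + 2)\<close> keep
  \<open>t + h n\<close> inside the parameter interval.\<close>

lemma param_derivative_measurable:
  fixes g g' :: "real \<Rightarrow> real \<Rightarrow> real"
  assumes g: "\<And>t. t \<in> {a<..<b} \<Longrightarrow> g t \<in> borel_measurable borel"
    and der: "\<And>x. ((\<lambda>t. g t x) has_real_derivative g' t x) (at t)" and t: "t \<in> {a<..<b}"
  shows "g' t \<in> borel_measurable borel"
proof (rule borel_measurable_LIMSEQ_real)
  define h where "h n = (b - t) / (real n + 2)" for n
  have h: "0 < h n" "t + h n \<in> {a<..<b}" for n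
  proof -
    show h0: "0 < h n" using t by (simp add: h_def)
    have "h n < b - t" using t by (simp add: h_def divide_less_eq)
    with h0 t show "t + h n \<in> {a<..<b}" by simp
  qed
  have "h \<longlonglongrightarrow> 0" unfolding h_def by real_asymp
  then have "filterlim h (at 0) sequentially"
    using h(1) by (simp add: filterlim_at less_imp_neq[symmetric])
  then show "(\<lambda>n. (g (t + h n) x - g t x) / h n) \<longlonglongrightarrow> g' t x" for x
    using der[of x] by (auto simp: DERIV_def intro: filterlim_compose)
  have [measurable]: "g (t + h n) \<in> borel_measurable borel" "g t \<in> borel_measurable borel" for n
    using g h t by auto
  show "(\<lambda>x. (g (t + h n) x - g t x) / h n) \<in> borel_measurable borel" for n
    by measurable
qed

lemma integrable_polynomial_tail:
  fixes s :: real
  assumes s: "0 < s"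
  shows "integrable lborel (\<lambda>x::real. (1 + \<bar>x\<bar>) powr (- 1 - s))"
proof -
  define v where "v x = (1 + x) powr (- 1 - s)" for x :: real
  define V where "V x = - ((1 + x) powr (- s) / s)" for x :: real
  define u where "u x = v x * indicator {0..} x" for x :: real
  have [measurable]: "v \<in> borel_measurable borel" "u \<in> borel_measurable borel"
    unfolding u_def[abs_def] v_def[abs_def] by measurable
  have "(\<integral>\<^sup>+x. ennreal (v x) * indicator {0..} x \<partial>lborel) = ennreal (0 - V 0)"
  proof (rule nn_integral_FTC_atLeast)
    show "(V has_real_derivative v x) (at x)" if "0 \<le> x" for x
      unfolding V_def v_def
    proof -
      have "((\<lambda>x. (1 + x) powr (- s)) has_real_derivative - s * (1 + x) powr (- s - 1) * 1) (at x)"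
        using that DERIV_fun_powr[where g="\<lambda>x. 1 + x" and m=1 and x=x and r="- s"]
        by (auto intro!: derivative_eq_intros)
      then have "((\<lambda>x. - ((1 + x) powr (- s) / s)) has_real_derivative - ((- s * (1 + x) powr (- s - 1) * 1) / s)) (at x)"
        by (intro DERIV_minus DERIV_cdivide)
      moreover have "- ((- s * (1 + x) powr (- s - 1) * 1) / s) = (1 + x) powr (- s - 1)" using s by simp
      moreover have "- s - 1 = - 1 - s" by simp
      ultimately show "((\<lambda>x. - ((1 + x) powr (- s) / s)) has_real_derivative (1 + x) powr (- 1 - s)) (at x)"
        by (simp only:)
    qed
    show "(V \<longlongrightarrow> 0) at_top" unfolding V_def using s by real_asymp
  qed (auto simp: v_def)
  then have "(\<integral>\<^sup>+x. ennreal (u x) \<partial>lborel) < \<infinity>"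
    by (simp add: u_def ennreal_mult' ennreal_indicator v_def)
  then have u: "integrable lborel u"
    by (intro integrableI_nonneg) (auto simp: u_def v_def)
  then have u': "integrable lborel (\<lambda>x. u (0 + (- 1) * x))"
    by (rule lborel_integrable_real_affine) simp
  show ?thesis
  proof (rule Bochner_Integration.integrable_bound)
    show "integrable lborel (\<lambda>x. u x + u (0 + (- 1) * x))" using u u' by auto
    show "AE x in lborel. norm ((1 + \<bar>x\<bar>) powr (- 1 - s)) \<le> norm (u x + u (0 + (- 1) * x))"
      by (intro AE_I2) (auto simp: u_def v_def indicator_def abs_if)
  qed measurable
qed

section \<open>The transition kernel and its dependence on the shift\<close>

context smooth_density
begin

text \<open>The error is relative to \<open>f (y - u)\<close> itself, so that it can be integrated
  against an invariant density and returns that density.\<close>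

lemma f_shift_diff: "\<bar>f (y - u) - f (y - v)\<bar> \<le> L * \<bar>u - v\<bar> * exp (L * \<bar>u - v\<bar>) * f (y - u)"
proof -
  have "norm (f (y - v) - f (y - u)) \<le> (L * (exp (L * \<bar>u - v\<bar>) * f (y - u))) * norm ((y - v) - (y - u))"
  proof (rule field_differentiable_bound[of "closed_segment (y - u) (y - v)"])
    fix z assume z: "z \<in> closed_segment (y - u) (y - v)"
    show "(f has_real_derivative l1 z * f z) (at z within closed_segment (y - u) (y - v))"
      using f_deriv DERIV_subset by blast
    have "\<bar>(y - u) - z\<bar> \<le> \<bar>u - v\<bar>"
      using z by (auto simp: closed_segment_eq_real_ivl split: if_splits)
    then have "exp (L * \<bar>(y - u) - z\<bar>) \<le> exp (L * \<bar>u - v\<bar>)"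
      using L_nonneg by (simp add: mult_left_mono)
    then have "f z \<le> exp (L * \<bar>u - v\<bar>) * f (y - u)"
      using f_ratio[of z "y - u"] f_pos[of "y - u"] by (smt (verit) mult_right_mono)
    then show "norm (l1 z * f z) \<le> L * (exp (L * \<bar>u - v\<bar>) * f (y - u))"
      using l1_bound[of z] f_pos[of z] L_nonneg by (auto simp: abs_mult intro!: mult_mono)
  qed auto
  then show ?thesis by (simp add: abs_minus_commute mult_ac)
qed

lemma convolution:
  assumes [measurable]: "s \<in> borel_measurable borel" and h: "integrable lborel h"
  shows "integrable lborel (\<lambda>x. f (y - s x) * h x)"
    and "integrable lborel (\<lambda>y. \<integral>x. f (y - s x) * h x \<partial>lborel)"
    and "(\<integral>y. \<integral>x. f (y - s x) * h x \<partial>lborel \<partial>lborel) = (\<integral>x. h x \<partial>lborel)"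
proof -
  have [measurable]: "h \<in> borel_measurable borel" using h by auto
  show "integrable lborel (\<lambda>x. f (y - s x) * h x)"
  proof (rule Bochner_Integration.integrable_bound)
    show "integrable lborel (\<lambda>x. exp L * h x)" using h by simp
    show "AE x in lborel. norm (f (y - s x) * h x) \<le> norm (exp L * h x)"
    proof (intro AE_I2)
      fix x
      have "\<bar>f (y - s x)\<bar> \<le> exp L" using f_le[of "y - s x"] f_pos[of "y - s x"] by simp
      then show "norm (f (y - s x) * h x) \<le> norm (exp L * h x)"
        by (simp add: abs_mult mult_right_mono)
    qed
  qed measurable
  have shift: "integrable lborel (\<lambda>y. f (y - u))" "(\<integral>y. f (y - u) \<partial>lborel) = 1" for u
    using lborel_integrable_real_affine[OF f_integrable, of 1 "- u"] lborel_integral_real_affine[of 1 f "- u"] f_integral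
    by simp_all
  have int: "integrable (lborel \<Otimes>\<^sub>M lborel) (\<lambda>(x, y). f (y - s x) * h x)"
  proof (rule lborel_pair.Fubini_integrable)
    have "(\<integral>y. norm (f (y - s x) * h x) \<partial>lborel) = \<bar>h x\<bar>" for x
      using f_pos shift by (simp add: abs_mult less_imp_le)
    then show "integrable lborel (\<lambda>x. \<integral>y. norm (case (x, y) of (x, y) \<Rightarrow> f (y - s x) * h x) \<partial>lborel)"
      using h by simp
    show "AE x in lborel. integrable lborel (\<lambda>y. case (x, y) of (x, y) \<Rightarrow> f (y - s x) * h x)"
      using shift by simp
  qed measurable
  show "integrable lborel (\<lambda>y. \<integral>x. f (y - s x) * h x \<partial>lborel)"
    using lborel_pair.integrable_snd[OF int] by simp
  have "(\<integral>y. \<integral>x. f (y - s x) * h x \<partial>lborel \<partial>lborel) = (\<integral>x. \<integral>y. f (y - s x) * h x \<partial>lborel \<partial>lborel)"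
    using lborel_pair.Fubini_integral[OF int] by simp
  also have "\<dots> = (\<integral>x. h x \<partial>lborel)" using shift by simp
  finally show "(\<integral>y. \<integral>x. f (y - s x) * h x \<partial>lborel \<partial>lborel) = (\<integral>x. h x \<partial>lborel)" .
qed

end

text \<open>\<open>K\<close> bounds both parameter derivatives of \<open>S\<close>. The bound
  \<open>tail\<close> uses \<open>1 + \<bar>x\<bar>\<close>, hence is integrable over the whole
  line.\<close>

locale regression = smooth_density f l1 l2 L
  for f l1 l2 :: "real \<Rightarrow> real" and L :: real +
  fixes a b K A r :: real and S Sd Sdd \<phi> :: "real \<Rightarrow> real \<Rightarrow> real"
  assumes ab: "a < b"
    and S_meas: "\<And>t. t \<in> {a<..<b} \<Longrightarrow> S t \<in> borel_measurable borel"
    and S_deriv: "\<And>t x. t \<in> {a<..<b} \<Longrightarrow> ((\<lambda>t. S t x) has_real_derivative Sd t x) (at t)"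
    and Sd_deriv: "\<And>t x. t \<in> {a<..<b} \<Longrightarrow> ((\<lambda>t. Sd t x) has_real_derivative Sdd t x) (at t)"
    and Sdd_cont: "\<And>x. continuous_on {a<..<b} (\<lambda>t. Sdd t x)"
    and Sd_bound: "\<And>t x. t \<in> {a<..<b} \<Longrightarrow> \<bar>Sd t x\<bar> \<le> K"
    and Sdd_bound: "\<And>t x. t \<in> {a<..<b} \<Longrightarrow> \<bar>Sdd t x\<bar> \<le> K"
    and inv: "\<And>t. t \<in> {a<..<b} \<Longrightarrow> invariant_density (S t) f (\<phi> t)"
    and r: "0 < r"
    and tail: "\<And>t x. t \<in> {a<..<b} \<Longrightarrow> \<phi> t x \<le> A * (1 + \<bar>x\<bar>) powr (- 1 - r)"
begin

lemma K_nonneg: "0 \<le> K"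
  using Sd_bound[of "(a + b) / 2" 0] ab by force

lemma Sd_meas: "t \<in> {a<..<b} \<Longrightarrow> Sd t \<in> borel_measurable borel"
  using param_derivative_measurable[where g=S and g'=Sd] S_meas S_deriv by blast

lemma Sdd_meas: "t \<in> {a<..<b} \<Longrightarrow> Sdd t \<in> borel_measurable borel"
  using param_derivative_measurable[where g=Sd and g'=Sdd] Sd_meas Sd_deriv by blast

lemma \<phi>_meas: "t \<in> {a<..<b} \<Longrightarrow> \<phi> t \<in> borel_measurable borel"
  and \<phi>_nonneg: "t \<in> {a<..<b} \<Longrightarrow> 0 \<le> \<phi> t x"
  using inv by (auto simp: invariant_density_def)

lemma \<phi>_integrable: "t \<in> {a<..<b} \<Longrightarrow> integrable lborel (\<phi> t)"
  and \<phi>_integral: "t \<in> {a<..<b} \<Longrightarrow> (\<integral>x. \<phi> t x \<partial>lborel) = 1"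
proof -
  assume t: "t \<in> {a<..<b}"
  have nn: "(\<integral>\<^sup>+x. ennreal (\<phi> t x) \<partial>lborel) = 1" using inv[OF t] unfolding invariant_density_def by blast
  show "integrable lborel (\<phi> t)"
    using nn \<phi>_meas[OF t] \<phi>_nonneg[OF t] by (intro integrableI_nonneg) auto
  show "(\<integral>x. \<phi> t x \<partial>lborel) = 1"
    using nn \<phi>_meas[OF t] \<phi>_nonneg[OF t] by (subst integral_eq_nn_integral) auto
qed

lemma \<phi>_eq: "t \<in> {a<..<b} \<Longrightarrow> \<phi> t y = (\<integral>x. f (y - S t x) * \<phi> t x \<partial>lborel)"
proof -
  assume t: "t \<in> {a<..<b}"
  have [measurable]: "S t \<in> borel_measurable borel" "\<phi> t \<in> borel_measurable borel"
    using t S_meas \<phi>_meas by auto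
  have "ennreal (\<phi> t y) = (\<integral>\<^sup>+x. ennreal (f (y - S t x) * \<phi> t x) \<partial>lborel)"
    using inv[OF t] unfolding invariant_density_def by blast
  then have "enn2real (ennreal (\<phi> t y)) = (\<integral>x. f (y - S t x) * \<phi> t x \<partial>lborel)"
    using \<phi>_nonneg[OF t] f_pos by (subst integral_eq_nn_integral) (auto simp: less_imp_le)
  then show ?thesis using \<phi>_nonneg[OF t] by simp
qed

lemma segment_in: "\<lbrakk>s \<in> {a<..<b}; t \<in> {a<..<b}\<rbrakk> \<Longrightarrow> closed_segment s t \<subseteq> {a<..<b}"
  by (intro closed_segment_subset) auto

lemma S_lipschitz: "\<lbrakk>s \<in> {a<..<b}; t \<in> {a<..<b}\<rbrakk> \<Longrightarrow> \<bar>S s x - S t x\<bar> \<le> K * \<bar>s - t\<bar>"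
  using field_differentiable_bound[of "{a<..<b}" "\<lambda>t. S t x" "\<lambda>t. Sd t x" K s t] S_deriv Sd_bound
  by (auto intro: DERIV_subset)

lemma Sd_lipschitz: "\<lbrakk>s \<in> {a<..<b}; t \<in> {a<..<b}\<rbrakk> \<Longrightarrow> \<bar>Sd s x - Sd t x\<bar> \<le> K * \<bar>s - t\<bar>"
  using field_differentiable_bound[of "{a<..<b}" "\<lambda>t. Sd t x" "\<lambda>t. Sdd t x" K s t] Sd_deriv Sdd_bound
  by (auto intro: DERIV_subset)

text \<open>The relative error of \<open>f_shift_diff\<close> after the shift has been bounded by
  \<open>K\<close> times the parameter distance.\<close>

definition \<eta> :: "real \<Rightarrow> real" where
  "\<eta> h = L * (K * \<bar>h\<bar>) * exp (L * (K * \<bar>h\<bar>))"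

lemma \<eta>_tendsto: "(\<eta> \<longlongrightarrow> 0) (at 0)"
proof -
  have "isCont \<eta> 0" unfolding \<eta>_def by (intro continuous_intros)
  then show ?thesis by (simp add: isCont_def \<eta>_def)
qed

lemma kernel_diff:
  assumes "s \<in> {a<..<b}" "t \<in> {a<..<b}"
  shows "\<bar>f (y - S t x) - f (y - S s x)\<bar> \<le> \<eta> (t - s) * f (y - S t x)"
proof -
  have "\<bar>S t x - S s x\<bar> \<le> K * \<bar>t - s\<bar>" by (rule S_lipschitz) fact+
  then have "L * \<bar>S t x - S s x\<bar> * exp (L * \<bar>S t x - S s x\<bar>) \<le> \<eta> (t - s)"
    unfolding \<eta>_def using L_nonneg K_nonneg by (intro mult_mono) (auto intro!: mult_left_mono)
  then have "L * \<bar>S t x - S s x\<bar> * exp (L * \<bar>S t x - S s x\<bar>) * f (y - S t x) \<le> \<eta> (t - s) * f (y - S t x)"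
    using f_pos[of "y - S t x"] by (intro mult_right_mono) auto
  then show ?thesis using f_shift_diff[of y "S t x" "S s x"] by linarith
qed

text \<open>Subtracting the invariance equations at \<open>t\<close> and \<open>s\<close>: the
  difference of the densities is reproduced by the kernel at \<open>s\<close>, up to the change of
  the kernel acting on \<open>\<phi> t\<close>.\<close>

lemma \<phi>_diff_pointwise:
  assumes s: "s \<in> {a<..<b}" and t: "t \<in> {a<..<b}"
  shows "\<bar>\<phi> t y - \<phi> s y - (\<integral>x. f (y - S s x) * (\<phi> t x - \<phi> s x) \<partial>lborel)\<bar> \<le> \<eta> (t - s) * \<phi> t y"
proof -
  note [measurable] = S_meas[OF s] S_meas[OF t]
  note i = convolution(1)[OF S_meas[OF s] \<phi>_integrable[OF t]] convolution(1)[OF S_meas[OF s] \<phi>_integrable[OF s]]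
    convolution(1)[OF S_meas[OF t] \<phi>_integrable[OF t]]
  have "\<phi> t y - \<phi> s y - (\<integral>x. f (y - S s x) * (\<phi> t x - \<phi> s x) \<partial>lborel)
     = (\<integral>x. (f (y - S t x) - f (y - S s x)) * \<phi> t x \<partial>lborel)"
    unfolding \<phi>_eq[OF t, of y] \<phi>_eq[OF s, of y] using i by (simp add: left_diff_distrib right_diff_distrib)
  also have "\<bar>\<dots>\<bar> \<le> (\<integral>x. \<bar>(f (y - S t x) - f (y - S s x)) * \<phi> t x\<bar> \<partial>lborel)"
    by (rule integral_abs_bound)
  also have "\<dots> \<le> (\<integral>x. \<eta> (t - s) * (f (y - S t x) * \<phi> t x) \<partial>lborel)"
  proof (intro integral_mono)
    show "integrable lborel (\<lambda>x. \<bar>(f (y - S t x) - f (y - S s x)) * \<phi> t x\<bar>)"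
      using i by (simp add: left_diff_distrib)
    show "\<bar>(f (y - S t x) - f (y - S s x)) * \<phi> t x\<bar> \<le> \<eta> (t - s) * (f (y - S t x) * \<phi> t x)" for x
      using mult_right_mono[OF kernel_diff[OF s t, of y x] \<phi>_nonneg[OF t, of x]] \<phi>_nonneg[OF t, of x]
      by (simp add: abs_mult mult.assoc)
  qed (use i in auto)
  also have "\<dots> = \<eta> (t - s) * \<phi> t y" by (simp add: \<phi>_eq[OF t, of y])
  finally show ?thesis .
qed

lemma A_nonneg: "0 \<le> A"
proof -
  have c: "(a + b) / 2 \<in> {a<..<b}" using ab by auto
  have "0 \<le> A * (1 + \<bar>0\<bar>) powr (- 1 - r)"
    using tail[OF c, of 0] \<phi>_nonneg[OF c, of 0] by linarith
  then show ?thesis by simp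
qed

text \<open>Uniform tightness from the common integrable envelope. The sets are levels of
  \<open>S s\<close>, because the Doeblin minorization is governed by the size of
  \<open>S s x\<close>, not of \<open>x\<close>.\<close>

lemma small_mass_outside:
  assumes s: "s \<in> {a<..<b}" and \<epsilon>: "0 < \<epsilon>"
  shows "\<exists>n::nat. \<forall>t\<in>{a<..<b}. (\<integral>x. \<phi> t x * indicator {x. real n < \<bar>S s x\<bar>} x \<partial>lborel) < \<epsilon>"
proof -
  define g where "g x = A * (1 + \<bar>x\<bar>) powr (- 1 - r)" for x
  note [measurable] = S_meas[OF s]
  have g: "integrable lborel g"
    unfolding g_def using integrable_polynomial_tail[OF r] by simp
  have g0: "0 \<le> g x" for x using A_nonneg by (simp add: g_def)
  have "(\<lambda>n. \<integral>x. g x * indicator {x. real n < \<bar>S s x\<bar>} x \<partial>lborel) \<longlonglongrightarrow> (\<integral>x. 0 \<partial>(lborel :: real measure))"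
  proof (rule integral_dominated_convergence[where w=g])
    show "AE x in lborel. (\<lambda>n. g x * indicator {x. real n < \<bar>S s x\<bar>} x) \<longlonglongrightarrow> 0"
    proof (intro AE_I2 tendsto_eventually)
      fix x
      show "\<forall>\<^sub>F n in sequentially. g x * indicator {x. real n < \<bar>S s x\<bar>} x = 0"
        using eventually_ge_at_top[of "nat \<lceil>\<bar>S s x\<bar>\<rceil>"]
        by eventually_elim (auto simp: indicator_def nat_ceiling_le_eq)
    qed
    show "AE x in lborel. norm (g x * indicator {x. real n < \<bar>S s x\<bar>} x) \<le> g x" for n
      using g0 by (auto simp: indicator_def)
  qed (use g in auto)
  then have "\<forall>\<^sub>F n in sequentially. (\<integral>x. g x * indicator {x. real n < \<bar>S s x\<bar>} x \<partial>lborel) < \<epsilon>"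
    using \<epsilon> by (intro order_tendstoD) auto
  then obtain n :: nat where n: "(\<integral>x. g x * indicator {x. real n < \<bar>S s x\<bar>} x \<partial>lborel) < \<epsilon>"
    by (auto simp: eventually_sequentially)
  have "(\<integral>x. \<phi> t x * indicator {x. real n < \<bar>S s x\<bar>} x \<partial>lborel) < \<epsilon>" if t: "t \<in> {a<..<b}" for t
  proof -
    have "(\<integral>x. \<phi> t x * indicator {x. real n < \<bar>S s x\<bar>} x \<partial>lborel) \<le> (\<integral>x. g x * indicator {x. real n < \<bar>S s x\<bar>} x \<partial>lborel)"
      using g \<phi>_integrable[OF t] tail[OF t, folded g_def]
      by (intro integral_mono integrable_real_mult_indicator mult_right_mono) auto
    with n show ?thesis by linarith
  qed
  then show ?thesis by blast
qed

text \<open>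
  Doeblin's argument: the kernel \<open>f (y - S s x)\<close> strictly contracts the part of the signed density
  \<open>\<phi> t - \<phi> s\<close> that lives where \<open>S s\<close> is bounded, because there it dominates a multiple of \<open>f\<close>.
\<close>
lemma \<phi>_L1_continuous:
  assumes s: "s \<in> {a<..<b}" and \<epsilon>: "0 < \<epsilon>"
  shows "\<exists>\<delta>>0. \<forall>t\<in>{a<..<b}. \<bar>t - s\<bar> < \<delta> \<longrightarrow> (\<integral>x. \<bar>\<phi> t x - \<phi> s x\<bar> \<partial>lborel) < \<epsilon>"
proof -
  have "0 < \<epsilon> / 8" using \<epsilon> by simp
  from small_mass_outside[OF s this] obtain n :: nat where
    n: "\<And>t. t \<in> {a<..<b} \<Longrightarrow> (\<integral>x. \<phi> t x * indicator {x. real n < \<bar>S s x\<bar>} x \<partial>lborel) < \<epsilon> / 8"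
    by blast
  \<comment> \<open>The minorization constant: \<open>c * f y \<le> f (y - S s x)\<close> whenever
    \<open>\<bar>S s x\<bar> \<le> real n\<close>, by \<open>f_ratio\<close>.\<close>
  define c where "c = exp (- (L * real n))"
  have c: "0 < c" by (simp add: c_def)
  have "\<forall>\<^sub>F h in at 0. \<eta> h < c * (\<epsilon> / 2)"
    using c \<epsilon> by (intro order_tendstoD[OF \<eta>_tendsto]) auto
  \<comment> \<open>The threshold is tuned to the end of the argument:
    \<open>2 * c * m \<le> \<eta> (t - s)\<close> then forces \<open>m < \<epsilon> / 4\<close>, and
    with \<open>N / 2 - \<epsilon> / 4 \<le> m\<close> this gives
    \<open>N < \<epsilon>\<close>.\<close>
  then obtain \<delta> where \<delta>: "0 < \<delta>" "\<And>h. h \<noteq> 0 \<Longrightarrow> \<bar>h\<bar> < \<delta> \<Longrightarrow> \<eta> h < c * (\<epsilon> / 2)"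
    by (auto simp: eventually_at dist_real_def)
  have "(\<integral>x. \<bar>\<phi> t x - \<phi> s x\<bar> \<partial>lborel) < \<epsilon>" if t: "t \<in> {a<..<b}" and ts: "\<bar>t - s\<bar> < \<delta>" for t
  proof (cases "t = s")
    case True
    then show ?thesis using \<epsilon> by simp
  next
    case False
    note [measurable] = S_meas[OF s] \<phi>_meas[OF s] \<phi>_meas[OF t]
    define D where "D x = \<phi> t x - \<phi> s x" for x
    define Dp where "Dp x = max 0 (D x)" for x
    define Dm where "Dm x = max 0 (- D x)" for x
    define G where "G = {x. \<not> real n < \<bar>S s x\<bar>}"
    have [measurable]: "D \<in> borel_measurable borel" "Dp \<in> borel_measurable borel" "Dm \<in> borel_measurable borel"
      "G \<in> sets borel"
      unfolding D_def Dp_def Dm_def G_def by measurable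
    have iD: "integrable lborel D" unfolding D_def using \<phi>_integrable s t by auto
    have iabs: "integrable lborel (\<lambda>x. \<bar>D x\<bar>)" using iD by simp
    have iDp: "integrable lborel Dp" and iDm: "integrable lborel Dm"
      by (rule Bochner_Integration.integrable_bound[OF iabs]; simp add: Dp_def Dm_def)+
    have D0: "(\<integral>x. D x \<partial>lborel) = 0"
      unfolding D_def using \<phi>_integrable[OF s] \<phi>_integrable[OF t] \<phi>_integral[OF s] \<phi>_integral[OF t] by simp
    have Dpm: "D x = Dp x - Dm x" "\<bar>D x\<bar> = Dp x + Dm x" "0 \<le> Dp x" "0 \<le> Dm x" for x
      by (auto simp: Dp_def Dm_def)
    define N where "N = (\<integral>x. \<bar>D x\<bar> \<partial>lborel)"
    have "(\<integral>x. D x \<partial>lborel) = (\<integral>x. Dp x \<partial>lborel) - (\<integral>x. Dm x \<partial>lborel)"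
      unfolding Dpm(1) using iDp iDm by simp
    moreover have "N = (\<integral>x. Dp x \<partial>lborel) + (\<integral>x. Dm x \<partial>lborel)"
      unfolding N_def Dpm(2) using iDp iDm by simp
    \<comment> \<open>Both densities have mass one, so the positive and negative parts of
      \<open>D\<close> carry equal mass.\<close>
    ultimately have half: "(\<integral>x. Dp x \<partial>lborel) = N / 2" "(\<integral>x. Dm x \<partial>lborel) = N / 2"
      using D0 by auto
    have out: "(\<integral>x. V x \<partial>lborel) - \<epsilon> / 4 \<le> (\<integral>x. V x * indicator G x \<partial>lborel)"
      if iV: "integrable lborel V" and V: "\<And>x. 0 \<le> V x" "\<And>x. V x \<le> \<bar>D x\<bar>" for V
    proof -
      have [measurable]: "V \<in> borel_measurable borel" using iV by auto
      have "(\<integral>x. V x \<partial>lborel) = (\<integral>x. V x * indicator G x + V x * indicator (- G) x \<partial>lborel)"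
        by (intro Bochner_Integration.integral_cong) (auto simp: indicator_def)
      also have "\<dots> = (\<integral>x. V x * indicator G x \<partial>lborel) + (\<integral>x. V x * indicator (- G) x \<partial>lborel)"
        using iV by (intro Bochner_Integration.integral_add integrable_real_mult_indicator) auto
      also have "(\<integral>x. V x * indicator (- G) x \<partial>lborel) \<le> (\<integral>x. \<phi> t x * indicator (- G) x + \<phi> s x * indicator (- G) x \<partial>lborel)"
      proof (intro integral_mono)
        show "V x * indicator (- G) x \<le> \<phi> t x * indicator (- G) x + \<phi> s x * indicator (- G) x" for x
          using V(2)[of x] \<phi>_nonneg[OF s, of x] \<phi>_nonneg[OF t, of x] by (auto simp: indicator_def D_def)
      qed (use iV \<phi>_integrable s t in \<open>auto intro!: integrable_real_mult_indicator\<close>)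
      also have "\<dots> = (\<integral>x. \<phi> t x * indicator (- G) x \<partial>lborel) + (\<integral>x. \<phi> s x * indicator (- G) x \<partial>lborel)"
        using \<phi>_integrable[OF s] \<phi>_integrable[OF t]
        by (intro Bochner_Integration.integral_add integrable_real_mult_indicator) auto
      also have "\<dots> < \<epsilon> / 4"
        using n[OF s] n[OF t] by (simp add: G_def Compl_eq)
      finally show ?thesis by simp
    qed
    define m where "m = min (\<integral>x. Dp x * indicator G x \<partial>lborel) (\<integral>x. Dm x * indicator G x \<partial>lborel)"
    have m: "N / 2 - \<epsilon> / 4 \<le> m"
      using out[OF iDp] out[OF iDm] half Dpm by (simp add: m_def)
    have lower: "c * m * f y \<le> (\<integral>x. f (y - S s x) * V x \<partial>lborel)"
      if iV: "integrable lborel V" and V: "\<And>x. 0 \<le> V x" and mV: "m \<le> (\<integral>x. V x * indicator G x \<partial>lborel)" for V y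
    proof -
      have "c * m * f y \<le> c * f y * (\<integral>x. V x * indicator G x \<partial>lborel)"
        using mult_left_mono[OF mV, of "c * f y"] c f_pos[of y] by (simp add: mult_ac)
      also have "\<dots> = (\<integral>x. c * f y * (V x * indicator G x) \<partial>lborel)" by simp
      also have "\<dots> \<le> (\<integral>x. f (y - S s x) * V x \<partial>lborel)"
      proof (intro integral_mono convolution(1)[OF S_meas[OF s] iV])
        show "integrable lborel (\<lambda>x. c * f y * (V x * indicator G x))"
          using iV by (intro integrable_mult_right integrable_real_mult_indicator) auto
        fix x
        show "c * f y * (V x * indicator G x) \<le> f (y - S s x) * V x"
        proof (cases "x \<in> G")
          case True
          have "f y \<le> exp (L * \<bar>(y - S s x) - y\<bar>) * f (y - S s x)" by (rule f_ratio)
          also have "\<dots> \<le> exp (L * real n) * f (y - S s x)"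
            using True L_nonneg f_pos[of "y - S s x"] by (intro mult_right_mono) (auto simp: G_def intro!: mult_left_mono)
          finally have "c * f y \<le> f (y - S s x)"
            by (simp add: c_def exp_minus field_simps)
          then show ?thesis using V[of x] True by (simp add: mult_right_mono)
        qed (use V[of x] f_pos[of "y - S s x"] in simp)
      qed
      finally show ?thesis .
    qed
    \<comment> \<open>The images \<open>P\<close> and \<open>Q\<close> of the two parts both
      dominate \<open>c * m * f y\<close>, hence their difference stays below their sum by twice
      this amount: the cancellation behind the contraction.\<close>
    have pt: "\<bar>D y\<bar> \<le> (\<integral>x. f (y - S s x) * \<bar>D x\<bar> \<partial>lborel) - 2 * (c * m) * f y + \<eta> (t - s) * \<phi> t y" for y
    proof -
      define P where "P = (\<integral>x. f (y - S s x) * Dp x \<partial>lborel)"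
      define Q where "Q = (\<integral>x. f (y - S s x) * Dm x \<partial>lborel)"
      note iP = convolution(1)[OF S_meas[OF s] iDp, of y] and iQ = convolution(1)[OF S_meas[OF s] iDm, of y]
      have 1: "(\<integral>x. f (y - S s x) * D x \<partial>lborel) = P - Q"
        unfolding Dpm(1) P_def Q_def using iP iQ by (simp add: right_diff_distrib)
      have 2: "(\<integral>x. f (y - S s x) * \<bar>D x\<bar> \<partial>lborel) = P + Q"
        unfolding Dpm(2) P_def Q_def using iP iQ by (simp add: distrib_left)
      have 3: "c * m * f y \<le> P" "c * m * f y \<le> Q"
        unfolding P_def Q_def using Dpm by (intro lower iDp iDm; simp add: m_def)+
      have "\<bar>D y - (\<integral>x. f (y - S s x) * D x \<partial>lborel)\<bar> \<le> \<eta> (t - s) * \<phi> t y"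
        using \<phi>_diff_pointwise[OF s t, of y] by (simp add: D_def)
      then show ?thesis using 1 2 3 by simp
    qed
    have "N \<le> (\<integral>y. (\<integral>x. f (y - S s x) * \<bar>D x\<bar> \<partial>lborel) - 2 * (c * m) * f y + \<eta> (t - s) * \<phi> t y \<partial>lborel)"
      unfolding N_def
      using iabs convolution(2)[OF S_meas[OF s] iabs] f_integrable \<phi>_integrable[OF t]
      by (intro integral_mono pt) auto
    \<comment> \<open>The kernel preserves the integral of \<open>\<bar>D\<bar>\<close>, so
      \<open>N\<close> occurs on both sides and cancels.\<close>
    also have "\<dots> = N - 2 * (c * m) + \<eta> (t - s)"
      using convolution(2,3)[OF S_meas[OF s] iabs] f_integrable \<phi>_integrable[OF t] f_integral \<phi>_integral[OF t]
      by (simp add: N_def)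
    finally have "2 * (c * m) \<le> \<eta> (t - s)" by simp
    also have "\<dots> < c * (\<epsilon> / 2)" using \<delta>(2)[of "t - s"] False ts by simp
    finally have "m < \<epsilon> / 4" using c by (simp add: mult.left_commute[of 2])
    then have "N < \<epsilon>" using m by simp
    then show ?thesis by (simp add: N_def D_def)
  qed
  then show ?thesis using \<delta>(1) by blast
qed

lemma \<phi>_le: "t \<in> {a<..<b} \<Longrightarrow> \<phi> t y \<le> exp L"
  by (rule invariant_density_le[OF inv])

text \<open>One application of the kernel, bounded by \<open>exp L\<close>, upgrades closeness in
  mean to closeness uniformly in \<open>y\<close>.\<close>

lemma \<phi>_uniformly_continuous:
  assumes s: "s \<in> {a<..<b}" and \<epsilon>: "0 < \<epsilon>"
  shows "\<exists>\<delta>>0. \<forall>t\<in>{a<..<b}. \<bar>t - s\<bar> < \<delta> \<longrightarrow> (\<forall>y. \<bar>\<phi> t y - \<phi> s y\<bar> < \<epsilon>)"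
proof -
  define \<epsilon>' where "\<epsilon>' = \<epsilon> / (2 * exp L)"
  have \<epsilon>': "0 < \<epsilon>'" using \<epsilon> by (simp add: \<epsilon>'_def)
  obtain \<delta>1 where \<delta>1: "0 < \<delta>1" "\<And>t. t \<in> {a<..<b} \<Longrightarrow> \<bar>t - s\<bar> < \<delta>1 \<Longrightarrow> (\<integral>x. \<bar>\<phi> t x - \<phi> s x\<bar> \<partial>lborel) < \<epsilon>'"
    using \<phi>_L1_continuous[OF s \<epsilon>'] by blast
  have "\<forall>\<^sub>F h in at 0. \<eta> h < \<epsilon>'"
    using \<epsilon>' by (intro order_tendstoD[OF \<eta>_tendsto]) auto
  then obtain \<delta>2 where \<delta>2: "0 < \<delta>2" "\<And>h. h \<noteq> 0 \<Longrightarrow> \<bar>h\<bar> < \<delta>2 \<Longrightarrow> \<eta> h < \<epsilon>'"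
    by (auto simp: eventually_at dist_real_def)
  have \<eta>_small: "\<eta> h < \<epsilon>'" if "\<bar>h\<bar> < \<delta>2" for h
    using \<delta>2(2)[of h] that \<epsilon>' by (cases "h = 0") (auto simp: \<eta>_def)
  have "\<bar>\<phi> t y - \<phi> s y\<bar> < \<epsilon>" if t: "t \<in> {a<..<b}" and ts: "\<bar>t - s\<bar> < min \<delta>1 \<delta>2" for t y
  proof -
    note [measurable] = S_meas[OF s] \<phi>_meas[OF s] \<phi>_meas[OF t]
    have iD: "integrable lborel (\<lambda>x. \<phi> t x - \<phi> s x)" using \<phi>_integrable s t by auto
    have "\<bar>\<integral>x. f (y - S s x) * (\<phi> t x - \<phi> s x) \<partial>lborel\<bar> \<le> (\<integral>x. \<bar>f (y - S s x) * (\<phi> t x - \<phi> s x)\<bar> \<partial>lborel)"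
      by (rule integral_abs_bound)
    also have "\<dots> \<le> (\<integral>x. exp L * \<bar>\<phi> t x - \<phi> s x\<bar> \<partial>lborel)"
    proof (intro integral_mono integrable_abs convolution(1)[OF S_meas[OF s] iD] integrable_mult_right iD)
      fix x
      have "\<bar>f (y - S s x)\<bar> \<le> exp L" using f_le[of "y - S s x"] f_pos[of "y - S s x"] by simp
      then show "\<bar>f (y - S s x) * (\<phi> t x - \<phi> s x)\<bar> \<le> exp L * \<bar>\<phi> t x - \<phi> s x\<bar>"
        by (simp add: abs_mult mult_right_mono)
    qed
    also have "\<dots> < exp L * \<epsilon>'"
      using \<delta>1(2)[OF t] ts by simp
    finally have 1: "\<bar>\<integral>x. f (y - S s x) * (\<phi> t x - \<phi> s x) \<partial>lborel\<bar> < \<epsilon> / 2"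
      by (simp add: \<epsilon>'_def)
    have "\<eta> (t - s) * \<phi> t y \<le> \<epsilon>' * exp L"
      using \<eta>_small[of "t - s"] ts \<phi>_le[OF t] \<phi>_nonneg[OF t] \<epsilon>' by (intro mult_mono) auto
    then have 2: "\<eta> (t - s) * \<phi> t y \<le> \<epsilon> / 2" by (simp add: \<epsilon>'_def)
    show ?thesis using \<phi>_diff_pointwise[OF s t, of y] 1 2 by linarith
  qed
  then show ?thesis using \<delta>1(1) \<delta>2(1) by (intro exI[of _ "min \<delta>1 \<delta>2"]) auto
qed

lemma \<phi>_cont: "continuous_on {a<..<b} (\<lambda>t. \<phi> t y)"
proof (unfold continuous_on_iff, intro ballI allI impI)
  fix s and e :: real assume "s \<in> {a<..<b}" "0 < e"
  then show "\<exists>d>0. \<forall>t\<in>{a<..<b}. dist t s < d \<longrightarrow> dist (\<phi> t y) (\<phi> s y) < e"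
    using \<phi>_uniformly_continuous[of s e] unfolding dist_real_def by blast
qed

lemma S_cont: "continuous_on {a<..<b} (\<lambda>t. S t x)" and Sd_cont: "continuous_on {a<..<b} (\<lambda>t. Sd t x)"
  by (rule DERIV_continuous_on[OF has_field_derivative_at_within[OF S_deriv]], simp,
      rule DERIV_continuous_on[OF has_field_derivative_at_within[OF Sd_deriv]], simp)

text \<open>The weight for all integrals over \<open>y\<close>. The exponent lies strictly between
  -1 and the tail exponent \<open>- 1 - r\<close>: \<open>m\<close> is integrable, and the densities
  are still negligible against it at infinity.\<close>

definition m :: "real \<Rightarrow> real" where
  "m y = (1 + \<bar>y\<bar>) powr (- 1 - r / 2)"

lemma m_pos: "0 < m y" and m_integrable: "integrable lborel m" and m_measurable [measurable]: "m \<in> borel_measurable borel"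
proof -
  show "0 < m y" by (simp add: m_def add_pos_nonneg)
  show "integrable lborel m" unfolding m_def[abs_def] using integrable_polynomial_tail[of "r / 2"] r by simp
  show "m \<in> borel_measurable borel" unfolding m_def[abs_def] by measurable
qed

lemma \<phi>_le_m: "t \<in> {a<..<b} \<Longrightarrow> \<phi> t y \<le> A * m y"
proof -
  assume t: "t \<in> {a<..<b}"
  have "(1 + \<bar>y\<bar>) powr (- 1 - r) \<le> m y" unfolding m_def using r by (intro powr_mono) auto
  then have "A * (1 + \<bar>y\<bar>) powr (- 1 - r) \<le> A * m y" using A_nonneg by (rule mult_left_mono)
  then show ?thesis using tail[OF t, of y] by linarith
qed

text \<open>Within \<open>\<bar>y\<bar> \<le> R\<close> uniform continuity is used and
  \<open>m\<close> is bounded below; outside, the spare power \<open>- (r / 2)\<close> of the tail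
  makes both densities small relative to \<open>m\<close>.\<close>

lemma \<phi>_weighted_continuous:
  assumes s: "s \<in> {a<..<b}" and \<epsilon>: "0 < \<epsilon>"
  shows "\<exists>\<delta>>0. \<forall>t\<in>{a<..<b}. \<bar>t - s\<bar> < \<delta> \<longrightarrow> (\<forall>y. \<bar>\<phi> t y - \<phi> s y\<bar> \<le> \<epsilon> * m y)"
proof -
  have "((\<lambda>R. A * (1 + R) powr (- (r / 2))) \<longlongrightarrow> A * 0) at_top"
    using r by (intro tendsto_mult tendsto_const) real_asymp
  then have "\<forall>\<^sub>F R in at_top. A * (1 + R) powr (- (r / 2)) < \<epsilon>"
    using \<epsilon> by (intro order_tendstoD) auto
  then obtain R where R: "0 < R" "A * (1 + R) powr (- (r / 2)) < \<epsilon>"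
    using eventually_gt_at_top[of 0] by (metis (no_types, lifting) eventually_conj eventually_happens trivial_limit_at_top_linorder)
  define \<epsilon>' where "\<epsilon>' = \<epsilon> * (1 + R) powr (- 1 - r / 2)"
  have "0 < \<epsilon>'" using \<epsilon> R by (simp add: \<epsilon>'_def)
  then obtain \<delta> where \<delta>: "0 < \<delta>" "\<And>t y. t \<in> {a<..<b} \<Longrightarrow> \<bar>t - s\<bar> < \<delta> \<Longrightarrow> \<bar>\<phi> t y - \<phi> s y\<bar> < \<epsilon>'"
    using \<phi>_uniformly_continuous[OF s] by blast
  have "\<bar>\<phi> t y - \<phi> s y\<bar> \<le> \<epsilon> * m y" if t: "t \<in> {a<..<b}" and ts: "\<bar>t - s\<bar> < \<delta>" for t y
  proof (cases "\<bar>y\<bar> \<le> R")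
    case True
    then have "(1 + R) powr (- 1 - r / 2) \<le> m y"
      unfolding m_def using r by (intro powr_mono2') auto
    then have "\<epsilon>' \<le> \<epsilon> * m y" using \<epsilon> by (simp add: \<epsilon>'_def)
    then show ?thesis using \<delta>(2)[OF t ts, of y] by linarith
  next
    case False
    have "\<bar>\<phi> t y - \<phi> s y\<bar> \<le> A * (1 + \<bar>y\<bar>) powr (- 1 - r)"
      using tail[OF t, of y] tail[OF s, of y] \<phi>_nonneg[OF t, of y] \<phi>_nonneg[OF s, of y] by linarith
    also have "\<dots> = (A * (1 + \<bar>y\<bar>) powr (- (r / 2))) * m y"
      unfolding m_def mult.assoc powr_add[symmetric]
      by (intro arg_cong2[where f="(*)"] arg_cong2[where f="(powr)"] refl) simp
    also have "\<dots> \<le> \<epsilon> * m y"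
    proof (rule mult_right_mono)
      have "(1 + \<bar>y\<bar>) powr (- (r / 2)) \<le> (1 + R) powr (- (r / 2))"
        using False R r by (intro powr_mono2') auto
      then have "A * (1 + \<bar>y\<bar>) powr (- (r / 2)) \<le> A * (1 + R) powr (- (r / 2))"
        using A_nonneg by (rule mult_left_mono)
      then show "A * (1 + \<bar>y\<bar>) powr (- (r / 2)) \<le> \<epsilon>" using R by linarith
    qed (use m_pos[of y] in simp)
    finally show ?thesis .
  qed
  then show ?thesis using \<delta>(1) by blast
qed

end

subsection \<open>The limit of the score process\<close>

text \<open>\<open>th\<close> is the true parameter and \<open>M\<close> its law. Positive
  information is required at every \<open>t\<close>, since the statistic is normalized at the
  estimate.\<close>

locale model = regression f l1 l2 L a b K A r S Sd Sdd \<phi> + P: ergodic_ar M X e "S th" f "\<phi> th"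
  for f l1 l2 :: "real \<Rightarrow> real" and L a b K A r :: real and S Sd Sdd \<phi> :: "real \<Rightarrow> real \<Rightarrow> real"
    and M :: "'w measure" and X e :: "nat \<Rightarrow> 'w \<Rightarrow> real" and th :: real +
  assumes th: "th \<in> {a<..<b}"
    and info_f_pos: "0 < (\<integral>x. (l1 x)\<^sup>2 * f x \<partial>lborel)"
    and info_S_pos: "\<And>t. t \<in> {a<..<b} \<Longrightarrow> 0 < (\<integral>x. (Sd t x)\<^sup>2 * \<phi> t x \<partial>lborel)"
begin

section \<open>Fisher information and the time change\<close>

definition I0 :: real where "I0 = (\<integral>x. (l1 x)\<^sup>2 * f x \<partial>lborel)"
definition J :: "real \<Rightarrow> real" where "J t = (\<integral>x. (Sd t x)\<^sup>2 * \<phi> t x \<partial>lborel)"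
definition info :: "real \<Rightarrow> real" where "info t = I0 * J t"

lemma I0_pos: "0 < I0" and J_pos: "t \<in> {a<..<b} \<Longrightarrow> 0 < J t" and info_pos: "t \<in> {a<..<b} \<Longrightarrow> 0 < info t"
  using info_f_pos info_S_pos by (auto simp: I0_def J_def info_def)

lemma meas_th [measurable]: "S th \<in> borel_measurable borel" "Sd th \<in> borel_measurable borel"
  "Sdd th \<in> borel_measurable borel" "\<phi> th \<in> borel_measurable borel"
  using S_meas Sd_meas Sdd_meas \<phi>_meas th by auto

lemma Sd_sq: "t \<in> {a<..<b} \<Longrightarrow> (Sd t x)\<^sup>2 \<le> K\<^sup>2"
  using power_mono[OF Sd_bound, where n=2] by simp

lemma Sd_sq_\<phi>_integrable: "t \<in> {a<..<b} \<Longrightarrow> integrable lborel (\<lambda>x. (Sd t x)\<^sup>2 * \<phi> t x)"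
proof -
  assume t: "t \<in> {a<..<b}"
  note [measurable] = Sd_meas[OF t] \<phi>_meas[OF t]
  show ?thesis
  proof (rule Bochner_Integration.integrable_bound)
    show "integrable lborel (\<lambda>x. K\<^sup>2 * \<phi> t x)" using \<phi>_integrable[OF t] by simp
    show "AE x in lborel. norm ((Sd t x)\<^sup>2 * \<phi> t x) \<le> norm (K\<^sup>2 * \<phi> t x)"
      using Sd_sq[OF t] \<phi>_nonneg[OF t] by (auto intro!: mult_right_mono)
  qed measurable
qed

definition Fc :: "real \<Rightarrow> real" where
  "Fc y = (\<integral>x. (if x < y then 1 else 0) * ((Sd th x)\<^sup>2 * \<phi> th x) \<partial>lborel) / J th"

lemma indicator_integrable:
  "integrable lborel (\<lambda>x. (if x < y then 1 else 0) * ((Sd th x)\<^sup>2 * \<phi> th x))"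
  by (rule Bochner_Integration.integrable_bound[OF Sd_sq_\<phi>_integrable[OF th]]) auto

lemma Fc_integral: "(\<integral>x. (if x < y then 1 else 0) * ((Sd th x)\<^sup>2 * \<phi> th x) \<partial>lborel) = J th * Fc y"
  using J_pos[OF th] by (simp add: Fc_def)

lemma Fc_mono: "y \<le> z \<Longrightarrow> Fc y \<le> Fc z"
  unfolding Fc_def using J_pos[OF th] \<phi>_nonneg[OF th]
  by (intro divide_right_mono integral_mono indicator_integrable) (auto intro: mult_nonneg_nonneg)

lemma Fc_nonneg: "0 \<le> Fc y" and Fc_le_1: "Fc y \<le> 1"
proof -
  show "0 \<le> Fc y"
    unfolding Fc_def using J_pos[OF th] \<phi>_nonneg[OF th]
    by (intro divide_nonneg_pos integral_nonneg_AE AE_I2) auto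
  have "J th * Fc y \<le> J th"
    unfolding Fc_integral[symmetric] unfolding J_def
    using \<phi>_nonneg[OF th] by (intro integral_mono indicator_integrable Sd_sq_\<phi>_integrable th) auto
  then show "Fc y \<le> 1" using J_pos[OF th] by simp
qed

text \<open>A common form of dominated convergence from which continuity and both limits at infinity
  follow.\<close>

lemma Fc_tendsto:
  assumes "AE x in lborel. (\<lambda>n. if x < s n then 1 else 0 :: real) \<longlonglongrightarrow> g x" and [measurable]: "g \<in> borel_measurable borel"
  shows "(\<lambda>n. Fc (s n)) \<longlonglongrightarrow> (\<integral>x. g x * ((Sd th x)\<^sup>2 * \<phi> th x) \<partial>lborel) / J th"
  unfolding Fc_def
proof (intro tendsto_divide tendsto_const)
  show "(\<lambda>n. \<integral>x. (if x < s n then 1 else 0) * ((Sd th x)\<^sup>2 * \<phi> th x) \<partial>lborel) \<longlonglongrightarrow> (\<integral>x. g x * ((Sd th x)\<^sup>2 * \<phi> th x) \<partial>lborel)"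
  proof (rule integral_dominated_convergence[OF _ _ Sd_sq_\<phi>_integrable[OF th]])
    show "AE x in lborel. (\<lambda>n. (if x < s n then 1 else 0) * ((Sd th x)\<^sup>2 * \<phi> th x)) \<longlonglongrightarrow> g x * ((Sd th x)\<^sup>2 * \<phi> th x)"
      using assms(1) by eventually_elim (intro tendsto_intros)
    show "AE x in lborel. norm ((if x < s n then 1 else 0) * ((Sd th x)\<^sup>2 * \<phi> th x)) \<le> (Sd th x)\<^sup>2 * \<phi> th x" for n
      using \<phi>_nonneg[OF th] by auto
  qed measurable
qed (use J_pos[OF th] in simp)

lemma Fc_continuous: "isCont Fc y"
  unfolding continuous_at_sequentially
proof (intro allI impI)
  fix s :: "nat \<Rightarrow> real" assume s: "s \<longlonglongrightarrow> y"
  have "(\<lambda>n. Fc (s n)) \<longlonglongrightarrow> (\<integral>x. (if x < y then 1 else 0) * ((Sd th x)\<^sup>2 * \<phi> th x) \<partial>lborel) / J th"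
  proof (rule Fc_tendsto)
    show "AE x in lborel. (\<lambda>n. if x < s n then 1 else 0 :: real) \<longlonglongrightarrow> (if x < y then 1 else 0)"
      using AE_lborel_singleton[of y]
    proof eventually_elim
      case (elim x)
      show ?case
      proof (cases "x < y")
        case True
        then have "\<forall>\<^sub>F n in sequentially. x < s n" using s by (intro order_tendstoD)
        then show ?thesis using True by (auto intro!: tendsto_eventually elim!: eventually_mono)
      next
        case False
        then have "\<forall>\<^sub>F n in sequentially. s n < x" using s elim by (intro order_tendstoD) auto
        then show ?thesis using False by (auto intro!: tendsto_eventually elim!: eventually_mono)
      qed
    qed
  qed measurable
  then show "(Fc \<circ> s) \<longlonglongrightarrow> Fc y" by (simp add: comp_def Fc_def[of y])
qed

lemma Fc_measurable [measurable]: "Fc \<in> borel_measurable borel"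
  using Fc_continuous by (intro borel_measurable_continuous_onI) (simp add: continuous_at_imp_continuous_on)

lemma Fc_limits: "(\<lambda>n. Fc (real n)) \<longlonglongrightarrow> 1" "(\<lambda>n. Fc (- real n)) \<longlonglongrightarrow> 0"
proof -
  have "(\<lambda>n. Fc (real n)) \<longlonglongrightarrow> (\<integral>x. 1 * ((Sd th x)\<^sup>2 * \<phi> th x) \<partial>lborel) / J th"
  proof (rule Fc_tendsto)
    have "\<forall>\<^sub>F n in sequentially. x < real n" for x
      using eventually_gt_at_top[of "nat \<lceil>x\<rceil>"] by eventually_elim linarith
    then show "AE x in lborel. (\<lambda>n. if x < real n then 1 else 0 :: real) \<longlonglongrightarrow> 1"
      by (intro AE_I2 tendsto_eventually) (auto elim!: eventually_mono)
  qed simp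
  then show "(\<lambda>n. Fc (real n)) \<longlonglongrightarrow> 1" using J_pos[OF th] by (simp add: J_def)
  have "(\<lambda>n. Fc (- real n)) \<longlonglongrightarrow> (\<integral>x. 0 * ((Sd th x)\<^sup>2 * \<phi> th x) \<partial>lborel) / J th"
  proof (rule Fc_tendsto)
    have "\<forall>\<^sub>F n in sequentially. (if x < - real n then 1 else 0 :: real) = 0" for x
      using eventually_gt_at_top[of "nat \<lceil>- x\<rceil>"] by eventually_elim (simp add: not_less, linarith)
    then show "AE x in lborel. (\<lambda>n. if x < - real n then 1 else 0 :: real) \<longlonglongrightarrow> 0"
      by (intro AE_I2 tendsto_eventually)
  qed simp
  then show "(\<lambda>n. Fc (- real n)) \<longlonglongrightarrow> 0" by simp
qed

text \<open>\<open>z\<close> is the smallest point with \<open>Fc z = t\<close>; thus the sublevel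
  set is a half-line even where \<open>Fc\<close> is flat.\<close>

lemma quantile:
  assumes "0 < t" "t < 1"
  obtains z where "Fc z = t" "\<And>y. Fc y < t \<longleftrightarrow> y < z"
proof -
  have "\<forall>\<^sub>F n in sequentially. Fc (- real n) < t" "\<forall>\<^sub>F n in sequentially. t < Fc (real n)"
    using order_tendstoD(2)[OF Fc_limits(2) assms(1)] order_tendstoD(1)[OF Fc_limits(1) assms(2)] by auto
  then have "\<forall>\<^sub>F n in sequentially. Fc (- real n) < t \<and> t < Fc (real n)" by (rule eventually_conj)
  then obtain n :: nat where n: "Fc (- real n) < t" "t < Fc (real n)"
    by (auto simp: eventually_sequentially)
  obtain z' where z': "Fc z' = t"
    using IVT[of Fc "- real n" t "real n"] n Fc_continuous by auto
  define D where "D = {y. t \<le> Fc y}"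
  have "closed D"
    unfolding D_def using Fc_continuous by (intro closed_Collect_le continuous_intros) (simp add: continuous_at_imp_continuous_on)
  have bdd: "bdd_below D"
  proof (rule bdd_belowI)
    fix y assume "y \<in> D"
    then have "t \<le> Fc y" by (simp add: D_def)
    show "- real n \<le> y"
    proof (rule ccontr)
      assume "\<not> - real n \<le> y"
      then have "Fc y \<le> Fc (- real n)" by (intro Fc_mono) simp
      then show False using n \<open>t \<le> Fc y\<close> by simp
    qed
  qed
  have "z' \<in> D" by (simp add: D_def z')
  then have "Inf D \<in> D" by (intro closed_contains_Inf bdd \<open>closed D\<close>) auto
  have "Inf D \<le> z'" by (rule cInf_lower) fact+
  then have "Fc (Inf D) \<le> t" using Fc_mono z' by fastforce
  with \<open>Inf D \<in> D\<close> have 1: "Fc (Inf D) = t" by (simp add: D_def)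
  have 2: "Fc y < t \<longleftrightarrow> y < Inf D" for y
  proof
    show "y < Inf D" if "Fc y < t"
      using that 1 Fc_mono[of "Inf D" y] by linarith
    show "Fc y < t" if "y < Inf D"
      using that cInf_lower[OF _ bdd, of y] by (force simp: D_def)
  qed
  from 1 2 show thesis by (rule that)
qed

text \<open>The time change carries the normalized weight to the uniform law on
  \<open>{0..1}\<close>.\<close>

lemma Fc_level_mass:
  assumes t: "0 \<le> t" "t \<le> 1"
  shows "(\<integral>x. (if Fc x < t then 1 else 0) * ((Sd th x)\<^sup>2 * \<phi> th x) \<partial>lborel) = J th * t"
proof -
  have int: "integrable lborel (\<lambda>x. (if Fc x < t then 1 else 0) * ((Sd th x)\<^sup>2 * \<phi> th x))" for t
    by (rule Bochner_Integration.integrable_bound[OF Sd_sq_\<phi>_integrable[OF th]]) auto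
  have inner: "(\<integral>x. (if Fc x < t then 1 else 0) * ((Sd th x)\<^sup>2 * \<phi> th x) \<partial>lborel) = J th * t" if t01: "0 < t" "t < 1" for t
  proof -
    obtain z where z: "Fc z = t" "\<And>y. Fc y < t \<longleftrightarrow> y < z" using quantile[OF t01] by blast
    show ?thesis unfolding z(2) Fc_integral z(1) ..
  qed
  consider "t = 0" | "0 < t" "t < 1" | "t = 1" using t by linarith
  then show ?thesis
  proof cases
    case 1
    have "\<not> Fc x < 0" for x using Fc_nonneg[of x] by simp
    then show ?thesis using 1 by simp
  next
    case 3
    let ?I = "\<integral>x. (if Fc x < 1 then 1 else 0) * ((Sd th x)\<^sup>2 * \<phi> th x) \<partial>lborel"
    have "?I \<le> J th"
      unfolding J_def using \<phi>_nonneg[OF th] by (intro integral_mono int Sd_sq_\<phi>_integrable th) auto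
    moreover have "J th \<le> ?I"
    proof (rule field_le_mult_one_interval)
      fix s :: real assume s01: "0 < s" "s < 1"
      have "J th * s \<le> ?I"
        unfolding inner[OF s01, symmetric] using \<phi>_nonneg[OF th] s01 by (intro integral_mono int) auto
      then show "s * J th \<le> ?I" by (simp add: mult.commute)
    qed
    ultimately show ?thesis using 3 by simp
  qed (rule inner)
qed

text \<open>The normalized score sum with predictable weight \<open>h\<close>. Every martingale of
  the argument has this form, which reduces variances and limit laws to integrals of
  weights.\<close>

definition sc :: "nat \<Rightarrow> (real \<Rightarrow> real) \<Rightarrow> 'w \<Rightarrow> real" where
  "sc n h \<omega> = (\<Sum>j<n. l1 (e (Suc j) \<omega>) * h (X j \<omega>)) / sqrt (real n)"

lemma sc_measurable:
  assumes [measurable]: "h \<in> borel_measurable borel"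
  shows "sc n h \<in> borel_measurable M"
  unfolding sc_def[abs_def] by measurable

lemma sc_bound:
  assumes h: "\<And>x. \<bar>h x\<bar> \<le> C"
  shows "\<bar>sc n h \<omega>\<bar> \<le> real n * (L * C)"
proof (cases "n = 0")
  case False
  have "\<bar>\<Sum>j<n. l1 (e (Suc j) \<omega>) * h (X j \<omega>)\<bar> \<le> (\<Sum>j<n. L * C)"
    by (intro order_trans[OF sum_abs] sum_mono) (auto simp: abs_mult intro!: mult_mono l1_bound h L_nonneg)
  moreover have "1 \<le> sqrt (real n)" using False by simp
  ultimately show ?thesis
    unfolding sc_def abs_divide
    by (intro order_trans[OF divide_left_mono[of 1 "\<bar>sqrt (real n)\<bar>"]]) auto
qed (simp add: sc_def)

text \<open>Equality holds for positive \<open>n\<close>; the inequality also covers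
  \<open>n = 0\<close>, where \<open>sc\<close> is zero by the convention for division.\<close>

lemma sc_second_moment:
  assumes [measurable]: "h \<in> borel_measurable borel" and h: "\<And>x. \<bar>h x\<bar> \<le> C"
  shows "integrable M (\<lambda>\<omega>. (sc n h \<omega>)\<^sup>2)" "(\<integral>\<omega>. (sc n h \<omega>)\<^sup>2 \<partial>M) \<le> I0 * (\<integral>x. (h x)\<^sup>2 * \<phi> th x \<partial>lborel)"
proof -
  show "integrable M (\<lambda>\<omega>. (sc n h \<omega>)\<^sup>2)"
    using power_mono[OF sc_bound[OF h], where n=2] sc_measurable[of h]
    by (intro P.integrable_const_bound[of _ "(real n * (L * C))\<^sup>2"]) auto
  have "(\<integral>\<omega>. (sc n h \<omega>)\<^sup>2 \<partial>M) = (real n * (I0 * (\<integral>x. (h x)\<^sup>2 * \<phi> th x \<partial>lborel))) / real n"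
    unfolding sc_def power_divide I0_def
    using P.expectation_score_sum_square[of h l1 C L n] h l1_bound integral_l1_f by simp
  moreover have "0 \<le> I0 * (\<integral>x. (h x)\<^sup>2 * \<phi> th x \<partial>lborel)"
    using I0_pos \<phi>_nonneg[OF th] by (intro mult_nonneg_nonneg integral_nonneg_AE) auto
  ultimately show "(\<integral>\<omega>. (sc n h \<omega>)\<^sup>2 \<partial>M) \<le> I0 * (\<integral>x. (h x)\<^sup>2 * \<phi> th x \<partial>lborel)" by (cases "n = 0") auto
qed

text \<open>Subtracting \<open>Fc y\<close> makes the weight orthogonal to \<open>Sd th\<close>
  under \<open>\<phi> th\<close>: this is the trace left by estimating the parameter.\<close>

definition \<psi> :: "real \<Rightarrow> real \<Rightarrow> real" where
  "\<psi> y x = - (Sd th x * ((if x < y then 1 else 0) - Fc y)) / sqrt (info th)"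

lemma \<psi>_measurable [measurable]: "\<psi> y \<in> borel_measurable borel"
  unfolding \<psi>_def[abs_def] by measurable

lemma \<psi>_bound: "\<bar>\<psi> y x\<bar> \<le> K / sqrt (info th)"
proof -
  have "\<bar>(if x < y then 1 else 0) - Fc y\<bar> \<le> 1" using Fc_nonneg[of y] Fc_le_1[of y] by auto
  then have "\<bar>Sd th x * ((if x < y then 1 else 0) - Fc y)\<bar> \<le> K * 1"
    unfolding abs_mult by (intro mult_mono Sd_bound[OF th] K_nonneg) auto
  then show ?thesis using info_pos[OF th] by (simp add: \<psi>_def abs_divide divide_right_mono)
qed

lemma \<psi>_product_integrable: "integrable lborel (\<lambda>x. \<psi> y x * \<psi> z x * \<phi> th x)"
proof (rule P.integrable_bounded_times(2))
  show "\<bar>\<psi> y x * \<psi> z x\<bar> \<le> (K / sqrt (info th)) * (K / sqrt (info th))" for x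
    unfolding abs_mult by (intro mult_mono \<psi>_bound order_trans[OF abs_ge_zero \<psi>_bound] abs_ge_zero)
qed measurable

text \<open>The indicators of \<open>x < y\<close> and \<open>x < z\<close> multiply to that of
  \<open>x < min y z\<close>, and \<open>info th = I0 * J th\<close> provides the
  normalization.\<close>

lemma \<psi>_cov: "I0 * (\<integral>x. \<psi> y x * \<psi> z x * \<phi> th x \<partial>lborel) = Fc (min y z) - Fc y * Fc z"
proof -
  let ?w = "\<lambda>x. (Sd th x)\<^sup>2 * \<phi> th x"
  let ?i = "\<lambda>y x. (if x < y then 1 else 0 :: real)"
  have sq: "sqrt (info th) * sqrt (info th) = info th" using info_pos[OF th] by simp
  have "\<psi> y x * \<psi> z x * \<phi> th x =
     (?i (min y z) x * ?w x - Fc z * (?i y x * ?w x) - Fc y * (?i z x * ?w x) + Fc y * Fc z * ?w x) / info th" for x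
  proof -
    have "\<psi> y x * \<psi> z x * \<phi> th x = (Sd th x * (?i y x - Fc y)) * (Sd th x * (?i z x - Fc z)) * \<phi> th x / info th"
      by (simp add: \<psi>_def sq abs_of_pos[OF info_pos[OF th]])
    also have "(Sd th x * (?i y x - Fc y)) * (Sd th x * (?i z x - Fc z)) * \<phi> th x =
       ?i (min y z) x * ?w x - Fc z * (?i y x * ?w x) - Fc y * (?i z x * ?w x) + Fc y * Fc z * ?w x"
      by (auto simp: power2_eq_square algebra_simps)
    finally show ?thesis .
  qed
  then have "(\<integral>x. \<psi> y x * \<psi> z x * \<phi> th x \<partial>lborel) =
     (J th * Fc (min y z) - Fc z * (J th * Fc y) - Fc y * (J th * Fc z) + Fc y * Fc z * J th) / info th"
    using indicator_integrable Sd_sq_\<phi>_integrable[OF th] by (simp del: min_less_iff_conj add: Fc_integral flip: J_def)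
  also have "\<dots> = J th * (Fc (min y z) - Fc y * Fc z) / info th"
    by (simp add: algebra_simps)
  finally show ?thesis using I0_pos J_pos[OF th] by (simp add: info_def)
qed

text \<open>
  \<open>Fc\<close> is the time change that turns the limit into a Brownian bridge, and \<open>Ut\<close> is what \<open>U_hat\<close>
  becomes when the estimator is replaced by its linear representation.
\<close>
definition Ut :: "nat \<Rightarrow> real \<Rightarrow> 'w \<Rightarrow> real" where
  "Ut n y = sc n (\<psi> y)"

lemma sc_linear: "sc n (\<lambda>x. c * g x + d * h x) \<omega> = c * sc n g \<omega> + d * sc n h \<omega>"
  by (simp add: sc_def algebra_simps sum.distrib sum_distrib_left add_divide_distrib sum_divide_distrib)

lemma Ut_pair_measurable [measurable]: "(\<lambda>x. Ut n (snd x) (fst x)) \<in> borel_measurable (M \<Otimes>\<^sub>M borel)"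
  unfolding Ut_def sc_def \<psi>_def by measurable

lemma Ut_measurable [measurable]: "Ut n y \<in> borel_measurable M"
  unfolding Ut_def by (rule sc_measurable) simp

lemma Ut_measurable_y [measurable]: "(\<lambda>y. Ut n y \<omega>) \<in> borel_measurable borel"
  unfolding Ut_def sc_def \<psi>_def by measurable

lemma Ut_bound: "\<bar>Ut n y \<omega>\<bar> \<le> real n * (L * (K / sqrt (info th)))"
  unfolding Ut_def by (rule sc_bound) (rule \<psi>_bound)

lemma Ut_square_mean: "integrable M (\<lambda>\<omega>. (Ut n y \<omega>)\<^sup>2)" "(\<integral>\<omega>. (Ut n y \<omega>)\<^sup>2 \<partial>M) \<le> Fc y - (Fc y)\<^sup>2"
  using sc_second_moment[of "\<psi> y" _ n, OF _ \<psi>_bound] \<psi>_cov[of y y] by (simp_all add: Ut_def power2_eq_square)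

lemma Ut_comb_mean:
  "integrable M (\<lambda>\<omega>. (c * Ut n y \<omega> + d * Ut n z \<omega>)\<^sup>2)"
  "(\<integral>\<omega>. (c * Ut n y \<omega> + d * Ut n z \<omega>)\<^sup>2 \<partial>M) \<le>
     c\<^sup>2 * (Fc y - (Fc y)\<^sup>2) + 2 * c * d * (Fc (min y z) - Fc y * Fc z) + d\<^sup>2 * (Fc z - (Fc z)\<^sup>2)"
proof -
  define h where "h x = c * \<psi> y x + d * \<psi> z x" for x
  have [measurable]: "h \<in> borel_measurable borel" unfolding h_def[abs_def] by measurable
  have hb: "\<bar>h x\<bar> \<le> \<bar>c\<bar> * (K / sqrt (info th)) + \<bar>d\<bar> * (K / sqrt (info th))" for x
    unfolding h_def by (intro order_trans[OF abs_triangle_ineq] add_mono)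
      (simp_all only: abs_mult, (intro mult_left_mono \<psi>_bound abs_ge_zero)+)
  have eq: "c * Ut n y \<omega> + d * Ut n z \<omega> = sc n h \<omega>" for \<omega>
    by (simp add: Ut_def h_def[abs_def] sc_linear)
  have "(\<integral>x. (h x)\<^sup>2 * \<phi> th x \<partial>lborel) = (\<integral>x. c\<^sup>2 * (\<psi> y x * \<psi> y x * \<phi> th x) + 2 * c * d * (\<psi> y x * \<psi> z x * \<phi> th x) + d\<^sup>2 * (\<psi> z x * \<psi> z x * \<phi> th x) \<partial>lborel)"
    by (intro Bochner_Integration.integral_cong refl) (simp add: h_def power2_eq_square algebra_simps)
  also have "\<dots> = c\<^sup>2 * (\<integral>x. \<psi> y x * \<psi> y x * \<phi> th x \<partial>lborel) + 2 * c * d * (\<integral>x. \<psi> y x * \<psi> z x * \<phi> th x \<partial>lborel) + d\<^sup>2 * (\<integral>x. \<psi> z x * \<psi> z x * \<phi> th x \<partial>lborel)"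
    using \<psi>_product_integrable by simp
  finally have "I0 * (\<integral>x. (h x)\<^sup>2 * \<phi> th x \<partial>lborel) =
     c\<^sup>2 * (I0 * (\<integral>x. \<psi> y x * \<psi> y x * \<phi> th x \<partial>lborel)) + 2 * c * d * (I0 * (\<integral>x. \<psi> y x * \<psi> z x * \<phi> th x \<partial>lborel)) + d\<^sup>2 * (I0 * (\<integral>x. \<psi> z x * \<psi> z x * \<phi> th x \<partial>lborel))"
    by (simp add: algebra_simps)
  then have "I0 * (\<integral>x. (h x)\<^sup>2 * \<phi> th x \<partial>lborel) =
     c\<^sup>2 * (Fc y - (Fc y)\<^sup>2) + 2 * c * d * (Fc (min y z) - Fc y * Fc z) + d\<^sup>2 * (Fc z - (Fc z)\<^sup>2)"
    unfolding \<psi>_cov by (simp add: power2_eq_square)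
  with sc_second_moment[of h _ n, OF _ hb]
  show "integrable M (\<lambda>\<omega>. (c * Ut n y \<omega> + d * Ut n z \<omega>)\<^sup>2)"
    "(\<integral>\<omega>. (c * Ut n y \<omega> + d * Ut n z \<omega>)\<^sup>2 \<partial>M) \<le>
     c\<^sup>2 * (Fc y - (Fc y)\<^sup>2) + 2 * c * d * (Fc (min y z) - Fc y * Fc z) + d\<^sup>2 * (Fc z - (Fc z)\<^sup>2)"
    unfolding eq by auto
qed

text \<open>The difference of squares factors into increment times sum. The increment has second
  moment at most \<open>1 / N\<close>, the sum at most 4, and the arithmetic-geometric inequality is
  balanced by \<open>s = sqrt N\<close>.\<close>

lemma Ut_square_diff_mean:
  assumes N: "0 < N" and close: "\<bar>Fc y - Fc z\<bar> \<le> 1 / real N"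
  shows "(\<integral>\<omega>. \<bar>(Ut n y \<omega>)\<^sup>2 - (Ut n z \<omega>)\<^sup>2\<bar> \<partial>M) \<le> 3 / sqrt (real N)"
proof -
  define s where "s = sqrt (real N)"
  have s: "0 < s" "1 / real N = 1 / s / s" using N by (auto simp: s_def)
  note i1 = Ut_comb_mean[where c=1 and d="-1" and n=n and y=y and z=z] and i2 = Ut_comb_mean[where c=1 and d=1 and n=n and y=y and z=z]
  have m1: "(\<integral>\<omega>. (Ut n y \<omega> - Ut n z \<omega>)\<^sup>2 \<partial>M) \<le> 1 / s / s"
  proof -
    have "(\<integral>\<omega>. (Ut n y \<omega> - Ut n z \<omega>)\<^sup>2 \<partial>M) \<le> Fc y + Fc z - 2 * Fc (min y z) - (Fc y - Fc z)\<^sup>2"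
      using i1(2) by (simp add: power2_eq_square algebra_simps)
    also have "\<dots> \<le> \<bar>Fc y - Fc z\<bar>"
      using Fc_mono[of y z] Fc_mono[of z y] zero_le_power2[of "Fc y - Fc z"] by (simp add: min_def del: zero_le_power2)
    finally show ?thesis using close s by simp
  qed
  have m2: "(\<integral>\<omega>. (Ut n y \<omega> + Ut n z \<omega>)\<^sup>2 \<partial>M) \<le> 4"
  proof -
    have "(\<integral>\<omega>. (Ut n y \<omega> + Ut n z \<omega>)\<^sup>2 \<partial>M) \<le> Fc y + Fc z + 2 * Fc (min y z) - (Fc y + Fc z)\<^sup>2"
      using i2(2) by (simp add: power2_eq_square algebra_simps)
    also have "\<dots> \<le> 4"
      using Fc_le_1[of y] Fc_le_1[of z] Fc_le_1[of "min y z"] zero_le_power2[of "Fc y + Fc z"] by linarith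
    finally show ?thesis .
  qed
  have pt: "\<bar>(Ut n y \<omega>)\<^sup>2 - (Ut n z \<omega>)\<^sup>2\<bar> \<le> s / 2 * (Ut n y \<omega> - Ut n z \<omega>)\<^sup>2 + 1 / (2 * s) * (Ut n y \<omega> + Ut n z \<omega>)\<^sup>2" for \<omega>
  proof -
    define u v where "u = \<bar>Ut n y \<omega> - Ut n z \<omega>\<bar>" and "v = \<bar>Ut n y \<omega> + Ut n z \<omega>\<bar>"
    have "\<bar>(Ut n y \<omega>)\<^sup>2 - (Ut n z \<omega>)\<^sup>2\<bar> = u * v"
      by (simp add: u_def v_def power2_eq_square square_diff_square_factored abs_mult mult.commute)
    also have "2 * s * (u * v) \<le> (s * u)\<^sup>2 + v\<^sup>2"
      using sum_squares_bound[of "s * u" v] by (simp add: mult_ac)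
    then have "u * v \<le> s / 2 * u\<^sup>2 + 1 / (2 * s) * v\<^sup>2"
      using s(1) by (simp add: field_simps power2_eq_square)
    finally show ?thesis by (simp add: u_def v_def)
  qed
  have "(\<integral>\<omega>. \<bar>(Ut n y \<omega>)\<^sup>2 - (Ut n z \<omega>)\<^sup>2\<bar> \<partial>M) \<le> (\<integral>\<omega>. s / 2 * (Ut n y \<omega> - Ut n z \<omega>)\<^sup>2 + 1 / (2 * s) * (Ut n y \<omega> + Ut n z \<omega>)\<^sup>2 \<partial>M)"
    using i1(1) i2(1) Ut_square_mean(1) by (intro integral_mono pt) auto
  also have "\<dots> = s / 2 * (\<integral>\<omega>. (Ut n y \<omega> - Ut n z \<omega>)\<^sup>2 \<partial>M) + 1 / (2 * s) * (\<integral>\<omega>. (Ut n y \<omega> + Ut n z \<omega>)\<^sup>2 \<partial>M)"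
    using i1(1) i2(1) by simp
  also have "\<dots> \<le> s / 2 * (1 / s / s) + 1 / (2 * s) * 4"
    using s(1) m1 m2 by (intro add_mono mult_left_mono) auto
  also have "\<dots> \<le> 3 / s" using s(1) by (simp add: field_simps)
  finally show ?thesis by (simp add: s_def)
qed

text \<open>A linear combination of values of \<open>Ut\<close> is again a score sum, with weight
  \<open>h\<close>, so the scalar limit theorem covers all finite-dimensional distributions.\<close>

lemma Ut_char_limit:
  "(\<lambda>n. \<integral>\<omega>. iexp (\<Sum>i<N. g i * Ut n (z i) \<omega>) \<partial>M) \<longlonglongrightarrow>
     complex_of_real (exp (- (\<Sum>i<N. \<Sum>j<N. g i * g j * (Fc (min (z i) (z j)) - Fc (z i) * Fc (z j))) / 2))"
proof -
  define h where "h x = (\<Sum>i<N. g i * \<psi> (z i) x)" for x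
  have [measurable]: "h \<in> borel_measurable borel" unfolding h_def[abs_def] by measurable
  have hb: "\<bar>h x\<bar> \<le> (\<Sum>i<N. \<bar>g i\<bar> * (K / sqrt (info th)))" for x
    unfolding h_def by (intro order_trans[OF sum_abs] sum_mono)
      (simp only: abs_mult, intro mult_left_mono \<psi>_bound abs_ge_zero)
  have eq: "(\<Sum>i<N. g i * Ut n (z i) \<omega>) = (\<Sum>j<n. l1 (e (Suc j) \<omega>) * h (X j \<omega>)) / sqrt (real n)" for n \<omega>
  proof -
    have "(\<Sum>i<N. g i * Ut n (z i) \<omega>) = (\<Sum>i<N. \<Sum>j<n. l1 (e (Suc j) \<omega>) * (g i * \<psi> (z i) (X j \<omega>))) / sqrt (real n)"
      by (simp add: Ut_def sc_def sum_distrib_left sum_divide_distrib mult_ac)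
    also have "\<dots> = (\<Sum>j<n. \<Sum>i<N. l1 (e (Suc j) \<omega>) * (g i * \<psi> (z i) (X j \<omega>))) / sqrt (real n)"
      by (subst sum.swap) (rule refl)
    finally show ?thesis by (simp add: h_def sum_distrib_left)
  qed
  have "(\<integral>x. (h x)\<^sup>2 * \<phi> th x \<partial>lborel) = (\<integral>x. (\<Sum>i<N. \<Sum>j<N. g i * g j * (\<psi> (z i) x * \<psi> (z j) x * \<phi> th x)) \<partial>lborel)"
    unfolding h_def power2_eq_square unfolding sum_product unfolding sum_distrib_right
    by (intro Bochner_Integration.integral_cong sum.cong refl) (simp only: mult_ac)
  also have "\<dots> = (\<Sum>i<N. \<Sum>j<N. g i * g j * (\<integral>x. \<psi> (z i) x * \<psi> (z j) x * \<phi> th x \<partial>lborel))"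
    using \<psi>_product_integrable by (simp add: Bochner_Integration.integral_sum Bochner_Integration.integrable_sum)
  finally have "(\<integral>x. (l1 x)\<^sup>2 * f x \<partial>lborel) * (\<integral>x. (h x)\<^sup>2 * \<phi> th x \<partial>lborel) =
      (\<Sum>i<N. \<Sum>j<N. g i * g j * (I0 * (\<integral>x. \<psi> (z i) x * \<psi> (z j) x * \<phi> th x \<partial>lborel)))"
    by (simp add: sum_distrib_left I0_def mult_ac)
  then have V: "(\<integral>x. (l1 x)\<^sup>2 * f x \<partial>lborel) * (\<integral>x. (h x)\<^sup>2 * \<phi> th x \<partial>lborel) =
      (\<Sum>i<N. \<Sum>j<N. g i * g j * (Fc (min (z i) (z j)) - Fc (z i) * Fc (z j)))"
    unfolding \<psi>_cov .
  show ?thesis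
    using P.score_clt[of h l1, OF _ _ hb l1_bound integral_l1_f] unfolding eq V by simp
qed

end

text \<open>The bound \<open>c\<close> serves integrability only and may grow with the sample size,
  as it does for \<open>Ut\<close>.\<close>

lemma (in prob_space) weighted_fubini:
  fixes g :: "'a \<Rightarrow> real \<Rightarrow> real"
  assumes g [measurable]: "(\<lambda>x. g (fst x) (snd x)) \<in> borel_measurable (M \<Otimes>\<^sub>M borel)" and c: "\<And>\<omega> y. \<bar>g \<omega> y\<bar> \<le> c"
    and u: "integrable lborel u" "\<And>y. 0 \<le> u y"
  shows "integrable M (\<lambda>\<omega>. \<integral>y. g \<omega> y * u y \<partial>lborel)"
    and "(\<integral>\<omega>. (\<integral>y. g \<omega> y * u y \<partial>lborel) \<partial>M) = (\<integral>y. (\<integral>\<omega>. g \<omega> y \<partial>M) * u y \<partial>lborel)"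
    and "\<omega> \<in> space M \<Longrightarrow> integrable lborel (\<lambda>y. g \<omega> y * u y)"
    and "integrable lborel (\<lambda>y. (\<integral>\<omega>. g \<omega> y \<partial>M) * u y)"
proof -
  interpret pair: pair_sigma_finite M lborel by unfold_locales
  have [measurable]: "u \<in> borel_measurable borel" using u by auto
  have gy [measurable]: "g \<omega> \<in> borel_measurable borel" if "\<omega> \<in> space M" for \<omega>
    using measurable_compose[OF measurable_Pair1'[OF that] g] by simp
  have int: "integrable lborel (\<lambda>y. g \<omega> y * u y)" if \<omega>: "\<omega> \<in> space M" for \<omega>
  proof (rule Bochner_Integration.integrable_bound)
    show "integrable lborel (\<lambda>y. c * u y)" using u by simp
    have [measurable]: "g \<omega> \<in> borel_measurable borel" by (rule gy) fact
    show "(\<lambda>y. g \<omega> y * u y) \<in> borel_measurable lborel" by measurable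
    show "AE y in lborel. norm (g \<omega> y * u y) \<le> norm (c * u y)"
      using c u(2) by (auto simp: abs_mult intro!: mult_right_mono order_trans[OF c abs_ge_self])
  qed
  then show "\<omega> \<in> space M \<Longrightarrow> integrable lborel (\<lambda>y. g \<omega> y * u y)" .
  have prod: "integrable (M \<Otimes>\<^sub>M lborel) (\<lambda>(\<omega>, y). g \<omega> y * u y)"
  proof (rule pair.Fubini_integrable)
    show [measurable]: "(\<lambda>(\<omega>, y). g \<omega> y * u y) \<in> borel_measurable (M \<Otimes>\<^sub>M lborel)"
      by (simp add: case_prod_beta')
    show "AE \<omega> in M. integrable lborel (\<lambda>y. case (\<omega>, y) of (\<omega>, y) \<Rightarrow> g \<omega> y * u y)"
      using int by (intro AE_I2) simp
    show "integrable M (\<lambda>\<omega>. \<integral>y. norm (case (\<omega>, y) of (\<omega>, y) \<Rightarrow> g \<omega> y * u y) \<partial>lborel)"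
    proof (rule integrable_const_bound)
      show "AE \<omega> in M. norm (\<integral>y. norm (case (\<omega>, y) of (\<omega>, y) \<Rightarrow> g \<omega> y * u y) \<partial>lborel) \<le> (\<integral>y. c * u y \<partial>lborel)"
      proof (intro AE_I2)
        fix \<omega> assume \<omega>: "\<omega> \<in> space M"
        have "(\<integral>y. \<bar>g \<omega> y * u y\<bar> \<partial>lborel) \<le> (\<integral>y. c * u y \<partial>lborel)"
          using int[OF \<omega>] u c
          by (intro integral_mono integrable_abs integrable_mult_right) (auto simp: abs_mult intro!: mult_right_mono)
        then show "norm (\<integral>y. norm (case (\<omega>, y) of (\<omega>, y) \<Rightarrow> g \<omega> y * u y) \<partial>lborel) \<le> (\<integral>y. c * u y \<partial>lborel)"
          by simp
      qed
      have "(\<lambda>x. norm (g (fst x) (snd x) * u (snd x))) \<in> borel_measurable (M \<Otimes>\<^sub>M lborel)" by measurable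
      then show "(\<lambda>\<omega>. \<integral>y. norm (case (\<omega>, y) of (\<omega>, y) \<Rightarrow> g \<omega> y * u y) \<partial>lborel) \<in> borel_measurable M"
        by (intro lborel.borel_measurable_lebesgue_integral) (simp add: case_prod_beta')
    qed
  qed
  show "integrable M (\<lambda>\<omega>. \<integral>y. g \<omega> y * u y \<partial>lborel)"
    using pair.integrable_fst[OF prod] by simp
  show "integrable lborel (\<lambda>y. (\<integral>\<omega>. g \<omega> y \<partial>M) * u y)"
    using pair.integrable_snd[OF prod] by simp
  show "(\<integral>\<omega>. (\<integral>y. g \<omega> y * u y \<partial>lborel) \<partial>M) = (\<integral>y. (\<integral>\<omega>. g \<omega> y \<partial>M) * u y \<partial>lborel)"
    using pair.Fubini_integral[OF prod] by simp
qed

lemma exp_neg_lipschitz: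
  fixes u v k :: real
  assumes "0 \<le> k" "0 \<le> u" "0 \<le> v"
  shows "\<bar>exp (- (k * u)) - exp (- (k * v))\<bar> \<le> k * \<bar>u - v\<bar>"
proof -
  have "norm (exp (- (k * u)) - exp (- (k * v))) \<le> k * norm (u - v)"
  proof (rule field_differentiable_bound[of "{0..}" "\<lambda>x. exp (- (k * x))" "\<lambda>x. - k * exp (- (k * x))"])
    show "((\<lambda>x. exp (- (k * x))) has_real_derivative - k * exp (- (k * z))) (at z within {0..})" for z
      by (auto intro!: derivative_eq_intros)
    show "norm (- k * exp (- (k * z))) \<le> k" if "z \<in> {0..}" for z
      using that assms(1) by (simp add: abs_mult mult_left_le)
  qed (use assms in auto)
  then show ?thesis by simp
qed

section \<open>The squared norm of the limiting process and its Laplace transform\<close>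

context model
begin

definition w :: "real \<Rightarrow> real \<Rightarrow> real" where
  "w t y = (Sd t y)\<^sup>2 * \<phi> t y / J t"

lemma w_nonneg: "t \<in> {a<..<b} \<Longrightarrow> 0 \<le> w t y"
  and w_integrable: "t \<in> {a<..<b} \<Longrightarrow> integrable lborel (w t)"
  and w_integral: "t \<in> {a<..<b} \<Longrightarrow> (\<integral>y. w t y \<partial>lborel) = 1"
  using J_pos[of t] \<phi>_nonneg[of t] Sd_sq_\<phi>_integrable[of t] by (simp_all add: w_def[abs_def] flip: J_def)

text \<open>The statistic with \<open>Ut\<close> in place of \<open>U_hat\<close> and with the
  weight taken at the true parameter.\<close>

definition Q :: "nat \<Rightarrow> 'w \<Rightarrow> real" where
  "Q n \<omega> = (\<integral>y. (Ut n y \<omega>)\<^sup>2 * w th y \<partial>lborel)"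

lemma Ut_sq_bound: "\<bar>(Ut n y \<omega>)\<^sup>2\<bar> \<le> (real n * (L * (K / sqrt (info th))))\<^sup>2"
  using power_mono[OF Ut_bound, where n=2] by simp

lemma Ut_sq_pair [measurable]: "(\<lambda>x. (Ut n (snd x) (fst x))\<^sup>2) \<in> borel_measurable (M \<Otimes>\<^sub>M borel)"
  by measurable

lemma Q_integrable: "integrable M (Q n)"
  unfolding Q_def by (rule P.weighted_fubini(1)[OF Ut_sq_pair Ut_sq_bound w_integrable[OF th] w_nonneg[OF th]])

lemma Q_nonneg: "0 \<le> Q n \<omega>"
  unfolding Q_def using w_nonneg[OF th] by (intro integral_nonneg_AE AE_I2) auto

lemma Q_laplace:
  assumes br: "bridge NB B" and k: "0 \<le> k"
  shows "(\<lambda>n. \<integral>\<omega>. exp (- (k * Q n \<omega>)) \<partial>M) \<longlonglongrightarrow> (\<integral>\<omega>. exp (- (k * bridge_functional B \<omega>)) \<partial>NB)"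
proof -
  interpret br: bridge NB B by fact
  have grid: "\<exists>R. (\<forall>n. R n \<in> borel_measurable M \<and> (\<forall>\<omega>. 0 \<le> R n \<omega>) \<and> integrable M (R n) \<and>
       (\<integral>\<omega>. \<bar>Q n \<omega> - R n \<omega>\<bar> \<partial>M) \<le> 3 / sqrt (real N)) \<and>
       (\<lambda>n. \<integral>\<omega>. exp (- (k * R n \<omega>)) \<partial>M) \<longlonglongrightarrow>
         (\<integral>\<omega>. exp (- (\<Sum>i<N. (sqrt (2 * k / real N) * B (real i / real N) \<omega>)\<^sup>2) / 2) \<partial>NB)" if N: "0 < N" for N
  proof -
    have "\<exists>z. Fc z = real i / real N" if "0 < i" "i < N" for i
      using quantile[of "real i / real N"] that N by (metis divide_less_eq_1 divide_pos_pos of_nat_0_less_iff of_nat_less_iff)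
    then obtain z where z: "\<And>i. 0 < i \<Longrightarrow> i < N \<Longrightarrow> Fc (z i) = real i / real N" by metis
    \<comment> \<open>Level zero need not be attained by \<open>Fc\<close>, so the value there is
      set to zero, in accordance with the bridge vanishing at time zero.\<close>
    define V where "V n i \<omega> = (if 0 < i \<and> i < N then Ut n (z i) \<omega> else 0)" for n i \<omega>
    \<comment> \<open>The cell on which \<open>Fc y\<close> lies between \<open>i / N\<close> and
      \<open>(i + 1) / N\<close>. Each has weight \<open>1 / N\<close>, so integrating the step
      process \<open>Vs\<close> yields the grid average \<open>R\<close>; points with
      \<open>Fc y = 1\<close> belong to no cell.\<close>
    define I where "I i y \<longleftrightarrow> real i \<le> real N * Fc y \<and> real N * Fc y < real i + 1" for i y
    define Vs where "Vs n y \<omega> = (\<Sum>i<N. (if I i y then 1 else 0) * (V n i \<omega>)\<^sup>2)" for n y \<omega>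
    define R where "R n \<omega> = (\<Sum>i<N. (V n i \<omega>)\<^sup>2) / real N" for n \<omega>
    have V_meas [measurable]: "V n i \<in> borel_measurable M" for n i unfolding V_def by (cases "0 < i \<and> i < N") auto
    have I_meas [measurable]: "Measurable.pred borel (I i)" for i unfolding I_def[abs_def] by measurable
    have V_bound: "\<bar>(V n i \<omega>)\<^sup>2\<bar> \<le> (real n * (L * (K / sqrt (info th))))\<^sup>2" for n i \<omega>
      using Ut_sq_bound[of n "z i" \<omega>] by (simp add: V_def)
    have R_int: "integrable M (R n)" for n
    proof -
      have "integrable M (\<lambda>\<omega>. (V n i \<omega>)\<^sup>2)" for i
        using V_bound by (intro P.integrable_const_bound[of _ "(real n * (L * (K / sqrt (info th))))\<^sup>2"]) auto
      then show ?thesis unfolding R_def by auto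
    qed
    have I_mass: "(\<integral>y. (if I i y then 1 else 0) * w th y \<partial>lborel) = 1 / real N" if i: "i < N" for i
    proof -
      have le: "real (Suc i) / real N \<le> 1" using i by simp
      have eq: "(if I i y then 1 else 0) * w th y =
         ((if Fc y < real (Suc i) / real N then 1 else 0) * ((Sd th y)\<^sup>2 * \<phi> th y) -
          (if Fc y < real i / real N then 1 else 0) * ((Sd th y)\<^sup>2 * \<phi> th y)) / J th" for y
        using N by (auto simp: I_def w_def field_simps)
      have int: "integrable lborel (\<lambda>y. (if Fc y < t then 1 else 0) * ((Sd th y)\<^sup>2 * \<phi> th y))" for t
        by (rule Bochner_Integration.integrable_bound[OF Sd_sq_\<phi>_integrable[OF th]]) auto
      have "(\<integral>y. (if I i y then 1 else 0) * w th y \<partial>lborel) =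
          (J th * (real (Suc i) / real N) - J th * (real i / real N)) / J th"
        unfolding eq using Fc_level_mass[of "real (Suc i) / real N"] Fc_level_mass[of "real i / real N"] int le i
        by simp
      also have "\<dots> = 1 / real N" using J_pos[OF th] by (simp add: add_divide_distrib field_simps)
      finally show ?thesis .
    qed
    have I_int: "integrable lborel (\<lambda>y. (if I i y then 1 else 0) * w th y)" for i
    proof (rule Bochner_Integration.integrable_bound[OF w_integrable[OF th]])
      have [measurable]: "w th \<in> borel_measurable borel" using w_integrable[OF th] by auto
      show "(\<lambda>y. (if I i y then 1 else 0) * w th y) \<in> borel_measurable lborel" by measurable
    qed auto
    have R_eq: "R n \<omega> = (\<integral>y. Vs n y \<omega> * w th y \<partial>lborel)" for n \<omega>
    proof -
      have "(\<integral>y. Vs n y \<omega> * w th y \<partial>lborel) = (\<integral>y. (\<Sum>i<N. (V n i \<omega>)\<^sup>2 * ((if I i y then 1 else 0) * w th y)) \<partial>lborel)"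
        unfolding Vs_def sum_distrib_right by (intro Bochner_Integration.integral_cong sum.cong refl) (simp only: mult_ac)
      also have "\<dots> = (\<Sum>i<N. (V n i \<omega>)\<^sup>2 * (\<integral>y. (if I i y then 1 else 0) * w th y \<partial>lborel))"
        by (subst Bochner_Integration.integral_sum) (use I_int in \<open>auto intro!: integrable_mult_right\<close>)
      also have "\<dots> = R n \<omega>" by (simp add: I_mass R_def sum_divide_distrib)
      finally show ?thesis ..
    qed
    have D_meas [measurable]: "(\<lambda>x. \<bar>(Ut n (snd x) (fst x))\<^sup>2 - Vs n (snd x) (fst x)\<bar>) \<in> borel_measurable (M \<Otimes>\<^sub>M borel)" for n
      unfolding Vs_def by measurable
    define c where "c n = (1 + real N) * (real n * (L * (K / sqrt (info th))))\<^sup>2" for n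
    have Vs_bound: "0 \<le> Vs n y \<omega>" "Vs n y \<omega> \<le> real N * (real n * (L * (K / sqrt (info th))))\<^sup>2" for n y \<omega>
    proof -
      show "0 \<le> Vs n y \<omega>" unfolding Vs_def by (intro sum_nonneg) auto
      have "Vs n y \<omega> \<le> (\<Sum>i<N. (real n * (L * (K / sqrt (info th))))\<^sup>2)"
        unfolding Vs_def using V_bound[of n _ \<omega>] by (intro sum_mono) auto
      then show "Vs n y \<omega> \<le> real N * (real n * (L * (K / sqrt (info th))))\<^sup>2" by simp
    qed
    have D_bound: "\<bar>\<bar>(Ut n y \<omega>)\<^sup>2 - Vs n y \<omega>\<bar>\<bar> \<le> c n" for n y \<omega>
      using Vs_bound(1)[of n y \<omega>] Vs_bound(2)[of n y \<omega>] Ut_sq_bound[of n y \<omega>] zero_le_power2[of "Ut n y \<omega>"]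
      unfolding c_def distrib_right mult_1 abs_idempotent by linarith
    \<comment> \<open>Where \<open>Fc y = 1\<close>, \<open>Ut\<close> has variance zero; in the
      lowest cell its variance is at most \<open>1 / N\<close>; elsewhere it is compared with its
      value at the quantile.\<close>
    have Vs_cases: "(\<integral>\<omega>. \<bar>(Ut n y \<omega>)\<^sup>2 - Vs n y \<omega>\<bar> \<partial>M) \<le> 3 / sqrt (real N)" for n y
    proof -
      define i where "i = nat \<lfloor>real N * Fc y\<rfloor>"
      have "0 \<le> real N * Fc y" using Fc_nonneg[of y] by simp
      then have i: "real i \<le> real N * Fc y" "real N * Fc y < real i + 1" by (auto simp: i_def)
      have I_iff: "I j y \<longleftrightarrow> j = i" for j using i by (auto simp: I_def)
      have Vs_eq: "Vs n y \<omega> = (if i < N then (V n i \<omega>)\<^sup>2 else 0)" for \<omega>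
        by (simp add: Vs_def I_iff if_distrib[of "\<lambda>x. x * _"] cong: if_cong)
      have sq: "1 / real N \<le> 3 / sqrt (real N)"
      proof -
        have "sqrt (real N) \<le> real N" using N by (intro real_le_lsqrt) (auto simp: power2_eq_square)
        then have "1 / real N \<le> 1 / sqrt (real N)" using N by (intro frac_le) auto
        also have "\<dots> \<le> 3 / sqrt (real N)" by (simp add: divide_right_mono)
        finally show ?thesis .
      qed
      consider "\<not> i < N" | "i = 0" "i < N" | "0 < i" "i < N" by linarith
      then show ?thesis
      proof cases
        case 1
        then have "real N \<le> real N * Fc y" using i by linarith
        then have "Fc y = 1" using N Fc_le_1[of y] by simp
        then have "(\<integral>\<omega>. \<bar>(Ut n y \<omega>)\<^sup>2 - Vs n y \<omega>\<bar> \<partial>M) \<le> 0"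
          using Ut_square_mean(2)[of n y] 1 by (simp add: Vs_eq)
        then show ?thesis by (rule order_trans) simp
      next
        case 2
        then have "Fc y \<le> 1 / real N" using i N by (simp add: field_simps)
        moreover have "(\<integral>\<omega>. \<bar>(Ut n y \<omega>)\<^sup>2 - Vs n y \<omega>\<bar> \<partial>M) \<le> Fc y - (Fc y)\<^sup>2"
          using Ut_square_mean(2)[of n y] 2 by (simp add: Vs_eq V_def)
        ultimately show ?thesis using sq zero_le_power2[of "Fc y"] by linarith
      next
        case 3
        have "\<bar>Fc y - Fc (z i)\<bar> \<le> 1 / real N"
        proof -
          have "real i / real N \<le> Fc y" "Fc y \<le> (real i + 1) / real N" using i N by (auto simp: field_simps)
          then show ?thesis unfolding z[OF 3] by (simp add: add_divide_distrib)
        qed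
        from Ut_square_diff_mean[OF N this, of n] show ?thesis
          using 3 by (simp add: Vs_eq V_def)
      qed
    qed
    have QR: "(\<integral>\<omega>. \<bar>Q n \<omega> - R n \<omega>\<bar> \<partial>M) \<le> 3 / sqrt (real N)" for n
    proof -
      note fub = P.weighted_fubini[where g="\<lambda>\<omega> y. \<bar>(Ut n y \<omega>)\<^sup>2 - Vs n y \<omega>\<bar>", OF D_meas D_bound w_integrable[OF th] w_nonneg[OF th]]
      have i1: "integrable lborel (\<lambda>y. (Ut n y \<omega>)\<^sup>2 * w th y)" if "\<omega> \<in> space M" for \<omega>
        by (rule P.weighted_fubini(3)[OF Ut_sq_pair Ut_sq_bound w_integrable[OF th] w_nonneg[OF th] that])
      have i2: "integrable lborel (\<lambda>y. Vs n y \<omega> * w th y)" for \<omega>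
      proof -
        have "Vs n y \<omega> * w th y = (\<Sum>i<N. (V n i \<omega>)\<^sup>2 * ((if I i y then 1 else 0) * w th y))" for y
          unfolding Vs_def sum_distrib_right by (intro sum.cong refl) (simp only: mult_ac)
        then show ?thesis using I_int by (auto intro!: Bochner_Integration.integrable_sum integrable_mult_right)
      qed
      have "(\<integral>\<omega>. \<bar>Q n \<omega> - R n \<omega>\<bar> \<partial>M) \<le> (\<integral>\<omega>. (\<integral>y. \<bar>(Ut n y \<omega>)\<^sup>2 - Vs n y \<omega>\<bar> * w th y \<partial>lborel) \<partial>M)"
      proof (intro integral_mono fub(1))
        show "integrable M (\<lambda>\<omega>. \<bar>Q n \<omega> - R n \<omega>\<bar>)" using Q_integrable R_int by simp
        fix \<omega> assume \<omega>: "\<omega> \<in> space M"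
        have "Q n \<omega> - R n \<omega> = (\<integral>y. ((Ut n y \<omega>)\<^sup>2 - Vs n y \<omega>) * w th y \<partial>lborel)"
          unfolding Q_def R_eq using i1[OF \<omega>] i2 by (simp add: left_diff_distrib)
        then have "\<bar>Q n \<omega> - R n \<omega>\<bar> \<le> (\<integral>y. \<bar>((Ut n y \<omega>)\<^sup>2 - Vs n y \<omega>) * w th y\<bar> \<partial>lborel)"
          by (simp only: integral_abs_bound)
        then show "\<bar>Q n \<omega> - R n \<omega>\<bar> \<le> (\<integral>y. \<bar>(Ut n y \<omega>)\<^sup>2 - Vs n y \<omega>\<bar> * w th y \<partial>lborel)"
          using w_nonneg[OF th] by (simp add: abs_mult)
      qed
      also have "\<dots> = (\<integral>y. (\<integral>\<omega>. \<bar>(Ut n y \<omega>)\<^sup>2 - Vs n y \<omega>\<bar> \<partial>M) * w th y \<partial>lborel)" by (rule fub(2))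
      also have "\<dots> \<le> (\<integral>y. 3 / sqrt (real N) * w th y \<partial>lborel)"
        using Vs_cases w_nonneg[OF th] w_integrable[OF th] by (intro integral_mono fub(4) mult_right_mono) auto
      also have "\<dots> = 3 / sqrt (real N)" using w_integral[OF th] by simp
      finally show ?thesis .
    qed
    have lim: "(\<lambda>n. \<integral>\<omega>. exp (- (k * R n \<omega>)) \<partial>M) \<longlonglongrightarrow>
         (\<integral>\<omega>. exp (- (\<Sum>i<N. (sqrt (2 * k / real N) * B (real i / real N) \<omega>)\<^sup>2) / 2) \<partial>NB)"
    proof -
      define Z where "Z n i \<omega> = sqrt (2 * k / real N) * V n i \<omega>" for n i \<omega>
      define Y where "Y i \<omega> = (if i < N then sqrt (2 * k / real N) * B (real i / real N) \<omega> else 0)" for i \<omega>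
      have Z_meas [measurable]: "Z n i \<in> borel_measurable M" for n i unfolding Z_def[abs_def] by measurable
      have Y_meas [measurable]: "Y i \<in> borel_measurable NB" for i
        unfolding Y_def using br.meas_grid[of i N] by (cases "i < N") auto
      have tgrid: "real i / real N \<in> {0..1}" if "i < N" for i using that by simp
      have "(\<lambda>n. \<integral>\<omega>. exp (- (\<Sum>i<N. (Z n i \<omega>)\<^sup>2) / 2) \<partial>M) \<longlonglongrightarrow> (\<integral>\<omega>. exp (- (\<Sum>i<N. (Y i \<omega>)\<^sup>2) / 2) \<partial>NB)"
      proof (rule laplace_squares_limit[OF P.prob_space_axioms br.prob_space_axioms Z_meas Y_meas])
        fix g :: "nat \<Rightarrow> real"
        \<comment> \<open>The coefficient at index zero is dropped because \<open>V n 0\<close>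
          vanishes; the bridge covariance at time zero vanishes too, so both quadratic forms
          agree.\<close>
        define g1 where "g1 i = (if i = 0 then 0 else g i * sqrt (2 * k / real N))" for i
        define g2 where "g2 i = g i * sqrt (2 * k / real N)" for i
        have 1: "(\<Sum>i<N. g i * Z n i \<omega>) = (\<Sum>i<N. g1 i * Ut n (z i) \<omega>)" for n \<omega>
          by (intro sum.cong refl) (simp add: Z_def V_def g1_def)
        have 2: "(\<Sum>i<N. g i * Y i \<omega>) = (\<Sum>i<N. g2 i * B (real i / real N) \<omega>)" for \<omega>
          by (intro sum.cong refl) (simp add: Y_def g2_def)
        have 3: "(\<Sum>i<N. \<Sum>j<N. g1 i * g1 j * (Fc (min (z i) (z j)) - Fc (z i) * Fc (z j))) =
            (\<Sum>i<N. \<Sum>j<N. g2 i * g2 j * br.cov (real i / real N) (real j / real N))"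
        proof (intro sum.cong refl)
          fix i j assume ij: "i \<in> {..<N}" "j \<in> {..<N}"
          show "g1 i * g1 j * (Fc (min (z i) (z j)) - Fc (z i) * Fc (z j)) =
              g2 i * g2 j * br.cov (real i / real N) (real j / real N)"
          proof (cases "i = 0 \<or> j = 0")
            case True
            then show ?thesis by (auto simp: g1_def br.cov_def)
          next
            case False
            have "Fc (min (z i) (z j)) = min (Fc (z i)) (Fc (z j))"
              using Fc_mono[of "z i" "z j"] Fc_mono[of "z j" "z i"] by (auto simp: min_def)
            then show ?thesis using False ij z by (simp add: g1_def g2_def br.cov_def)
          qed
        qed
        have 4: "(\<integral>\<omega>. iexp (\<Sum>i<N. g2 i * B (real i / real N) \<omega>) \<partial>NB) = complex_of_real (exp (-
            (\<Sum>i<N. \<Sum>j<N. g1 i * g1 j * (Fc (min (z i) (z j)) - Fc (z i) * Fc (z j))) / 2))"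
          unfolding 3 by (rule br.char_sum) (rule tgrid)
        show "(\<lambda>n. \<integral>\<omega>. iexp (\<Sum>i<N. g i * Z n i \<omega>) \<partial>M) \<longlonglongrightarrow> (\<integral>\<omega>. iexp (\<Sum>i<N. g i * Y i \<omega>) \<partial>NB)"
          unfolding 1 2 4 by (rule Ut_char_limit)
      qed
      moreover have "(\<Sum>i<N. (Z n i \<omega>)\<^sup>2) / 2 = k * R n \<omega>" for n \<omega>
        using k N by (simp add: Z_def R_def power_mult_distrib sum_distrib_left sum_divide_distrib mult_ac)
      ultimately show ?thesis by (simp add: Y_def)
    qed
    show ?thesis
    proof (intro exI[of _ R] conjI allI lim QR R_int)
      show "R n \<in> borel_measurable M" "0 \<le> R n \<omega>" for n \<omega>
        using R_int[of n] by (auto simp: R_def intro!: divide_nonneg_nonneg sum_nonneg)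
    qed
  qed
  show ?thesis
  proof (rule LIMSEQ_I)
    fix \<epsilon> :: real assume \<epsilon>: "0 < \<epsilon>"
    let ?L = "\<integral>\<omega>. exp (- (k * bridge_functional B \<omega>)) \<partial>NB"
    have "(\<lambda>N. k * (3 / sqrt (real N))) \<longlonglongrightarrow> k * 0"
      by (intro tendsto_mult tendsto_const) real_asymp
    then have e1: "\<forall>\<^sub>F N in sequentially. k * (3 / sqrt (real N)) < \<epsilon> / 3"
      using \<epsilon> by (intro order_tendstoD(2)[of _ "k * 0"]) auto
    have "\<forall>\<^sub>F N in sequentially. dist (\<integral>\<omega>. exp (- (\<Sum>i<N. (sqrt (2 * k / real N) * B (real i / real N) \<omega>)\<^sup>2) / 2) \<partial>NB) ?L < \<epsilon> / 3"
      using br.laplace_grid_limit[OF k] \<epsilon> by (intro tendstoD) auto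
    with e1 eventually_gt_at_top[of 0]
    have "\<forall>\<^sub>F N in sequentially. 0 < N \<and> k * (3 / sqrt (real N)) < \<epsilon> / 3 \<and>
       dist (\<integral>\<omega>. exp (- (\<Sum>i<N. (sqrt (2 * k / real N) * B (real i / real N) \<omega>)\<^sup>2) / 2) \<partial>NB) ?L < \<epsilon> / 3"
      by eventually_elim auto
    \<comment> \<open>\<open>N\<close> can be fixed before \<open>n\<close>, as the discretization
      error does not depend on \<open>n\<close>.\<close>
    then obtain N :: nat where N: "0 < N" "k * (3 / sqrt (real N)) < \<epsilon> / 3"
       "dist (\<integral>\<omega>. exp (- (\<Sum>i<N. (sqrt (2 * k / real N) * B (real i / real N) \<omega>)\<^sup>2) / 2) \<partial>NB) ?L < \<epsilon> / 3"
      by (auto simp: eventually_sequentially)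
    let ?LN = "\<integral>\<omega>. exp (- (\<Sum>i<N. (sqrt (2 * k / real N) * B (real i / real N) \<omega>)\<^sup>2) / 2) \<partial>NB"
    obtain R where R: "\<And>n. R n \<in> borel_measurable M" "\<And>n \<omega>. 0 \<le> R n \<omega>" "\<And>n. integrable M (R n)"
       "\<And>n. (\<integral>\<omega>. \<bar>Q n \<omega> - R n \<omega>\<bar> \<partial>M) \<le> 3 / sqrt (real N)" "(\<lambda>n. \<integral>\<omega>. exp (- (k * R n \<omega>)) \<partial>M) \<longlonglongrightarrow> ?LN"
      using grid[OF N(1)] by blast
    from LIMSEQ_D[OF R(5), of "\<epsilon> / 3"] \<epsilon> obtain n0 where
      n0: "\<And>n. n0 \<le> n \<Longrightarrow> \<bar>(\<integral>\<omega>. exp (- (k * R n \<omega>)) \<partial>M) - ?LN\<bar> < \<epsilon> / 3" by auto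
    have "\<bar>(\<integral>\<omega>. exp (- (k * Q n \<omega>)) \<partial>M) - ?L\<bar> < \<epsilon>" if n: "n0 \<le> n" for n
    proof -
      have [measurable]: "Q n \<in> borel_measurable M" "R n \<in> borel_measurable M" using Q_integrable R by auto
      have i: "integrable M (\<lambda>\<omega>. exp (- (k * Q n \<omega>)))" "integrable M (\<lambda>\<omega>. exp (- (k * R n \<omega>)))"
        using k Q_nonneg R(2) by (auto intro!: P.integrable_const_bound[of _ 1])
      have "\<bar>(\<integral>\<omega>. exp (- (k * Q n \<omega>)) \<partial>M) - (\<integral>\<omega>. exp (- (k * R n \<omega>)) \<partial>M)\<bar> = \<bar>\<integral>\<omega>. exp (- (k * Q n \<omega>)) - exp (- (k * R n \<omega>)) \<partial>M\<bar>"
        using i by simp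
      also have "\<dots> \<le> (\<integral>\<omega>. \<bar>exp (- (k * Q n \<omega>)) - exp (- (k * R n \<omega>))\<bar> \<partial>M)" by (rule integral_abs_bound)
      also have "\<dots> \<le> (\<integral>\<omega>. k * \<bar>Q n \<omega> - R n \<omega>\<bar> \<partial>M)"
        using i Q_integrable R(3) k Q_nonneg R(2) by (intro integral_mono exp_neg_lipschitz) auto
      also have "\<dots> \<le> k * (3 / sqrt (real N))" using mult_left_mono[OF R(4)[of n] k] by simp
      finally show ?thesis using N n0[OF n] unfolding dist_real_def by linarith
    qed
    then show "\<exists>n0. \<forall>n\<ge>n0. norm ((\<integral>\<omega>. exp (- (k * Q n \<omega>)) \<partial>M) - ?L) < \<epsilon>" by auto
  qed
qed

end

subsection \<open>Replacing the estimator by the true parameter\<close>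

text \<open>An exceptional event instead of a probability: the set where \<open>P n\<close> fails need not be measurable.\<close>
definition whp :: "'a measure \<Rightarrow> real \<Rightarrow> (nat \<Rightarrow> 'a \<Rightarrow> bool) \<Rightarrow> bool" where
  "whp M \<eta> P \<longleftrightarrow> (\<exists>n0. \<forall>n\<ge>n0. \<exists>E\<in>sets M. measure M E \<le> \<eta> \<and> (\<forall>\<omega>\<in>space M - E. P n \<omega>))"

text \<open>Only positive \<open>n\<close> have to be checked; the threshold is raised to one. The
  properties of the estimator start there.\<close>

lemma whp_mono:
  assumes "whp M \<eta> P" and "\<And>n \<omega>. 0 < n \<Longrightarrow> \<omega> \<in> space M \<Longrightarrow> P n \<omega> \<Longrightarrow> R n \<omega>"
  shows "whp M \<eta> R"
proof -
  obtain n0 where n0: "\<And>n. n0 \<le> n \<Longrightarrow> \<exists>E\<in>sets M. measure M E \<le> \<eta> \<and> (\<forall>\<omega>\<in>space M - E. P n \<omega>)"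
    using assms(1) unfolding whp_def by blast
  have "\<exists>E\<in>sets M. measure M E \<le> \<eta> \<and> (\<forall>\<omega>\<in>space M - E. R n \<omega>)" if n: "max 1 n0 \<le> n" for n
    using n0[of n] n assms(2)[of n] by (auto intro!: bexI)
  then show ?thesis unfolding whp_def by blast
qed

lemma whp_sure: "0 \<le> \<eta> \<Longrightarrow> \<forall>\<^sub>F n in sequentially. \<forall>\<omega>\<in>space M. P n \<omega> \<Longrightarrow> whp M \<eta> P"
  unfolding whp_def eventually_sequentially
  by (elim exE, rule exI, intro allI impI bexI[of _ "{}"]) auto

section \<open>Events of small probability and a Slutsky argument\<close>

context prob_space
begin

lemma whp_conj:
  assumes P: "whp M \<eta> P" and R: "whp M \<zeta> R"
  shows "whp M (\<eta> + \<zeta>) (\<lambda>n \<omega>. P n \<omega> \<and> R n \<omega>)"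
proof -
  obtain n1 where n1: "\<And>n. n1 \<le> n \<Longrightarrow> \<exists>E\<in>events. prob E \<le> \<eta> \<and> (\<forall>\<omega>\<in>space M - E. P n \<omega>)"
    using P unfolding whp_def by blast
  obtain n2 where n2: "\<And>n. n2 \<le> n \<Longrightarrow> \<exists>E\<in>events. prob E \<le> \<zeta> \<and> (\<forall>\<omega>\<in>space M - E. R n \<omega>)"
    using R unfolding whp_def by blast
  have "\<exists>E\<in>events. prob E \<le> \<eta> + \<zeta> \<and> (\<forall>\<omega>\<in>space M - E. P n \<omega> \<and> R n \<omega>)" if n: "max n1 n2 \<le> n" for n
  proof -
    obtain E where E: "E \<in> events" "prob E \<le> \<eta>" "\<forall>\<omega>\<in>space M - E. P n \<omega>" using n1[of n] n by auto
    obtain E' where E': "E' \<in> events" "prob E' \<le> \<zeta>" "\<forall>\<omega>\<in>space M - E'. R n \<omega>" using n2[of n] n by auto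
    have "prob (E \<union> E') \<le> \<eta> + \<zeta>"
      using measure_Un_le[OF E(1) E'(1)] E(2) E'(2) by linarith
    then show ?thesis using E E' by (intro bexI[of _ "E \<union> E'"]) auto
  qed
  then show ?thesis unfolding whp_def by blast
qed

lemma whp_conv_in_prob:
  assumes c: "conv_in_prob M Y c" and Y: "\<And>n. 0 < n \<Longrightarrow> Y n \<in> borel_measurable M" and pos: "0 < \<epsilon>" "0 < \<eta>"
  shows "whp M \<eta> (\<lambda>n \<omega>. \<bar>Y n \<omega> - c\<bar> \<le> \<epsilon>)"
proof -
  have "\<forall>\<^sub>F n in sequentially. prob {\<omega>\<in>space M. \<epsilon> < \<bar>Y n \<omega> - c\<bar>} < \<eta>"
    using c pos unfolding conv_in_prob_def by (intro order_tendstoD(2)[of _ 0]) auto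
  then obtain n0 where n0: "\<And>n. n0 \<le> n \<Longrightarrow> prob {\<omega>\<in>space M. \<epsilon> < \<bar>Y n \<omega> - c\<bar>} < \<eta>"
    unfolding eventually_sequentially by blast
  have "\<exists>E\<in>events. prob E \<le> \<eta> \<and> (\<forall>\<omega>\<in>space M - E. \<bar>Y n \<omega> - c\<bar> \<le> \<epsilon>)" if n: "max 1 n0 \<le> n" for n
  proof (rule bexI[of _ "{\<omega>\<in>space M. \<epsilon> < \<bar>Y n \<omega> - c\<bar>}"])
    have [measurable]: "Y n \<in> borel_measurable M" using Y n by simp
    show "{\<omega>\<in>space M. \<epsilon> < \<bar>Y n \<omega> - c\<bar>} \<in> events" by measurable
    show "prob {\<omega>\<in>space M. \<epsilon> < \<bar>Y n \<omega> - c\<bar>} \<le> \<eta> \<and> (\<forall>\<omega>\<in>space M - {\<omega>\<in>space M. \<epsilon> < \<bar>Y n \<omega> - c\<bar>}. \<bar>Y n \<omega> - c\<bar> \<le> \<epsilon>)"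
      using n0[of n] n by (auto simp: not_less)
  qed
  then show ?thesis unfolding whp_def by blast
qed

lemma whp_markov:
  assumes int: "\<And>n. integrable M (Y n)" and nonneg: "\<And>n \<omega>. 0 \<le> Y n \<omega>" and pos: "0 < C"
    and mean: "\<forall>\<^sub>F n in sequentially. (\<integral>\<omega>. Y n \<omega> \<partial>M) \<le> \<eta> * C"
  shows "whp M \<eta> (\<lambda>n \<omega>. Y n \<omega> \<le> C)"
proof -
  obtain n0 where n0: "\<And>n. n0 \<le> n \<Longrightarrow> (\<integral>\<omega>. Y n \<omega> \<partial>M) \<le> \<eta> * C"
    using mean unfolding eventually_sequentially by blast
  have "\<exists>E\<in>events. prob E \<le> \<eta> \<and> (\<forall>\<omega>\<in>space M - E. Y n \<omega> \<le> C)" if n: "n0 \<le> n" for n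
  proof (rule bexI[of _ "{\<omega>\<in>space M. C \<le> Y n \<omega>}"])
    have [measurable]: "Y n \<in> borel_measurable M" using int by auto
    show "{\<omega>\<in>space M. C \<le> Y n \<omega>} \<in> events" by measurable
    have "prob {\<omega>\<in>space M. C \<le> Y n \<omega>} \<le> (\<integral>\<omega>. Y n \<omega> \<partial>M) / C"
      by (rule integral_Markov_inequality_measure[where A="{}"]) (use int nonneg pos in auto)
    also have "\<dots> \<le> \<eta>" using n0[OF n] pos by (simp add: field_simps)
    finally show "prob {\<omega>\<in>space M. C \<le> Y n \<omega>} \<le> \<eta> \<and> (\<forall>\<omega>\<in>space M - {\<omega>\<in>space M. C \<le> Y n \<omega>}. Y n \<omega> \<le> C)"
      by auto
  qed
  then show ?thesis unfolding whp_def by blast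
qed

text \<open>Outside the exceptional event \<open>exp (- k * _)\<close> is Lipschitz with constant
  \<open>k\<close>; on it, both values lie between zero and one.\<close>

lemma laplace_transfer:
  fixes D V :: "nat \<Rightarrow> 'a \<Rightarrow> real" and k :: real
  assumes close: "\<And>\<epsilon> \<eta>. 0 < \<epsilon> \<Longrightarrow> 0 < \<eta> \<Longrightarrow> whp M \<eta> (\<lambda>n \<omega>. \<bar>D n \<omega> - V n \<omega>\<bar> \<le> \<epsilon>)"
    and D: "\<And>n. 0 < n \<Longrightarrow> D n \<in> borel_measurable M" "\<And>n \<omega>. 0 < n \<Longrightarrow> \<omega> \<in> space M \<Longrightarrow> 0 \<le> D n \<omega>"
    and V: "\<And>n. V n \<in> borel_measurable M" "\<And>n \<omega>. 0 \<le> V n \<omega>" and k: "0 \<le> k"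
    and lim: "(\<lambda>n. \<integral>\<omega>. exp (- (k * V n \<omega>)) \<partial>M) \<longlonglongrightarrow> c"
  shows "(\<lambda>n. \<integral>\<omega>. exp (- (k * D n \<omega>)) \<partial>M) \<longlonglongrightarrow> c"
proof -
  have "(\<lambda>n. (\<integral>\<omega>. exp (- (k * D n \<omega>)) \<partial>M) - (\<integral>\<omega>. exp (- (k * V n \<omega>)) \<partial>M)) \<longlonglongrightarrow> 0"
  proof (rule LIMSEQ_I)
    fix \<epsilon> :: real assume \<epsilon>: "0 < \<epsilon>"
    \<comment> \<open>The denominator \<open>k + 1\<close> keeps the quotient meaningful for
      \<open>k = 0\<close>.\<close>
    define \<zeta> where "\<zeta> = \<epsilon> / (2 * (k + 1))"
    have \<zeta>: "0 < \<zeta>" "k * \<zeta> < \<epsilon> / 2"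
    proof -
      show "0 < \<zeta>" using \<epsilon> k by (simp add: \<zeta>_def)
      have "k * \<zeta> < (k + 1) * \<zeta>" using \<open>0 < \<zeta>\<close> by simp
      also have "\<dots> = \<epsilon> / 2"
      proof -
        have "x * (\<epsilon> / (2 * x)) = \<epsilon> / 2" if "x \<noteq> 0" for x using that by simp
        from this[of "k + 1"] show ?thesis using k by (simp add: \<zeta>_def)
      qed
      finally show "k * \<zeta> < \<epsilon> / 2" .
    qed
    obtain n0 where n0: "\<And>n. n0 \<le> n \<Longrightarrow> \<exists>E\<in>events. prob E \<le> \<epsilon> / 2 \<and> (\<forall>\<omega>\<in>space M - E. \<bar>D n \<omega> - V n \<omega>\<bar> \<le> \<zeta>)"
      using close[of \<zeta> "\<epsilon> / 2"] \<epsilon> \<zeta> unfolding whp_def by auto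
    have "\<bar>(\<integral>\<omega>. exp (- (k * D n \<omega>)) \<partial>M) - (\<integral>\<omega>. exp (- (k * V n \<omega>)) \<partial>M)\<bar> < \<epsilon>" if n: "max 1 n0 \<le> n" for n
    proof -
      obtain E where E: "E \<in> events" "prob E \<le> \<epsilon> / 2" "\<And>\<omega>. \<omega> \<in> space M - E \<Longrightarrow> \<bar>D n \<omega> - V n \<omega>\<bar> \<le> \<zeta>"
        using n0[of n] n by auto
      have [measurable]: "D n \<in> borel_measurable M" "V n \<in> borel_measurable M" "E \<in> events" using D V E n by auto
      have i: "integrable M (\<lambda>\<omega>. exp (- (k * D n \<omega>)))" "integrable M (\<lambda>\<omega>. exp (- (k * V n \<omega>)))"
        using k D(2)[of n] V(2) n by (auto intro!: integrable_const_bound[of _ 1])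
      have "\<bar>(\<integral>\<omega>. exp (- (k * D n \<omega>)) \<partial>M) - (\<integral>\<omega>. exp (- (k * V n \<omega>)) \<partial>M)\<bar> = \<bar>\<integral>\<omega>. exp (- (k * D n \<omega>)) - exp (- (k * V n \<omega>)) \<partial>M\<bar>"
        using i by simp
      also have "\<dots> \<le> (\<integral>\<omega>. \<bar>exp (- (k * D n \<omega>)) - exp (- (k * V n \<omega>))\<bar> \<partial>M)" by (rule integral_abs_bound)
      finally have first: "\<bar>(\<integral>\<omega>. exp (- (k * D n \<omega>)) \<partial>M) - (\<integral>\<omega>. exp (- (k * V n \<omega>)) \<partial>M)\<bar> \<le>
         (\<integral>\<omega>. \<bar>exp (- (k * D n \<omega>)) - exp (- (k * V n \<omega>))\<bar> \<partial>M)" .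
      have iE: "integrable M (indicator E :: 'a \<Rightarrow> real)"
        using E(1) by (intro integrable_real_indicator) (simp_all add: less_top[symmetric])
      have "(\<integral>\<omega>. \<bar>exp (- (k * D n \<omega>)) - exp (- (k * V n \<omega>))\<bar> \<partial>M) \<le> (\<integral>\<omega>. k * \<zeta> + indicator E \<omega> \<partial>M)"
      proof (rule integral_mono)
        show "integrable M (\<lambda>\<omega>. k * \<zeta> + indicator E \<omega>)" using iE by simp
        fix \<omega> assume \<omega>: "\<omega> \<in> space M"
        have D0: "0 \<le> D n \<omega>" using D(2)[of n \<omega>] n \<omega> by simp
        show "\<bar>exp (- (k * D n \<omega>)) - exp (- (k * V n \<omega>))\<bar> \<le> k * \<zeta> + indicator E \<omega>"
        proof (cases "\<omega> \<in> E")
          case True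
          have "0 < exp (- (k * D n \<omega>))" "exp (- (k * D n \<omega>)) \<le> 1" "0 < exp (- (k * V n \<omega>))" "exp (- (k * V n \<omega>)) \<le> 1"
            using k D0 V(2)[of n \<omega>] by auto
          moreover have "0 \<le> k * \<zeta>" using k \<zeta> by simp
          moreover have "indicator E \<omega> = (1::real)" using True by simp
          ultimately show ?thesis by linarith
        next
          case False
          have "\<bar>exp (- (k * D n \<omega>)) - exp (- (k * V n \<omega>))\<bar> \<le> k * \<bar>D n \<omega> - V n \<omega>\<bar>"
            by (rule exp_neg_lipschitz[OF k D0 V(2)])
          also have "\<dots> \<le> k * \<zeta>" using E(3)[of \<omega>] \<omega> False k by (intro mult_left_mono) auto
          finally show ?thesis using False by simp
        qed
      qed (use i in auto)
      also have "\<dots> = k * \<zeta> + prob E" using E(1) iE by (simp add: prob_space)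
      finally show ?thesis using first E(2) \<zeta> by linarith
    qed
    then show "\<exists>n0. \<forall>n\<ge>n0. norm ((\<integral>\<omega>. exp (- (k * D n \<omega>)) \<partial>M) - (\<integral>\<omega>. exp (- (k * V n \<omega>)) \<partial>M) - 0) < \<epsilon>"
      unfolding real_norm_def diff_0_right by blast
  qed
  from tendsto_add[OF this lim] show ?thesis by simp
qed

end

section \<open>Continuity of the weight and Taylor expansion in the parameter\<close>

context model
begin

text \<open>\<open>W\<close> is the weight before normalization. Its closeness relative to
  \<open>m\<close> integrates to closeness of \<open>J\<close>, and from these the normalized weight
  and both statements on the information follow.\<close>

lemma w_continuous:
  assumes \<epsilon>: "0 < \<epsilon>"
  shows "\<exists>\<delta>>0. \<forall>t\<in>{a<..<b}. \<bar>t - th\<bar> < \<delta> \<longrightarrow> (\<forall>y. \<bar>w t y - w th y\<bar> \<le> \<epsilon> * m y) \<and>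
     \<bar>sqrt (info th / info t) - 1\<bar> \<le> \<epsilon> \<and> info th / 2 \<le> info t"
proof -
  define W where "W t y = (Sd t y)\<^sup>2 * \<phi> t y" for t y
  define m0 where "m0 = (\<integral>y. m y \<partial>lborel)"
  have m0: "0 \<le> m0" unfolding m0_def using m_pos by (intro integral_nonneg_AE AE_I2) (auto intro: less_imp_le)
  have W_cont: "\<exists>\<delta>>0. \<forall>t\<in>{a<..<b}. \<bar>t - th\<bar> < \<delta> \<longrightarrow> (\<forall>y. \<bar>W t y - W th y\<bar> \<le> \<zeta> * m y)" if \<zeta>: "0 < \<zeta>" for \<zeta>
  proof -
    define \<zeta>1 where "\<zeta>1 = \<zeta> / (2 * (K\<^sup>2 + 1))"
    define \<delta>2 where "\<delta>2 = \<zeta> / (4 * (K\<^sup>2 * A + 1))"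
    have K1: "0 < K\<^sup>2 + 1" and KA: "0 < K\<^sup>2 * A + 1"
      using A_nonneg by (auto intro: add_nonneg_pos)
    have "0 < \<zeta>1" "0 < \<delta>2" using \<zeta> K1 KA by (auto simp: \<zeta>1_def \<delta>2_def)
    obtain \<delta>1 where \<delta>1: "0 < \<delta>1" "\<And>t y. t \<in> {a<..<b} \<Longrightarrow> \<bar>t - th\<bar> < \<delta>1 \<Longrightarrow> \<bar>\<phi> t y - \<phi> th y\<bar> \<le> \<zeta>1 * m y"
      using \<phi>_weighted_continuous[OF th \<open>0 < \<zeta>1\<close>] by blast
    have "\<bar>W t y - W th y\<bar> \<le> \<zeta> * m y" if t: "t \<in> {a<..<b}" and d: "\<bar>t - th\<bar> < min \<delta>1 \<delta>2" for t y
    proof -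
      \<comment> \<open>The change of the density is separated from that of \<open>Sd\<close>; the
        latter is a difference of squares.\<close>
      have "W t y - W th y = (Sd t y)\<^sup>2 * (\<phi> t y - \<phi> th y) + (Sd t y - Sd th y) * (Sd t y + Sd th y) * \<phi> th y"
        by (simp add: W_def power2_eq_square algebra_simps)
      also have "\<bar>\<dots>\<bar> \<le> K\<^sup>2 * (\<zeta>1 * m y) + (K * \<delta>2) * (2 * K) * (A * m y)"
      proof (intro order_trans[OF abs_triangle_ineq] add_mono)
        show "\<bar>(Sd t y)\<^sup>2 * (\<phi> t y - \<phi> th y)\<bar> \<le> K\<^sup>2 * (\<zeta>1 * m y)"
          unfolding abs_mult using Sd_sq[OF t, of y] \<delta>1(2)[OF t, of y] d by (intro mult_mono) auto
        have "\<bar>Sd t y - Sd th y\<bar> \<le> K * \<bar>t - th\<bar>" by (rule Sd_lipschitz[OF t th])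
        also have "\<dots> \<le> K * \<delta>2" using d K_nonneg by (intro mult_left_mono) auto
        finally have 1: "\<bar>Sd t y - Sd th y\<bar> \<le> K * \<delta>2" .
        have 2: "\<bar>Sd t y + Sd th y\<bar> \<le> 2 * K" using Sd_bound[OF t, of y] Sd_bound[OF th, of y] by linarith
        have 3: "\<bar>\<phi> th y\<bar> \<le> A * m y" using \<phi>_le_m[OF th, of y] \<phi>_nonneg[OF th, of y] by simp
        show "\<bar>(Sd t y - Sd th y) * (Sd t y + Sd th y) * \<phi> th y\<bar> \<le> (K * \<delta>2) * (2 * K) * (A * m y)"
          unfolding abs_mult using 1 2 3 K_nonneg \<open>0 < \<delta>2\<close> by (intro mult_mono) auto
      qed
      also have "\<dots> = (K\<^sup>2 * \<zeta>1 + 2 * (K\<^sup>2 * A) * \<delta>2) * m y" by (simp add: power2_eq_square algebra_simps)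
      also have "\<dots> \<le> (\<zeta> / 2 + \<zeta> / 2) * m y"
      proof (intro mult_right_mono add_mono)
        show "K\<^sup>2 * \<zeta>1 \<le> \<zeta> / 2" using K1 \<zeta> by (simp add: \<zeta>1_def field_simps)
        show "2 * (K\<^sup>2 * A) * \<delta>2 \<le> \<zeta> / 2" using KA \<zeta> by (simp add: \<delta>2_def field_simps)
      qed (use m_pos[of y] in simp)
      finally show ?thesis by simp
    qed
    then show ?thesis using \<delta>1(1) \<open>0 < \<delta>2\<close> by (intro exI[of _ "min \<delta>1 \<delta>2"]) auto
  qed
  have J_close: "\<bar>J t - J th\<bar> \<le> \<zeta> * m0" if t: "t \<in> {a<..<b}" and c: "\<And>y. \<bar>W t y - W th y\<bar> \<le> \<zeta> * m y" for t \<zeta>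
  proof -
    have "J t - J th = (\<integral>y. W t y - W th y \<partial>lborel)"
      unfolding J_def W_def using Sd_sq_\<phi>_integrable[OF t] Sd_sq_\<phi>_integrable[OF th] by simp
    also have "\<bar>\<dots>\<bar> \<le> (\<integral>y. \<bar>W t y - W th y\<bar> \<partial>lborel)" by (rule integral_abs_bound)
    also have "\<dots> \<le> (\<integral>y. \<zeta> * m y \<partial>lborel)"
      using c m_integrable Sd_sq_\<phi>_integrable[OF t] Sd_sq_\<phi>_integrable[OF th]
      by (intro integral_mono integrable_abs) (auto simp: W_def)
    finally show ?thesis by (simp add: m0_def)
  qed
  have Jp: "0 < J th" by (rule J_pos[OF th])
  have "isCont (\<lambda>x. sqrt (J th / x)) (J th)" using Jp by (intro continuous_intros) auto
  then obtain \<kappa> where \<kappa>: "0 < \<kappa>" "\<And>x. \<bar>x - J th\<bar> < \<kappa> \<Longrightarrow> \<bar>sqrt (J th / x) - 1\<bar> < \<epsilon>"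
    unfolding continuous_at_eps_delta dist_real_def using \<epsilon> Jp by force
  \<comment> \<open>The first entry controls the numerator of \<open>w\<close>, the second keeps
    \<open>J t\<close> within \<kappa> and half of \<open>J th\<close>, the third controls the
    change of the denominator. Added ones prevent division by zero.\<close>
  define \<zeta> where "\<zeta> = min (\<epsilon> * J th / 4) (min (min \<kappa> (J th / 2) / (2 * (m0 + 1))) (\<epsilon> * (J th)\<^sup>2 / (4 * (m0 + 1) * (K\<^sup>2 * A + 1))))"
  have KA: "0 < K\<^sup>2 * A + 1" using A_nonneg by (auto intro: add_nonneg_pos)
  have \<zeta>: "0 < \<zeta>" using \<epsilon> Jp \<kappa> m0 KA by (simp add: \<zeta>_def)
  obtain \<delta> where \<delta>: "0 < \<delta>" "\<And>t y. t \<in> {a<..<b} \<Longrightarrow> \<bar>t - th\<bar> < \<delta> \<Longrightarrow> \<bar>W t y - W th y\<bar> \<le> \<zeta> * m y"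
    using W_cont[OF \<zeta>] by blast
  have "(\<forall>y. \<bar>w t y - w th y\<bar> \<le> \<epsilon> * m y) \<and> \<bar>sqrt (info th / info t) - 1\<bar> \<le> \<epsilon> \<and> info th / 2 \<le> info t"
    if t: "t \<in> {a<..<b}" and d: "\<bar>t - th\<bar> < \<delta>" for t
  proof -
    have Jc: "\<bar>J t - J th\<bar> \<le> \<zeta> * m0" by (rule J_close[OF t \<delta>(2)[OF t d]])
    have Jc1: "\<zeta> * m0 \<le> \<zeta> * (m0 + 1)" using \<zeta> by simp
    have "\<zeta> * (m0 + 1) \<le> (min \<kappa> (J th / 2) / (2 * (m0 + 1))) * (m0 + 1)"
      using m0 by (intro mult_right_mono) (auto simp: \<zeta>_def)
    also have "\<dots> = min \<kappa> (J th / 2) / 2"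
    proof -
      have "x / (2 * c) * c = x / 2" if "c \<noteq> 0" for x c :: real using that by simp
      then show ?thesis using m0 by (metis add_nonneg_pos less_irrefl zero_less_one)
    qed
    finally have J2: "\<bar>J t - J th\<bar> \<le> min \<kappa> (J th / 2) / 2" using Jc Jc1 by linarith
    have Jt: "J th / 2 \<le> J t" "\<bar>J t - J th\<bar> < \<kappa>"
    proof -
      have "min \<kappa> (J th / 2) / 2 \<le> \<kappa> / 2" "min \<kappa> (J th / 2) / 2 \<le> J th / 4" by simp_all
      then show "J th / 2 \<le> J t" "\<bar>J t - J th\<bar> < \<kappa>" using J2 \<kappa>(1) Jp by linarith+
    qed
    have Jt0: "0 < J t" by (rule J_pos[OF t])
    have "\<zeta> * (m0 + 1) \<le> (\<epsilon> * (J th)\<^sup>2 / (4 * (m0 + 1) * (K\<^sup>2 * A + 1))) * (m0 + 1)"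
      using m0 by (intro mult_right_mono) (auto simp: \<zeta>_def)
    also have "\<dots> = \<epsilon> * (J th)\<^sup>2 / (4 * (K\<^sup>2 * A + 1))"
    proof -
      have "x / (4 * c * z) * c = x / (4 * z)" if "c \<noteq> 0" for x c z :: real using that by simp
      then show ?thesis using m0 by (metis add_nonneg_pos less_irrefl zero_less_one)
    qed
    finally have "\<bar>J t - J th\<bar> \<le> \<epsilon> * (J th)\<^sup>2 / (4 * (K\<^sup>2 * A + 1))"
      using Jc Jc1 by linarith
    then have "\<bar>J t - J th\<bar> * (4 * (K\<^sup>2 * A + 1)) \<le> \<epsilon> * (J th)\<^sup>2"
      using KA by (subst (asm) pos_le_divide_eq) auto
    then have J3: "\<bar>J t - J th\<bar> * (K\<^sup>2 * A + 1) \<le> \<epsilon> * (J th)\<^sup>2 / 4"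
      by (simp add: algebra_simps)
    have "\<bar>w t y - w th y\<bar> \<le> \<epsilon> * m y" for y
    proof -
      have eq: "w t y - w th y = (W t y - W th y) / J t + W th y * (J th - J t) / (J t * J th)"
        using Jt0 Jp by (simp add: w_def W_def field_simps)
      have "\<bar>(W t y - W th y) / J t + W th y * (J th - J t) / (J t * J th)\<bar> \<le> (\<zeta> * m y) / (J th / 2) + (K\<^sup>2 * A * m y) * \<bar>J t - J th\<bar> / (J th / 2 * J th)"
      proof (intro order_trans[OF abs_triangle_ineq] add_mono)
        show "\<bar>(W t y - W th y) / J t\<bar> \<le> (\<zeta> * m y) / (J th / 2)"
          unfolding abs_divide using \<delta>(2)[OF t d, of y] Jt Jt0 Jp \<zeta> m_pos[of y]
          by (intro frac_le) auto
        have "\<bar>W th y\<bar> \<le> K\<^sup>2 * (A * m y)"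
          unfolding W_def abs_mult using Sd_sq[OF th, of y] \<phi>_le_m[OF th, of y] \<phi>_nonneg[OF th, of y]
          by (intro mult_mono) auto
        from mult_right_mono[OF this, of "\<bar>J th - J t\<bar>"]
        have "\<bar>W th y\<bar> * \<bar>J th - J t\<bar> \<le> (K\<^sup>2 * A * m y) * \<bar>J t - J th\<bar>"
          by (simp add: abs_minus_commute mult.assoc)
        moreover have "J th / 2 * J th \<le> J t * J th" using Jt Jp by (intro mult_right_mono) auto
        ultimately show "\<bar>W th y * (J th - J t) / (J t * J th)\<bar> \<le> (K\<^sup>2 * A * m y) * \<bar>J t - J th\<bar> / (J th / 2 * J th)"
          unfolding abs_divide abs_mult using Jt Jt0 Jp m_pos[of y] A_nonneg
          by (intro frac_le) auto
      qed
      also have "\<dots> = (2 * \<zeta> / J th + 2 * (K\<^sup>2 * A * \<bar>J t - J th\<bar>) / (J th)\<^sup>2) * m y"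
        using Jp by (simp add: field_simps power2_eq_square)
      also have "\<dots> \<le> (\<epsilon> / 2 + \<epsilon> / 2) * m y"
      proof (intro mult_right_mono add_mono)
        have "\<zeta> \<le> \<epsilon> * J th / 4" unfolding \<zeta>_def by (rule min.cobounded1)
        then show "2 * \<zeta> / J th \<le> \<epsilon> / 2" using Jp by (simp add: field_simps)
        have "K\<^sup>2 * A * \<bar>J t - J th\<bar> \<le> \<bar>J t - J th\<bar> * (K\<^sup>2 * A + 1)" by (simp add: algebra_simps)
        with J3 have "K\<^sup>2 * A * \<bar>J t - J th\<bar> \<le> \<epsilon> * (J th)\<^sup>2 / 4" by linarith
        then show "2 * (K\<^sup>2 * A * \<bar>J t - J th\<bar>) / (J th)\<^sup>2 \<le> \<epsilon> / 2" using Jp by (simp add: field_simps)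
      qed (use m_pos[of y] in simp)
      finally show ?thesis unfolding eq by simp
    qed
    moreover have "\<bar>sqrt (info th / info t) - 1\<bar> \<le> \<epsilon>"
      using \<kappa>(2)[OF Jt(2)] I0_pos by (simp add: info_def)
    moreover have "info th / 2 \<le> info t" using Jt(1) I0_pos by (simp add: info_def)
    ultimately show ?thesis by blast
  qed
  then show ?thesis using \<delta>(1) by blast
qed


text \<open>Radii shrinking to zero; all these neighbourhoods of \<open>th\<close> lie in the
  parameter interval.\<close>

definition d :: "nat \<Rightarrow> real" where
  "d k = min (th - a) (b - th) / real (Suc k)"

lemma d_pos: "0 < d k" and d_in: "\<bar>t - th\<bar> < d k \<Longrightarrow> t \<in> {a<..<b}"
proof -
  define d0 where "d0 = min (th - a) (b - th)"
  have d0: "0 < d0" using th by (simp add: d0_def)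
  then show "0 < d k" by (simp add: d_def d0_def)
  have "d k \<le> d0" using d0 unfolding d_def d0_def[symmetric] by (simp add: divide_le_eq)
  then show "\<bar>t - th\<bar> < d k \<Longrightarrow> t \<in> {a<..<b}" by (auto simp: d0_def abs_less_iff)
qed

text \<open>The supremum runs over rationals only, to be measurable in \<open>x\<close>.\<close>
definition \<rho> :: "nat \<Rightarrow> real \<Rightarrow> real" where
  "\<rho> k x = (SUP q\<in>{q\<in>\<rat>. \<bar>q - th\<bar> < d k}. \<bar>Sdd q x - Sdd th x\<bar>)"

lemma \<rho>_bdd: "bdd_above ((\<lambda>q. \<bar>Sdd q x - Sdd th x\<bar>) ` {q\<in>\<rat>. \<bar>q - th\<bar> < d k})"
proof (rule bdd_aboveI2)
  fix q assume "q \<in> {q\<in>\<rat>. \<bar>q - th\<bar> < d k}"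
  then show "\<bar>Sdd q x - Sdd th x\<bar> \<le> 2 * K"
    using Sdd_bound[OF d_in, of q k x] Sdd_bound[OF th, of x] by auto
qed

lemma rational_near: "\<exists>q. q \<in> {q\<in>\<rat>. \<bar>q - th\<bar> < d k}"
proof -
  obtain q where "q \<in> \<rat>" "th < q" "q < th + d k" using Rats_dense_in_real[of th "th + d k"] d_pos[of k] by auto
  then show ?thesis by (intro exI[of _ q]) auto
qed

lemma \<rho>_least: "(\<And>q. \<bar>q - th\<bar> < d k \<Longrightarrow> \<bar>Sdd q x - Sdd th x\<bar> \<le> c) \<Longrightarrow> \<rho> k x \<le> c"
  unfolding \<rho>_def using rational_near by (intro cSUP_least) auto

text \<open>By continuity in the parameter, a violation at \<open>t\<close> would persist at
  rationals slightly to the right of \<open>t\<close>, which the supremum covers.\<close>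

lemma \<rho>_upper:
  assumes t: "\<bar>t - th\<bar> < d k"
  shows "\<bar>Sdd t x - Sdd th x\<bar> \<le> \<rho> k x"
proof (rule ccontr)
  assume "\<not> ?thesis"
  then have c: "\<rho> k x < \<bar>Sdd t x - Sdd th x\<bar>" by simp
  have "isCont (\<lambda>t. \<bar>Sdd t x - Sdd th x\<bar>) t"
    using Sdd_cont[of x] d_in[OF t] by (intro continuous_intros) (simp add: continuous_on_eq_continuous_at)
  then have "\<forall>\<^sub>F u in at t. \<rho> k x < \<bar>Sdd u x - Sdd th x\<bar>"
    unfolding isCont_def using c by (rule order_tendstoD)
  then obtain \<epsilon> where \<epsilon>: "0 < \<epsilon>" "\<And>u. u \<noteq> t \<Longrightarrow> \<bar>u - t\<bar> < \<epsilon> \<Longrightarrow> \<rho> k x < \<bar>Sdd u x - Sdd th x\<bar>"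
    by (auto simp: eventually_at dist_real_def)
  have "t < min (t + \<epsilon>) (th + d k)" using t \<epsilon> by auto
  from Rats_dense_in_real[OF this] obtain q where q: "q \<in> \<rat>" "t < q" "q < t + \<epsilon>" "q < th + d k" by auto
  then have "\<bar>Sdd q x - Sdd th x\<bar> \<le> \<rho> k x"
    unfolding \<rho>_def using t by (intro cSUP_upper \<rho>_bdd) auto
  then show False using \<epsilon>(2)[of q] q by auto
qed

lemma \<rho>_nonneg: "0 \<le> \<rho> k x"
  using \<rho>_upper[of th k x] d_pos[of k] by simp

lemma \<rho>_le: "\<rho> k x \<le> 2 * K"
proof (rule \<rho>_least)
  fix q assume "\<bar>q - th\<bar> < d k"
  from Sdd_bound[OF d_in[OF this], of x] Sdd_bound[OF th, of x]
  show "\<bar>Sdd q x - Sdd th x\<bar> \<le> 2 * K" by linarith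
qed

lemma \<rho>_measurable [measurable]: "\<rho> k \<in> borel_measurable borel"
  unfolding \<rho>_def[abs_def]
proof (rule borel_measurable_cSUP)
  show "countable {q \<in> \<rat>. \<bar>q - th\<bar> < d k}"
    using countable_rat by (rule countable_subset[rotated]) auto
  fix q assume "q \<in> {q \<in> \<rat>. \<bar>q - th\<bar> < d k}"
  then have "q \<in> {a<..<b}" using d_in by auto
  note [measurable] = Sdd_meas[OF this]
  show "(\<lambda>x. \<bar>Sdd q x - Sdd th x\<bar>) \<in> borel_measurable borel" by measurable
qed (rule \<rho>_bdd)

text \<open>Continuity of \<open>Sdd\<close> holds for each \<open>x\<close> separately, so the
  oscillation tends to zero pointwise; the bound \<open>2 * K\<close> turns this into convergence of
  its stationary mean.\<close>

lemma \<rho>_mean_tendsto: "(\<lambda>k. \<integral>x. \<rho> k x * \<phi> th x \<partial>lborel) \<longlonglongrightarrow> 0"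
proof -
  have "(\<lambda>k. \<integral>x. \<rho> k x * \<phi> th x \<partial>lborel) \<longlonglongrightarrow> (\<integral>x. 0 \<partial>(lborel :: real measure))"
  proof (rule integral_dominated_convergence[where w="\<lambda>x. 2 * K * \<phi> th x"])
    show "integrable lborel (\<lambda>x. 2 * K * \<phi> th x)" using \<phi>_integrable[OF th] by simp
    show "AE x in lborel. norm (\<rho> k x * \<phi> th x) \<le> 2 * K * \<phi> th x" for k
      using \<rho>_nonneg \<rho>_le \<phi>_nonneg[OF th] by (intro AE_I2) (simp add: abs_mult mult_right_mono)
    have "(\<lambda>k. \<rho> k x) \<longlonglongrightarrow> 0" for x
    proof (rule LIMSEQ_I)
      fix \<epsilon> :: real assume \<epsilon>: "0 < \<epsilon>"
      have "isCont (\<lambda>t. Sdd t x) th"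
        using Sdd_cont[of x] th by (simp add: continuous_on_eq_continuous_at)
      then obtain \<delta> where \<delta>: "0 < \<delta>" "\<And>t. \<bar>t - th\<bar> < \<delta> \<Longrightarrow> \<bar>Sdd t x - Sdd th x\<bar> < \<epsilon> / 2"
        unfolding continuous_at_eps_delta dist_real_def using \<epsilon> by (metis half_gt_zero)
      have "d \<longlonglongrightarrow> 0" unfolding d_def[abs_def] by real_asymp
      then have "\<forall>\<^sub>F k in sequentially. d k < \<delta>" using \<delta>(1) by (intro order_tendstoD)
      then obtain k0 where k0: "\<And>k. k0 \<le> k \<Longrightarrow> d k < \<delta>" by (auto simp: eventually_sequentially)
      have "\<bar>\<rho> k x\<bar> < \<epsilon>" if "k0 \<le> k" for k
      proof -
        have "\<rho> k x \<le> \<epsilon> / 2" using \<delta>(2) k0[OF that] by (intro \<rho>_least less_imp_le) auto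
        then show ?thesis using \<rho>_nonneg[of k x] \<epsilon> by simp
      qed
      then show "\<exists>k0. \<forall>k\<ge>k0. norm (\<rho> k x - 0) < \<epsilon>" by auto
    qed
    then show "AE x in lborel. (\<lambda>k. \<rho> k x * \<phi> th x) \<longlonglongrightarrow> 0"
      by (intro AE_I2 tendsto_mult_left_zero)
  qed auto
  then show ?thesis by simp
qed

lemma S_taylor:
  assumes t: "t \<in> {a<..<b}"
  shows "\<bar>S t x - S th x - (t - th) * Sd th x\<bar> \<le> K * (t - th)\<^sup>2"
proof -
  have "norm ((S t x - t * Sd th x) - (S th x - th * Sd th x)) \<le> (K * \<bar>t - th\<bar>) * norm (t - th)"
  proof (rule field_differentiable_bound[of "closed_segment t th" "\<lambda>u. S u x - u * Sd th x" "\<lambda>u. Sd u x - Sd th x"])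
    fix u assume u: "u \<in> closed_segment t th"
    then have uin: "u \<in> {a<..<b}" using segment_in[OF t th] by blast
    show "((\<lambda>u. S u x - u * Sd th x) has_real_derivative Sd u x - Sd th x) (at u within closed_segment t th)"
      by (rule DERIV_subset[of _ _ _ UNIV]) (auto intro!: derivative_eq_intros S_deriv[OF uin])
    have "\<bar>u - th\<bar> \<le> \<bar>t - th\<bar>" using u by (auto simp: closed_segment_eq_real_ivl split: if_splits)
    then have "K * \<bar>u - th\<bar> \<le> K * \<bar>t - th\<bar>" using K_nonneg by (rule mult_left_mono)
    then show "norm (Sd u x - Sd th x) \<le> K * \<bar>t - th\<bar>"
      using Sd_lipschitz[OF uin th, of x] by simp
  qed auto
  then show ?thesis by (simp add: algebra_simps power2_eq_square flip: abs_mult)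
qed

text \<open>With only continuity of \<open>Sdd\<close> at hand, the remainder is linear in
  \<open>\<bar>t - th\<bar>\<close>, with the oscillation as its coefficient.\<close>

lemma Sd_taylor:
  assumes t: "\<bar>t - th\<bar> < d k"
  shows "\<bar>Sd t x - Sd th x - (t - th) * Sdd th x\<bar> \<le> \<rho> k x * \<bar>t - th\<bar>"
proof -
  have "norm ((Sd t x - t * Sdd th x) - (Sd th x - th * Sdd th x)) \<le> \<rho> k x * norm (t - th)"
  proof (rule field_differentiable_bound[of "closed_segment t th" "\<lambda>u. Sd u x - u * Sdd th x" "\<lambda>u. Sdd u x - Sdd th x"])
    fix u assume u: "u \<in> closed_segment t th"
    then have u': "\<bar>u - th\<bar> < d k" using t by (auto simp: closed_segment_eq_real_ivl split: if_splits)
    show "((\<lambda>u. Sd u x - u * Sdd th x) has_real_derivative Sdd u x - Sdd th x) (at u within closed_segment t th)"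
      by (rule DERIV_subset[of _ _ _ UNIV]) (auto intro!: derivative_eq_intros Sd_deriv[OF d_in[OF u']])
    show "norm (Sdd u x - Sdd th x) \<le> \<rho> k x" using \<rho>_upper[OF u'] by simp
  qed auto
  then show ?thesis by (simp add: algebra_simps)
qed

text \<open>Twice \<open>L * K\<^sup>2\<close>, from linearizing \<open>S\<close> and from changing
  \<open>Sd\<close>, plus \<open>L * K ^ 3\<close> from linearizing \<open>l1\<close>.\<close>

definition C2 :: real where "C2 = 2 * L * K\<^sup>2 + L * K ^ 3"

lemma C2_nonneg: "0 \<le> C2"
  using L_nonneg K_nonneg by (simp add: C2_def)

text \<open>First-order expansion of one score summand in the parameter. Here \<open>u\<close> is
  the true innovation, and the residual at \<open>t\<close> is
  \<open>u - (S t x - S th x)\<close>.\<close>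

lemma term_expansion:
  assumes t: "\<bar>t - th\<bar> < d k"
  shows "\<bar>l1 (u - (S t x - S th x)) * Sd t x - (l1 u * Sd th x + (t - th) * (l1 u * Sdd th x - l2 u * (Sd th x)\<^sup>2))\<bar>
    \<le> L * \<bar>t - th\<bar> * \<rho> k x + C2 * (t - th)\<^sup>2"
proof -
  define h where "h = t - th"
  define D where "D = S t x - S th x"
  have tin: "t \<in> {a<..<b}" by (rule d_in[OF t])
  have Db: "\<bar>D\<bar> \<le> K * \<bar>h\<bar>" unfolding D_def h_def by (rule S_lipschitz[OF tin th])
  have Sdb: "\<bar>Sd t x\<bar> \<le> K" "\<bar>Sd th x\<bar> \<le> K" using Sd_bound tin th by auto
  have e1: "\<bar>l1 u * (Sd t x - Sd th x - h * Sdd th x)\<bar> \<le> L * (\<rho> k x * \<bar>h\<bar>)"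
    unfolding abs_mult using Sd_taylor[OF t, of x] L_nonneg by (intro mult_mono l1_bound) (auto simp: h_def)
  have e2: "\<bar>(D - h * Sd th x) * Sd t x\<bar> \<le> (K * h\<^sup>2) * K"
    unfolding abs_mult using S_taylor[OF tin, of x] K_nonneg Sdb by (intro mult_mono) (auto simp: h_def D_def)
  have e3: "\<bar>h * Sd th x * (Sd t x - Sd th x)\<bar> \<le> (\<bar>h\<bar> * K) * (K * \<bar>h\<bar>)"
    unfolding abs_mult using Sd_lipschitz[OF tin th, of x] K_nonneg Sdb by (intro mult_mono) (auto simp: h_def)
  have e4: "\<bar>l2 u * ((D - h * Sd th x) * Sd t x + h * Sd th x * (Sd t x - Sd th x))\<bar> \<le> L * ((K * h\<^sup>2) * K + (\<bar>h\<bar> * K) * (K * \<bar>h\<bar>))"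
    unfolding abs_mult[of "l2 u"] using e2 e3 L_nonneg
    by (intro mult_mono l2_bound order_trans[OF abs_triangle_ineq]) auto
  have e5: "\<bar>(l1 (u - D) - l1 u + l2 u * D) * Sd t x\<bar> \<le> (L * (K * \<bar>h\<bar>)\<^sup>2) * K"
    unfolding abs_mult
  proof (intro mult_mono Sdb)
    have "\<bar>l1 (u - D) - l1 u + l2 u * D\<bar> \<le> L * D\<^sup>2" using l1_taylor[of u "- D"] by simp
    also have "\<dots> \<le> L * (K * \<bar>h\<bar>)\<^sup>2" using power_mono[OF Db, of 2] L_nonneg by (simp add: mult_left_mono)
    finally show "\<bar>l1 (u - D) - l1 u + l2 u * D\<bar> \<le> L * (K * \<bar>h\<bar>)\<^sup>2" .
  qed (use L_nonneg in auto)
  \<comment> \<open>The error splits into the remainder of \<open>Sd\<close>, that of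
    \<open>S\<close> together with the change of \<open>Sd\<close>, and that of
    \<open>l1\<close>.\<close>
  have "l1 (u - D) * Sd t x - (l1 u * Sd th x + h * (l1 u * Sdd th x - l2 u * (Sd th x)\<^sup>2)) =
    l1 u * (Sd t x - Sd th x - h * Sdd th x) - l2 u * ((D - h * Sd th x) * Sd t x + h * Sd th x * (Sd t x - Sd th x))
     + (l1 (u - D) - l1 u + l2 u * D) * Sd t x"
    by (simp add: power2_eq_square algebra_simps)
  then have "\<bar>l1 (u - D) * Sd t x - (l1 u * Sd th x + h * (l1 u * Sdd th x - l2 u * (Sd th x)\<^sup>2))\<bar>
     \<le> L * (\<rho> k x * \<bar>h\<bar>) + L * ((K * h\<^sup>2) * K + (\<bar>h\<bar> * K) * (K * \<bar>h\<bar>)) + (L * (K * \<bar>h\<bar>)\<^sup>2) * K"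
    using e1 e4 e5 by linarith
  also have "\<dots> = L * \<bar>h\<bar> * \<rho> k x + C2 * h\<^sup>2"
    by (simp add: C2_def power2_eq_square power3_eq_cube algebra_simps)
  finally show ?thesis unfolding D_def h_def .
qed

end

section \<open>Remainder terms along the sample path\<close>

context model
begin

definition m0 :: real where "m0 = (\<integral>y. m y \<partial>lborel)"

lemma m0_nonneg: "0 \<le> m0"
  unfolding m0_def using m_pos by (intro integral_nonneg_AE AE_I2) (auto intro: less_imp_le)

definition T :: "nat \<Rightarrow> 'w \<Rightarrow> real" where
  "T n \<omega> = (\<integral>y. (Ut n y \<omega>)\<^sup>2 * m y \<partial>lborel)"

lemma T_integrable: "integrable M (T n)" and T_mean: "(\<integral>\<omega>. T n \<omega> \<partial>M) \<le> m0" and T_nonneg: "0 \<le> T n \<omega>"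
proof -
  note fub = P.weighted_fubini[OF Ut_sq_pair Ut_sq_bound m_integrable less_imp_le[OF m_pos]]
  show "integrable M (T n)" unfolding T_def by (rule fub(1))
  have "(\<integral>\<omega>. T n \<omega> \<partial>M) = (\<integral>y. (\<integral>\<omega>. (Ut n y \<omega>)\<^sup>2 \<partial>M) * m y \<partial>lborel)" unfolding T_def by (rule fub(2))
  also have "\<dots> \<le> (\<integral>y. 1 * m y \<partial>lborel)"
  proof (intro integral_mono fub(4) mult_right_mono)
    show "(\<integral>\<omega>. (Ut n y \<omega>)\<^sup>2 \<partial>M) \<le> 1" for y
      using Ut_square_mean(2)[of n y] Fc_le_1[of y] zero_le_power2[of "Fc y"] by linarith
  qed (use m_integrable m_pos in \<open>auto intro: less_imp_le\<close>)
  finally show "(\<integral>\<omega>. T n \<omega> \<partial>M) \<le> m0" by (simp add: m0_def)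
  show "0 \<le> T n \<omega>" unfolding T_def by (intro integral_nonneg_AE AE_I2 mult_nonneg_nonneg less_imp_le[OF m_pos]) simp
qed

text \<open>The total score; \<open>An\<close> below is its part over \<open>X j < y\<close>. In
  these terms the estimator satisfies
  \<open>sqrt n * (est - th) = - Ainf / info th + o(1)\<close>.\<close>

definition Ainf :: "nat \<Rightarrow> 'w \<Rightarrow> real" where
  "Ainf n \<omega> = sc n (Sd th) \<omega>"

definition An :: "nat \<Rightarrow> real \<Rightarrow> 'w \<Rightarrow> real" where
  "An n y \<omega> = sc n (\<lambda>x. Sd th x * (if x < y then 1 else 0)) \<omega>"

lemma Ut_eq: "Ut n y \<omega> = - (An n y \<omega> - Fc y * Ainf n \<omega>) / sqrt (info th)"
proof -
  have "\<psi> y = (\<lambda>x. (- 1 / sqrt (info th)) * (Sd th x * (if x < y then 1 else 0)) + (Fc y / sqrt (info th)) * Sd th x)"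
    by (rule ext) (simp add: \<psi>_def algebra_simps diff_divide_distrib add_divide_distrib)
  then have "Ut n y \<omega> = (- 1 / sqrt (info th)) * An n y \<omega> + (Fc y / sqrt (info th)) * Ainf n \<omega>"
    by (simp only: Ut_def An_def Ainf_def sc_linear)
  then show ?thesis by (simp add: algebra_simps diff_divide_distrib)
qed

text \<open>The parameter derivative, at \<open>th\<close>, of the averaged score terms with
  \<open>X j < y\<close>.\<close>

definition G :: "nat \<Rightarrow> real \<Rightarrow> 'w \<Rightarrow> real" where
  "G n y \<omega> = (\<Sum>j<n. (l1 (e (Suc j) \<omega>) * Sdd th (X j \<omega>) - l2 (e (Suc j) \<omega>) * (Sd th (X j \<omega>))\<^sup>2) *
     (if X j \<omega> < y then 1 else 0)) / real n"

definition \<Gamma> :: "nat \<Rightarrow> 'w \<Rightarrow> real" where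
  "\<Gamma> n \<omega> = (\<integral>y. (G n y \<omega> - info th * Fc y)\<^sup>2 * m y \<partial>lborel)"

definition cG :: real where "cG = L * K + L * K\<^sup>2 + info th"

lemma G_bound: "\<bar>G n y \<omega> - info th * Fc y\<bar> \<le> cG"
proof -
  have t: "\<bar>(l1 u * Sdd th x - l2 u * (Sd th x)\<^sup>2) * (if x < y then 1 else 0)\<bar> \<le> L * K + L * K\<^sup>2" for u x
  proof -
    have "\<bar>l1 u * Sdd th x\<bar> \<le> L * K" "\<bar>l2 u * (Sd th x)\<^sup>2\<bar> \<le> L * K\<^sup>2"
      unfolding abs_mult using Sdd_bound[OF th] Sd_sq[OF th] l1_bound l2_bound L_nonneg by (auto intro!: mult_mono)
    then show ?thesis using L_nonneg K_nonneg by (auto simp: abs_le_iff)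
  qed
  have "\<bar>G n y \<omega>\<bar> \<le> L * K + L * K\<^sup>2"
  proof (cases "n = 0")
    case True
    then show ?thesis using L_nonneg K_nonneg by (simp add: G_def)
  next
    case False
    have "\<bar>\<Sum>j<n. (l1 (e (Suc j) \<omega>) * Sdd th (X j \<omega>) - l2 (e (Suc j) \<omega>) * (Sd th (X j \<omega>))\<^sup>2) *
     (if X j \<omega> < y then 1 else 0)\<bar> \<le> (\<Sum>j<n. L * K + L * K\<^sup>2)"
      by (intro order_trans[OF sum_abs] sum_mono t)
    then show ?thesis using False by (simp add: G_def abs_divide divide_le_eq mult.commute)
  qed
  moreover have "\<bar>info th * Fc y\<bar> \<le> info th"
    using info_pos[OF th] Fc_nonneg[of y] Fc_le_1[of y] by (simp add: abs_mult)
  ultimately show ?thesis unfolding cG_def by linarith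
qed

lemma G_pair [measurable]: "(\<lambda>x. (G n (snd x) (fst x) - info th * Fc (snd x))\<^sup>2) \<in> borel_measurable (M \<Otimes>\<^sub>M borel)"
  unfolding G_def by measurable

lemma G_sq_bound: "\<bar>(G n y \<omega> - info th * Fc y)\<^sup>2\<bar> \<le> cG\<^sup>2"
  using power_mono[OF G_bound, where n=2] by simp

text \<open>The part with \<open>l1\<close> averages to zero because the score is centred; in the
  part with \<open>l2\<close> the information identity produces
  \<open>I0 * J th * Fc y\<close>.\<close>

lemma G_mean_tendsto: "(\<lambda>n. \<integral>\<omega>. (G n y \<omega> - info th * Fc y)\<^sup>2 \<partial>M) \<longlonglongrightarrow> 0"
proof -
  define h1 where "h1 x = Sdd th x * (if x < y then 1 else 0)" for x
  define h2 where "h2 x = (Sd th x)\<^sup>2 * (if x < y then 1 else 0)" for x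
  define u1 where "u1 n \<omega> = (\<Sum>j<n. l1 (e (Suc j) \<omega>) * h1 (X j \<omega>)) / real n" for n \<omega>
  define u2 where "u2 n \<omega> = (\<Sum>j<n. l2 (e (Suc j) \<omega>) * h2 (X j \<omega>)) / real n - (- I0) * (J th * Fc y)" for n \<omega>
  have [measurable]: "h1 \<in> borel_measurable borel" "h2 \<in> borel_measurable borel"
    unfolding h1_def[abs_def] h2_def[abs_def] by measurable
  have hb: "\<bar>h1 x\<bar> \<le> K" "\<bar>h2 x\<bar> \<le> K\<^sup>2" for x
    using Sdd_bound[OF th, of x] Sd_sq[OF th, of x] K_nonneg by (auto simp: h1_def h2_def)
  have lim1: "(\<lambda>n. \<integral>\<omega>. (u1 n \<omega>)\<^sup>2 \<partial>M) \<longlonglongrightarrow> 0"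
    using P.average_L2[of h1 l1 K L, OF _ _ hb(1) l1_bound] by (simp add: u1_def integral_l1_f)
  have h2_int: "(\<integral>x. h2 x * \<phi> th x \<partial>lborel) = J th * Fc y"
    unfolding Fc_integral[symmetric] by (intro Bochner_Integration.integral_cong) (auto simp: h2_def)
  have lim2: "(\<lambda>n. \<integral>\<omega>. (u2 n \<omega>)\<^sup>2 \<partial>M) \<longlonglongrightarrow> 0"
    using P.average_L2[of h2 l2 "K\<^sup>2" L, OF _ _ hb(2) l2_bound] by (simp add: u2_def integral_l2_f h2_int I0_def)
  have [measurable]: "u1 n \<in> borel_measurable M" "u2 n \<in> borel_measurable M" for n
    unfolding u1_def u2_def by measurable
  have ub1: "\<bar>u1 n \<omega>\<bar> \<le> L * K" for n \<omega>
  proof (cases "n = 0")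
    case False
    have "\<bar>\<Sum>j<n. l1 (e (Suc j) \<omega>) * h1 (X j \<omega>)\<bar> \<le> (\<Sum>j<n. L * K)"
      by (intro order_trans[OF sum_abs] sum_mono) (auto simp: abs_mult intro!: mult_mono l1_bound hb L_nonneg)
    then show ?thesis using False by (simp add: u1_def abs_divide divide_le_eq mult.commute)
  qed (use L_nonneg K_nonneg in \<open>simp add: u1_def\<close>)
  have G_eq: "G n y \<omega> - info th * Fc y = u1 n \<omega> - u2 n \<omega>" for n \<omega>
  proof -
    have "G n y \<omega> = (\<Sum>j<n. l1 (e (Suc j) \<omega>) * h1 (X j \<omega>) - l2 (e (Suc j) \<omega>) * h2 (X j \<omega>)) / real n"
      unfolding G_def h1_def h2_def by (intro arg_cong2[where f="(/)"] sum.cong refl) (simp add: algebra_simps)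
    then show ?thesis by (simp add: u1_def u2_def sum_subtractf diff_divide_distrib info_def algebra_simps)
  qed
  have i1: "integrable M (\<lambda>\<omega>. (u1 n \<omega>)\<^sup>2)" for n
    using power_mono[OF ub1, where n=2] by (intro P.integrable_const_bound[of _ "(L * K)\<^sup>2"]) auto
  have ub2: "\<bar>u2 n \<omega>\<bar> \<le> L * K + cG" for n \<omega>
    using ub1[of n \<omega>] G_bound[of n y \<omega>] unfolding G_eq by linarith
  have i2: "integrable M (\<lambda>\<omega>. (u2 n \<omega>)\<^sup>2)" for n
    using power_mono[OF ub2, where n=2] by (intro P.integrable_const_bound[of _ "(L * K + cG)\<^sup>2"]) auto
  have lim: "(\<lambda>n. 2 * (\<integral>\<omega>. (u1 n \<omega>)\<^sup>2 \<partial>M) + 2 * (\<integral>\<omega>. (u2 n \<omega>)\<^sup>2 \<partial>M)) \<longlonglongrightarrow> 0"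
    using tendsto_add[OF tendsto_mult_left[OF lim1, of 2] tendsto_mult_left[OF lim2, of 2]] by simp
  show ?thesis
  proof (rule tendsto_0_le[OF lim])
    fix n
    have pt: "(u1 n \<omega> - u2 n \<omega>)\<^sup>2 \<le> 2 * (u1 n \<omega>)\<^sup>2 + 2 * (u2 n \<omega>)\<^sup>2" for \<omega>
      using zero_le_power2[of "u1 n \<omega> + u2 n \<omega>"] by (simp add: power2_sum power2_diff)
    have "(\<integral>\<omega>. (G n y \<omega> - info th * Fc y)\<^sup>2 \<partial>M) \<le> (\<integral>\<omega>. 2 * (u1 n \<omega>)\<^sup>2 + 2 * (u2 n \<omega>)\<^sup>2 \<partial>M)"
      unfolding G_eq
    proof (intro integral_mono pt)
      show "integrable M (\<lambda>\<omega>. (u1 n \<omega> - u2 n \<omega>)\<^sup>2)"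
        using G_sq_bound[of n y] unfolding G_eq by (intro P.integrable_const_bound[of _ "cG\<^sup>2"]) auto
    qed (use i1 i2 in auto)
    also have "\<dots> = 2 * (\<integral>\<omega>. (u1 n \<omega>)\<^sup>2 \<partial>M) + 2 * (\<integral>\<omega>. (u2 n \<omega>)\<^sup>2 \<partial>M)" using i1 i2 by simp
    finally show "(\<integral>\<omega>. (G n y \<omega> - info th * Fc y)\<^sup>2 \<partial>M) \<le> 2 * (\<integral>\<omega>. (u1 n \<omega>)\<^sup>2 \<partial>M) + 2 * (\<integral>\<omega>. (u2 n \<omega>)\<^sup>2 \<partial>M)" .
  qed simp
qed

text \<open>Fubini reduces the mean of \<Gamma> to the convergence for each \<open>y\<close>, and
  \<open>cG\<^sup>2 * m\<close> dominates.\<close>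

lemma \<Gamma>_integrable: "integrable M (\<Gamma> n)" and \<Gamma>_mean: "(\<lambda>n. \<integral>\<omega>. \<Gamma> n \<omega> \<partial>M) \<longlonglongrightarrow> 0" and \<Gamma>_nonneg: "0 \<le> \<Gamma> n \<omega>"
proof -
  note fub = P.weighted_fubini[where g="\<lambda>\<omega> y. (G _ y \<omega> - info th * Fc y)\<^sup>2", OF G_pair G_sq_bound m_integrable less_imp_le[OF m_pos]]
  show "integrable M (\<Gamma> n)" unfolding \<Gamma>_def by (rule fub(1))
  show "0 \<le> \<Gamma> n \<omega>" unfolding \<Gamma>_def by (intro integral_nonneg_AE AE_I2 mult_nonneg_nonneg less_imp_le[OF m_pos]) simp
  have eq: "(\<integral>\<omega>. \<Gamma> n \<omega> \<partial>M) = (\<integral>y. (\<integral>\<omega>. (G n y \<omega> - info th * Fc y)\<^sup>2 \<partial>M) * m y \<partial>lborel)" for n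
    unfolding \<Gamma>_def by (rule fub(2))
  have "(\<lambda>n. \<integral>y. (\<integral>\<omega>. (G n y \<omega> - info th * Fc y)\<^sup>2 \<partial>M) * m y \<partial>lborel) \<longlonglongrightarrow> (\<integral>y. 0 \<partial>(lborel :: real measure))"
  proof (rule integral_dominated_convergence[where w="\<lambda>y. cG\<^sup>2 * m y"])
    show "(\<lambda>y. (\<integral>\<omega>. (G n y \<omega> - info th * Fc y)\<^sup>2 \<partial>M) * m y) \<in> borel_measurable lborel" for n
      using fub(4) by auto
    show "AE y in lborel. (\<lambda>n. (\<integral>\<omega>. (G n y \<omega> - info th * Fc y)\<^sup>2 \<partial>M) * m y) \<longlonglongrightarrow> 0"
      by (intro AE_I2 tendsto_mult_left_zero G_mean_tendsto)
    show "AE y in lborel. norm ((\<integral>\<omega>. (G n y \<omega> - info th * Fc y)\<^sup>2 \<partial>M) * m y) \<le> cG\<^sup>2 * m y" for n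
    proof (intro AE_I2)
      fix y
      have [measurable]: "(\<lambda>\<omega>. (G n y \<omega> - info th * Fc y)\<^sup>2) \<in> borel_measurable M" unfolding G_def by measurable
      have "(\<integral>\<omega>. (G n y \<omega> - info th * Fc y)\<^sup>2 \<partial>M) \<le> cG\<^sup>2"
        using G_sq_bound[of n y] by (intro P.integral_le_const P.integrable_const_bound[of _ "cG\<^sup>2"]) auto
      moreover have "0 \<le> (\<integral>\<omega>. (G n y \<omega> - info th * Fc y)\<^sup>2 \<partial>M)" by (intro integral_nonneg_AE) simp
      ultimately show "norm ((\<integral>\<omega>. (G n y \<omega> - info th * Fc y)\<^sup>2 \<partial>M) * m y) \<le> cG\<^sup>2 * m y"
        using m_pos[of y] by (simp add: abs_mult mult_right_mono)
    qed
  qed (use m_integrable in auto)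
  then show "(\<lambda>n. \<integral>\<omega>. \<Gamma> n \<omega> \<partial>M) \<longlonglongrightarrow> 0" unfolding eq by simp
qed

text \<open>The empirical oscillation. By stationarity its mean is bounded uniformly in
  \<open>n\<close>, so that \<open>k\<close> can be fixed before \<open>n\<close> grows.\<close>

definition rbar :: "nat \<Rightarrow> nat \<Rightarrow> 'w \<Rightarrow> real" where
  "rbar k n \<omega> = (\<Sum>j<n. \<rho> k (X j \<omega>)) / real n"

lemma rbar_nonneg: "0 \<le> rbar k n \<omega>"
  unfolding rbar_def by (intro divide_nonneg_nonneg sum_nonneg \<rho>_nonneg) auto

lemma rbar_integrable: "integrable M (rbar k n)" and rbar_mean: "(\<integral>\<omega>. rbar k n \<omega> \<partial>M) \<le> (\<integral>x. \<rho> k x * \<phi> th x \<partial>lborel)"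
proof -
  have i: "integrable M (\<lambda>\<omega>. \<rho> k (X j \<omega>))" for j
    using \<rho>_nonneg \<rho>_le by (intro P.integrable_const_bound[of _ "2 * K"]) auto
  then show "integrable M (rbar k n)" unfolding rbar_def by auto
  have "(\<integral>\<omega>. rbar k n \<omega> \<partial>M) = (\<Sum>j<n. \<integral>x. \<rho> k x * \<phi> th x \<partial>lborel) / real n"
    unfolding rbar_def using i by (simp add: Bochner_Integration.integral_sum P.expectation_X)
  moreover have "0 \<le> (\<integral>x. \<rho> k x * \<phi> th x \<partial>lborel)"
    using \<rho>_nonneg \<phi>_nonneg[OF th] by (intro integral_nonneg_AE AE_I2) auto
  ultimately show "(\<integral>\<omega>. rbar k n \<omega> \<partial>M) \<le> (\<integral>x. \<rho> k x * \<phi> th x \<partial>lborel)" by (cases "n = 0") auto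
qed

text \<open>\<open>U_hat\<close> evaluated along the sample path.\<close>
definition Uh :: "nat \<Rightarrow> real \<Rightarrow> real \<Rightarrow> 'w \<Rightarrow> real" where
  "Uh n t y \<omega> = - 1 / sqrt (info t * real n) *
     (\<Sum>j<n. l1 (X (Suc j) \<omega> - S t (X j \<omega>)) * Sd t (X j \<omega>) * (if X j \<omega> < y then 1 else 0))"

text \<open>Summation of \<open>term_expansion\<close>. With
  \<open>sqrt n * \<bar>t - th\<bar>\<close> bounded, the first error is as small as
  \<open>rbar\<close> and the second is of order \<open>1 / sqrt n\<close>.\<close>

lemma Uh_expansion:
  assumes n: "0 < n" and \<omega>: "\<omega> \<in> space M" and t: "\<bar>t - th\<bar> < d k"
  shows "\<bar>- sqrt (info t) * Uh n t y \<omega> - (An n y \<omega> + sqrt (real n) * (t - th) * G n y \<omega>)\<bar>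
    \<le> L * (sqrt (real n) * \<bar>t - th\<bar>) * rbar k n \<omega> + C2 * (sqrt (real n) * (t - th)\<^sup>2)"
proof -
  define s where "s = sqrt (real n)"
  have s: "0 < s" "real n = s * s" using n by (auto simp: s_def)
  define i where "i j = (if X j \<omega> < y then 1 else 0 :: real)" for j
  define a1 where "a1 j = l1 (X (Suc j) \<omega> - S t (X j \<omega>)) * Sd t (X j \<omega>)" for j
  define a2 where "a2 j = l1 (e (Suc j) \<omega>) * Sd th (X j \<omega>)" for j
  define a3 where "a3 j = l1 (e (Suc j) \<omega>) * Sdd th (X j \<omega>) - l2 (e (Suc j) \<omega>) * (Sd th (X j \<omega>))\<^sup>2" for j
  have tin: "t \<in> {a<..<b}" by (rule d_in[OF t])
  have It: "0 < sqrt (info t)" using info_pos[OF tin] by simp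
  have 1: "- sqrt (info t) * Uh n t y \<omega> = (\<Sum>j<n. a1 j * i j) / s"
    using It by (simp add: Uh_def a1_def i_def s_def real_sqrt_mult)
  have 2: "An n y \<omega> = (\<Sum>j<n. a2 j * i j) / s"
    by (simp add: An_def sc_def a2_def i_def s_def mult.assoc)
  have 3: "sqrt (real n) * (t - th) * G n y \<omega> = (\<Sum>j<n. (t - th) * a3 j * i j) / s"
  proof -
    have "G n y \<omega> = (\<Sum>j<n. a3 j * i j) / (s * s)"
      using s(2) by (simp add: G_def a3_def i_def)
    moreover have "s * h * (x / (s * s)) = h * x / s" for h x using s(1) by simp
    ultimately have "sqrt (real n) * (t - th) * G n y \<omega> = (t - th) * (\<Sum>j<n. a3 j * i j) / s"
      unfolding s_def[symmetric] by (simp only:)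
    then show ?thesis by (simp add: sum_distrib_left mult.assoc)
  qed
  have eq: "- sqrt (info t) * Uh n t y \<omega> - (An n y \<omega> + sqrt (real n) * (t - th) * G n y \<omega>) =
     (\<Sum>j<n. (a1 j - (a2 j + (t - th) * a3 j)) * i j) / s"
    unfolding 1 2 3 by (simp add: algebra_simps sum.distrib sum_subtractf add_divide_distrib diff_divide_distrib)
  have "\<bar>(\<Sum>j<n. (a1 j - (a2 j + (t - th) * a3 j)) * i j) / s\<bar> \<le> (\<Sum>j<n. L * \<bar>t - th\<bar> * \<rho> k (X j \<omega>) + C2 * (t - th)\<^sup>2) / s"
    unfolding abs_divide abs_of_pos[OF s(1)]
  proof (intro divide_right_mono order_trans[OF sum_abs] sum_mono)
    fix j
    have res: "X (Suc j) \<omega> - S t (X j \<omega>) = e (Suc j) \<omega> - (S t (X j \<omega>) - S th (X j \<omega>))"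
      using P.X_Suc[OF \<omega>, of j] by simp
    have "\<bar>a1 j - (a2 j + (t - th) * a3 j)\<bar> \<le> L * \<bar>t - th\<bar> * \<rho> k (X j \<omega>) + C2 * (t - th)\<^sup>2"
      unfolding a1_def a2_def a3_def res by (rule term_expansion[OF t])
    moreover have "\<bar>(a1 j - (a2 j + (t - th) * a3 j)) * i j\<bar> \<le> \<bar>a1 j - (a2 j + (t - th) * a3 j)\<bar>"
      by (simp add: i_def)
    ultimately show "\<bar>(a1 j - (a2 j + (t - th) * a3 j)) * i j\<bar> \<le> L * \<bar>t - th\<bar> * \<rho> k (X j \<omega>) + C2 * (t - th)\<^sup>2"
      by linarith
  qed (use s in simp)
  also have "\<dots> = (L * \<bar>t - th\<bar> * (\<Sum>j<n. \<rho> k (X j \<omega>)) + (s * s) * (C2 * (t - th)\<^sup>2)) / s"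
    using s(2) by (simp add: sum.distrib sum_distrib_left)
  also have "\<dots> = L * (s * \<bar>t - th\<bar>) * rbar k n \<omega> + C2 * (s * (t - th)\<^sup>2)"
    using s by (simp add: rbar_def field_simps)
  finally show ?thesis unfolding eq by (simp add: s_def)
qed

text \<open>Constants for \<open>remainder_bound\<close>: \<open>cH\<close> bounds
  \<open>sqrt n * \<bar>t - th\<bar>\<close>, \<open>cE\<close> the expansion error relative to
  \<delta>, \<open>cW\<close> the weight relative to \<open>m\<close>, and \<open>c3\<close>
  collects the total. The ones in \<open>cH\<close> and \<open>cW\<close> come from
  \<open>\<delta> \<le> 1\<close>.\<close>

definition cH :: "real \<Rightarrow> real" where "cH c = (1 + c) / info th"
definition cE :: "real \<Rightarrow> real" where "cE c = L * cH c + C2 * (cH c)\<^sup>2"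
definition cW :: real where "cW = K\<^sup>2 * A / J th + 1"
definition c3 :: "real \<Rightarrow> real" where
  "c3 c = cW * (9 * c + 16 / info th * (m0 + (cH c)\<^sup>2 + (cE c)\<^sup>2 * m0)) + c"

lemma w_le: "w th y \<le> K\<^sup>2 * A / J th * m y"
proof -
  have "(Sd th y)\<^sup>2 * \<phi> th y \<le> K\<^sup>2 * (A * m y)"
    using Sd_sq[OF th, of y] \<phi>_le_m[OF th, of y] \<phi>_nonneg[OF th, of y] by (intro mult_mono) auto
  then show ?thesis using J_pos[OF th] by (simp add: w_def divide_right_mono mult.assoc)
qed

text \<open>A deterministic estimate for one path. The parameter \<open>t\<close> is an arbitrary
  number near \<open>th\<close>, so the dependence of the estimator on the sample does not enter;
  one \<delta> measures all sources of error.\<close>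

lemma remainder_bound:
  assumes n: "0 < n" and \<omega>: "\<omega> \<in> space M" and t: "\<bar>t - th\<bar> < d k" and \<delta>: "0 < \<delta>" "\<delta> \<le> 1" and c: "0 \<le> c"
    and T: "T n \<omega> \<le> c" and Ainf: "\<bar>Ainf n \<omega>\<bar> \<le> c"
    and O: "\<bar>info th * (sqrt (real n) * (t - th)) + Ainf n \<omega>\<bar> \<le> \<delta>"
    and G: "\<Gamma> n \<omega> \<le> \<delta>\<^sup>2" and rb: "rbar k n \<omega> \<le> \<delta>" and sn: "1 / sqrt (real n) \<le> \<delta>"
    and w: "\<And>y. \<bar>w t y - w th y\<bar> \<le> \<delta> * m y" and \<kappa>: "\<bar>sqrt (info th / info t) - 1\<bar> \<le> \<delta>" and it: "info th / 2 \<le> info t"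
  shows "\<bar>(\<integral>y. (Uh n t y \<omega>)\<^sup>2 * w t y \<partial>lborel) - Q n \<omega>\<bar> \<le> c3 c * \<delta>"
proof -
  define H where "H = sqrt (real n) * (t - th)"
  define I where "I = info th"
  \<comment> \<open>The remainder in the representation of the estimator, multiplied by the
    information.\<close>
  define O' where "O' = I * H + Ainf n \<omega>"
  define E where "E y = - sqrt (info t) * Uh n t y \<omega> - (An n y \<omega> + H * G n y \<omega>)" for y
  define g where "g y = G n y \<omega> - I * Fc y" for y
  have I: "0 < I" using info_pos[OF th] by (simp add: I_def)
  have tin: "t \<in> {a<..<b}" by (rule d_in[OF t])
  have It: "0 < info t" by (rule info_pos[OF tin])
  have O'_le: "\<bar>O'\<bar> \<le> \<delta>" using O by (simp add: O'_def H_def I_def)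
  have H_le: "\<bar>H\<bar> \<le> cH c"
  proof -
    have "I * \<bar>H\<bar> = \<bar>O' - Ainf n \<omega>\<bar>" using I by (simp add: O'_def abs_mult)
    also have "\<dots> \<le> 1 + c" using O'_le Ainf \<delta> by linarith
    finally show ?thesis using I by (simp add: cH_def I_def field_simps)
  qed
  have cH0: "0 \<le> cH c" using H_le by linarith
  have cE0: "0 \<le> cE c" using cH0 L_nonneg C2_nonneg by (simp add: cE_def)
  have E_le: "\<bar>E y\<bar> \<le> cE c * \<delta>" for y
  proof -
    have "\<bar>E y\<bar> \<le> L * (sqrt (real n) * \<bar>t - th\<bar>) * rbar k n \<omega> + C2 * (sqrt (real n) * (t - th)\<^sup>2)"
      using Uh_expansion[OF n \<omega> t, of y] by (simp add: E_def H_def)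
    moreover have "sqrt (real n) * \<bar>t - th\<bar> = \<bar>H\<bar>" by (simp add: H_def abs_mult)
    moreover have "sqrt (real n) * (t - th)\<^sup>2 = H\<^sup>2 * (1 / sqrt (real n))"
    proof -
      have "x * z\<^sup>2 = (x * z)\<^sup>2 * (1 / x)" if "x \<noteq> 0" for x z :: real
        using that by (simp add: power2_eq_square)
      then show ?thesis unfolding H_def using n by simp
    qed
    ultimately have "\<bar>E y\<bar> \<le> L * \<bar>H\<bar> * rbar k n \<omega> + C2 * (H\<^sup>2 * (1 / sqrt (real n)))" by simp
    also have "L * \<bar>H\<bar> * rbar k n \<omega> + C2 * (H\<^sup>2 * (1 / sqrt (real n))) \<le> L * cH c * \<delta> + C2 * ((cH c)\<^sup>2 * \<delta>)"
      using H_le rb sn L_nonneg C2_nonneg cH0 rbar_nonneg[of k n \<omega>] power_mono[OF H_le, of 2]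
      by (intro add_mono mult_mono mult_left_mono mult_nonneg_nonneg) auto
    finally show ?thesis by (simp add: cE_def algebra_simps)
  qed
  define \<kappa>' where "\<kappa>' = sqrt (info th / info t) - 1"
  \<comment> \<open>\<open>I * H * Fc y\<close> from the limit of \<open>G\<close> meets
    \<open>Fc y * Ainf\<close> from \<open>An\<close>; they combine to \<open>O' * Fc y\<close>,
    which is small. Only the change of normalization \<open>\<kappa>'\<close> still multiplies
    \<open>Ut\<close>.\<close>
  have diff: "Uh n t y \<omega> - Ut n y \<omega> = \<kappa>' * Ut n y \<omega> - (O' * Fc y + H * g y + E y) / sqrt (info t)" for y
  proof -
    have st: "0 < sqrt (info t)" and sI: "0 < sqrt I" using It I by auto
    have U1: "Uh n t y \<omega> = - (An n y \<omega> + H * G n y \<omega> + E y) / sqrt (info t)"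
      using st by (simp add: E_def)
    have "An n y \<omega> = Fc y * Ainf n \<omega> - sqrt I * Ut n y \<omega>"
      using sI by (simp add: Ut_eq I_def)
    then have "Uh n t y \<omega> = (sqrt I * Ut n y \<omega> - (O' * Fc y + H * g y + E y)) / sqrt (info t)"
      unfolding U1 by (simp add: O'_def g_def algebra_simps)
    then show ?thesis
      using st by (simp add: \<kappa>'_def I_def real_sqrt_divide diff_divide_distrib algebra_simps)
  qed
  have sq_diff: "(Uh n t y \<omega> - Ut n y \<omega>)\<^sup>2 \<le>
      4 * (\<delta>\<^sup>2 * (Ut n y \<omega>)\<^sup>2 + 2 / I * (\<delta>\<^sup>2 + (cH c)\<^sup>2 * (g y)\<^sup>2 + (cE c)\<^sup>2 * \<delta>\<^sup>2))" for y
  proof -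
    \<comment> \<open>The Cauchy-Schwarz inequality for four summands, with the defect written as a
      sum of squares.\<close>
    have four: "(p - (q + r + s) / z)\<^sup>2 \<le> 4 * (p\<^sup>2 + (q\<^sup>2 + r\<^sup>2 + s\<^sup>2) / z\<^sup>2)" for p q r s z :: real
    proof -
      have "(p - (q' + r' + s'))\<^sup>2 \<le> 4 * (p\<^sup>2 + (q'\<^sup>2 + r'\<^sup>2 + s'\<^sup>2))" for q' r' s'
      proof -
        have "4 * (p\<^sup>2 + (q'\<^sup>2 + r'\<^sup>2 + s'\<^sup>2)) - (p - (q' + r' + s'))\<^sup>2 =
          (p + q')\<^sup>2 + (p + r')\<^sup>2 + (p + s')\<^sup>2 + (q' - r')\<^sup>2 + (q' - s')\<^sup>2 + (r' - s')\<^sup>2"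
          by (simp add: power2_eq_square algebra_simps)
        also have "0 \<le> \<dots>" by simp
        finally show ?thesis by simp
      qed
      from this[of "q / z" "r / z" "s / z"] show ?thesis by (simp add: power_divide add_divide_distrib)
    qed
    have "(Uh n t y \<omega> - Ut n y \<omega>)\<^sup>2 \<le> 4 * ((\<kappa>' * Ut n y \<omega>)\<^sup>2 + ((O' * Fc y)\<^sup>2 + (H * g y)\<^sup>2 + (E y)\<^sup>2) / (sqrt (info t))\<^sup>2)"
      unfolding diff by (rule four)
    also have "(sqrt (info t))\<^sup>2 = info t" using It by simp
    finally have s1: "(Uh n t y \<omega> - Ut n y \<omega>)\<^sup>2 \<le> 4 * ((\<kappa>' * Ut n y \<omega>)\<^sup>2 + ((O' * Fc y)\<^sup>2 + (H * g y)\<^sup>2 + (E y)\<^sup>2) / info t)" .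
    have s2: "((O' * Fc y)\<^sup>2 + (H * g y)\<^sup>2 + (E y)\<^sup>2) / info t \<le> (\<delta>\<^sup>2 + (cH c)\<^sup>2 * (g y)\<^sup>2 + (cE c)\<^sup>2 * \<delta>\<^sup>2) / (I / 2)"
    proof (rule frac_le)
      have 1: "(O' * Fc y)\<^sup>2 \<le> \<delta>\<^sup>2"
      proof -
        have "\<bar>O' * Fc y\<bar> \<le> \<delta> * 1"
          unfolding abs_mult using O'_le \<delta> Fc_nonneg[of y] Fc_le_1[of y] by (intro mult_mono) auto
        from power_mono[OF this, of 2] show ?thesis by simp
      qed
      have 2: "(H * g y)\<^sup>2 \<le> (cH c)\<^sup>2 * (g y)\<^sup>2"
        unfolding power_mult_distrib using power_mono[OF H_le, of 2] by (intro mult_right_mono) auto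
      have 3: "(E y)\<^sup>2 \<le> (cE c)\<^sup>2 * \<delta>\<^sup>2"
        using power_mono[OF E_le[of y], of 2] by (simp add: power_mult_distrib)
      show "(O' * Fc y)\<^sup>2 + (H * g y)\<^sup>2 + (E y)\<^sup>2 \<le> \<delta>\<^sup>2 + (cH c)\<^sup>2 * (g y)\<^sup>2 + (cE c)\<^sup>2 * \<delta>\<^sup>2"
        using 1 2 3 by linarith
    qed (use it I in \<open>auto simp: I_def\<close>)
    have s3: "(\<kappa>' * Ut n y \<omega>)\<^sup>2 \<le> \<delta>\<^sup>2 * (Ut n y \<omega>)\<^sup>2"
      unfolding power_mult_distrib using power_mono[of "\<bar>\<kappa>'\<bar>" \<delta> 2] \<kappa> by (intro mult_right_mono) (auto simp: \<kappa>'_def)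
    have s4: "(\<delta>\<^sup>2 + (cH c)\<^sup>2 * (g y)\<^sup>2 + (cE c)\<^sup>2 * \<delta>\<^sup>2) / (I / 2) = 2 / I * (\<delta>\<^sup>2 + (cH c)\<^sup>2 * (g y)\<^sup>2 + (cE c)\<^sup>2 * \<delta>\<^sup>2)"
      by simp
    show ?thesis by (rule order_trans[OF s1 mult_left_mono[OF add_mono[OF s3 s2[unfolded s4]]]]) simp
  qed
  have cW: "1 \<le> cW" using A_nonneg J_pos[OF th] by (simp add: cW_def)
  have w_t: "0 \<le> w t y" "w t y \<le> cW * m y" for y
  proof -
    show "0 \<le> w t y" by (rule w_nonneg[OF tin])
    have "w t y \<le> w th y + \<delta> * m y" using w[of y] by linarith
    also have "\<dots> \<le> K\<^sup>2 * A / J th * m y + 1 * m y"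
      using w_le[of y] \<delta> m_pos[of y] by (intro add_mono mult_right_mono) auto
    finally show "w t y \<le> cW * m y" by (simp add: cW_def algebra_simps)
  qed
  define B1 where "B1 = cW * 9 * \<delta> + \<delta>"
  \<comment> \<open>The factor \<open>1 / \<delta>\<close> stems from the weighted
    arithmetic-geometric inequality below; it is compensated by
    \<open>\<Gamma> n \<omega> \<le> \<delta>\<^sup>2\<close>.\<close>
  define B2 where "B2 = cW * (16 / I * (cH c)\<^sup>2) / \<delta>"
  define B3 where "B3 = cW * (16 / I * (1 + (cE c)\<^sup>2)) * \<delta>"
  have pt: "\<bar>(Uh n t y \<omega>)\<^sup>2 * w t y - (Ut n y \<omega>)\<^sup>2 * w th y\<bar> \<le>
      B1 * ((Ut n y \<omega>)\<^sup>2 * m y) + B2 * ((g y)\<^sup>2 * m y) + B3 * m y" for y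
  proof -
    define u where "u = \<bar>Ut n y \<omega>\<bar>"
    define v where "v = \<bar>Uh n t y \<omega> - Ut n y \<omega>\<bar>"
    have eq1: "(Uh n t y \<omega>)\<^sup>2 - (Ut n y \<omega>)\<^sup>2 = (Uh n t y \<omega> - Ut n y \<omega>)\<^sup>2 + 2 * Ut n y \<omega> * (Uh n t y \<omega> - Ut n y \<omega>)"
      by (simp add: power2_eq_square algebra_simps)
    have "\<bar>(Uh n t y \<omega>)\<^sup>2 - (Ut n y \<omega>)\<^sup>2\<bar> \<le> v\<^sup>2 + 2 * u * v"
      unfolding eq1 by (rule order_trans[OF abs_triangle_ineq]) (simp add: u_def v_def abs_mult)
    \<comment> \<open>Weighting by \<delta> leaves a small multiple of \<open>u\<^sup>2\<close>,
      whose integral is merely bounded, and puts \<open>1 / \<delta>\<close> on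
      \<open>v\<^sup>2\<close>, which is of smaller order.\<close>
    moreover have "2 * u * v \<le> \<delta> * u\<^sup>2 + v\<^sup>2 / \<delta>"
    proof -
      have "0 \<le> (\<delta> * u - v)\<^sup>2 / \<delta>" using \<delta> by simp
      also have "\<dots> = \<delta> * u\<^sup>2 + v\<^sup>2 / \<delta> - 2 * u * v" using \<delta> by (simp add: power2_diff field_simps power2_eq_square)
      finally show ?thesis by simp
    qed
    moreover have "v\<^sup>2 + (\<delta> * u\<^sup>2 + v\<^sup>2 / \<delta>) \<le> \<delta> * u\<^sup>2 + 2 / \<delta> * v\<^sup>2"
    proof -
      have "v\<^sup>2 \<le> v\<^sup>2 / \<delta>" using \<delta> by (simp add: le_divide_eq mult_left_le)
      then show ?thesis by simp
    qed
    ultimately have "\<bar>(Uh n t y \<omega>)\<^sup>2 - (Ut n y \<omega>)\<^sup>2\<bar> \<le> \<delta> * u\<^sup>2 + 2 / \<delta> * v\<^sup>2"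
      by linarith
    also have "\<dots> \<le> \<delta> * u\<^sup>2 + 2 / \<delta> * (4 * (\<delta>\<^sup>2 * u\<^sup>2 + 2 / I * (\<delta>\<^sup>2 + (cH c)\<^sup>2 * (g y)\<^sup>2 + (cE c)\<^sup>2 * \<delta>\<^sup>2)))"
      using sq_diff[of y] \<delta> by (intro add_left_mono mult_left_mono) (auto simp: u_def v_def)
    also have "\<dots> = 9 * \<delta> * u\<^sup>2 + 16 / I * (cH c)\<^sup>2 / \<delta> * (g y)\<^sup>2 + 16 / I * (1 + (cE c)\<^sup>2) * \<delta>"
      using \<delta> I by (simp add: field_simps power2_eq_square)
    finally have sq: "\<bar>(Uh n t y \<omega>)\<^sup>2 - (Ut n y \<omega>)\<^sup>2\<bar> \<le>
      9 * \<delta> * u\<^sup>2 + 16 / I * (cH c)\<^sup>2 / \<delta> * (g y)\<^sup>2 + 16 / I * (1 + (cE c)\<^sup>2) * \<delta>" (is "_ \<le> ?R") .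
    have eq2: "(Uh n t y \<omega>)\<^sup>2 * w t y - (Ut n y \<omega>)\<^sup>2 * w th y =
       ((Uh n t y \<omega>)\<^sup>2 - (Ut n y \<omega>)\<^sup>2) * w t y + (Ut n y \<omega>)\<^sup>2 * (w t y - w th y)" by (simp add: algebra_simps)
    have "\<bar>(Uh n t y \<omega>)\<^sup>2 * w t y - (Ut n y \<omega>)\<^sup>2 * w th y\<bar> \<le> ?R * (cW * m y) + u\<^sup>2 * (\<delta> * m y)"
      unfolding eq2
    proof (intro order_trans[OF abs_triangle_ineq] add_mono)
      show "\<bar>((Uh n t y \<omega>)\<^sup>2 - (Ut n y \<omega>)\<^sup>2) * w t y\<bar> \<le> ?R * (cW * m y)"
        unfolding abs_mult using sq w_t[of y] order_trans[OF abs_ge_zero sq] by (intro mult_mono) auto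
      show "\<bar>(Ut n y \<omega>)\<^sup>2 * (w t y - w th y)\<bar> \<le> u\<^sup>2 * (\<delta> * m y)"
        unfolding abs_mult using w[of y] by (intro mult_mono) (auto simp: u_def)
    qed
    also have "\<dots> = B1 * ((Ut n y \<omega>)\<^sup>2 * m y) + B2 * ((g y)\<^sup>2 * m y) + B3 * m y"
      by (simp add: B1_def B2_def B3_def u_def algebra_simps)
    finally show ?thesis .
  qed
  have iT: "integrable lborel (\<lambda>y. (Ut n y \<omega>)\<^sup>2 * m y)"
    by (rule P.weighted_fubini(3)[OF Ut_sq_pair Ut_sq_bound m_integrable less_imp_le[OF m_pos] \<omega>])
  have ig: "integrable lborel (\<lambda>y. (g y)\<^sup>2 * m y)"
    unfolding g_def I_def by (rule P.weighted_fubini(3)[where g="\<lambda>\<omega> y. (G n y \<omega> - info th * Fc y)\<^sup>2", OF G_pair G_sq_bound m_integrable less_imp_le[OF m_pos] \<omega>])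
  have iQ: "integrable lborel (\<lambda>y. (Ut n y \<omega>)\<^sup>2 * w th y)"
    by (rule P.weighted_fubini(3)[OF Ut_sq_pair Ut_sq_bound w_integrable[OF th] w_nonneg[OF th] \<omega>])
  \<comment> \<open>The pointwise comparison \<open>pt\<close> itself provides the integrable
    majorant.\<close>
  have iU: "integrable lborel (\<lambda>y. (Uh n t y \<omega>)\<^sup>2 * w t y)"
  proof (rule Bochner_Integration.integrable_bound)
    show "integrable lborel (\<lambda>y. (B1 * ((Ut n y \<omega>)\<^sup>2 * m y) + B2 * ((g y)\<^sup>2 * m y) + B3 * m y) + (Ut n y \<omega>)\<^sup>2 * w th y)"
      using iT ig iQ m_integrable by auto
    have [measurable]: "w t \<in> borel_measurable borel" using w_integrable[OF tin] by auto
    show "(\<lambda>y. (Uh n t y \<omega>)\<^sup>2 * w t y) \<in> borel_measurable lborel" unfolding Uh_def by measurable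
    show "AE y in lborel. norm ((Uh n t y \<omega>)\<^sup>2 * w t y) \<le> norm ((B1 * ((Ut n y \<omega>)\<^sup>2 * m y) + B2 * ((g y)\<^sup>2 * m y) + B3 * m y) + (Ut n y \<omega>)\<^sup>2 * w th y)"
    proof (intro AE_I2)
      fix y
      have "0 \<le> (Uh n t y \<omega>)\<^sup>2 * w t y" using w_t by simp
      then show "norm ((Uh n t y \<omega>)\<^sup>2 * w t y) \<le> norm ((B1 * ((Ut n y \<omega>)\<^sup>2 * m y) + B2 * ((g y)\<^sup>2 * m y) + B3 * m y) + (Ut n y \<omega>)\<^sup>2 * w th y)"
        using pt[of y] unfolding real_norm_def by linarith
    qed
  qed
  have "\<bar>(\<integral>y. (Uh n t y \<omega>)\<^sup>2 * w t y \<partial>lborel) - Q n \<omega>\<bar> = \<bar>\<integral>y. (Uh n t y \<omega>)\<^sup>2 * w t y - (Ut n y \<omega>)\<^sup>2 * w th y \<partial>lborel\<bar>"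
    unfolding Q_def using iU iQ by simp
  also have "\<dots> \<le> (\<integral>y. \<bar>(Uh n t y \<omega>)\<^sup>2 * w t y - (Ut n y \<omega>)\<^sup>2 * w th y\<bar> \<partial>lborel)" by (rule integral_abs_bound)
  also have "\<dots> \<le> (\<integral>y. B1 * ((Ut n y \<omega>)\<^sup>2 * m y) + B2 * ((g y)\<^sup>2 * m y) + B3 * m y \<partial>lborel)"
    using iU iQ iT ig m_integrable by (intro integral_mono pt) auto
  also have "\<dots> = B1 * T n \<omega> + B2 * \<Gamma> n \<omega> + B3 * m0"
    using iT ig m_integrable by (simp add: T_def \<Gamma>_def m0_def g_def I_def)
  also have "\<dots> \<le> B1 * c + B2 * \<delta>\<^sup>2 + B3 * m0"
  proof (intro add_mono mult_left_mono T G order_refl)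
    show "0 \<le> B1" "0 \<le> B2" "0 \<le> B3" using \<delta> cW I by (auto simp: B1_def B2_def B3_def)
  qed
  also have "\<dots> = c3 c * \<delta>"
    using \<delta> I by (simp add: B1_def B2_def B3_def c3_def I_def[symmetric] power2_eq_square field_simps)
  finally show ?thesis .
qed


theorem statistic_close:
  fixes est :: "nat \<Rightarrow> 'w \<Rightarrow> real"
  assumes est_meas: "\<And>n. 0 < n \<Longrightarrow> est n \<in> borel_measurable M"
    and consistent: "conv_in_prob M est th"
    and representation: "conv_in_prob M (\<lambda>n \<omega>. sqrt (real n) * (est n \<omega> - th) + Ainf n \<omega> / info th) 0"
    and \<epsilon>: "0 < \<epsilon>" and \<zeta>: "0 < \<zeta>"
  shows "whp M \<zeta> (\<lambda>n \<omega>. \<bar>(\<integral>y. (Uh n (est n \<omega>) y \<omega>)\<^sup>2 * w (est n \<omega>) y \<partial>lborel) - Q n \<omega>\<bar> \<le> \<epsilon>)"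
proof -
  define I where "I = info th"
  have I: "0 < I" using info_pos[OF th] by (simp add: I_def)
  \<comment> \<open>Seven exceptional events are united, each of probability at most
    \<open>\<zeta> / 8\<close>.\<close>
  define \<zeta>' where "\<zeta>' = \<zeta> / 8"
  have \<zeta>': "0 < \<zeta>'" using \<zeta> by (simp add: \<zeta>'_def)
  \<comment> \<open>Large enough for Markov's inequality: \<open>T\<close> has mean at most
    \<open>m0\<close> and \<open>Ainf\<^sup>2\<close> mean at most \<open>info th\<close>. The lower
    bound one allows passing from \<open>Ainf\<^sup>2 \<le> c\<close> to
    \<open>\<bar>Ainf\<bar> \<le> c\<close>.\<close>
  define c where "c = max 1 (max (m0 / \<zeta>') (I / \<zeta>'))"
  have c: "1 \<le> c" "m0 \<le> \<zeta>' * c" "I \<le> \<zeta>' * c"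
  proof -
    show "1 \<le> c" by (simp add: c_def)
    have "m0 / \<zeta>' \<le> c" "I / \<zeta>' \<le> c" unfolding c_def by (simp_all add: le_max_iff_disj)
    then show "m0 \<le> \<zeta>' * c" "I \<le> \<zeta>' * c" using \<zeta>' by (simp_all add: pos_divide_le_eq mult.commute)
  qed
  have c30: "0 \<le> c3 c"
  proof -
    have "1 \<le> cW" using A_nonneg J_pos[OF th] by (simp add: cW_def)
    then show ?thesis unfolding c3_def using c m0_nonneg I
      by (intro add_nonneg_nonneg mult_nonneg_nonneg divide_nonneg_nonneg) (auto simp: I_def)
  qed
  define \<delta> where "\<delta> = min 1 (\<epsilon> / (c3 c + 1))"
  have \<delta>: "0 < \<delta>" "\<delta> \<le> 1" "c3 c * \<delta> \<le> \<epsilon>"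
  proof -
    show "0 < \<delta>" "\<delta> \<le> 1" using \<epsilon> c30 by (auto simp: \<delta>_def)
    have "\<delta> \<le> \<epsilon> / (c3 c + 1)" unfolding \<delta>_def by (rule min.cobounded2)
    then have "\<delta> * (c3 c + 1) \<le> \<epsilon>" using c30 by (subst (asm) pos_le_divide_eq) auto
    then show "c3 c * \<delta> \<le> \<epsilon>" using \<open>0 < \<delta>\<close> by (simp add: algebra_simps)
  qed
  have "\<forall>\<^sub>F k in sequentially. (\<integral>x. \<rho> k x * \<phi> th x \<partial>lborel) < \<zeta>' * \<delta>"
    using \<zeta>' \<delta> by (intro order_tendstoD[OF \<rho>_mean_tendsto]) auto
  \<comment> \<open>The radius index is fixed here, independently of \<open>n\<close>; consistency
    then moves the estimator into the corresponding neighbourhood.\<close>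
  then obtain k :: nat where k: "(\<integral>x. \<rho> k x * \<phi> th x \<partial>lborel) < \<zeta>' * \<delta>"
    by (auto simp: eventually_sequentially)
  obtain \<delta>0 where \<delta>0: "0 < \<delta>0" "\<And>t. t \<in> {a<..<b} \<Longrightarrow> \<bar>t - th\<bar> < \<delta>0 \<Longrightarrow> (\<forall>y. \<bar>w t y - w th y\<bar> \<le> \<delta> * m y) \<and>
     \<bar>sqrt (info th / info t) - 1\<bar> \<le> \<delta> \<and> info th / 2 \<le> info t"
    using w_continuous[OF \<delta>(1)] by blast
  define r0 where "r0 = min (\<delta>0 / 2) (d k / 2)"
  have r0: "0 < r0" "r0 < \<delta>0" "r0 < d k" using \<delta>0(1) d_pos[of k] by (auto simp: r0_def min_def)
  have h1: "whp M \<zeta>' (\<lambda>n \<omega>. T n \<omega> \<le> c)"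
    using T_mean c by (intro P.whp_markov T_integrable T_nonneg always_eventually allI) (auto intro: order_trans)
  have h2: "whp M \<zeta>' (\<lambda>n \<omega>. (Ainf n \<omega>)\<^sup>2 \<le> c)"
  proof (intro P.whp_markov always_eventually allI)
    have "\<bar>Sd th x\<bar> \<le> K" for x by (rule Sd_bound[OF th])
    note sm = sc_second_moment[of "Sd th", OF meas_th(2) this]
    show "integrable M (\<lambda>\<omega>. (Ainf n \<omega>)\<^sup>2)" for n using sm(1) by (simp add: Ainf_def)
    show "(\<integral>\<omega>. (Ainf n \<omega>)\<^sup>2 \<partial>M) \<le> \<zeta>' * c" for n
      using sm(2)[of n] c(3) by (simp add: Ainf_def I_def info_def J_def)
  qed (use c in auto)
  have h3: "whp M \<zeta>' (\<lambda>n \<omega>. \<Gamma> n \<omega> \<le> \<delta>\<^sup>2)"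
  proof (intro P.whp_markov \<Gamma>_integrable \<Gamma>_nonneg)
    have "\<forall>\<^sub>F n in sequentially. (\<integral>\<omega>. \<Gamma> n \<omega> \<partial>M) < \<zeta>' * \<delta>\<^sup>2"
      using \<zeta>' \<delta> by (intro order_tendstoD[OF \<Gamma>_mean]) auto
    then show "\<forall>\<^sub>F n in sequentially. (\<integral>\<omega>. \<Gamma> n \<omega> \<partial>M) \<le> \<zeta>' * \<delta>\<^sup>2" by eventually_elim simp
  qed (use \<delta> in simp)
  have h4: "whp M \<zeta>' (\<lambda>n \<omega>. rbar k n \<omega> \<le> \<delta>)"
    using rbar_mean[of k] k \<delta> by (intro P.whp_markov rbar_integrable rbar_nonneg always_eventually allI)
      (auto intro: order_trans less_imp_le)
  have h5: "whp M \<zeta>' (\<lambda>n \<omega>. \<bar>est n \<omega> - th\<bar> \<le> r0)"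
    by (rule P.whp_conv_in_prob[OF consistent est_meas r0(1) \<zeta>'])
  have [measurable]: "Ainf n \<in> borel_measurable M" for n unfolding Ainf_def[abs_def] by (rule sc_measurable) simp
  have h6: "whp M \<zeta>' (\<lambda>n \<omega>. \<bar>sqrt (real n) * (est n \<omega> - th) + Ainf n \<omega> / info th - 0\<bar> \<le> \<delta> / I)"
  proof (rule P.whp_conv_in_prob[OF representation _ _ \<zeta>'])
    show "(\<lambda>\<omega>. sqrt (real n) * (est n \<omega> - th) + Ainf n \<omega> / info th) \<in> borel_measurable M" if "0 < n" for n
    proof -
      have [measurable]: "est n \<in> borel_measurable M" by (rule est_meas) fact
      show ?thesis by measurable
    qed
  qed (use \<delta> I in simp)
  have h7: "whp M \<zeta>' (\<lambda>n \<omega>. 1 / sqrt (real n) \<le> \<delta>)"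
  proof (rule whp_sure)
    have "(\<lambda>n. 1 / sqrt (real n)) \<longlonglongrightarrow> 0" by real_asymp
    then have "\<forall>\<^sub>F n in sequentially. 1 / sqrt (real n) < \<delta>" using \<delta> by (intro order_tendstoD)
    then show "\<forall>\<^sub>F n in sequentially. \<forall>\<omega>\<in>space M. 1 / sqrt (real n) \<le> \<delta>" by eventually_elim simp
  qed (use \<zeta>' in simp)
  have "whp M (\<zeta>' + (\<zeta>' + (\<zeta>' + (\<zeta>' + (\<zeta>' + (\<zeta>' + \<zeta>')))))) (\<lambda>n \<omega>. \<bar>(\<integral>y. (Uh n (est n \<omega>) y \<omega>)\<^sup>2 * w (est n \<omega>) y \<partial>lborel) - Q n \<omega>\<bar> \<le> \<epsilon>)"
  proof (rule whp_mono[OF P.whp_conj[OF h1 P.whp_conj[OF h2 P.whp_conj[OF h3 P.whp_conj[OF h4 P.whp_conj[OF h5 P.whp_conj[OF h6 h7]]]]]]])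
    fix n :: nat and \<omega> assume n: "0 < n" and \<omega>: "\<omega> \<in> space M"
    assume H: "T n \<omega> \<le> c \<and> (Ainf n \<omega>)\<^sup>2 \<le> c \<and> \<Gamma> n \<omega> \<le> \<delta>\<^sup>2 \<and> rbar k n \<omega> \<le> \<delta> \<and> \<bar>est n \<omega> - th\<bar> \<le> r0 \<and>
        \<bar>sqrt (real n) * (est n \<omega> - th) + Ainf n \<omega> / info th - 0\<bar> \<le> \<delta> / I \<and> 1 / sqrt (real n) \<le> \<delta>"
    define t where "t = est n \<omega>"
    have td: "\<bar>t - th\<bar> < d k" and t0: "\<bar>t - th\<bar> < \<delta>0" using H r0 by (auto simp: t_def)
    have tin: "t \<in> {a<..<b}" by (rule d_in[OF td])
    have "\<bar>(\<integral>y. (Uh n t y \<omega>)\<^sup>2 * w t y \<partial>lborel) - Q n \<omega>\<bar> \<le> c3 c * \<delta>"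
    proof (rule remainder_bound[OF n \<omega> td \<delta>(1,2)])
      show "\<bar>Ainf n \<omega>\<bar> \<le> c"
      proof (rule power2_le_imp_le)
        have "(Ainf n \<omega>)\<^sup>2 \<le> c" using H by simp
        also have "c \<le> c\<^sup>2" using c(1) by (simp add: power2_eq_square)
        finally show "\<bar>Ainf n \<omega>\<bar>\<^sup>2 \<le> c\<^sup>2" by simp
      qed (use c in simp)
      have "info th * (sqrt (real n) * (t - th)) + Ainf n \<omega> = I * (sqrt (real n) * (t - th) + Ainf n \<omega> / info th)"
        using I by (simp add: I_def distrib_left)
      moreover have "\<bar>I * (sqrt (real n) * (t - th) + Ainf n \<omega> / info th)\<bar> \<le> I * (\<delta> / I)"
        unfolding abs_mult using H I by (intro mult_mono) (auto simp: t_def)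
      ultimately show "\<bar>info th * (sqrt (real n) * (t - th)) + Ainf n \<omega>\<bar> \<le> \<delta>" using I by simp
    qed (use H c \<delta>0(2)[OF tin t0] in auto)
    also note \<delta>(3)
    finally show "\<bar>(\<integral>y. (Uh n (est n \<omega>) y \<omega>)\<^sup>2 * w (est n \<omega>) y \<partial>lborel) - Q n \<omega>\<bar> \<le> \<epsilon>"
      by (simp add: t_def)
  qed
  moreover have "\<zeta>' + (\<zeta>' + (\<zeta>' + (\<zeta>' + (\<zeta>' + (\<zeta>' + \<zeta>'))))) \<le> \<zeta>" using \<zeta> by (simp add: \<zeta>'_def)
  ultimately show ?thesis unfolding whp_def by (meson order_trans)
qed

end

subsection \<open>The test\<close>

text \<open>For \<open>1 \<le> \<bar>x\<bar>\<close>, \<open>1 + \<bar>x\<bar>\<close> is at most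
  \<open>2 * \<bar>x\<bar>\<close>; otherwise the constant \<open>D\<close> takes over. The factor
  \<open>2 powr (1 + r)\<close> accounts for both cases.\<close>

lemma polynomial_tail_bound:
  fixes r C D :: real
  assumes r: "0 < r" and C: "0 \<le> C" and D: "0 \<le> D" and D_le: "p \<le> D"
    and C_le: "x \<noteq> 0 \<Longrightarrow> p \<le> C * \<bar>x\<bar> powr (- 1 - r)"
  shows "p \<le> ((C + D) * 2 powr (1 + r)) * (1 + \<bar>x\<bar>) powr (- 1 - r)"
proof (cases "1 \<le> \<bar>x\<bar>")
  case True
  have "\<bar>x\<bar> powr (- 1 - r) \<le> ((1 + \<bar>x\<bar>) / 2) powr (- 1 - r)"
    using True r by (intro powr_mono2') auto
  also have "\<dots> = 2 powr (1 + r) * (1 + \<bar>x\<bar>) powr (- 1 - r)"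
    using powr_minus_divide[of 2 "1 + r"] by (simp add: powr_divide)
  finally have 1: "\<bar>x\<bar> powr (- 1 - r) \<le> 2 powr (1 + r) * (1 + \<bar>x\<bar>) powr (- 1 - r)" .
  have "p \<le> C * \<bar>x\<bar> powr (- 1 - r)" using C_le True by auto
  also have "\<dots> \<le> (C + D) * (2 powr (1 + r) * (1 + \<bar>x\<bar>) powr (- 1 - r))"
    using 1 C D by (intro mult_mono) auto
  finally show ?thesis by (simp add: mult.assoc)
next
  case False
  have "2 powr (- 1 - r) \<le> (1 + \<bar>x\<bar>) powr (- 1 - r)"
    using False r by (intro powr_mono2') auto
  then have "2 powr (1 + r) * 2 powr (- 1 - r) \<le> 2 powr (1 + r) * (1 + \<bar>x\<bar>) powr (- 1 - r)"
    by (intro mult_left_mono) auto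
  then have 1: "1 \<le> 2 powr (1 + r) * (1 + \<bar>x\<bar>) powr (- 1 - r)"
    by (simp flip: powr_add)
  have "p \<le> (C + D) * 1" using D_le C by simp
  also have "\<dots> \<le> (C + D) * (2 powr (1 + r) * (1 + \<bar>x\<bar>) powr (- 1 - r))"
    using 1 C D by (intro mult_left_mono) auto
  finally show ?thesis by (simp add: mult.assoc)
qed

text \<open>Once the estimator is inserted, the integrand is jointly measurable in the data and
  \<open>y\<close>, because \<open>S\<close>, \<open>S_dot\<close> and \<phi> are continuous in the
  parameter; integrating out \<open>y\<close> preserves this.\<close>

lemma (in regression) Delta_stat_measurable:
  assumes Sd_eq: "Sd = S_dot S" and l1_eq: "l1 = deriv (log_density f)"
    and est [measurable]: "est n \<in> borel_measurable (data_space n)"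
    and est_in: "\<And>x. x \<in> space (data_space n) \<Longrightarrow> est n x \<in> {a<..<b}"
  shows "Delta_stat S f \<phi> est n \<in> borel_measurable (data_space n)"
proof -
  let ?N = "data_space n \<Otimes>\<^sub>M (borel :: real measure)"
  have est_fst: "(\<lambda>z. est n (fst z)) \<in> borel_measurable ?N" by measurable
  have car: "(\<lambda>z. g (est n (fst z)) (Y z)) \<in> borel_measurable ?N"
    if "Y \<in> borel_measurable ?N" "\<And>t. t \<in> {a<..<b} \<Longrightarrow> g t \<in> borel_measurable borel" "\<And>x. continuous_on {a<..<b} (\<lambda>t. g t x)"
    for g :: "real \<Rightarrow> real \<Rightarrow> real" and Y
    by (rule caratheodory_measurable[OF ab est_fst]) (use that est_in in \<open>auto simp: space_pair_measure\<close>)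
  have comp: "(\<lambda>z. fst z j) \<in> borel_measurable ?N" if "j \<le> n" for j
    by (rule measurable_compose[OF measurable_fst measurable_component_singleton]) (use that in simp)
  have mSd: "(\<lambda>z. S_dot S (est n (fst z)) (Y z)) \<in> borel_measurable ?N" if "Y \<in> borel_measurable ?N" for Y
    using car[OF that Sd_meas Sd_cont] unfolding Sd_eq .
  have mS: "(\<lambda>z. S (est n (fst z)) (Y z)) \<in> borel_measurable ?N" if "Y \<in> borel_measurable ?N" for Y
    by (rule car[OF that S_meas S_cont])
  have m\<phi>: "(\<lambda>z. \<phi> (est n (fst z)) (Y z)) \<in> borel_measurable ?N" if "Y \<in> borel_measurable ?N" for Y
    by (rule car[OF that \<phi>_meas \<phi>_cont])
  have [measurable]: "(\<lambda>z. S_dot S (est n (fst z)) (snd z)) \<in> borel_measurable ?N" "(\<lambda>z. \<phi> (est n (fst z)) (snd z)) \<in> borel_measurable ?N"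
    using mSd[of snd] m\<phi>[of snd] by auto
  have info: "(\<lambda>x. info_regression S \<phi> (est n x)) \<in> borel_measurable (data_space n)"
    unfolding info_regression_def
    by (intro lborel.borel_measurable_lebesgue_integral) (simp add: case_prod_beta')
  note [measurable] = measurable_compose[OF measurable_fst info]
  have fisher [measurable]: "(\<lambda>z. fisher_info S f \<phi> (est n (fst z))) \<in> borel_measurable ?N"
    unfolding fisher_info_def by measurable
  have mU [measurable]: "(\<lambda>z. U_hat S f \<phi> (est n (fst z)) n (fst z) (snd z)) \<in> borel_measurable ?N"
  proof -
    have "(\<lambda>z. deriv (log_density f) (fst z j - S (est n (fst z)) (fst z (j - 1))) * S_dot S (est n (fst z)) (fst z (j - 1)) *
        indicator {..<snd z} (fst z (j - 1))) \<in> borel_measurable ?N" if j: "j \<in> {1..n}" for j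
    proof -
      have [measurable]: "(\<lambda>z. fst z j) \<in> borel_measurable ?N" "(\<lambda>z. fst z (j - 1)) \<in> borel_measurable ?N"
        using j by (auto intro!: comp)
      note [measurable] = mS[of "\<lambda>z. fst z (j - 1)"] mSd[of "\<lambda>z. fst z (j - 1)"]
      have [measurable]: "deriv (log_density f) \<in> borel_measurable borel"
        unfolding l1_eq[symmetric] by measurable
      have ind: "indicator {..<snd z} (fst z (j - 1)) = (if fst z (j - 1) < snd z then 1 else 0 :: real)" for z :: "(nat \<Rightarrow> real) \<times> real"
        by (simp add: indicator_def)
      show ?thesis unfolding ind by measurable
    qed
    then show ?thesis
      unfolding U_hat_def by (rule borel_measurable_times[OF _ borel_measurable_sum, rotated]) measurable
  qed
  show ?thesis
    unfolding Delta_stat_def Let_def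
    by (intro lborel.borel_measurable_lebesgue_integral) (simp add: case_prod_beta')
qed

text \<open>Allows the index \<open>n = 0\<close> to be disregarded, for which nothing is assumed
  about the estimator.\<close>

lemma weak_conv_m_eventually:
  assumes "weak_conv_m \<mu> \<nu>" "\<forall>\<^sub>F n in sequentially. \<mu> n = \<mu>' n"
  shows "weak_conv_m \<mu>' \<nu>"
  unfolding weak_conv_m_def weak_conv_def
proof (intro allI impI)
  fix x assume "isCont (cdf \<nu>) x"
  then have "(\<lambda>n. cdf (\<mu> n) x) \<longlonglongrightarrow> cdf \<nu> x"
    using assms(1) by (simp add: weak_conv_m_def weak_conv_def)
  then show "(\<lambda>n. cdf (\<mu>' n) x) \<longlonglongrightarrow> cdf \<nu> x"
    by (rule Lim_transform_eventually) (use assms(2) in \<open>auto elim: eventually_mono\<close>)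
qed

lemma sample_measurable:
  assumes "\<And>j. X j \<in> borel_measurable M"
  shows "sample X n \<in> measurable M (data_space n)"
  unfolding sample_def[abs_def] using assms by (intro measurable_restrict) auto

text \<open>Translates the statistic on the data space into path functionals, transfers the Laplace
  limit from \<open>Q\<close> to it, and reads off weak convergence.\<close>

lemma Delta_stat_weak_conv:
  fixes est :: "nat \<Rightarrow> (nat \<Rightarrow> real) \<Rightarrow> real"
  assumes model: "model f l1 l2 L a b K A r S Sd Sdd \<phi> M X e th"
    and Sd_eq: "Sd = S_dot S" and l1_eq: "l1 = deriv (log_density f)"
    and info_f: "info_density f = (\<integral>x. (l1 x)\<^sup>2 * f x \<partial>lborel)"
    and est: "\<And>n. 0 < n \<Longrightarrow> est n \<in> borel_measurable (data_space n)"
    and est_in: "\<And>n x. 0 < n \<Longrightarrow> x \<in> space (data_space n) \<Longrightarrow> est n x \<in> {a<..<b}"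
    and consistent: "conv_in_prob M (\<lambda>n \<omega>. est n (sample X n \<omega>)) th"
    and representation: "conv_in_prob M
        (\<lambda>n \<omega>. sqrt (real n) * (est n (sample X n \<omega>) - th) -
           (- 1 / (fisher_info S f \<phi> th * sqrt (real n))) *
             (\<Sum>j=1..n. deriv (log_density f) (X j \<omega> - S th (X (j - 1) \<omega>)) * S_dot S th (X (j - 1) \<omega>))) 0"
    and br: "bridge NB B"
  shows "weak_conv_m (\<lambda>n. distr M borel (\<lambda>\<omega>. Delta_stat S f \<phi> est n (sample X n \<omega>))) (distr NB borel (bridge_functional B))"
proof -
  interpret model f l1 l2 L a b K A r S Sd Sdd \<phi> M X e th by fact
  interpret br: bridge NB B by fact
  have info_eq: "fisher_info S f \<phi> t = info t" "info_regression S \<phi> t = J t" for t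
    by (simp_all add: fisher_info_def info_def info_f I0_def info_regression_def J_def flip: Sd_eq)
  \<comment> \<open>The index shift between observations numbered from one and innovations written
    as \<open>e (Suc j)\<close>.\<close>
  have sums: "(\<Sum>j=1..n. g j (j - 1)) = (\<Sum>j<n. g (Suc j) j)" for g :: "nat \<Rightarrow> nat \<Rightarrow> real" and n
    by (induction n) auto
  have smp: "sample X n \<in> measurable M (data_space n)" for n by (rule sample_measurable) simp
  define D where "D n \<omega> = Delta_stat S f \<phi> est n (sample X n \<omega>)" for n \<omega>
  have D_meas: "D n \<in> borel_measurable M" if "0 < n" for n
    unfolding D_def
    by (rule measurable_compose[OF smp Delta_stat_measurable[OF Sd_eq l1_eq]]) (use est est_in that in auto)
  have smp_space: "sample X n \<omega> \<in> space (data_space n)" for n \<omega>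
    by (simp add: sample_def space_PiM)
  have tin: "est n (sample X n \<omega>) \<in> {a<..<b}" if "0 < n" for n \<omega>
    by (rule est_in[OF that smp_space])
  have D_eq: "D n \<omega> = (\<integral>y. (Uh n (est n (sample X n \<omega>)) y \<omega>)\<^sup>2 * w (est n (sample X n \<omega>)) y \<partial>lborel)" if n: "0 < n" for n \<omega>
  proof -
    define t where "t = est n (sample X n \<omega>)"
    have "U_hat S f \<phi> t n (sample X n \<omega>) y = Uh n t y \<omega>" for y
    proof -
      have "(\<Sum>j=1..n. deriv (log_density f) (sample X n \<omega> j - S t (sample X n \<omega> (j - 1))) * S_dot S t (sample X n \<omega> (j - 1)) *
          indicator {..<y} (sample X n \<omega> (j - 1))) =
        (\<Sum>j=1..n. l1 (X j \<omega> - S t (X (j - 1) \<omega>)) * Sd t (X (j - 1) \<omega>) * (if X (j - 1) \<omega> < y then 1 else 0))"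
        by (intro sum.cong refl) (auto simp: sample_def l1_eq Sd_eq indicator_def)
      also have "\<dots> = (\<Sum>j<n. l1 (X (Suc j) \<omega> - S t (X j \<omega>)) * Sd t (X j \<omega>) * (if X j \<omega> < y then 1 else 0))"
        by (rule sums)
      finally show ?thesis by (simp only: U_hat_def Uh_def info_eq)
    qed
    then show ?thesis
      by (simp add: D_def Delta_stat_def Let_def w_def info_eq mult.assoc flip: t_def Sd_eq)
  qed
  have D_nonneg: "0 \<le> D n \<omega>" if n: "0 < n" for n \<omega>
    unfolding D_eq[OF n] using w_nonneg[OF tin[OF n]]
    by (intro integral_nonneg_AE AE_I2 mult_nonneg_nonneg) auto
  have rep: "conv_in_prob M (\<lambda>n \<omega>. sqrt (real n) * (est n (sample X n \<omega>) - th) + Ainf n \<omega> / info th) 0"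
  proof -
    have "sqrt (real n) * (est n (sample X n \<omega>) - th) -
           (- 1 / (fisher_info S f \<phi> th * sqrt (real n))) *
             (\<Sum>j=1..n. deriv (log_density f) (X j \<omega> - S th (X (j - 1) \<omega>)) * S_dot S th (X (j - 1) \<omega>)) =
        sqrt (real n) * (est n (sample X n \<omega>) - th) + Ainf n \<omega> / info th" if \<omega>: "\<omega> \<in> space M" for n \<omega>
    proof -
      have "(\<Sum>j=1..n. deriv (log_density f) (X j \<omega> - S th (X (j - 1) \<omega>)) * S_dot S th (X (j - 1) \<omega>)) =
          (\<Sum>j<n. l1 (e (Suc j) \<omega>) * Sd th (X j \<omega>))"
        using sums[of "\<lambda>i j. deriv (log_density f) (X i \<omega> - S th (X j \<omega>)) * S_dot S th (X j \<omega>)" n]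
        by (simp add: P.X_Suc[OF \<omega>] l1_eq Sd_eq)
      then show ?thesis by (simp add: info_eq Ainf_def sc_def field_simps)
    qed
    then have "{\<omega>\<in>space M. \<epsilon> < \<bar>sqrt (real n) * (est n (sample X n \<omega>) - th) -
           (- 1 / (fisher_info S f \<phi> th * sqrt (real n))) *
             (\<Sum>j=1..n. deriv (log_density f) (X j \<omega> - S th (X (j - 1) \<omega>)) * S_dot S th (X (j - 1) \<omega>)) - 0\<bar>} =
       {\<omega>\<in>space M. \<epsilon> < \<bar>sqrt (real n) * (est n (sample X n \<omega>) - th) + Ainf n \<omega> / info th - 0\<bar>}" for \<epsilon> n
      by auto
    with representation show ?thesis unfolding conv_in_prob_def by (simp only:)
  qed
  have close: "whp M \<zeta> (\<lambda>n \<omega>. \<bar>D n \<omega> - Q n \<omega>\<bar> \<le> \<epsilon>)" if "0 < \<epsilon>" "0 < \<zeta>" for \<epsilon> \<zeta>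
  proof (rule whp_mono[OF statistic_close[of "\<lambda>n \<omega>. est n (sample X n \<omega>)", OF _ consistent rep that]])
    show "(\<lambda>\<omega>. est n (sample X n \<omega>)) \<in> borel_measurable M" if "0 < n" for n
      by (rule measurable_compose[OF smp est[OF that]])
  qed (simp add: D_eq)
  have lap: "(\<lambda>n. \<integral>\<omega>. exp (- (k * D n \<omega>)) \<partial>M) \<longlonglongrightarrow> (\<integral>\<omega>. exp (- (k * bridge_functional B \<omega>)) \<partial>NB)" if k: "0 \<le> k" for k
  proof (rule P.laplace_transfer[OF close])
    show "Q n \<in> borel_measurable M" for n using Q_integrable by auto
  qed (use D_meas D_nonneg Q_nonneg k Q_laplace[OF br k] in auto)
  \<comment> \<open>At \<open>n = 0\<close> the statistic is replaced by zero, since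
    \<open>laplace_weak_conv\<close> asks for measurability and nonnegativity at every
    index.\<close>
  define D' where "D' n \<omega> = (if 0 < n then D n \<omega> else 0)" for n \<omega>
  have "weak_conv_m (\<lambda>n. distr M borel (D' n)) (distr NB borel (bridge_functional B))"
  proof (rule laplace_weak_conv[OF P.prob_space_axioms br.prob_space_axioms])
    show "D' n \<in> borel_measurable M" for n
      unfolding D'_def using D_meas[of n] by (cases "0 < n") auto
    show "(\<lambda>n. \<integral>\<omega>. exp (- (real k * D' n \<omega>)) \<partial>M) \<longlonglongrightarrow> (\<integral>\<omega>. exp (- (real k * bridge_functional B \<omega>)) \<partial>NB)" for k
      by (rule Lim_transform_eventually[OF lap])
         (auto simp: D'_def intro!: eventually_mono[OF eventually_gt_at_top[of 0]])
  qed (auto simp: D'_def D_nonneg br.bridge_functional_nonneg)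
  then have "weak_conv_m (\<lambda>n. distr M borel (D n)) (distr NB borel (bridge_functional B))"
    by (rule weak_conv_m_eventually)
       (auto simp: D'_def[abs_def] intro!: eventually_mono[OF eventually_gt_at_top[of 0]])
  then show ?thesis by (simp add: D_def[abs_def])
qed

theorem proposition6:
  fixes a b \<alpha> c :: real
    and S :: "real \<Rightarrow> real \<Rightarrow> real" and f :: "real \<Rightarrow> real" and \<phi> :: "real \<Rightarrow> real \<Rightarrow> real"
    and P :: "real \<Rightarrow> 'w measure" and X :: "nat \<Rightarrow> 'w \<Rightarrow> real"
    and est :: "nat \<Rightarrow> (nat \<Rightarrow> real) \<Rightarrow> real"
    and M :: "'b measure" and B :: "real \<Rightarrow> 'b \<Rightarrow> real"
    and \<Theta> :: "real set"
  assumes "a < b"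
    and \<Theta>: "\<Theta> = {a<..<b}"
    and f_pos: "\<And>x. 0 < f x"
    and S_meas: "\<And>\<theta>. \<theta> \<in> \<Theta> \<Longrightarrow> S \<theta> \<in> borel_measurable borel"
    and invariant: "\<And>\<theta>. \<theta> \<in> \<Theta> \<Longrightarrow> invariant_density (S \<theta>) f (\<phi> \<theta>)"
    and model: "\<And>\<theta>. \<theta> \<in> \<Theta> \<Longrightarrow> autoregression (P \<theta>) X (S \<theta>) f (\<phi> \<theta>)"
    and ergodic: "\<And>\<theta>. \<theta> \<in> \<Theta> \<Longrightarrow> ergodic_with_density (P \<theta>) X (\<phi> \<theta>)"
    and tail: "\<exists>C>0. \<exists>\<gamma>>0. \<forall>\<theta>\<in>\<Theta>. \<forall>x. x \<noteq> 0 \<longrightarrow> \<phi> \<theta> x \<le> C * \<bar>x\<bar> powr (- 1 - \<gamma>)"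
    and smooth_f: "three_bounded_derivs (log_density f)"
    and smooth_S: "two_bounded_param_derivs \<Theta> S"
    and info_f_finite: "integrable lborel (\<lambda>x. (deriv f x)\<^sup>2 / f x)"
    and info_S_finite: "\<And>\<theta>. \<theta> \<in> \<Theta> \<Longrightarrow> integrable lborel (\<lambda>x. (S_dot S \<theta> x)\<^sup>2 * \<phi> \<theta> x)"
    and info_pos: "\<And>\<theta>. \<theta> \<in> \<Theta> \<Longrightarrow> 0 < fisher_info S f \<phi> \<theta>"
    and mle: "max_likelihood_estimator \<Theta> S f \<phi> est"
    and consistent: "\<And>\<theta>. \<theta> \<in> \<Theta> \<Longrightarrow> conv_in_prob (P \<theta>) (\<lambda>n \<omega>. est n (sample X n \<omega>)) \<theta>"
    and representation: "\<And>\<theta>. \<theta> \<in> \<Theta> \<Longrightarrow>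
      conv_in_prob (P \<theta>)
        (\<lambda>n \<omega>. sqrt (real n) * (est n (sample X n \<omega>) - \<theta>) -
           (- 1 / (fisher_info S f \<phi> \<theta> * sqrt (real n))) *
             (\<Sum>j=1..n. deriv (log_density f) (X j \<omega> - S \<theta> (X (j - 1) \<omega>)) * S_dot S \<theta> (X (j - 1) \<omega>)))
        0"
    and bridge: "brownian_bridge M B"
    and alpha: "0 < \<alpha>" "\<alpha> < 1"
    and c: "measure M {\<omega>\<in>space M. bridge_functional B \<omega> > c} = \<alpha>"
  shows "asymp_distribution_free \<Theta> P X (Delta_stat S f \<phi> est) (distr M borel (bridge_functional B)) \<and>
         (\<lambda>n. indicator {x. Delta_stat S f \<phi> est n x > c}) \<in> asymp_size_class \<Theta> P X \<alpha>"
proof -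
  define l1 where "l1 = deriv (log_density f)"
  define l2 where "l2 = deriv l1"
  define l3 where "l3 = deriv l2"
  define Sd where "Sd = S_dot S"
  define Sdd where "Sdd t x = deriv (\<lambda>t. Sd t x) t" for t x
  have l_pow: "(deriv ^^ 0) (log_density f) = log_density f" "(deriv ^^ 1) (log_density f) = l1"
    "(deriv ^^ 2) (log_density f) = l2" "(deriv ^^ 3) (log_density f) = l3"
    by (simp_all add: l1_def l2_def l3_def numeral_2_eq_2 numeral_3_eq_3)
  have "\<forall>i<3. \<forall>x. (deriv ^^ i) (log_density f) field_differentiable at x"
    using smooth_f by (simp add: three_bounded_derivs_def)
  from this[rule_format, of 0] this[rule_format, of 1] this[rule_format, of 2]
  have l_deriv: "(log_density f has_real_derivative l1 x) (at x)" "(l1 has_real_derivative l2 x) (at x)"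
    "(l2 has_real_derivative l3 x) (at x)" for x
    unfolding l_pow by (simp_all add: l1_def l2_def l3_def DERIV_deriv_iff_field_differentiable)
  have "\<forall>i\<in>{1..3}. bounded (range ((deriv ^^ i) (log_density f)))"
    using smooth_f by (simp add: three_bounded_derivs_def)
  from this[rule_format, of 1] this[rule_format, of 2] this[rule_format, of 3]
  have "bounded (range l1)" "bounded (range l2)" "bounded (range l3)" unfolding l_pow by simp_all
  then obtain L1 L2 L3 where "\<And>x. \<bar>l1 x\<bar> \<le> L1" "\<And>x. \<bar>l2 x\<bar> \<le> L2" "\<And>x. \<bar>l3 x\<bar> \<le> L3"
    unfolding bounded_iff by auto
  then obtain L where L: "\<And>x. \<bar>l1 x\<bar> \<le> L" "\<And>x. \<bar>l2 x\<bar> \<le> L" "\<And>x. \<bar>l3 x\<bar> \<le> L"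
    by (metis max.coboundedI1 max.coboundedI2)
  have S_pow: "(deriv ^^ 0) (\<lambda>t. S t x) = (\<lambda>t. S t x)" "(deriv ^^ 1) (\<lambda>t. S t x) = (\<lambda>t. Sd t x)"
    "(deriv ^^ 2) (\<lambda>t. S t x) = (\<lambda>t. Sdd t x)" for x
    by (simp_all add: Sd_def Sdd_def S_dot_def[abs_def] numeral_2_eq_2 fun_eq_iff)
  have "\<forall>i<2. \<forall>\<theta>\<in>\<Theta>. \<forall>x. (deriv ^^ i) (\<lambda>t. S t x) field_differentiable at \<theta>"
    using smooth_S by (simp add: two_bounded_param_derivs_def)
  from this[rule_format, of 0] this[rule_format, of 1]
  have S_deriv: "((\<lambda>t. S t x) has_real_derivative Sd t x) (at t)" "((\<lambda>t. Sd t x) has_real_derivative Sdd t x) (at t)"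
    if "t \<in> \<Theta>" for t x
    using that unfolding S_pow by (simp_all add: Sd_def S_dot_def Sdd_def DERIV_deriv_iff_field_differentiable)
  have S_bounds: "\<forall>i\<in>{1..2}. (\<forall>x. continuous_on \<Theta> ((deriv ^^ i) (\<lambda>t. S t x))) \<and>
                 (\<exists>K. \<forall>\<theta>\<in>\<Theta>. \<forall>x. \<bar>(deriv ^^ i) (\<lambda>t. S t x) \<theta>\<bar> \<le> K)"
    using smooth_S by (simp add: two_bounded_param_derivs_def)
  from S_bounds[rule_format, of 1] S_bounds[rule_format, of 2]
  have Sdd_cont: "\<And>x. continuous_on \<Theta> (\<lambda>t. Sdd t x)"
    and "\<exists>K. \<forall>\<theta>\<in>\<Theta>. \<forall>x. \<bar>Sd \<theta> x\<bar> \<le> K" "\<exists>K. \<forall>\<theta>\<in>\<Theta>. \<forall>x. \<bar>Sdd \<theta> x\<bar> \<le> K"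
    unfolding S_pow by simp_all
  then obtain K1 K2 where "\<forall>\<theta>\<in>\<Theta>. \<forall>x. \<bar>Sd \<theta> x\<bar> \<le> K1" "\<forall>\<theta>\<in>\<Theta>. \<forall>x. \<bar>Sdd \<theta> x\<bar> \<le> K2" by blast
  then obtain K where K: "\<And>t x. t \<in> \<Theta> \<Longrightarrow> \<bar>Sd t x\<bar> \<le> K" "\<And>t x. t \<in> \<Theta> \<Longrightarrow> \<bar>Sdd t x\<bar> \<le> K"
    by (metis max.coboundedI1 max.coboundedI2)
  have mid: "(a + b) / 2 \<in> \<Theta>" using \<open>a < b\<close> by (auto simp: \<Theta>)
  have f_eq: "f = (\<lambda>x. exp (log_density f x))" using f_pos by (simp add: log_density_def)
  have f_deriv: "(f has_real_derivative l1 x * f x) (at x)" for x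
    using DERIV_fun_exp[OF l_deriv(1)[of x]] f_eq by (metis mult.commute)
  \<comment> \<open>\<open>f\<close> is the density of the first innovation under any parameter; the
    midpoint of the interval serves as a witness.\<close>
  have f_mass: "(\<integral>\<^sup>+x. ennreal (f x) \<partial>lborel) = 1"
  proof -
    from model[OF mid] obtain \<epsilon> where M: "prob_space (P ((a + b) / 2))"
      and \<epsilon>: "distributed (P ((a + b) / 2)) lborel (\<epsilon> (1::nat)) (\<lambda>x. ennreal (f x))"
      unfolding autoregression_def by blast
    interpret prob_space "P ((a + b) / 2)" by (rule M)
    have "prob_space (density lborel (\<lambda>x. ennreal (f x)))"
      using prob_space_distr[of "\<epsilon> 1" lborel] \<epsilon> by (simp add: distributed_def)
    then show ?thesis
      using prob_space.emeasure_space_1[of "density lborel (\<lambda>x. ennreal (f x))"] \<epsilon>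
      by (simp add: emeasure_density distributed_def)
  qed
  interpret dens: smooth_density f l1 l2 L
  proof
    show "\<bar>l2 x - l2 y\<bar> \<le> L * \<bar>x - y\<bar>" for x y
      using field_differentiable_bound[of UNIV l2 l3 L x y] l_deriv(3) L(3) by simp
  qed (use f_pos f_deriv l_deriv L f_mass in auto)
  from tail obtain C r where Cr: "0 < C" "0 < r" "\<And>t x. t \<in> \<Theta> \<Longrightarrow> x \<noteq> 0 \<Longrightarrow> \<phi> t x \<le> C * \<bar>x\<bar> powr (- 1 - r)"
    by blast
  \<comment> \<open>The constant of \<open>polynomial_tail_bound\<close>, with \<open>exp L\<close>
    as the bound near the origin.\<close>
  define A where "A = (C + exp L) * 2 powr (1 + r)"
  have reg: "regression f l1 l2 L a b K A r S Sd Sdd \<phi>"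
  proof
    show "\<phi> t x \<le> A * (1 + \<bar>x\<bar>) powr (- 1 - r)" if "t \<in> {a<..<b}" for t x
      unfolding A_def
      by (rule polynomial_tail_bound)
         (use Cr that dens.invariant_density_le[OF invariant] in \<open>auto simp: \<Theta>\<close>)
  qed (use \<open>a < b\<close> S_meas S_deriv Sdd_cont K invariant Cr in \<open>simp_all add: \<Theta>\<close>)
  interpret br: bridge M B by unfold_locales (rule bridge)
  have info_f: "info_density f = (\<integral>x. (l1 x)\<^sup>2 * f x \<partial>lborel)"
  proof -
    have "deriv f x = l1 x * f x" for x by (rule DERIV_imp_deriv[OF f_deriv])
    then show ?thesis
      unfolding info_density_def using f_pos
      by (intro Bochner_Integration.integral_cong) (simp_all add: power2_eq_square less_imp_neq[symmetric])
  qed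
  have info_f_nonneg: "0 \<le> info_density f"
    unfolding info_f using f_pos by (intro integral_nonneg_AE AE_I2) (simp add: less_imp_le)
  have est: "est n \<in> borel_measurable (data_space n)" "x \<in> space (data_space n) \<Longrightarrow> est n x \<in> \<Theta>" if "0 < n" for n x
    using mle that unfolding max_likelihood_estimator_def by (auto simp: Suc_le_eq)
  have D_meas: "Delta_stat S f \<phi> est n \<in> borel_measurable (data_space n)" if "0 < n" for n
    by (rule regression.Delta_stat_measurable[OF reg Sd_def l1_def]) (use est[OF that] in \<open>auto simp: \<Theta>\<close>)
  have wconv: "weak_conv_m (\<lambda>n. distr (P \<theta>) borel (\<lambda>\<omega>. Delta_stat S f \<phi> est n (sample X n \<omega>))) (distr M borel (bridge_functional B))"
    and X_meas: "\<And>j. X j \<in> borel_measurable (P \<theta>)" and P_prob: "prob_space (P \<theta>)" if \<theta>: "\<theta> \<in> \<Theta>" for \<theta>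
  proof -
    from model[OF \<theta>] obtain \<epsilon> where M: "prob_space (P \<theta>)" "distributed (P \<theta>) lborel (X 0) (\<lambda>x. ennreal (\<phi> \<theta> x))"
      and \<epsilon>: "\<And>j. 1 \<le> j \<Longrightarrow> distributed (P \<theta>) lborel (\<epsilon> j) (\<lambda>x. ennreal (f x))"
        "prob_space.indep_vars (P \<theta>) (\<lambda>_. borel) (\<epsilon>(0 := X 0)) UNIV"
        "\<And>j \<omega>. 1 \<le> j \<Longrightarrow> \<omega> \<in> space (P \<theta>) \<Longrightarrow> X j \<omega> = S \<theta> (X (j - 1) \<omega>) + \<epsilon> j \<omega>"
      unfolding autoregression_def by blast
    interpret P: prob_space "P \<theta>" by (rule M)
    interpret P: ar_process "P \<theta>" X "\<epsilon>(0 := X 0)" "S \<theta>" f "\<phi> \<theta>"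
    proof
      show "X (Suc j) \<omega> = S \<theta> (X j \<omega>) + (\<epsilon>(0 := X 0)) (Suc j) \<omega>" if "\<omega> \<in> space (P \<theta>)" for j \<omega>
        using \<epsilon>(3)[of "Suc j" \<omega>] that by simp
    qed (use \<epsilon> M S_meas[OF \<theta>] invariant[OF \<theta>] f_pos in \<open>auto simp: less_imp_le\<close>)
    interpret P: ergodic_ar "P \<theta>" X "\<epsilon>(0 := X 0)" "S \<theta>" f "\<phi> \<theta>"
      by unfold_locales (rule ergodic[OF \<theta>])
    have prod_pos: "0 < info_density f * info_regression S \<phi> t" if "t \<in> \<Theta>" for t
      using info_pos[OF that] by (simp add: fisher_info_def)
    \<comment> \<open>Only the product of the two informations is known to be positive; a
      nonnegative first factor makes both factors positive.\<close>
    have "0 < info_density f"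
      using prod_pos[OF \<theta>] info_f_nonneg by (metis less_eq_real_def mult_zero_left)
    moreover have "0 < info_regression S \<phi> t" if "t \<in> \<Theta>" for t
      using prod_pos[OF that] \<open>0 < info_density f\<close> by (simp add: zero_less_mult_iff)
    ultimately have mod: "model f l1 l2 L a b K A r S Sd Sdd \<phi> (P \<theta>) X (\<epsilon>(0 := X 0)) \<theta>"
      using reg P.ergodic_ar_axioms \<theta>
      by (auto intro!: model.intro model_axioms.intro simp: info_f info_regression_def Sd_def \<Theta>)
    show "weak_conv_m (\<lambda>n. distr (P \<theta>) borel (\<lambda>\<omega>. Delta_stat S f \<phi> est n (sample X n \<omega>))) (distr M borel (bridge_functional B))"
      by (rule Delta_stat_weak_conv[OF mod Sd_def l1_def info_f _ _ consistent[OF \<theta>] representation[OF \<theta>] br.bridge_axioms])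
         (use est in \<open>auto simp: \<Theta>\<close>)
    show "X j \<in> borel_measurable (P \<theta>)" for j by (rule P.X_measurable)
    show "prob_space (P \<theta>)" by (rule M)
  qed
  have size: "(\<lambda>n. \<integral>\<omega>. indicator {x. Delta_stat S f \<phi> est n x > c} (sample X n \<omega>) \<partial>P \<theta>) \<longlonglongrightarrow> \<alpha>" if \<theta>: "\<theta> \<in> \<Theta>" for \<theta>
  proof -
    interpret P: prob_space "P \<theta>" by (rule P_prob[OF \<theta>])
    let ?\<mu> = "\<lambda>n. distr (P \<theta>) borel (\<lambda>\<omega>. Delta_stat S f \<phi> est n (sample X n \<omega>))"
    let ?\<nu> = "distr M borel (bridge_functional B)"
    interpret nu: prob_space ?\<nu> by (rule br.prob_space_distr) simp
    interpret nu: real_distribution ?\<nu> by unfold_locales auto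
    \<comment> \<open>Without an atom at \<open>c\<close>, the critical value is a continuity point
      of the limit distribution function, and weak convergence gives the limit of the rejection
      probabilities.\<close>
    have "measure ?\<nu> {c} = 0"
      using br.bridge_functional_atomless[of c]
      by (subst measure_distr) (auto simp: vimage_def Int_def conj_commute)
    then have "isCont (cdf ?\<nu>) c" by (simp add: nu.isCont_cdf)
    then have lim: "(\<lambda>n. 1 - cdf (?\<mu> n) c) \<longlonglongrightarrow> 1 - cdf ?\<nu> c"
      using wconv[OF \<theta>] by (intro tendsto_intros) (auto simp: weak_conv_m_def weak_conv_def)
    have limit_eq: "1 - cdf ?\<nu> c = \<alpha>"
    proof -
      have "\<alpha> = measure ?\<nu> {c<..}"
        unfolding c[symmetric] by (subst measure_distr) (auto intro!: arg_cong[where f="measure M"])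
      also have "\<dots> = 1 - cdf ?\<nu> c"
        unfolding cdf_def using nu.prob_compl[of "{..c}"] by (simp add: Compl_atMost flip: Compl_eq_Diff_UNIV)
      finally show ?thesis ..
    qed
    have "1 - cdf (?\<mu> n) c = (\<integral>\<omega>. indicator {x. Delta_stat S f \<phi> est n x > c} (sample X n \<omega>) \<partial>P \<theta>)" if n: "0 < n" for n
    proof -
      have D [measurable]: "(\<lambda>\<omega>. Delta_stat S f \<phi> est n (sample X n \<omega>)) \<in> borel_measurable (P \<theta>)"
        by (rule measurable_compose[OF sample_measurable[OF X_meas[OF \<theta>]] D_meas[OF n]])
      have "(\<integral>\<omega>. indicator {x. Delta_stat S f \<phi> est n x > c} (sample X n \<omega>) \<partial>P \<theta>) =
         (\<integral>\<omega>. indicator {\<omega>\<in>space (P \<theta>). Delta_stat S f \<phi> est n (sample X n \<omega>) > c} \<omega> \<partial>P \<theta>)"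
        by (intro Bochner_Integration.integral_cong refl) (simp add: indicator_def)
      also have "\<dots> = P.prob {\<omega>\<in>space (P \<theta>). c < Delta_stat S f \<phi> est n (sample X n \<omega>)}"
        by simp
      also have "\<dots> = 1 - P.prob {\<omega>\<in>space (P \<theta>). \<not> c < Delta_stat S f \<phi> est n (sample X n \<omega>)}"
        by (subst P.prob_neg) auto
      also have "{\<omega>\<in>space (P \<theta>). \<not> c < Delta_stat S f \<phi> est n (sample X n \<omega>)} =
          (\<lambda>\<omega>. Delta_stat S f \<phi> est n (sample X n \<omega>)) -` {..c} \<inter> space (P \<theta>)"
        by auto
      also have "P.prob \<dots> = cdf (?\<mu> n) c"
        unfolding cdf_def by (subst measure_distr) auto
      finally show ?thesis ..
    qed
    then have ev: "\<forall>\<^sub>F n in sequentially. 1 - cdf (?\<mu> n) c = (\<integral>\<omega>. indicator {x. Delta_stat S f \<phi> est n x > c} (sample X n \<omega>) \<partial>P \<theta>)"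
      by (rule eventually_mono[OF eventually_gt_at_top[of 0]])
    show ?thesis using Lim_transform_eventually[OF lim ev] unfolding limit_eq .
  qed
  have test_meas: "indicator {x. Delta_stat S f \<phi> est n x > c} \<in> borel_measurable (data_space n)" if n: "0 < n" for n
  proof -
    note [measurable] = D_meas[OF n]
    have "(\<lambda>x. if c < Delta_stat S f \<phi> est n x then 1 else 0 :: real) \<in> borel_measurable (data_space n)"
      by measurable
    then show ?thesis by (simp add: indicator_def[abs_def] of_bool_def)
  qed
  show ?thesis
    unfolding asymp_distribution_free_def asymp_size_class_def
    using D_meas wconv size test_meas by (auto simp: Suc_le_eq)
qed

end
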